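(* Consider the three-user complex Gaussian interference channel and the auxiliary variables described in the context. Let \begin{align*} A=\frac13\Big\{& I(X_{1G};Y_{1G})+I(X_{2G};Y_{2G},S_{2G}\mid X_{1G})+I(X_{3G};Y_{3G}\mid U_{3G})\\ &+I(X_{2G};Y_{2G})+I(X_{3G};Y_{3G},S_{3G}\mid X_{2G})+I(X_{1G};Y_{1G}\mid U_{1G})\\ &+I(X_{3G};Y_{3G})+I(X_{1G};Y_{1G},S_{1G}\mid X_{3G})+I(X_{2G};Y_{2G}\mid U_{2G})\Big\}, \end{align*} $I_0=\frac13\{I(U_{1G};Y_{1G}+\tilde V_{N_3})+I(U_{2G};Y_{2G}+\tilde V_{N_1})+I(U_{3G};Y_{3G}+\tilde V_{N_2})\}$ and $I_1=\frac13\{I(U_{1G};Y_{1G}+\tilde V'_{N_3})+I(U_{2G};Y_{2G}+\tilde V'_{N_1})+I(U_{3G};Y_{3G}+\tilde V'_{N_2})\}$. (a) If $(N_1,N_2,N_3,W_1,W_2,W_3)$ satisfy $\sigma^2_{V_{W_1}}\ge\sigma^2_{N_2}$, $\sigma^2_{V_{N_2}}\ge|h_{13}|^2\sigma^2_{Z_3-W_3}$; $\sigma^2_{V_{W_2}}\ge\sigma^2_{N_3}$, $\sigma^2_{V_{N_3}}\ge|h_{21}|^2\sigma^2_{Z_1-W_1}$; $\sigma^2_{V_{W_3}}\ge\sigma^2_{N_1}$, $\sigma^2_{V_{N_1}}\ge|h_{32}|^2\sigma^2_{Z_2-W_2}$, then every achievable rate triple satisfies $R_1+R_2+R_3\le A+I_0$.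 (b) If $(N_1,N_2,N_3,W_1,W_2,W_3)$ satisfy $\sigma^2_{V_{W_1}}\ge\sigma^2_{W_1}$, $\sigma^2_{V'_{N_2}}\ge|h_{23}|^2\sigma^2_{Z_3-W_3}$; $\sigma^2_{V_{W_2}}\ge\sigma^2_{W_2}$, $\sigma^2_{V'_{N_3}}\ge|h_{31}|^2\sigma^2_{Z_1-W_1}$; $\sigma^2_{V_{W_3}}\ge\sigma^2_{W_3}$, $\sigma^2_{V'_{N_1}}\ge|h_{12}|^2\sigma^2_{Z_2-W_2}$, then every achievable rate triple satisfies $R_1+R_2+R_3\le A+I_1$. In particular the sum capacity is at most $A+\min\{I_0,I_1\}$ when both sets of conditions hold. Moreover, the same bounds hold after any permutation of the user indices (giving $3!$ such bounds).
   Context: Three-user complex Gaussian interference channel: $Y_1=X_1+h_{12}X_2+h_{13}X_3+Z_1$, $Y_2=X_2+h_{23}X_3+h_{21}X_1+Z_2$, $Y_3=X_3+h_{31}X_1+h_{32}X_2+Z_3$, with constant complex coefficients $h_{ij}$ known to all terminals, noises $Z_k\sim\mathcal{CN}(0,1)$ i.i.d. over time and independent of the inputs, and average power constraints $\sum_{t=1}^n|x_{k,t}|^2\le nP_k$ on transmitter $k$'s codewords. A rate triple is achievable if there exist length-$n$ codes with independent messages uniform on $[1:2^{nR_k}]$ and average error probability tending to $0$; the sum capacity is the supremum of $R_1+R_2+R_3$ over achievable triples. Logarithms are base 2. Gaussian evaluation: $X_{kG}\sim\mathcal{CN}(0,P_k)$, mutually independent and independent of all noises; a subscript $G$ means the variable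 is formed with each $X_k$ replaced by $X_{kG}$. For jointly circularly symmetric complex Gaussian $A,B$: $\sigma^2_A=\mathbb{E}|A|^2$, $\sigma^2_{A|B}=\sigma^2_A-|\mathbb{E}[AB^*]|^2/\sigma^2_B$. Noises: for $k=1,2,3$, $W_k\sim\mathcal{CN}(0,\sigma^2_{W_k})$, $N_k\sim\mathcal{CN}(0,\sigma^2_{N_k})$ with $\sigma^2_{W_k},\sigma^2_{N_k}\le1$; $W_k$ is jointly Gaussian with $Z_k$ with $\mathbb{E}[Z_kW_k^*]=\rho_{W_k}\sigma_{W_k}$ and independent of everything else; $N_k$ is jointly Gaussian with $Z_k$ with $\mathbb{E}[Z_kN_k^*]=\rho_{N_k}\sigma_{N_k}$ and independent of everything else. Genie signals: $U_1=h_{12}X_2+h_{13}X_3+W_1$, $U_2=h_{23}X_3+h_{21}X_1+W_2$, $U_3=h_{31}X_1+h_{32}X_2+W_3$; $S_1=h_{31}X_1+h_{32}X_2+N_1$, $S_2=h_{12}X_2+h_{13}X_3+N_2$, $S_3=h_{23}X_3+h_{21}X_1+N_3$. Variances: $\sigma^2_{V_{W_k}}=\sigma^2_{W_k|Z_k-W_k}$; $\sigma^2_{V_{N_1}}=\sigma^2_{N_1|Z_1-h_{12}h_{32}^{-1}N_1}$, $\sigma^2_{V_{N_2}}=\sigma^2_{N_2|Z_2-h_{23}h_{13}^{-1}N_2}$, $\sigma^2_{V_{N_3}}=\sigma^2_{N_3|Z_3-h_{31}h_{21}^{-1}N_3}$; $\sigma^2_{V'_{N_1}}=\sigma^2_{Z_1|N_1-h_{32}h_{12}^{-1}Z_1}$,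 $\sigma^2_{V'_{N_2}}=\sigma^2_{Z_2|N_2-h_{13}h_{23}^{-1}Z_2}$, $\sigma^2_{V'_{N_3}}=\sigma^2_{Z_3|N_3-h_{21}h_{31}^{-1}Z_3}$. $V_{N_k}\sim\mathcal{CN}(0,\sigma^2_{V_{N_k}})$ and $V'_{N_k}\sim\mathcal{CN}(0,\sigma^2_{V'_{N_k}})$ are independent of all other variables, and $\tilde V_{N_1}=\sqrt{|h_{32}|^{-2}-\sigma^{-2}_{V_{N_1}}\sigma^2_{Z_2-W_2}}\,V_{N_1}$, $\tilde V_{N_2}=\sqrt{|h_{13}|^{-2}-\sigma^{-2}_{V_{N_2}}\sigma^2_{Z_3-W_3}}\,V_{N_2}$, $\tilde V_{N_3}=\sqrt{|h_{21}|^{-2}-\sigma^{-2}_{V_{N_3}}\sigma^2_{Z_1-W_1}}\,V_{N_3}$; $\tilde V'_{N_1}=\sqrt{|h_{12}|^{-2}-\sigma^{-2}_{V'_{N_1}}\sigma^2_{Z_2-W_2}}\,V'_{N_1}$, $\tilde V'_{N_2}=\sqrt{|h_{23}|^{-2}-\sigma^{-2}_{V'_{N_2}}\sigma^2_{Z_3-W_3}}\,V'_{N_2}$, $\tilde V'_{N_3}=\sqrt{|h_{31}|^{-2}-\sigma^{-2}_{V'_{N_3}}\sigma^2_{Z_1-W_1}}\,V'_{N_3}$ (the expressions presuppose the cross coefficients with negative exponents are nonzero). *)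

theory Defs
  imports "HOL-Probability.Probability" "HOL-Combinatorics.Permutations"
begin

text \<open>Users are indexed by 1, 2, 3.  ch_h Q k j is the cross coefficient h_kj (k different from j),
  ch_P Q k the power P_k; the auxiliary noises W_k, N_k have standard deviations
  sW Q k, sN Q k and correlation coefficients rW Q k, rN Q k, i.e.
  E[Z_k W_k^*] = rW_k sW_k and E[Z_k N_k^*] = rN_k sN_k.\<close>

record prm =
  ch_h :: "nat \<Rightarrow> nat \<Rightarrow> complex"
  ch_P :: "nat \<Rightarrow> real"
  sW :: "nat \<Rightarrow> real"
  rW :: "nat \<Rightarrow> complex"
  sN :: "nat \<Rightarrow> real"
  rN :: "nat \<Rightarrow> complex"

definition users :: "nat set" where "users = {1, 2, 3}"

definition cgauss :: "real \<Rightarrow> complex measure" where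
  "cgauss v = density lborel (\<lambda>z. ennreal (exp (- (cmod z)\<^sup>2 / v) / (pi * v)))"

definition noiseM :: "nat \<Rightarrow> (nat \<times> nat \<Rightarrow> complex) measure" where
  "noiseM n = PiM (users \<times> {..<n}) (\<lambda>_. cgauss 1)"

text \<open>Encoders e k w t: codeword symbol at time t of user k for message w.
  Messages m k, received block at receiver k.\<close>
definition rx :: "(nat \<Rightarrow> nat \<Rightarrow> complex) \<Rightarrow> nat \<Rightarrow> (nat \<Rightarrow> nat \<Rightarrow> nat \<Rightarrow> complex)
     \<Rightarrow> (nat \<Rightarrow> nat) \<Rightarrow> (nat \<times> nat \<Rightarrow> complex) \<Rightarrow> nat \<Rightarrow> (nat \<Rightarrow> complex)" where
  "rx h n e m z k = (\<lambda>t\<in>{..<n}. e k (m k) t + (\<Sum>j\<in>users - {k}. h k j * e j (m j) t) + z (k, t))"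

definition is_code :: "(nat \<Rightarrow> real) \<Rightarrow> nat \<Rightarrow> (nat \<Rightarrow> nat)
     \<Rightarrow> (nat \<Rightarrow> nat \<Rightarrow> nat \<Rightarrow> complex) \<Rightarrow> (nat \<Rightarrow> (nat \<Rightarrow> complex) \<Rightarrow> nat) \<Rightarrow> bool" where
  "is_code P n M e d \<longleftrightarrow>
     (\<forall>k\<in>users. \<forall>w<M k. (\<Sum>t<n. (cmod (e k w t))\<^sup>2) \<le> real n * P k) \<and>
     (\<forall>k\<in>users. d k \<in> measurable (PiM {..<n} (\<lambda>_. borel)) (count_space UNIV))"

definition err :: "(nat \<Rightarrow> nat \<Rightarrow> complex) \<Rightarrow> nat \<Rightarrow> (nat \<Rightarrow> nat)
     \<Rightarrow> (nat \<Rightarrow> nat \<Rightarrow> nat \<Rightarrow> complex) \<Rightarrow> (nat \<Rightarrow> (nat \<Rightarrow> complex) \<Rightarrow> nat) \<Rightarrow> real" where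
  "err h n M e d = (1 / real (M 1 * M 2 * M 3)) *
     (\<Sum>m\<in>PiE users (\<lambda>k. {..<M k}).
        measure (noiseM n) {z \<in> space (noiseM n). \<exists>k\<in>users. d k (rx h n e m z k) \<noteq> m k})"

definition msize :: "nat \<Rightarrow> (nat \<Rightarrow> real) \<Rightarrow> nat \<Rightarrow> nat" where
  "msize n R k = nat \<lceil>2 powr (real n * R k)\<rceil>"

definition achievable :: "(nat \<Rightarrow> nat \<Rightarrow> complex) \<Rightarrow> (nat \<Rightarrow> real) \<Rightarrow> (nat \<Rightarrow> real) \<Rightarrow> bool" where
  "achievable h P R \<longleftrightarrow> (\<forall>k\<in>users. 0 \<le> R k) \<and>
     (\<exists>e d. (\<forall>n. is_code P n (msize n R) (e n) (d n)) \<and>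
            (\<lambda>n. err h n (msize n R) (e n) (d n)) \<longlonglongrightarrow> 0)"

definition sum_capacity :: "(nat \<Rightarrow> nat \<Rightarrow> complex) \<Rightarrow> (nat \<Rightarrow> real) \<Rightarrow> ereal" where
  "sum_capacity h P = (SUP R\<in>{R. achievable h P R}. ereal (R 1 + R 2 + R 3))"

text \<open>Independent/primitive jointly Gaussian variables: inputs X_kG, noises Z_k, W_k, N_k,
  and the extra variables V_N (GV) and V'_N (GV'), the latter two indexed by the label
  of the (possibly permuted) user.  A jointly Gaussian variable is represented as a
  complex linear form over these.\<close>

datatype gv = GX nat | GZ nat | GW nat | GN nat | GV nat | GV' nat

type_synonym lin = "gv \<Rightarrow> complex"

definition gbase :: "gv set" where
  "gbase = (\<Union>k\<in>users. {GX k, GZ k, GW k, GN k, GV k, GV' k})"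

definition gcov :: "(gv \<Rightarrow> gv \<Rightarrow> complex) \<Rightarrow> lin \<Rightarrow> lin \<Rightarrow> complex" where
  "gcov K a b = (\<Sum>i\<in>gbase. \<Sum>j\<in>gbase. a i * cnj (b j) * K i j)"

definition K0 :: "prm \<Rightarrow> gv \<Rightarrow> gv \<Rightarrow> complex" where
  "K0 Q i j = (case (i, j) of
      (GX k, GX l) \<Rightarrow> if k = l then complex_of_real (ch_P Q k) else 0
    | (GZ k, GZ l) \<Rightarrow> if k = l then 1 else 0
    | (GW k, GW l) \<Rightarrow> if k = l then complex_of_real ((sW Q k)\<^sup>2) else 0
    | (GN k, GN l) \<Rightarrow> if k = l then complex_of_real ((sN Q k)\<^sup>2) else 0
    | (GZ k, GW l) \<Rightarrow> if k = l then rW Q k * complex_of_real (sW Q k) else 0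
    | (GW k, GZ l) \<Rightarrow> if k = l then cnj (rW Q k) * complex_of_real (sW Q k) else 0
    | (GZ k, GN l) \<Rightarrow> if k = l then rN Q k * complex_of_real (sN Q k) else 0
    | (GN k, GZ l) \<Rightarrow> if k = l then cnj (rN Q k) * complex_of_real (sN Q k) else 0
    | _ \<Rightarrow> 0)"

definition lbase :: "gv \<Rightarrow> lin" where "lbase g = (\<lambda>v. if v = g then 1 else 0)"
definition ladd :: "lin \<Rightarrow> lin \<Rightarrow> lin" where "ladd a b = (\<lambda>v. a v + b v)"
definition lsub :: "lin \<Rightarrow> lin \<Rightarrow> lin" where "lsub a b = (\<lambda>v. a v - b v)"
definition lsc :: "complex \<Rightarrow> lin \<Rightarrow> lin" where "lsc c a = (\<lambda>v. c * a v)"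

definition lI :: "prm \<Rightarrow> nat \<Rightarrow> lin" where
  "lI Q k = (\<lambda>v. case v of GX j \<Rightarrow> if j \<in> users \<and> j \<noteq> k then ch_h Q k j else 0 | _ \<Rightarrow> 0)"

definition lY :: "prm \<Rightarrow> nat \<Rightarrow> lin" where
  "lY Q k = ladd (lbase (GX k)) (ladd (lI Q k) (lbase (GZ k)))"

definition lU :: "prm \<Rightarrow> nat \<Rightarrow> lin" where
  "lU Q k = ladd (lI Q k) (lbase (GW k))"

definition nxt :: "nat \<Rightarrow> nat" where "nxt i = (if i = 3 then 1 else i + 1)"
definition prv :: "nat \<Rightarrow> nat" where "prv i = nxt (nxt i)"

text \<open>S for label i (w.r.t. user relabelling p): interference at receiver p(prv i) plus N_{p i}.
  For p = id: S_1 = h31 X1 + h32 X2 + N1 etc.\<close>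
definition lS :: "prm \<Rightarrow> (nat \<Rightarrow> nat) \<Rightarrow> nat \<Rightarrow> lin" where
  "lS Q p i = ladd (lI Q (p (prv i))) (lbase (GN (p i)))"

definition gvar :: "(gv \<Rightarrow> gv \<Rightarrow> complex) \<Rightarrow> lin \<Rightarrow> real" where
  "gvar K a = Re (gcov K a a)"

definition csv :: "(gv \<Rightarrow> gv \<Rightarrow> complex) \<Rightarrow> lin \<Rightarrow> lin \<Rightarrow> real" where
  "csv K a b = gvar K a - (cmod (gcov K a b))\<^sup>2 / gvar K b"

definition vVW :: "prm \<Rightarrow> nat \<Rightarrow> real" where
  "vVW Q k = csv (K0 Q) (lbase (GW k)) (lsub (lbase (GZ k)) (lbase (GW k)))"

definition vZW :: "prm \<Rightarrow> nat \<Rightarrow> real" where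
  "vZW Q k = gvar (K0 Q) (lsub (lbase (GZ k)) (lbase (GW k)))"

definition vVN :: "prm \<Rightarrow> (nat \<Rightarrow> nat) \<Rightarrow> nat \<Rightarrow> real" where
  "vVN Q p i = csv (K0 Q) (lbase (GN (p i)))
     (lsub (lbase (GZ (p i))) (lsc (ch_h Q (p i) (p (nxt i)) / ch_h Q (p (prv i)) (p (nxt i))) (lbase (GN (p i)))))"

definition vVN' :: "prm \<Rightarrow> (nat \<Rightarrow> nat) \<Rightarrow> nat \<Rightarrow> real" where
  "vVN' Q p i = csv (K0 Q) (lbase (GZ (p i)))
     (lsub (lbase (GN (p i))) (lsc (ch_h Q (p (prv i)) (p (nxt i)) / ch_h Q (p i) (p (nxt i))) (lbase (GZ (p i)))))"

definition Kf :: "prm \<Rightarrow> (nat \<Rightarrow> nat) \<Rightarrow> gv \<Rightarrow> gv \<Rightarrow> complex" where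
  "Kf Q p i j = (case (i, j) of
      (GV k, GV l) \<Rightarrow> if k = l then complex_of_real (vVN Q p k) else 0
    | (GV' k, GV' l) \<Rightarrow> if k = l then complex_of_real (vVN' Q p k) else 0
    | _ \<Rightarrow> K0 Q i j)"

definition tc :: "prm \<Rightarrow> (nat \<Rightarrow> nat) \<Rightarrow> nat \<Rightarrow> real" where
  "tc Q p i = sqrt (1 / (cmod (ch_h Q (p (prv i)) (p (nxt i))))\<^sup>2 - vZW Q (p (nxt i)) / vVN Q p i)"

definition tc' :: "prm \<Rightarrow> (nat \<Rightarrow> nat) \<Rightarrow> nat \<Rightarrow> real" where
  "tc' Q p i = sqrt (1 / (cmod (ch_h Q (p i) (p (nxt i))))\<^sup>2 - vZW Q (p (nxt i)) / vVN' Q p i)"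

text \<open>Conditional variance of A given a list of jointly Gaussian variables (MMSE of the best
  linear estimate, which for jointly Gaussian variables is the conditional variance).\<close>
definition condvar :: "(gv \<Rightarrow> gv \<Rightarrow> complex) \<Rightarrow> lin \<Rightarrow> lin list \<Rightarrow> real" where
  "condvar K a cs = (INF c::nat \<Rightarrow> complex.
      gvar K (\<lambda>v. a v - (\<Sum>i<length cs. c i * (cs ! i) v)))"

text \<open>Mutual information I(A; Bs | Cs) (bits) for jointly circularly symmetric complex
  Gaussian variables, A scalar: log(var(A|Cs)/var(A|Bs,Cs)), with value 0 if A is
  degenerate given Cs and +infinity if A is determined by Bs,Cs but not by Cs.\<close>
definition gmi :: "(gv \<Rightarrow> gv \<Rightarrow> complex) \<Rightarrow> lin \<Rightarrow> lin list \<Rightarrow> lin list \<Rightarrow> ereal" where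
  "gmi K a bs cs = (let s1 = condvar K a cs; s2 = condvar K a (bs @ cs) in
      if s1 = 0 then 0 else if s2 = 0 then \<infinity> else ereal (log 2 (s1 / s2)))"

definition Aterm :: "prm \<Rightarrow> (nat \<Rightarrow> nat) \<Rightarrow> ereal" where
  "Aterm Q p = ereal (1/3) * (\<Sum>i\<in>users.
       gmi (K0 Q) (lbase (GX (p i))) [lY Q (p i)] []
     + gmi (K0 Q) (lbase (GX (p (nxt i)))) [lY Q (p (nxt i)), lS Q p (nxt i)] [lbase (GX (p i))]
     + gmi (K0 Q) (lbase (GX (p (prv i)))) [lY Q (p (prv i))] [lU Q (p (prv i))])"

definition I0term :: "prm \<Rightarrow> (nat \<Rightarrow> nat) \<Rightarrow> ereal" where
  "I0term Q p = ereal (1/3) * (\<Sum>i\<in>users.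
       gmi (Kf Q p) (lU Q (p i)) [ladd (lY Q (p i)) (lsc (complex_of_real (tc Q p (prv i))) (lbase (GV (prv i))))] [])"

definition I1term :: "prm \<Rightarrow> (nat \<Rightarrow> nat) \<Rightarrow> ereal" where
  "I1term Q p = ereal (1/3) * (\<Sum>i\<in>users.
       gmi (Kf Q p) (lU Q (p i)) [ladd (lY Q (p i)) (lsc (complex_of_real (tc' Q p (prv i))) (lbase (GV' (prv i))))] [])"

definition cond_a :: "prm \<Rightarrow> (nat \<Rightarrow> nat) \<Rightarrow> bool" where
  "cond_a Q p \<longleftrightarrow> (\<forall>i\<in>users.
      vVW Q (p i) \<ge> (sN Q (p (nxt i)))\<^sup>2 \<and>
      vVN Q p (nxt i) \<ge> (cmod (ch_h Q (p i) (p (prv i))))\<^sup>2 * vZW Q (p (prv i)))"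

definition cond_b :: "prm \<Rightarrow> (nat \<Rightarrow> nat) \<Rightarrow> bool" where
  "cond_b Q p \<longleftrightarrow> (\<forall>i\<in>users.
      vVW Q (p i) \<ge> (sW Q (p i))\<^sup>2 \<and>
      vVN' Q p (nxt i) \<ge> (cmod (ch_h Q (p (nxt i)) (p (prv i))))\<^sup>2 * vZW Q (p (prv i)))"

end

theory Submission
  imports Defs "HOL-Library.Function_Algebras"
begin

text \<open>
  For a codebook \<open>c\<close> of power \<open>P\<close> let \<open>D(c, v)\<close> be the gap between the Gaussian entropy
  \<open>n ln (\<pi> e (P + v))\<close> and the entropy of a random codeword plus Gaussian noise of variance \<open>v\<close>.
  The gap is non-negative and decreases in \<open>v\<close>.  Fano's inequality is used three times at every
  receiver: with interference treated as noise, with the side information \<open>S\<close> and the previous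
  user's input, and with the noisy interference \<open>U\<close>.  Gaussian cross entropies turn these bounds into the three
  kinds of terms of \<open>A\<close> plus a signed sum of gaps of single codebooks and of interference
  codebooks at various noise levels.  Summed over the three users, the conditions on the auxiliary
  noises make the gaps cancel, so the sum rate is at most \<open>A\<close>, while \<open>I\<^sub>0\<close> and \<open>I\<^sub>1\<close> are non-negative.
  For \<open>U\<close> one needs that Gaussian inputs minimise the mutual information of two signals that are
  coupled only through correlated Gaussian noise.  If the auxiliary noises are degenerate,
  then either a term of \<open>A\<close> is infinite or the bounds survive with a simpler proof.
\<close>

section \<open>Gaussian vectors\<close>

text \<open>Codebooks are finite, so every law that occurs is a finite Gaussian mixture: densities
  are positive and explicit, and their logarithms grow at most quadratically, which makes all
  entropy integrals finite. Fano's inequality is stated against an output density \<open>q\<close>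
  of free choice; a \<open>q\<close> that is exact in one coordinate and Gaussian in the other
  yields both the mixture entropies that must survive and the Gaussian terms that are wanted. The
  gaps cancel along the cycle of users: the side information of user \<open>j\<close> spends the gap
  of the interference at receiver \<open>prv j\<close> and creates one for the codeword of
  \<open>nxt j\<close>; the other two bounds at a receiver together create a gap of its interference
  and spend one of its codeword. The obstacle is \<open>U\<close>: it leaves the joint entropy of a
  noisy codeword and a noisy interference that share a noise component. Maximum entropy bounds this
  by Gaussian entropies, whereas the two marginal entropies are needed. Hence the doubling argument
  with sums and differences of this pair and an independent Gaussian pair.\<close>

definition Lam :: "nat \<Rightarrow> (nat \<Rightarrow> complex) measure" where
  "Lam n = PiM {..<n} (\<lambda>_. lborel)"

definition nsq :: "nat \<Rightarrow> (nat \<Rightarrow> complex) \<Rightarrow> real" where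
  "nsq n y = (\<Sum>t<n. (cmod (y t))\<^sup>2)"

definition gd :: "nat \<Rightarrow> real \<Rightarrow> (nat \<Rightarrow> complex) \<Rightarrow> real" where
  "gd n v y = exp (- nsq n y / v) / (pi * v) ^ n"

definition sc :: "complex \<Rightarrow> (nat \<Rightarrow> complex) \<Rightarrow> nat \<Rightarrow> complex" where
  "sc k y = (\<lambda>t. k * y t)"

abbreviation rs :: "nat \<Rightarrow> (nat \<Rightarrow> complex) \<Rightarrow> nat \<Rightarrow> complex" where
  "rs n y \<equiv> restrict y {..<n}"

lemma sc_apply [simp]: "sc k y t = k * y t"
  by (simp add: sc_def)

lemma sc_simps [simp]:
  "sc k (x + y) = sc k x + sc k y" "sc k (x - y) = sc k x - sc k y"
  "sc k (sc l y) = sc (k * l) y" "sc 1 y = y" "sc 0 y = 0" "sc k 0 = 0"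
  by (auto simp: fun_eq_iff algebra_simps)

lemma nsq_nonneg [simp]: "0 \<le> nsq n y"
  by (simp add: nsq_def sum_nonneg)

lemma nsq_rs [simp]: "nsq n (rs n y) = nsq n y"
  by (simp add: nsq_def)

lemma nsq_rs2 [simp]: "nsq n (rs n y - c) = nsq n (y - c)" "nsq n (rs n y + c) = nsq n (y + c)"
  "nsq n (c - rs n y) = nsq n (c - y)"  "nsq n (c + rs n y) = nsq n (c + y)"
  by (simp_all add: nsq_def)

lemma nsq_sc [simp]: "nsq n (sc k y) = (cmod k)\<^sup>2 * nsq n y"
  by (simp add: nsq_def norm_mult power_mult_distrib sum_distrib_left)

lemma nsq_cong: "(\<And>t. t < n \<Longrightarrow> x t = y t) \<Longrightarrow> nsq n x = nsq n y"
  by (simp add: nsq_def)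

lemma gd_cong: "(\<And>t. t < n \<Longrightarrow> x t = y t) \<Longrightarrow> gd n v x = gd n v y"
  using nsq_cong[of n x y] by (simp add: gd_def)

lemma gd_uminus: "gd n v (- y) = gd n v y"
  by (simp add: gd_def nsq_def)

lemma gd_pos [simp]: "0 < v \<Longrightarrow> 0 < gd n v y"
  by (simp add: gd_def)

lemma gd_nonneg [simp]: "0 < v \<Longrightarrow> 0 \<le> gd n v y"
  by (simp add: gd_def)

text \<open>Vectors are total functions of which only the first \<open>n\<close> entries count, and
  sums or multiples of elements of \<open>Lam n\<close> may leave its extensional carrier. Asking
  for measurability entry by entry makes a restriction necessary only where an actual element of the
  space is required.\<close>

definition mv :: "'a measure \<Rightarrow> nat \<Rightarrow> ('a \<Rightarrow> nat \<Rightarrow> complex) \<Rightarrow> bool" where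
  "mv N n f \<longleftrightarrow> (\<forall>t<n. (\<lambda>\<omega>. f \<omega> t) \<in> borel_measurable N)"

lemma mvI [intro]:
  "mv N n f \<Longrightarrow> mv N n g \<Longrightarrow> mv N n (\<lambda>\<omega>. f \<omega> + g \<omega>)"
  "mv N n f \<Longrightarrow> mv N n g \<Longrightarrow> mv N n (\<lambda>\<omega>. f \<omega> - g \<omega>)"
  "mv N n f \<Longrightarrow> mv N n (\<lambda>\<omega>. sc k (f \<omega>))"
  "mv N n (\<lambda>\<omega>. c)"
  "mv N n f \<Longrightarrow> mv N n (\<lambda>\<omega>. rs n (f \<omega>))"
  unfolding mv_def by (simp_all add: borel_measurable_add borel_measurable_diff borel_measurable_times)

lemma mv_Lam: "f \<in> measurable N (Lam n) \<Longrightarrow> mv N n f"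
  unfolding mv_def Lam_def
proof (intro allI impI)
  fix t assume "f \<in> measurable N (PiM {..<n} (\<lambda>_. lborel))" "t < n"
  then have "(\<lambda>\<omega>. f \<omega> t) \<in> measurable N lborel"
    using measurable_compose[OF _ measurable_component_singleton[of t "{..<n}" "\<lambda>_. lborel :: complex measure"], of f N] by simp
  then show "(\<lambda>\<omega>. f \<omega> t) \<in> borel_measurable N" by simp
qed

lemma measurable_Lam_mv: "mv N n f \<Longrightarrow> (\<lambda>\<omega>. rs n (f \<omega>)) \<in> measurable N (Lam n)"
  unfolding mv_def Lam_def by (intro measurable_restrict) auto

lemma mv_basic [intro]: "mv (Lam n) n (\<lambda>x. x)"
  "mv (Lam n \<Otimes>\<^sub>M M') n fst" "mv (M' \<Otimes>\<^sub>M Lam n) n snd"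
  by (rule mv_Lam, simp)+

lemma nsq_measurable: "mv N n f \<Longrightarrow> (\<lambda>\<omega>. nsq n (f \<omega>)) \<in> borel_measurable N"
  unfolding mv_def nsq_def by (intro borel_measurable_sum) auto

lemma gd_measurable: "mv N n f \<Longrightarrow> (\<lambda>\<omega>. gd n v (f \<omega>)) \<in> borel_measurable N"
  unfolding gd_def using nsq_measurable[of N n f] by measurable

section \<open>Lebesgue measure on complex \<open>n\<close>-space under translations and
  dilations\<close>

interpretation lb: product_sigma_finite "\<lambda>_::nat. lborel :: complex measure"
  by standard

lemma sigma_finite_Lam [simp]: "sigma_finite_measure (Lam n)"
  unfolding Lam_def by (rule lb.sigma_finite) simp

lemma space_Lam: "space (Lam n) = PiE {..<n} (\<lambda>_. UNIV)"
  by (simp add: Lam_def space_PiM)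

lemma rs_space_Lam [simp]: "y \<in> space (Lam n) \<Longrightarrow> rs n y = y"
  by (auto simp: space_Lam PiE_def extensional_restrict)

lemma Lam_box: "(\<And>t. t < n \<Longrightarrow> A t \<in> sets borel) \<Longrightarrow>
    emeasure (Lam n) (PiE {..<n} A) = (\<Prod>t<n. emeasure lborel (A t))"
  unfolding Lam_def by (intro lb.emeasure_PiM) auto

lemma distr_Lam_translate: "distr (Lam n) (Lam n) (\<lambda>y. rs n (y + c)) = Lam n"
proof -
  have m: "(\<lambda>y. rs n (y + c)) \<in> measurable (Lam n) (Lam n)"
    by (intro measurable_Lam_mv) auto
  show ?thesis
  unfolding Lam_def
  proof (rule lb.PiM_eqI)
    fix A :: "nat \<Rightarrow> complex set" assume A: "\<And>i. i \<in> {..<n} \<Longrightarrow> A i \<in> sets lborel"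
    have A': "A t \<in> sets borel" if "t < n" for t using A that by auto
    have pre: "(\<lambda>y. rs n (y + c)) -` PiE {..<n} A \<inter> space (Lam n) = PiE {..<n} (\<lambda>t. (+) (c t) -` A t)"
      by (auto simp: space_Lam PiE_iff add.commute)
    have "emeasure (distr (Lam n) (Lam n) (\<lambda>y. rs n (y + c))) (PiE {..<n} A)
        = emeasure (Lam n) (PiE {..<n} (\<lambda>t. (+) (c t) -` A t))"
      by (subst emeasure_distr[OF m]) (use A in \<open>simp_all add: pre\<close>, auto simp: Lam_def intro!: sets_PiM_I_finite)
    also have "\<dots> = (\<Prod>t<n. emeasure lborel ((+) (c t) -` A t))"
      by (rule Lam_box) (use A' in \<open>auto intro!: measurable_sets_borel[where M=borel]\<close>)
    also have "\<dots> = (\<Prod>t<n. emeasure lborel (A t))"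
    proof (rule prod.cong[OF refl])
      fix t assume t: "t \<in> {..<n}"
      have "emeasure lborel (A t) = emeasure (distr lborel borel ((+) (c t))) (A t)"
        by (simp only: lborel_distr_plus)
      also have "\<dots> = emeasure lborel ((+) (c t) -` A t)"
        using A' t by (subst emeasure_distr) auto
      finally show "emeasure lborel ((+) (c t) -` A t) = emeasure lborel (A t)" by simp
    qed
    finally show "emeasure (distr (PiM {..<n} (\<lambda>_. lborel)) (PiM {..<n} (\<lambda>_. lborel)) (\<lambda>y. rs n (y + c))) (PiE {..<n} A) =
         (\<Prod>i<n. emeasure lborel (A i))"
      by (simp add: Lam_def)
  qed auto
qed

lemma nn_integral_translate:
  assumes [measurable]: "F \<in> borel_measurable (Lam n)"
  shows "(\<integral>\<^sup>+y. F (rs n (y + c)) \<partial>Lam n) = (\<integral>\<^sup>+y. F y \<partial>Lam n)"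
proof -
  have m: "(\<lambda>y. rs n (y + c)) \<in> measurable (Lam n) (Lam n)"
    by (intro measurable_Lam_mv) auto
  show ?thesis
    by (subst (2) distr_Lam_translate[of n c, symmetric], subst nn_integral_distr[OF m]) simp_all
qed

text \<open>Boxes determine Lebesgue measure, and a box in the plane is a product of two intervals.
  This opens the way to Fubini in the real and imaginary parts.\<close>

lemma nn_integral_complex:
  assumes [measurable]: "F \<in> borel_measurable borel"
  shows "(\<integral>\<^sup>+z. F z \<partial>lborel) = (\<integral>\<^sup>+x. \<integral>\<^sup>+y. F (Complex x y) \<partial>lborel \<partial>lborel)"
proof -
  have e: "lborel = distr (lborel \<Otimes>\<^sub>M lborel) borel (\<lambda>(x,y). Complex x y)"
  proof (rule lborel_eqI)
    fix l u :: complex assume lu: "\<And>b. b \<in> Basis \<Longrightarrow> l \<bullet> b \<le> u \<bullet> b"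
    then have le: "Re l \<le> Re u" "Im l \<le> Im u" using lu[of 1] lu[of \<i>] by (auto simp: Basis_complex_def)
    have m: "(\<lambda>(x,y). Complex x y) \<in> measurable (lborel \<Otimes>\<^sub>M lborel) borel"
      by (simp add: complex_eq_iff borel_measurable_complex_iff split_beta')
    have pre: "(\<lambda>(x,y). Complex x y) -` box l u \<inter> space (lborel \<Otimes>\<^sub>M lborel) = {Re l<..<Re u} \<times> {Im l<..<Im u}"
      by (auto simp: space_pair_measure box_def Basis_complex_def)
    have "emeasure (distr (lborel \<Otimes>\<^sub>M lborel) borel (\<lambda>(x,y). Complex x y)) (box l u)
        = emeasure (lborel \<Otimes>\<^sub>M lborel) ({Re l<..<Re u} \<times> {Im l<..<Im u})"
      by (subst emeasure_distr[OF m]) (auto simp: pre)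
    also have "\<dots> = ennreal (Re u - Re l) * ennreal (Im u - Im l)"
      using le by (subst lborel.emeasure_pair_measure_Times) auto
    also have "\<dots> = (\<Prod>b\<in>Basis. (u - l) \<bullet> b)"
      using le by (simp add: Basis_complex_def ennreal_mult'[symmetric])
    finally show "emeasure (distr (lborel \<Otimes>\<^sub>M lborel) borel (\<lambda>(x,y). Complex x y)) (box l u) = (\<Prod>b\<in>Basis. (u - l) \<bullet> b)" .
  qed simp
  have m: "(\<lambda>(x,y). Complex x y) \<in> measurable (lborel \<Otimes>\<^sub>M lborel) borel"
    by (simp add: complex_eq_iff borel_measurable_complex_iff split_beta')
  have "(\<integral>\<^sup>+z. F z \<partial>lborel) = (\<integral>\<^sup>+p. F ((\<lambda>(x,y). Complex x y) p) \<partial>(lborel \<Otimes>\<^sub>M lborel))"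
    by (subst e, subst nn_integral_distr[OF m]) auto
  also have "\<dots> = (\<integral>\<^sup>+x. \<integral>\<^sup>+y. F (Complex x y) \<partial>lborel \<partial>lborel)"
    using measurable_compose[OF m assms] by (subst lborel.nn_integral_fst[symmetric]) simp_all
  finally show ?thesis .
qed

lemma Complex_measurable: "f \<in> borel_measurable M \<Longrightarrow> g \<in> borel_measurable M \<Longrightarrow>
   (\<lambda>x. Complex (f x) (g x)) \<in> borel_measurable M"
  by (simp add: borel_measurable_complex_iff)

lemma nn_integral_shift_real: "f \<in> borel_measurable borel \<Longrightarrow>
  (\<integral>\<^sup>+x. f (x + c) \<partial>lborel) = (\<integral>\<^sup>+x. f (x::real) \<partial>lborel)"
  using nn_integral_real_affine[of f 1 c] by (simp add: add.commute)

text \<open>After Fubini a shear is a translation of one coordinate for each fixed value of the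
  other.\<close>

lemma nn_integral_complex_shear:
  assumes [measurable]: "F \<in> borel_measurable borel"
  shows "(\<integral>\<^sup>+z. F (z + of_real (s * Im z)) \<partial>lborel) = (\<integral>\<^sup>+z. F z \<partial>lborel)"
    and "(\<integral>\<^sup>+z. F (z + \<i> * of_real (s * Re z)) \<partial>lborel) = (\<integral>\<^sup>+z. F z \<partial>lborel)"
proof -
  note [measurable] = Complex_measurable
  have "(\<integral>\<^sup>+z. F (z + of_real (s * Im z)) \<partial>lborel) = (\<integral>\<^sup>+x. \<integral>\<^sup>+y. F (Complex (x + s * y) y) \<partial>lborel \<partial>lborel)"
    by (subst nn_integral_complex) (auto intro!: nn_integral_cong arg_cong[where f=F] simp: complex_eq_iff)
  also have "\<dots> = (\<integral>\<^sup>+y. \<integral>\<^sup>+x. F (Complex (x + s * y) y) \<partial>lborel \<partial>lborel)"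
    by (rule lborel_pair.Fubini') measurable
  also have "\<dots> = (\<integral>\<^sup>+y. \<integral>\<^sup>+x. F (Complex x y) \<partial>lborel \<partial>lborel)"
    by (intro nn_integral_cong nn_integral_shift_real[of "\<lambda>x. F (Complex x _)"]) measurable
  also have "\<dots> = (\<integral>\<^sup>+x. \<integral>\<^sup>+y. F (Complex x y) \<partial>lborel \<partial>lborel)"
    by (rule lborel_pair.Fubini'[symmetric]) measurable
  also have "\<dots> = (\<integral>\<^sup>+z. F z \<partial>lborel)" by (simp add: nn_integral_complex)
  finally show "(\<integral>\<^sup>+z. F (z + of_real (s * Im z)) \<partial>lborel) = (\<integral>\<^sup>+z. F z \<partial>lborel)" .
  have "(\<integral>\<^sup>+z. F (z + \<i> * of_real (s * Re z)) \<partial>lborel) = (\<integral>\<^sup>+x. \<integral>\<^sup>+y. F (Complex x (y + s * x)) \<partial>lborel \<partial>lborel)"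
    by (subst nn_integral_complex) (auto intro!: nn_integral_cong arg_cong[where f=F] simp: complex_eq_iff)
  also have "\<dots> = (\<integral>\<^sup>+x. \<integral>\<^sup>+y. F (Complex x y) \<partial>lborel \<partial>lborel)"
    by (intro nn_integral_cong nn_integral_shift_real[of "\<lambda>y. F (Complex _ y)"]) measurable
  also have "\<dots> = (\<integral>\<^sup>+z. F z \<partial>lborel)" by (simp add: nn_integral_complex)
  finally show "(\<integral>\<^sup>+z. F (z + \<i> * of_real (s * Re z)) \<partial>lborel) = (\<integral>\<^sup>+z. F z \<partial>lborel)" .
qed

lemma nn_integral_complex_scaleR:
  assumes [measurable]: "F \<in> borel_measurable borel" and r: "r \<noteq> 0"
  shows "(\<integral>\<^sup>+z. F (of_real r * z) \<partial>lborel) = ennreal (1 / r\<^sup>2) * (\<integral>\<^sup>+z. F (z::complex) \<partial>lborel)"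
proof -
  have [measurable]: "(\<lambda>x::complex. r *\<^sub>R x) \<in> borel_measurable borel" by simp
  have "(\<integral>\<^sup>+z. F z \<partial>lborel) = (\<integral>\<^sup>+z. ennreal (r\<^sup>2) * F (of_real r * z) \<partial>lborel)"
    by (subst lborel_affine[OF r, of 0], subst nn_integral_density)
      (auto simp: nn_integral_distr scaleR_conv_of_real)
  also have "\<dots> = ennreal (r\<^sup>2) * (\<integral>\<^sup>+z. F (of_real r * z) \<partial>lborel)"
    by (subst nn_integral_cmult) auto
  finally show ?thesis using r
    by (simp add: mult.assoc[symmetric] ennreal_mult'[symmetric])
qed

text \<open>The factor is a positive dilation times a rotation. Real dilations are affine changes of
  variables; a rotation is a product of three shears, each of which preserves area, unless its sine
  vanishes and it is multiplication by 1 or -1.\<close>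

lemma nn_integral_complex_scale:
  assumes [measurable]: "F \<in> borel_measurable borel" and k: "k \<noteq> 0"
  shows "(\<integral>\<^sup>+z. F (k * z) \<partial>lborel) = ennreal (1 / (cmod k)\<^sup>2) * (\<integral>\<^sup>+z. F (z::complex) \<partial>lborel)"
proof -
  have rot: "(\<integral>\<^sup>+z. G (u * z) \<partial>lborel) = (\<integral>\<^sup>+z. G z \<partial>lborel)" if u: "cmod u = 1" and [measurable]: "G \<in> borel_measurable borel"
    for u :: complex and G
  proof (cases "Im u = 0")
    case True
    have *: "(cmod u)\<^sup>2 = 1" using u by simp
    have "(Re u)\<^sup>2 = 1" using * True by (simp add: cmod_power2)
    moreover have "Re u \<noteq> 0" using \<open>(Re u)\<^sup>2 = 1\<close> by auto
    moreover have "u = of_real (Re u)" using True by (simp add: complex_eq_iff)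
    ultimately show ?thesis using nn_integral_complex_scaleR[of G "Re u"] by simp
  next
    case False
    \<comment> \<open>With \<open>u = cos t + i sin t\<close> this is \<open>- tan (t/2)\<close>: a
      rotation is the product of the shears with parameters \<open>s\<close>, \<open>sin t\<close>
      and \<open>s\<close>.\<close>
    define s where "s = (Re u - 1) / Im u"
    have *: "(Re u)\<^sup>2 + (Im u)\<^sup>2 = 1" using u by (metis cmod_power2 one_power2)
    have sI: "s * Im u = Re u - 1" using False by (simp add: s_def)
    have s2: "s * (Re u + 1) = - Im u"
    proof -
      have "s * (Re u + 1) * Im u = (Re u - 1) * (Re u + 1)"
        by (simp only: sI[symmetric] mult_ac)
      also have "\<dots> = - (Im u) * Im u" using * by (simp add: algebra_simps power2_eq_square)
      finally show ?thesis using mult_right_cancel[OF False] by blast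
    qed
    define S1 where "S1 z = z + of_real (s * Im z)" for z :: complex
    define S2 where "S2 z = z + \<i> * of_real (Im u * Re z)" for z :: complex
    have [measurable]: "S1 \<in> borel_measurable borel" "S2 \<in> borel_measurable borel"
      unfolding S1_def S2_def by measurable
    have rotz: "u * z = S1 (S2 (S1 z))" for z
    proof -
      define x y where "x = Re z" and "y = Im z"
      have i1: "Im (S2 (S1 z)) = y + Im u * (x + s * y)" by (simp add: S1_def S2_def x_def y_def)
      have r1: "Re (S2 (S1 z)) = x + s * y" by (simp add: S1_def S2_def x_def y_def)
      have i2: "y + Im u * (x + s * y) = Im u * x + Re u * y"
      proof -
        have "y + Im u * (x + s * y) = Im u * x + y * (1 + s * Im u)" by (simp add: algebra_simps)
        then show ?thesis unfolding sI by simp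
      qed
      have r2: "x + s * y + s * (Im u * x + Re u * y) = Re u * x - Im u * y"
      proof -
        have "x + s * y + s * (Im u * x + Re u * y) = x * (1 + s * Im u) + y * (s * (Re u + 1))"
          by (simp add: algebra_simps)
        also have "\<dots> = Re u * x - Im u * y" unfolding sI s2 by (simp add: algebra_simps)
        finally show ?thesis .
      qed
      have i3: "Im (S2 (S1 z)) = Im u * x + Re u * y" using i1 i2 by simp
      have "Re (S1 (S2 (S1 z))) = Re u * x - Im u * y"
        unfolding S1_def[of "S2 (S1 z)"] using r1 i3 r2 by simp
      moreover have "Im (S1 (S2 (S1 z))) = Im u * x + Re u * y"
        unfolding S1_def[of "S2 (S1 z)"] using i3 by simp
      ultimately show ?thesis
        by (simp add: complex_eq_iff x_def y_def)
    qed
    have "(\<integral>\<^sup>+z. G (u * z) \<partial>lborel) = (\<integral>\<^sup>+z. (\<lambda>z. G (S1 (S2 z))) (S1 z) \<partial>lborel)" by (simp add: rotz)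
    also have "\<dots> = (\<integral>\<^sup>+z. (\<lambda>z. G (S1 z)) (S2 z) \<partial>lborel)"
      unfolding S1_def[abs_def] by (subst nn_integral_complex_shear(1)) (simp_all)
    also have "\<dots> = (\<integral>\<^sup>+z. G (S1 z) \<partial>lborel)"
      unfolding S2_def[abs_def] by (subst nn_integral_complex_shear(2)) (simp_all)
    also have "\<dots> = (\<integral>\<^sup>+z. G z \<partial>lborel)"
      unfolding S1_def[abs_def] by (subst nn_integral_complex_shear(1)) (simp_all)
    finally show ?thesis .
  qed
  have "(\<integral>\<^sup>+z. F (k * z) \<partial>lborel) = (\<integral>\<^sup>+z. (\<lambda>z. F (of_real (cmod k) * z)) (sgn k * z) \<partial>lborel)"
    using k by (simp add: sgn_eq mult.assoc[symmetric])
  also have "\<dots> = (\<integral>\<^sup>+z. F (of_real (cmod k) * z) \<partial>lborel)"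
    using k by (intro rot) (auto simp: norm_sgn)
  also have "\<dots> = ennreal (1 / (cmod k)\<^sup>2) * (\<integral>\<^sup>+z. F (z::complex) \<partial>lborel)"
    using k by (intro nn_integral_complex_scaleR) auto
  finally show ?thesis .
qed

section \<open>The circularly symmetric Gaussian density\<close>

definition g1 :: "real \<Rightarrow> complex \<Rightarrow> real" where
  "g1 v z = exp (- (cmod z)\<^sup>2 / v) / (pi * v)"

lemma gd_prod: "gd n v y = (\<Prod>t<n. g1 v (y t))"
  by (simp add: gd_def g1_def nsq_def prod_dividef exp_sum[symmetric] sum_divide_distrib sum_negf)

lemma g1_measurable [measurable]: "g1 v \<in> borel_measurable borel"
  unfolding g1_def by measurable

lemma g1_nonneg: "0 < v \<Longrightarrow> 0 \<le> g1 v z"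
  by (simp add: g1_def)

text \<open>The squared modulus splits, so real and imaginary part are independent real Gaussians
  with half of the variance each.\<close>

lemma g1_normal: "0 < v \<Longrightarrow> g1 v (Complex x y) = normal_density 0 (sqrt (v/2)) x * normal_density 0 (sqrt (v/2)) y"
proof -
  assume v: "0 < v"
  have nd: "normal_density 0 (sqrt (v/2)) x = exp (- (x\<^sup>2 / v)) / sqrt (pi * v)" for x
    using v by (simp add: normal_density_def)
  have "exp (- (x\<^sup>2 / v)) * exp (- (y\<^sup>2 / v)) = exp (- (cmod (Complex x y))\<^sup>2 / v)"
    unfolding exp_add[symmetric] cmod_power2 by (simp add: add_divide_distrib diff_divide_distrib)
  then show ?thesis using v by (simp add: nd g1_def real_sqrt_mult_self)
qed

lemma nn_integral_normal: "0 < s \<Longrightarrow> (\<integral>\<^sup>+x. normal_density 0 s x \<partial>lborel) = 1"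
  by (subst nn_integral_eq_integral) (auto simp: normal_density_nonneg)

lemma nn_integral_normal2: "0 < s \<Longrightarrow> (\<integral>\<^sup>+x. normal_density 0 s x * x\<^sup>2 \<partial>lborel) = ennreal (s\<^sup>2)"
  using normal_moment_even[of s 0 1]
  by (subst nn_integral_eq_integral)
     (auto simp: normal_density_nonneg has_bochner_integral_iff numeral_2_eq_2)

lemma nn_integral_g1: "0 < v \<Longrightarrow> (\<integral>\<^sup>+z. g1 v z \<partial>lborel) = 1"
  by (subst nn_integral_complex)
     (simp_all add: g1_normal ennreal_mult normal_density_nonneg nn_integral_cmult nn_integral_normal)

lemma nn_integral_g1_sq: assumes v: "0 < v" shows "(\<integral>\<^sup>+z. g1 v z * (cmod z)\<^sup>2 \<partial>lborel) = ennreal v"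
proof -
  let ?N = "normal_density 0 (sqrt (v/2))"
  have s: "0 < sqrt (v/2)" using v by simp
  have "(\<integral>\<^sup>+z. g1 v z * (cmod z)\<^sup>2 \<partial>lborel)
     = (\<integral>\<^sup>+x. \<integral>\<^sup>+y. ennreal (?N x * x\<^sup>2) * ennreal (?N y) + ennreal (?N x) * ennreal (?N y * y\<^sup>2) \<partial>lborel \<partial>lborel)"
    by (subst nn_integral_complex)
      (auto intro!: nn_integral_cong simp: g1_normal[OF v] ennreal_mult[symmetric] ennreal_plus[symmetric]
        cmod_power2 algebra_simps simp del: ennreal_plus)
  also have "\<dots> = (\<integral>\<^sup>+x. ennreal (?N x * x\<^sup>2) + ennreal (?N x) * ennreal (v/2) \<partial>lborel)"
    using v by (intro nn_integral_cong)
      (simp add: nn_integral_add nn_integral_cmult nn_integral_normal[OF s] nn_integral_normal2[OF s])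
  also have "\<dots> = ennreal (v/2) + ennreal (v/2)"
    using v by (simp add: nn_integral_add nn_integral_multc nn_integral_normal[OF s] nn_integral_normal2[OF s])
  also have "\<dots> = ennreal v" using v by (simp add: ennreal_plus[symmetric] del: ennreal_plus)
  finally show ?thesis .
qed

lemma gd_measurable_ennreal: "mv N n f \<Longrightarrow> (\<lambda>\<omega>. ennreal (gd n v (f \<omega>))) \<in> borel_measurable N"
  using gd_measurable[of N n f v] by simp

lemma mv_id_minus [intro]: "mv (Lam n) n (\<lambda>y. y - c)" "mv (Lam n) n (\<lambda>y. y + c)" "mv (Lam n) n (\<lambda>y. sc k y)"
  by (rule mvI mv_basic)+

lemma nn_integral_gd: assumes v: "0 < v" shows "(\<integral>\<^sup>+y. gd n v (y - c) \<partial>Lam n) = 1"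
proof -
  have "(\<integral>\<^sup>+y. gd n v (y - c) \<partial>Lam n) = (\<integral>\<^sup>+y. (\<lambda>y. ennreal (gd n v y)) (rs n (y + (- c))) \<partial>Lam n)"
    by (intro nn_integral_cong arg_cong[where f=ennreal] gd_cong) simp_all
  also have "\<dots> = (\<integral>\<^sup>+y. gd n v y \<partial>Lam n)"
    by (rule nn_integral_translate[OF gd_measurable_ennreal[OF mv_basic(1)]])
  also have "\<dots> = (\<integral>\<^sup>+y. (\<Prod>t<n. ennreal (g1 v (y t))) \<partial>PiM {..<n} (\<lambda>_. lborel))"
    by (simp add: gd_prod Lam_def prod_ennreal g1_nonneg v)
  also have "\<dots> = 1"
    by (subst lb.product_nn_integral_prod) (simp_all add: nn_integral_g1 v)
  finally show ?thesis .
qed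

lemma nn_integral_gd_comp: assumes v: "0 < v" and t: "t < n"
  shows "(\<integral>\<^sup>+y. gd n v y * (cmod (y t))\<^sup>2 \<partial>Lam n) = ennreal v"
proof -
  have "(\<integral>\<^sup>+y. gd n v y * (cmod (y t))\<^sup>2 \<partial>Lam n)
      = (\<integral>\<^sup>+y. (\<Prod>s<n. ennreal (if s = t then g1 v (y s) * (cmod (y s))\<^sup>2 else g1 v (y s))) \<partial>PiM {..<n} (\<lambda>_. lborel))"
    unfolding Lam_def
  proof (intro nn_integral_cong)
    fix y :: "nat \<Rightarrow> complex"
    have "gd n v y * (cmod (y t))\<^sup>2 = (\<Prod>s<n. if s = t then g1 v (y s) * (cmod (y s))\<^sup>2 else g1 v (y s))"
      using t unfolding gd_prod by (subst (1 2) prod.remove[of _ t]) (auto intro!: prod.cong)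
    then show "ennreal (gd n v y * (cmod (y t))\<^sup>2) = (\<Prod>s<n. ennreal (if s = t then g1 v (y s) * (cmod (y s))\<^sup>2 else g1 v (y s)))"
      by (simp add: prod_ennreal g1_nonneg v)
  qed
  also have "\<dots> = (\<Prod>s<n. \<integral>\<^sup>+z. ennreal (if s = t then g1 v z * (cmod z)\<^sup>2 else g1 v z) \<partial>lborel)"
    by (subst lb.product_nn_integral_prod) auto
  also have "\<dots> = (\<Prod>s<n. if s = t then ennreal v else 1)"
    by (intro prod.cong) (auto simp: nn_integral_g1 nn_integral_g1_sq v)
  also have "\<dots> = ennreal v" using t by (subst prod.delta) auto
  finally show ?thesis .
qed

text \<open>It is enough to compare measures on boxes, coordinate by coordinate; each complex
  coordinate contributes the Jacobian \<open>(cmod k)\<^sup>2\<close>, whence the exponent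
  \<open>2*n\<close>.\<close>

lemma nn_integral_Lam_scale:
  assumes [measurable]: "F \<in> borel_measurable (Lam n)" and k: "k \<noteq> 0"
  shows "(\<integral>\<^sup>+y. F (rs n (sc k y)) \<partial>Lam n) = ennreal (1 / (cmod k)^(2*n)) * (\<integral>\<^sup>+y. F y \<partial>Lam n)"
proof -
  let ?P = "density (distr (Lam n) (Lam n) (\<lambda>y. rs n (sc k y))) (\<lambda>_. ennreal ((cmod k)^(2*n)))"
  have m[measurable]: "(\<lambda>y. rs n (sc k y)) \<in> measurable (Lam n) (Lam n)"
    by (intro measurable_Lam_mv) auto
  have P: "?P = PiM {..<n} (\<lambda>_. lborel)"
  proof (rule lb.PiM_eqI)
    show "sets ?P = sets (PiM {..<n} (\<lambda>_. lborel))" by (simp add: Lam_def)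
    fix A :: "nat \<Rightarrow> complex set" assume A: "\<And>i. i \<in> {..<n} \<Longrightarrow> A i \<in> sets lborel"
    have A': "A t \<in> sets borel" if "t < n" for t using A that by auto
    have sA: "PiE {..<n} A \<in> sets (Lam n)"
      using A by (auto simp: Lam_def intro!: sets_PiM_I_finite)
    have pre: "(\<lambda>y. rs n (sc k y)) -` PiE {..<n} A \<inter> space (Lam n) = PiE {..<n} (\<lambda>t. (*) k -` A t)"
      by (auto simp: space_Lam PiE_iff)
    have one: "emeasure lborel ((*) k -` A t) = ennreal (1 / (cmod k)\<^sup>2) * emeasure lborel (A t)" if t: "t < n" for t
    proof -
      have "emeasure lborel ((*) k -` A t) = (\<integral>\<^sup>+z. indicator (A t) (k * z) \<partial>lborel)"
        using A'[OF t] by (subst nn_integral_indicator[symmetric])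
          (auto intro!: nn_integral_cong measurable_sets_borel[where M=borel] simp: indicator_def)
      also have "\<dots> = ennreal (1 / (cmod k)\<^sup>2) * (\<integral>\<^sup>+z. indicator (A t) z \<partial>lborel)"
        using A'[OF t] k by (intro nn_integral_complex_scale) auto
      finally show ?thesis using A'[OF t] by simp
    qed
    have "emeasure ?P (PiE {..<n} A) = ennreal ((cmod k)^(2*n)) * emeasure (Lam n) (PiE {..<n} (\<lambda>t. (*) k -` A t))"
      using sA by (subst emeasure_density_const) (simp_all add: emeasure_distr[OF m] pre)
    also have "emeasure (Lam n) (PiE {..<n} (\<lambda>t. (*) k -` A t)) = (\<Prod>t<n. emeasure lborel ((*) k -` A t))"
      by (rule Lam_box) (use A' in \<open>auto intro!: measurable_sets_borel[where M=borel]\<close>)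
    also have "\<dots> = (\<Prod>t<n. ennreal (1 / (cmod k)\<^sup>2) * emeasure lborel (A t))"
      by (intro prod.cong) (auto simp: one)
    also have "\<dots> = ennreal ((1 / (cmod k)\<^sup>2)^n) * (\<Prod>t<n. emeasure lborel (A t))"
      by (simp add: prod.distrib ennreal_power)
    also have "ennreal ((cmod k)^(2*n)) * (ennreal ((1 / (cmod k)\<^sup>2)^n) * (\<Prod>t<n. emeasure lborel (A t))) = (\<Prod>t<n. emeasure lborel (A t))"
      using k by (simp add: mult.assoc[symmetric] ennreal_mult'[symmetric] power_mult power_one_over)
    finally show "emeasure ?P (PiE {..<n} A) = (\<Prod>i<n. emeasure lborel (A i))" .
  qed simp
  have "(\<integral>\<^sup>+y. F y \<partial>Lam n) = (\<integral>\<^sup>+y. F y \<partial>?P)" unfolding P by (simp add: Lam_def)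
  also have "\<dots> = ennreal ((cmod k)^(2*n)) * (\<integral>\<^sup>+y. F (rs n (sc k y)) \<partial>Lam n)"
    by (subst nn_integral_density) (simp_all add: nn_integral_distr nn_integral_cmult)
  finally show ?thesis using k
    by (simp add: mult.assoc[symmetric] ennreal_mult'[symmetric])
qed

section \<open>Inner products, transport of integrals and Gaussian second moments\<close>

definition ip :: "nat \<Rightarrow> (nat \<Rightarrow> complex) \<Rightarrow> (nat \<Rightarrow> complex) \<Rightarrow> real" where
  "ip n x y = (\<Sum>t<n. Re (x t * cnj (y t)))"

lemma cmod_add_sq: "(cmod (a + b))\<^sup>2 = (cmod a)\<^sup>2 + 2 * Re (a * cnj b) + (cmod b)\<^sup>2"
  unfolding cmod_power2 by (simp add: power2_eq_square algebra_simps)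

lemma nsq_add: "nsq n (x + y) = nsq n x + 2 * ip n x y + nsq n y"
  by (simp add: nsq_def ip_def cmod_add_sq sum.distrib sum_distrib_left)

lemma nsq_minus [simp]: "nsq n (- x) = nsq n x"
  by (simp add: nsq_def)

lemma ip_linear: "ip n (x + y) z = ip n x z + ip n y z" "ip n z (x + y) = ip n z x + ip n z y"
  "ip n (x - y) z = ip n x z - ip n y z" "ip n z (x - y) = ip n z x - ip n z y"
  "ip n (- x) z = - ip n x z" "ip n z (- x) = - ip n z x"
  by (simp_all add: ip_def sum.distrib sum_subtractf sum_negf algebra_simps)

lemma nsq_diff: "nsq n (x - y) = nsq n x - 2 * ip n x y + nsq n y"
  using nsq_add[of n x "- y"] by (simp add: ip_linear)

lemma ip_commute: "ip n x y = ip n y x"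
  by (simp add: ip_def algebra_simps)

lemma ip_sc: "ip n (sc k x) y = ip n x (sc (cnj k) y)"
  by (simp add: ip_def algebra_simps)

lemma ip_sc_real: "ip n x (sc (of_real r) y) = r * ip n x y" "ip n x (sc (of_real r * k) y) = r * ip n x (sc k y)"
  by (simp_all add: ip_def sum_distrib_left algebra_simps)

lemma nsq_add_le: "nsq n (x + y) \<le> 2 * nsq n x + 2 * nsq n y"
  using nsq_nonneg[of n "x - y"] by (simp add: nsq_add nsq_diff)

lemma nsq_diff_le: "nsq n (x - y) \<le> 2 * nsq n x + 2 * nsq n y"
  using nsq_nonneg[of n "x + y"] by (simp add: nsq_add nsq_diff)

text \<open>Bayes' rule for \<open>Y = k X + noise\<close>: the joint density is factored once as
  prior times channel and once as output times posterior. \<open>k'\<close> is the coefficient of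
  the linear minimum mean square estimate of \<open>X\<close> from \<open>Y\<close>, and
  \<open>s * u / w\<close> is its error variance.\<close>

lemma gd_swap:
  assumes s: "0 < s" and u: "0 < u" and w: "w = u + (cmod k)\<^sup>2 * s" and k': "k' = of_real (s / w) * cnj k"
  shows "gd n s x * gd n u (y - sc k x) = gd n w y * gd n (s * u / w) (x - sc k' y)"
proof -
  have wp: "0 < w" using s u w by (simp add: add_pos_nonneg)
  have i: "ip n x (sc k' y) = s / w * ip n y (sc k x)"
    unfolding k' ip_sc_real by (simp add: ip_sc[symmetric] ip_commute)
  have ck: "(cmod k')\<^sup>2 = (s / w)\<^sup>2 * (cmod k)\<^sup>2"
    using s wp by (simp add: k' norm_mult norm_divide power_mult_distrib power_divide)
  define K where "K = (cmod k)\<^sup>2"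
  define X Y J where "X = nsq n x" and "Y = nsq n y" and "J = ip n y (sc k x)"
  have K: "w = u + K * s" using w K_def by simp
  have "X / s + (Y - 2 * J + K * X) / u = Y / w + (X - 2 * (s / w * J) + (s / w)\<^sup>2 * K * Y) / (s * u / w)"
  proof -
    have a: "X / s + K * X / u = X * w / (s * u)"
      using s u by (simp add: K field_simps)
    have b: "Y / u = Y / w + (s / w)\<^sup>2 * K * Y * w / (s * u)"
    proof -
      have "Y / w + (s / w)\<^sup>2 * K * Y * w / (s * u) = Y / w * (1 + K * s / u)"
        using s u wp by (simp add: power2_eq_square field_simps)
      also have "1 + K * s / u = w / u" using u by (simp add: K field_simps)
      finally show ?thesis using wp by simp
    qed
    have c: "2 * (s / w * J) * w / (s * u) = 2 * J / u" using s wp by simp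
    have "(X - 2 * (s / w * J) + (s / w)\<^sup>2 * K * Y) / (s * u / w)
       = X * w / (s * u) - 2 * (s / w * J) * w / (s * u) + (s / w)\<^sup>2 * K * Y * w / (s * u)"
      using s u wp by (simp add: add_divide_distrib diff_divide_distrib algebra_simps)
    then show ?thesis using a b c by (simp add: add_divide_distrib diff_divide_distrib)
  qed
  then have e: "nsq n x / s + nsq n (y - sc k x) / u = nsq n y / w + nsq n (x - sc k' y) / (s * u / w)"
    by (simp add: nsq_diff i ck X_def Y_def J_def K_def)
  have p: "(pi * s) ^ n * (pi * u) ^ n = (pi * w) ^ n * (pi * (s * u / w)) ^ n"
    using wp by (simp add: power_mult_distrib[symmetric] mult_ac)
  have "gd n s x * gd n u (y - sc k x) = exp (- (nsq n x / s + nsq n (y - sc k x) / u)) / ((pi * s) ^ n * (pi * u) ^ n)"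
    by (simp add: gd_def exp_add[symmetric] exp_diff exp_minus field_simps)
  also have "\<dots> = exp (- (nsq n y / w + nsq n (x - sc k' y) / (s * u / w))) / ((pi * w) ^ n * (pi * (s * u / w)) ^ n)"
    unfolding e p ..
  also have "\<dots> = gd n w y * gd n (s * u / w) (x - sc k' y)"
    by (simp add: gd_def exp_add[symmetric] exp_diff exp_minus field_simps)
  finally show ?thesis .
qed

text \<open>After the factors are exchanged by \<open>gd_swap\<close>, the output density leaves the
  integral and the posterior density integrates to 1.\<close>

lemma nn_integral_gd_conv:
  assumes s: "0 < s" and u: "0 < u"
  shows "(\<integral>\<^sup>+x. ennreal (gd n s (x - m)) * ennreal (gd n u (y - sc k x)) \<partial>Lam n) = ennreal (gd n (u + (cmod k)\<^sup>2 * s) (y - sc k m))"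
proof -
  define w k' where "w = u + (cmod k)\<^sup>2 * s" and "k' = complex_of_real (s / w) * cnj k"
  have wp: "0 < w" using s u by (simp add: w_def add_pos_nonneg)
  have eq: "gd n s (x - m) * gd n u (y - sc k x) = gd n w (y - sc k m) * gd n (s * u / w) (x - (m + sc k' (y - sc k m)))" for x
  proof -
    have "gd n s (x - m) * gd n u ((y - sc k m) - sc k (x - m)) = gd n w (y - sc k m) * gd n (s * u / w) ((x - m) - sc k' (y - sc k m))"
      by (rule gd_swap[OF s u]) (simp_all add: w_def k'_def)
    moreover have "(y - sc k m) - sc k (x - m) = y - sc k x" by (simp add: algebra_simps)
    moreover have "(x - m) - sc k' (y - sc k m) = x - (m + sc k' (y - sc k m))" by (simp add: algebra_simps)
    ultimately show ?thesis by (simp only:)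
  qed
  have "(\<integral>\<^sup>+x. ennreal (gd n s (x - m)) * ennreal (gd n u (y - sc k x)) \<partial>Lam n)
     = (\<integral>\<^sup>+x. ennreal (gd n w (y - sc k m)) * ennreal (gd n (s * u / w) (x - (m + sc k' (y - sc k m)))) \<partial>Lam n)"
    using s u wp by (simp add: ennreal_mult[symmetric] eq)
  also have "\<dots> = ennreal (gd n w (y - sc k m))"
    using s u wp by (subst nn_integral_cmult[OF gd_measurable_ennreal[OF mv_id_minus(1)]]) (simp_all only: nn_integral_gd mult_1_right divide_pos_pos mult_pos_pos)
  finally show ?thesis by (simp add: w_def)
qed

lemma integral_translate:
  fixes F :: "(nat \<Rightarrow> complex) \<Rightarrow> real"
  assumes F: "F \<in> borel_measurable (Lam n)"
  shows "integrable (Lam n) (\<lambda>y. F (rs n (y + c))) \<longleftrightarrow> integrable (Lam n) F"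
    and "(\<integral>y. F (rs n (y + c)) \<partial>Lam n) = (\<integral>y. F y \<partial>Lam n)"
proof -
  have m: "(\<lambda>y. rs n (y + c)) \<in> measurable (Lam n) (Lam n)"
    by (rule measurable_Lam_mv) auto
  show "integrable (Lam n) (\<lambda>y. F (rs n (y + c))) \<longleftrightarrow> integrable (Lam n) F"
    using integrable_distr_eq[OF m F] by (simp only: distr_Lam_translate)
  show "(\<integral>y. F (rs n (y + c)) \<partial>Lam n) = (\<integral>y. F y \<partial>Lam n)"
    using integral_distr[OF m F] by (simp only: distr_Lam_translate)
qed

text \<open>The hypothesis \<open>eq\<close> says that \<open>X\<close> carries the measure with
  density \<open>p\<close> to the one with density \<open>r\<close>. It can be checked with
  nonnegative integrals, where no integrability questions arise; the conclusions then hold for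
  signed integrands such as logarithms of densities.\<close>

lemma push_integral:
  fixes p :: "'a \<Rightarrow> real" and r g :: "'b \<Rightarrow> real"
  assumes X[measurable]: "X \<in> measurable M N" and p[measurable]: "p \<in> borel_measurable M" and r[measurable]: "r \<in> borel_measurable N"
    and p0: "\<And>x. 0 \<le> p x" and r0: "\<And>y. 0 \<le> r y"
    and eq: "\<And>F. F \<in> borel_measurable N \<Longrightarrow> (\<integral>\<^sup>+x. ennreal (p x) * F (X x) \<partial>M) = (\<integral>\<^sup>+y. ennreal (r y) * F y \<partial>N)"
    and g[measurable]: "g \<in> borel_measurable N"
  shows "integrable M (\<lambda>x. p x * g (X x)) \<longleftrightarrow> integrable N (\<lambda>y. r y * g y)"
    and "(\<integral>x. p x * g (X x) \<partial>M) = (\<integral>y. r y * g y \<partial>N)"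
proof -
  have X': "X \<in> measurable (density M (\<lambda>x. ennreal (p x))) N" by simp
  have e: "distr (density M (\<lambda>x. ennreal (p x))) N X = density N (\<lambda>y. ennreal (r y))"
  proof (rule measure_eqI)
    fix A assume "A \<in> sets (distr (density M (\<lambda>x. ennreal (p x))) N X)"
    then have A[measurable]: "A \<in> sets N" by simp
    have XA: "X -` A \<inter> space M \<in> sets M" by measurable
    have "emeasure (distr (density M (\<lambda>x. ennreal (p x))) N X) A = emeasure (density M (\<lambda>x. ennreal (p x))) (X -` A \<inter> space M)"
      using A by (simp add: emeasure_distr[OF X'])
    also have "\<dots> = (\<integral>\<^sup>+x. ennreal (p x) * indicator A (X x) \<partial>M)"
      using XA by (subst emeasure_density) (auto intro!: nn_integral_cong simp: indicator_def)
    also have "\<dots> = (\<integral>\<^sup>+y. ennreal (r y) * indicator A y \<partial>N)" using A by (intro eq) simp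
    also have "\<dots> = emeasure (density N (\<lambda>y. ennreal (r y))) A" using A by (simp add: emeasure_density)
    finally show "emeasure (distr (density M (\<lambda>x. ennreal (p x))) N X) A = emeasure (density N (\<lambda>y. ennreal (r y))) A" .
  qed simp
  have gX: "(\<lambda>x. g (X x)) \<in> borel_measurable M" by measurable
  show "integrable M (\<lambda>x. p x * g (X x)) \<longleftrightarrow> integrable N (\<lambda>y. r y * g y)"
    using integrable_distr_eq[OF X' g] integrable_real_density[OF p _ gX] integrable_real_density[OF r _ g] p0 r0
    by (simp add: e)
  show "(\<integral>x. p x * g (X x) \<partial>M) = (\<integral>y. r y * g y \<partial>N)"
    using integral_distr[OF X' g] integral_real_density[OF p _ gX] integral_real_density[OF r _ g] p0 r0
    by (simp add: e)
qed

text \<open>Nonnegativity of relative entropy, from \<open>ln t \<le> t - 1\<close> at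
  \<open>t = q / p\<close>. Total mass at most 1 suffices for \<open>q\<close>.\<close>

lemma gibbs:
  fixes p q :: "'a \<Rightarrow> real"
  assumes q[measurable]: "q \<in> borel_measurable M" and p0: "\<And>x. 0 < p x" and q0: "\<And>x. 0 < q x"
    and ip: "integrable M p" "(\<integral>x. p x \<partial>M) = 1" and iq: "(\<integral>\<^sup>+x. ennreal (q x) \<partial>M) \<le> 1"
    and i1: "integrable M (\<lambda>x. p x * ln (p x))" and i2: "integrable M (\<lambda>x. p x * ln (q x))"
  shows "(\<integral>x. p x * ln (q x) \<partial>M) \<le> (\<integral>x. p x * ln (p x) \<partial>M)"
proof -
  have inq: "integrable M q" using iq q0
    by (intro integrableI_nonneg) (auto simp: less_imp_le intro: le_less_trans)
  have "ennreal (\<integral>x. q x \<partial>M) \<le> 1" using iq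
    by (subst nn_integral_eq_integral[symmetric, OF inq]) (auto simp: q0 less_imp_le)
  then have q1: "(\<integral>x. q x \<partial>M) \<le> 1" by (simp add: ennreal_le_1)
  have pt: "p x * ln (q x) - p x * ln (p x) \<le> q x - p x" for x
  proof -
    have "ln (q x / p x) \<le> q x / p x - 1" using p0 q0 by (intro ln_le_minus_one) simp
    then have "p x * ln (q x / p x) \<le> p x * (q x / p x - 1)" using p0[of x] by (intro mult_left_mono) auto
    then show ?thesis using p0[of x] q0[of x] by (simp add: ln_div algebra_simps)
  qed
  have "(\<integral>x. p x * ln (q x) - p x * ln (p x) \<partial>M) \<le> (\<integral>x. q x - p x \<partial>M)"
    using pt i1 i2 inq ip by (intro integral_mono) auto
  then show ?thesis using i1 i2 inq ip q1 by simp
qed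

lemma Lam_comp_measurable: "t < n \<Longrightarrow> (\<lambda>y. y t) \<in> borel_measurable (Lam n)"
  using mv_basic(1)[of n] by (simp add: mv_def)

lemma gd_bi: "0 < v \<Longrightarrow> has_bochner_integral (Lam n) (gd n v) 1"
  using nn_integral_gd[of v n 0] gd_measurable[OF mv_basic(1), of n v]
  by (intro has_bochner_integral_nn_integral) (auto simp: less_imp_le)

lemma gd_bi_sq: assumes "0 < v" "t < n" shows "has_bochner_integral (Lam n) (\<lambda>y. gd n v y * (cmod (y t))\<^sup>2) v"
  using nn_integral_gd_comp[OF assms] gd_measurable[OF mv_basic(1), of n v] Lam_comp_measurable[OF assms(2)] assms
  by (intro has_bochner_integral_nn_integral) (auto simp: less_imp_le)

lemma distr_Lam_neg: "distr (Lam n) (Lam n) (\<lambda>y. rs n (sc (-1) y)) = Lam n"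
proof (rule measure_eqI)
  have m: "(\<lambda>y. rs n (sc (-1) y)) \<in> measurable (Lam n) (Lam n)"
    by (rule measurable_Lam_mv) auto
  fix A assume "A \<in> sets (distr (Lam n) (Lam n) (\<lambda>y. rs n (sc (-1) y)))"
  then have A: "A \<in> sets (Lam n)" by simp
  have "emeasure (distr (Lam n) (Lam n) (\<lambda>y. rs n (sc (-1) y))) A = (\<integral>\<^sup>+y. indicator A (rs n (sc (-1) y)) \<partial>Lam n)"
    using A by (simp add: nn_integral_indicator[symmetric] nn_integral_distr[OF m] del: nn_integral_indicator)
  also have "\<dots> = emeasure (Lam n) A"
    using A by (subst nn_integral_Lam_scale) simp_all
  finally show "emeasure (distr (Lam n) (Lam n) (\<lambda>y. rs n (sc (-1) y))) A = emeasure (Lam n) A" .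
qed simp

text \<open>The integrand is odd and Lebesgue measure is invariant under reflection, so the integral
  equals its own negative. Integrability comes from the second moment.\<close>

lemma gd_bi_lin: assumes v: "0 < v" and t: "t < n" shows "has_bochner_integral (Lam n) (\<lambda>y. gd n v y * Re (a * y t)) 0"
proof -
  note gm = gd_measurable[OF mv_basic(1), of n v] and cm = Lam_comp_measurable[OF t]
  have fm: "(\<lambda>y. gd n v y * Re (a * y t)) \<in> borel_measurable (Lam n)" using gm cm by measurable
  have i: "integrable (Lam n) (\<lambda>y. gd n v y * Re (a * y t))"
  proof (rule Bochner_Integration.integrable_bound[OF _ fm])
    show "integrable (Lam n) (\<lambda>y. cmod a * (gd n v y + gd n v y * (cmod (y t))\<^sup>2))"
      using gd_bi[OF v, of n] gd_bi_sq[OF v t] by (auto simp: has_bochner_integral_iff)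
    have "\<bar>gd n v y * Re (a * y t)\<bar> \<le> cmod a * (gd n v y + gd n v y * (cmod (y t))\<^sup>2)" for y
    proof -
      have "\<bar>Re (a * y t)\<bar> \<le> cmod a * cmod (y t)" using abs_Re_le_cmod[of "a * y t"] by (simp add: norm_mult)
      also have "\<dots> \<le> cmod a * (1 + (cmod (y t))\<^sup>2)"
      proof (rule mult_left_mono)
        have "0 \<le> (cmod (y t) - 1)\<^sup>2" by simp
        then have "2 * cmod (y t) \<le> 1 + (cmod (y t))\<^sup>2" by (simp add: power2_diff)
        then show "cmod (y t) \<le> 1 + (cmod (y t))\<^sup>2" using norm_ge_zero[of "y t"] by linarith
      qed simp
      finally have "gd n v y * \<bar>Re (a * y t)\<bar> \<le> gd n v y * (cmod a * (1 + (cmod (y t))\<^sup>2))"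
        using v by (intro mult_left_mono) auto
      then show ?thesis using v by (simp add: abs_mult algebra_simps del: times_complex.sel)
    qed
    then show "AE y in Lam n. norm (gd n v y * Re (a * y t)) \<le> norm (cmod a * (gd n v y + gd n v y * (cmod (y t))\<^sup>2))"
      using v by (auto simp del: times_complex.sel intro: order_trans[OF _ abs_ge_self])
  qed
  have m: "(\<lambda>y. rs n (sc (-1) y)) \<in> measurable (Lam n) (Lam n)"
    by (rule measurable_Lam_mv) auto
  have "(\<integral>y. gd n v y * Re (a * y t) \<partial>Lam n) = (\<integral>y. gd n v (rs n (sc (-1) y)) * Re (a * rs n (sc (-1) y) t) \<partial>Lam n)"
    by (subst distr_Lam_neg[symmetric], subst integral_distr[OF m fm]) simp
  also have "\<dots> = (\<integral>y. - (gd n v y * Re (a * y t)) \<partial>Lam n)"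
    using t by (intro Bochner_Integration.integral_cong) (auto simp: gd_def algebra_simps diff_divide_distrib)
  finally have "(\<integral>y. gd n v y * Re (a * y t) \<partial>Lam n) = 0" by simp
  with i show ?thesis by (simp only: has_bochner_integral_iff)
qed

text \<open>Translating by \<open>c\<close> centres the Gaussian; in the expanded square the mixed
  terms are linear in \<open>y\<close> and integrate to 0.\<close>

lemma gd_moment:
  assumes v: "0 < v"
  shows "has_bochner_integral (Lam n) (\<lambda>y. gd n v (y - c) * nsq n (sc k y + m)) ((cmod k)\<^sup>2 * real n * v + nsq n (sc k c + m))"
proof -
  define m' where "m' = sc k c + m"
  define F where "F y = gd n v (y - c) * nsq n (sc k y + m)" for y
  have Fm: "F \<in> borel_measurable (Lam n)"
    unfolding F_def by (intro borel_measurable_times gd_measurable nsq_measurable mvI mv_basic)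
  have Fr: "F (rs n (y + c)) = gd n v y * nsq n (sc k y + m')" for y
    unfolding F_def m'_def by (intro arg_cong2[where f="(*)"] gd_cong nsq_cong) (simp_all add: algebra_simps)
  have *: "gd n v y * nsq n (sc k y + m') = (\<Sum>t<n. (cmod k)\<^sup>2 * (gd n v y * (cmod (y t))\<^sup>2) + 2 * (gd n v y * Re (k * cnj (m' t) * y t))) + nsq n m' * gd n v y" for y
  proof -
    have "nsq n (sc k y + m') = (\<Sum>t<n. (cmod k)\<^sup>2 * (cmod (y t))\<^sup>2 + 2 * Re (k * cnj (m' t) * y t)) + nsq n m'"
      unfolding nsq_add nsq_sc unfolding nsq_def ip_def by (simp add: sum.distrib sum_distrib_left mult_ac del: times_complex.sel)
    then show ?thesis by (simp add: sum_distrib_left algebra_simps)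
  qed
  have "has_bochner_integral (Lam n) (\<lambda>y. gd n v y * nsq n (sc k y + m')) ((\<Sum>t<n. (cmod k)\<^sup>2 * v + 2 * 0) + nsq n m' * 1)"
    unfolding * by (intro has_bochner_integral_add has_bochner_integral_sum has_bochner_integral_mult_right gd_bi gd_bi_sq gd_bi_lin v) auto
  then have "has_bochner_integral (Lam n) (\<lambda>y. F (rs n (y + c))) ((cmod k)\<^sup>2 * real n * v + nsq n m')"
    by (simp add: Fr algebra_simps)
  then have "has_bochner_integral (Lam n) F ((cmod k)\<^sup>2 * real n * v + nsq n m')"
    using integral_translate[OF Fm, of c] by (simp add: has_bochner_integral_iff)
  then show ?thesis unfolding F_def m'_def .
qed

section \<open>Gaussian mixtures and their entropies\<close>

text \<open>The average runs over the messages and not over the set of codewords, so coinciding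
  codewords count with their multiplicity.\<close>

definition fm :: "nat \<Rightarrow> 'w set \<Rightarrow> ('w \<Rightarrow> nat \<Rightarrow> complex) \<Rightarrow> real \<Rightarrow> (nat \<Rightarrow> complex) \<Rightarrow> real" where
  "fm n J c v y = (\<Sum>w\<in>J. gd n v (y - c w)) / real (card J)"

lemma fm_pos: "finite J \<Longrightarrow> J \<noteq> {} \<Longrightarrow> 0 < v \<Longrightarrow> 0 < fm n J c v y"
  unfolding fm_def by (intro divide_pos_pos sum_pos) (auto simp: card_gt_0_iff)

lemma fm_nonneg: "0 < v \<Longrightarrow> 0 \<le> fm n J c v y"
  unfolding fm_def by (intro divide_nonneg_nonneg sum_nonneg) auto

lemma fm_measurable: "mv N n f \<Longrightarrow> (\<lambda>\<omega>. fm n J c v (f \<omega>)) \<in> borel_measurable N"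
  unfolding fm_def by (intro borel_measurable_divide borel_measurable_sum gd_measurable mvI) auto

lemma fm_measurable_ennreal: "mv N n f \<Longrightarrow> (\<lambda>\<omega>. ennreal (fm n J c v (f \<omega>))) \<in> borel_measurable N"
  using fm_measurable[of N n f J c v] by simp

lemma fm_cong: "(\<And>t. t < n \<Longrightarrow> x t = y t) \<Longrightarrow> fm n J c v x = fm n J c v y"
  unfolding fm_def by (intro arg_cong2[where f="(/)"] sum.cong gd_cong) auto

lemma fm_rs [simp]: "fm n J c v (rs n y) = fm n J c v y"
  by (rule fm_cong) simp

lemma fm_shift: "fm n J c v (y - m) = fm n J (\<lambda>w. c w + m) v y"
  unfolding fm_def by (simp add: algebra_simps)

lemma nn_integral_avg:
  assumes "finite J" "J \<noteq> {}" "\<And>w. w \<in> J \<Longrightarrow> f w \<in> borel_measurable M" "\<And>w. w \<in> J \<Longrightarrow> (\<integral>\<^sup>+x. ennreal (f w x) \<partial>M) = ennreal (g w)"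
    "\<And>w x. 0 \<le> f w x" "\<And>w. 0 \<le> g w"
  shows "(\<integral>\<^sup>+x. ennreal ((\<Sum>w\<in>J. f w x) / real (card J)) \<partial>M) = ennreal ((\<Sum>w\<in>J. g w) / real (card J))"
proof -
  have "(\<integral>\<^sup>+x. ennreal ((\<Sum>w\<in>J. f w x) / real (card J)) \<partial>M) = (\<integral>\<^sup>+x. ennreal (1 / real (card J)) * (\<Sum>w\<in>J. ennreal (f w x)) \<partial>M)"
    using assms by (intro nn_integral_cong) (simp add: sum_ennreal ennreal_mult[symmetric] sum_nonneg)
  also have "\<dots> = ennreal (1 / real (card J)) * (\<Sum>w\<in>J. \<integral>\<^sup>+x. ennreal (f w x) \<partial>M)"
    using assms by (subst nn_integral_cmult) (auto simp: nn_integral_sum simp del: sum_ennreal)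
  also have "\<dots> = ennreal (1 / real (card J)) * (\<Sum>w\<in>J. ennreal (g w))" using assms by simp
  also have "\<dots> = ennreal ((\<Sum>w\<in>J. g w) / real (card J))"
    using assms by (simp add: sum_ennreal ennreal_mult[symmetric] sum_nonneg)
  finally show ?thesis .
qed

lemma nn_integral_fm:
  assumes "finite J" "J \<noteq> {}" "0 < v" shows "(\<integral>\<^sup>+y. fm n J c v (y - m) \<partial>Lam n) = 1"
proof -
  have "(\<integral>\<^sup>+y. fm n J (\<lambda>w. c w + m) v y \<partial>Lam n) = ennreal ((\<Sum>w\<in>J. 1) / real (card J))"
    unfolding fm_def using assms
    by (intro nn_integral_avg) (simp_all add: nn_integral_gd gd_measurable mv_id_minus)
  also have "\<dots> = 1" using assms by simp
  finally show ?thesis by (simp add: fm_shift)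
qed

lemma nn_integral_fm_conv:
  assumes "finite J" "J \<noteq> {}" "0 < s" "0 < u"
  shows "(\<integral>\<^sup>+x. ennreal (gd n s (x - m)) * ennreal (fm n J c u (y - sc k x)) \<partial>Lam n) = ennreal (fm n J c (u + (cmod k)\<^sup>2 * s) (y - sc k m))"
proof -
  have w: "0 < u + (cmod k)\<^sup>2 * s" using assms by (simp add: add_pos_nonneg)
  have "(\<integral>\<^sup>+x. ennreal (gd n s (x - m)) * ennreal (fm n J c u (y - sc k x)) \<partial>Lam n)
     = (\<integral>\<^sup>+x. ennreal ((\<Sum>w\<in>J. gd n s (x - m) * gd n u ((y - c w) - sc k x)) / real (card J)) \<partial>Lam n)"
    using assms unfolding fm_def
    by (intro nn_integral_cong) (simp add: ennreal_mult[symmetric] sum_nonneg sum_distrib_left algebra_simps)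
  also have "\<dots> = ennreal ((\<Sum>w\<in>J. gd n (u + (cmod k)\<^sup>2 * s) ((y - c w) - sc k m)) / real (card J))"
  proof (intro nn_integral_avg)
    fix w
    show "(\<lambda>x. gd n s (x - m) * gd n u (y - c w - sc k x)) \<in> borel_measurable (Lam n)"
      by (intro borel_measurable_times gd_measurable mvI mv_basic)
    show "(\<integral>\<^sup>+x. ennreal (gd n s (x - m) * gd n u (y - c w - sc k x)) \<partial>Lam n) = ennreal (gd n (u + (cmod k)\<^sup>2 * s) (y - c w - sc k m))"
      using nn_integral_gd_conv[of s u n m "y - c w" k] assms by (simp add: ennreal_mult)
  qed (use assms w in auto)
  also have "\<dots> = ennreal (fm n J c (u + (cmod k)\<^sup>2 * s) (y - sc k m))"
    unfolding fm_def by (simp add: algebra_simps)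
  finally show ?thesis .
qed

lemma fm_moment:
  assumes "finite J" "J \<noteq> {}" "0 < v"
  shows "has_bochner_integral (Lam n) (\<lambda>y. fm n J c v y * nsq n (sc k y + m)) ((cmod k)\<^sup>2 * real n * v + (\<Sum>w\<in>J. nsq n (sc k (c w) + m)) / real (card J))"
proof -
  have e: "(cmod k)\<^sup>2 * real n * v + (\<Sum>w\<in>J. nsq n (sc k (c w) + m)) / real (card J) = (\<Sum>w\<in>J. (cmod k)\<^sup>2 * real n * v + nsq n (sc k (c w) + m)) / real (card J)"
    using assms by (simp add: sum.distrib add_divide_distrib)
  have f: "fm n J c v y * nsq n (sc k y + m) = (\<Sum>w\<in>J. gd n v (y - c w) * nsq n (sc k y + m)) / real (card J)" for y
    unfolding fm_def by (simp add: sum_distrib_right)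
  show ?thesis unfolding e f
    by (intro has_bochner_integral_divide_zero has_bochner_integral_sum gd_moment assms)
qed

lemma fm_bi: assumes "finite J" "J \<noteq> {}" "0 < v" shows "has_bochner_integral (Lam n) (fm n J c v) 1"
  using nn_integral_fm[OF assms, of n c 0] fm_measurable[OF mv_basic(1), of n J c v] fm_nonneg[OF assms(3), of n J c]
  by (intro has_bochner_integral_nn_integral) auto

lemma ln_gd: "0 < v \<Longrightarrow> ln (gd n v y) = - nsq n y / v - real n * ln (pi * v)"
  by (simp add: gd_def ln_div ln_realpow)

text \<open>A mixture is at most the largest value of its components and at least the contribution
  of any single one. The logarithm of a Gaussian is quadratic, so both estimates are. With finite
  second moments this settles integrability wherever the logarithm of a mixture is
  integrated.\<close>

lemma ln_fm_bound:
  assumes J: "finite J" "J \<noteq> {}" and v: "0 < v"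
  obtains C where "0 \<le> C" "\<And>y. \<bar>ln (fm n J c v y)\<bar> \<le> C * (1 + nsq n y)"
proof -
  obtain w0 where w0: "w0 \<in> J" using J by auto
  have M: "1 \<le> real (card J)" using J by (simp add: Suc_leI card_gt_0_iff)
  define L where "L = real n * ln (pi * v)"
  define C where "C = \<bar>L\<bar> + ln (real (card J)) + 2 * nsq n (c w0) / v + 2 / v"
  have C0: "0 \<le> C" using M v by (simp add: C_def)
  have "\<bar>ln (fm n J c v y)\<bar> \<le> C * (1 + nsq n y)" for y
  proof -
    have gle: "gd n v z \<le> exp (- L)" for z
    proof -
      have "ln (gd n v z) \<le> - L" using v by (simp add: ln_gd L_def)
      then show ?thesis using v by (metis exp_le_cancel_iff exp_ln gd_pos)
    qed
    have "(\<Sum>w\<in>J. gd n v (y - c w)) \<le> real (card J) * exp (- L)"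
      using gle by (intro sum_bounded_above) auto
    then have "fm n J c v y \<le> exp (- L)" using M by (simp add: fm_def pos_divide_le_eq mult.commute)
    then have u: "ln (fm n J c v y) \<le> - L" using fm_pos[OF J v, of n c y] by (metis ln_exp ln_le_cancel_iff exp_gt_zero)
    have "gd n v (y - c w0) / real (card J) \<le> fm n J c v y"
      unfolding fm_def using J w0 v by (intro divide_right_mono member_le_sum) auto
    then have "ln (gd n v (y - c w0) / real (card J)) \<le> ln (fm n J c v y)"
      using M v fm_pos[OF J v, of n c y] by (subst ln_le_cancel_iff) auto
    then have "- nsq n (y - c w0) / v - L - ln (real (card J)) \<le> ln (fm n J c v y)"
      using M v gd_pos[OF v, of n "y - c w0"] by (simp add: ln_div ln_gd L_def)
    moreover have "nsq n (y - c w0) / v \<le> (2 * nsq n y + 2 * nsq n (c w0)) / v"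
      using v by (intro divide_right_mono nsq_diff_le) auto
    ultimately have l: "- (2 * nsq n (c w0) / v + L + ln (real (card J))) - 2 / v * nsq n y \<le> ln (fm n J c v y)"
      by (simp add: add_divide_distrib)
    define B where "B = \<bar>L\<bar> + ln (real (card J)) + 2 * nsq n (c w0) / v"
    have B0: "0 \<le> B" using M v by (simp add: B_def)
    have CB: "C * (1 + nsq n y) = B + B * nsq n y + 2 / v + 2 / v * nsq n y"
    proof -
      have "C = B + 2 / v" by (simp add: C_def B_def)
      then show ?thesis by (simp only: distrib_left distrib_right mult_1_right mult_1_left)
    qed
    have "\<bar>ln (fm n J c v y)\<bar> \<le> B + 2 / v * nsq n y"
    proof (rule abs_leI)
      have "0 \<le> ln (real (card J)) + 2 * nsq n (c w0) / v + 2 / v * nsq n y" using M v by simp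
      then show "ln (fm n J c v y) \<le> B + 2 / v * nsq n y" using u unfolding B_def by linarith
      show "- ln (fm n J c v y) \<le> B + 2 / v * nsq n y" using l unfolding B_def by linarith
    qed
    also have "\<dots> \<le> C * (1 + nsq n y)" unfolding CB using B0 v by simp
    finally show ?thesis .
  qed
  with C0 that show thesis by blast
qed

lemma integrable_fm_qb:
  assumes "finite J" "J \<noteq> {}" "0 < v" and g: "g \<in> borel_measurable (Lam n)" and b: "\<And>y. \<bar>g y\<bar> \<le> C * (1 + nsq n y)"
  shows "integrable (Lam n) (\<lambda>y. fm n J c v y * g y)"
proof (rule Bochner_Integration.integrable_bound)
  show "integrable (Lam n) (\<lambda>y. C * (fm n J c v y + fm n J c v y * nsq n (sc 1 y + 0)))"
    using fm_bi[OF assms(1-3)] fm_moment[OF assms(1-3)] by (intro integrable_mult_right Bochner_Integration.integrable_add) (auto simp only: has_bochner_integral_iff)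
  show "(\<lambda>y. fm n J c v y * g y) \<in> borel_measurable (Lam n)"
    using g fm_measurable[OF mv_basic(1)] by (intro borel_measurable_times)
  have "\<bar>fm n J c v y * g y\<bar> \<le> C * (fm n J c v y + fm n J c v y * nsq n y)" for y
    using mult_left_mono[OF b[of y] fm_nonneg[OF assms(3), of n J c y]] fm_nonneg[OF assms(3), of n J c y]
    by (simp add: abs_mult algebra_simps)
  then show "AE y in Lam n. norm (fm n J c v y * g y) \<le> norm (C * (fm n J c v y + fm n J c v y * nsq n (sc 1 y + 0)))"
    by (intro AE_I2) (auto intro: order_trans[OF _ abs_ge_self])
qed

section \<open>Differential entropies of mixtures, in nats\<close>

definition H :: "nat \<Rightarrow> 'w set \<Rightarrow> ('w \<Rightarrow> nat \<Rightarrow> complex) \<Rightarrow> real \<Rightarrow> real" where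
  "H n J c v = - (\<integral>y. fm n J c v y * ln (fm n J c v y) \<partial>Lam n)"

lemma ln_fm_measurable: "mv N n f \<Longrightarrow> (\<lambda>\<omega>. ln (fm n J c v (f \<omega>))) \<in> borel_measurable N"
  using fm_measurable[of N n f J c v] by simp

lemma H_integrable:
  assumes "finite J" "J \<noteq> {}" "0 < v"
  shows "integrable (Lam n) (\<lambda>y. fm n J c v y * ln (fm n J c v y))"
proof -
  obtain C where "0 \<le> C" "\<And>y. \<bar>ln (fm n J c v y)\<bar> \<le> C * (1 + nsq n y)" using ln_fm_bound[OF assms, of n c] by blast
  then show ?thesis using assms by (intro integrable_fm_qb[where C=C] ln_fm_measurable mv_basic) auto
qed

lemma fm_ln_gd:
  assumes "finite J" "J \<noteq> {}" "0 < v" "0 < u"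
  shows "has_bochner_integral (Lam n) (\<lambda>y. fm n J c v y * ln (gd n u (sc k y + m)))
    (- (((cmod k)\<^sup>2 * real n * v + (\<Sum>w\<in>J. nsq n (sc k (c w) + m)) / real (card J)) / u) - real n * ln (pi * u))"
proof -
  have e: "fm n J c v y * ln (gd n u (sc k y + m)) = (- 1 / u) * (fm n J c v y * nsq n (sc k y + m)) - real n * ln (pi * u) * fm n J c v y" for y
    using assms by (simp add: ln_gd algebra_simps)
  have "has_bochner_integral (Lam n) (\<lambda>y. fm n J c v y * ln (gd n u (sc k y + m)))
    ((-1 / u) * ((cmod k)\<^sup>2 * real n * v + (\<Sum>w\<in>J. nsq n (sc k (c w) + m)) / real (card J)) - real n * ln (pi * u) * 1)"
    unfolding e by (intro has_bochner_integral_diff has_bochner_integral_mult_right fm_moment fm_bi assms)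
  then show ?thesis by simp
qed

lemma ln_pie: "0 < u \<Longrightarrow> ln (pi * exp 1 * u) = ln (pi * u) + 1"
  by (simp add: ln_mult)

text \<open>Gaussian maximum entropy: compare with the Gaussian of variance \<epsilon> +
  \<open>v\<close>, whose cross entropy depends only on the second moment of the mixture, which the
  power constraint bounds.\<close>

lemma H_le:
  assumes J: "finite J" "J \<noteq> {}" and v: "0 < v" and e: "0 \<le> \<epsilon>" and pw: "(\<Sum>w\<in>J. nsq n (c w)) \<le> real (card J) * (real n * \<epsilon>)"
  shows "H n J c v \<le> real n * ln (pi * exp 1 * (\<epsilon> + v))"
proof -
  let ?p = "fm n J c v" and ?u = "\<epsilon> + v"
  have u: "0 < ?u" using v e by simp
  have q: "has_bochner_integral (Lam n) (\<lambda>y. ?p y * ln (gd n ?u (sc 1 y + 0))) (- (((cmod 1)\<^sup>2 * real n * v + (\<Sum>w\<in>J. nsq n (sc 1 (c w) + 0)) / real (card J)) / ?u) - real n * ln (pi * ?u))"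
    by (rule fm_ln_gd[OF J v u])
  have "(\<integral>y. ?p y * ln (gd n ?u (sc 1 y + 0)) \<partial>Lam n) \<le> (\<integral>y. ?p y * ln (?p y) \<partial>Lam n)"
  proof (rule gibbs)
    show "(\<lambda>y. gd n ?u (sc 1 y + 0)) \<in> borel_measurable (Lam n)" by (intro gd_measurable mvI mv_basic)
    show "(\<integral>\<^sup>+y. ennreal (gd n ?u (sc 1 y + 0)) \<partial>Lam n) \<le> 1" using nn_integral_gd[OF u, of n 0] by simp
  qed (use J v u fm_pos[OF J v] fm_bi[OF J v, of n c] H_integrable[OF J v] q in \<open>auto simp: has_bochner_integral_iff\<close>)
  then have "H n J c v \<le> (real n * v + (\<Sum>w\<in>J. nsq n (c w)) / real (card J)) / ?u + real n * ln (pi * ?u)"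
    using has_bochner_integral_integral_eq[OF q] by (simp add: H_def)
  also have "(\<Sum>w\<in>J. nsq n (c w)) / real (card J) \<le> real n * \<epsilon>"
    using pw J by (simp add: pos_divide_le_eq card_gt_0_iff mult.commute)
  then have "(real n * v + (\<Sum>w\<in>J. nsq n (c w)) / real (card J)) / ?u \<le> real n * ?u / ?u"
    using u by (intro divide_right_mono) (auto simp: algebra_simps)
  also have "real n * ?u / ?u + real n * ln (pi * ?u) = real n * ln (pi * exp 1 * ?u)"
  proof -
    have "real n * ?u / ?u = real n" using u by simp
    then show ?thesis unfolding ln_pie[OF u] by (simp only: distrib_left mult_1_right add.commute)
  qed
  finally show ?thesis by simp
qed

lemma H_zero:
  assumes J: "finite J" "J \<noteq> {}" and v: "0 < v" and z: "\<And>w. w \<in> J \<Longrightarrow> nsq n (c w) = 0"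
  shows "H n J c v = real n * ln (pi * exp 1 * v)"
proof -
  have c0: "c w t = 0" if "w \<in> J" "t < n" for w t
    using z[OF that(1)] that(2) by (auto simp: nsq_def sum_nonneg_eq_0_iff)
  have "fm n J c v y = gd n v (sc 1 y + 0)" for y
  proof -
    have "fm n J c v y = (\<Sum>w\<in>J. gd n v y) / real (card J)"
      unfolding fm_def by (intro arg_cong2[where f="(/)"] sum.cong gd_cong) (auto simp: c0)
    then show ?thesis using J by simp
  qed
  then have "- H n J c v = (\<integral>y. fm n J c v y * ln (gd n v (sc 1 y + 0)) \<partial>Lam n)"
    by (simp add: H_def)
  also have "\<dots> = - ((real n * v + (\<Sum>w\<in>J. nsq n (sc 1 (c w) + 0)) / real (card J)) / v) - real n * ln (pi * v)"
    using has_bochner_integral_integral_eq[OF fm_ln_gd[OF J v v, of n c 1 0]] by simp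
  also have "\<dots> = - (real n * ln (pi * exp 1 * v))" using v by (simp add: z ln_mult algebra_simps)
  finally show ?thesis by simp
qed

lemma integral_H_shift:
  assumes J: "finite J" "J \<noteq> {}" and v: "0 < v"
  shows "has_bochner_integral (Lam n) (\<lambda>y. fm n J c v (y - m) * ln (fm n J c v (y - m))) (- H n J c v)"
proof -
  have F: "(\<lambda>y. fm n J c v y * ln (fm n J c v y)) \<in> borel_measurable (Lam n)"
    by (intro borel_measurable_times fm_measurable ln_fm_measurable mv_basic)
  show ?thesis
    using integral_translate[OF F, of "- m"] H_integrable[OF assms, of n c]
    by (simp add: has_bochner_integral_iff H_def)
qed

lemma gd_scale: "k \<noteq> 0 \<Longrightarrow> 0 < v \<Longrightarrow> gd n ((cmod k)\<^sup>2 * v) (sc k y) = gd n v y / (cmod k)^(2*n)"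
  by (simp add: gd_def power_mult_distrib mult_ac) (simp add: power_mult[symmetric] mult.commute)

lemma fm_scale: assumes "k \<noteq> 0" "0 < v"
  shows "fm n J (\<lambda>w. sc k (c w)) ((cmod k)\<^sup>2 * v) (sc k y) = fm n J c v y / (cmod k)^(2*n)"
proof -
  have "gd n ((cmod k)\<^sup>2 * v) (sc k y - sc k (c w)) = gd n v (y - c w) / (cmod k)^(2*n)" for w
    using gd_scale[OF assms, of n "y - c w"] by simp
  then show ?thesis unfolding fm_def by (simp add: sum_divide_distrib mult.commute)
qed

lemma nn_fm_scale:
  assumes k: "k \<noteq> 0" and v: "0 < v" and F: "F \<in> borel_measurable (Lam n)"
  shows "(\<integral>\<^sup>+y. ennreal (fm n J c v y) * F (rs n (sc k y)) \<partial>Lam n) = (\<integral>\<^sup>+y. ennreal (fm n J (\<lambda>w. sc k (c w)) ((cmod k)\<^sup>2 * v) y) * F y \<partial>Lam n)"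
proof -
  let ?G = "\<lambda>y. ennreal ((cmod k)^(2*n)) * (ennreal (fm n J (\<lambda>w. sc k (c w)) ((cmod k)\<^sup>2 * v) y) * F y)"
  have Gm: "?G \<in> borel_measurable (Lam n)"
    using F fm_measurable_ennreal[OF mv_basic(1)] by (intro borel_measurable_times_ennreal borel_measurable_const)
  have "ennreal (fm n J c v y) * F (rs n (sc k y)) = ?G (rs n (sc k y))" for y
  proof -
    have "ennreal (fm n J c v y) = ennreal ((cmod k)^(2*n) * (fm n J c v y / (cmod k)^(2*n)))" using k by simp
    also have "\<dots> = ennreal ((cmod k)^(2*n)) * ennreal (fm n J (\<lambda>w. sc k (c w)) ((cmod k)\<^sup>2 * v) (rs n (sc k y)))"
      using fm_nonneg[OF v, of n J c y] by (simp only: fm_rs fm_scale[OF k v]) (intro ennreal_mult, simp_all)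
    finally show ?thesis by (simp add: mult.assoc)
  qed
  then have "(\<integral>\<^sup>+y. ennreal (fm n J c v y) * F (rs n (sc k y)) \<partial>Lam n) = (\<integral>\<^sup>+y. ?G (rs n (sc k y)) \<partial>Lam n)" by (simp only:)
  also have "\<dots> = ennreal (1 / (cmod k)^(2*n)) * (\<integral>\<^sup>+y. ?G y \<partial>Lam n)" by (rule nn_integral_Lam_scale[OF Gm k])
  also have "\<dots> = (\<integral>\<^sup>+y. ennreal (fm n J (\<lambda>w. sc k (c w)) ((cmod k)\<^sup>2 * v) y) * F y \<partial>Lam n)"
    using k F fm_measurable_ennreal[OF mv_basic(1), of n J "\<lambda>w. sc k (c w)" "(cmod k)\<^sup>2 * v"]
    by (subst nn_integral_cmult) (simp_all add: mult.assoc[symmetric] ennreal_mult'[symmetric])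
  finally show ?thesis .
qed

text \<open>A dilation multiplies the density by a constant, the inverse Jacobian, whose logarithm
  is the entropy shift.\<close>

lemma H_scale:
  assumes J: "finite J" "J \<noteq> {}" and v: "0 < v" and k: "k \<noteq> 0"
  shows "H n J (\<lambda>w. sc k (c w)) ((cmod k)\<^sup>2 * v) = H n J c v + real n * ln ((cmod k)\<^sup>2)"
proof -
  let ?q = "fm n J (\<lambda>w. sc k (c w)) ((cmod k)\<^sup>2 * v)"
  have kv: "0 < (cmod k)\<^sup>2 * v" using k v by simp
  have m: "(\<lambda>y. rs n (sc k y)) \<in> measurable (Lam n) (Lam n)" by (intro measurable_Lam_mv mvI mv_basic)
  have "(\<integral>y. fm n J c v y * ln (?q (rs n (sc k y))) \<partial>Lam n) = (\<integral>y. ?q y * ln (?q y) \<partial>Lam n)"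
    using J v kv by (intro push_integral(2)[OF m]) (auto intro!: fm_measurable ln_fm_measurable mv_basic fm_nonneg nn_fm_scale[OF k v])
  then have "H n J (\<lambda>w. sc k (c w)) ((cmod k)\<^sup>2 * v) = - (\<integral>y. fm n J c v y * ln (?q (sc k y)) \<partial>Lam n)"
    by (simp add: H_def)
  also have "(\<integral>y. fm n J c v y * ln (?q (sc k y)) \<partial>Lam n) = (\<integral>y. fm n J c v y * ln (fm n J c v y) - real n * ln ((cmod k)\<^sup>2) * fm n J c v y \<partial>Lam n)"
  proof (intro Bochner_Integration.integral_cong refl)
    fix y
    have "ln (?q (sc k y)) = ln (fm n J c v y) - real n * ln ((cmod k)\<^sup>2)"
      using fm_pos[OF J v, of n c y] k by (simp add: fm_scale[OF k v] ln_div ln_realpow power_mult)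
    then show "fm n J c v y * ln (?q (sc k y)) = fm n J c v y * ln (fm n J c v y) - real n * ln ((cmod k)\<^sup>2) * fm n J c v y"
      by (simp only: right_diff_distrib) (simp only: mult_ac)
  qed
  also have "\<dots> = - H n J c v - real n * ln ((cmod k)\<^sup>2) * 1"
    using H_integrable[OF J v, of n c] fm_bi[OF J v, of n c] by (simp add: H_def has_bochner_integral_iff)
  finally show ?thesis by linarith
qed

section \<open>Pairs of vectors with correlated Gaussian noise\<close>

abbreviation LL :: "nat \<Rightarrow> ((nat \<Rightarrow> complex) \<times> (nat \<Rightarrow> complex)) measure" where
  "LL n \<equiv> Lam n \<Otimes>\<^sub>M Lam n"

lemma pair_Lam: "pair_sigma_finite (Lam n) (Lam n)"
  by (intro pair_sigma_finite.intro) simp_all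

lemma nn_LL: "F \<in> borel_measurable (LL n) \<Longrightarrow> (\<integral>\<^sup>+z. F z \<partial>LL n) = (\<integral>\<^sup>+x. \<integral>\<^sup>+y. F (x, y) \<partial>Lam n \<partial>Lam n)"
  using sigma_finite_measure.nn_integral_fst[OF sigma_finite_Lam, of F "Lam n" n] by simp

lemma nn_LL': "F \<in> borel_measurable (LL n) \<Longrightarrow> (\<integral>\<^sup>+z. F z \<partial>LL n) = (\<integral>\<^sup>+y. \<integral>\<^sup>+x. F (x, y) \<partial>Lam n \<partial>Lam n)"
  using pair_sigma_finite.nn_integral_snd[OF pair_Lam, of F n] by simp

text \<open>The joint density of \<open>\<eta>0 + E\<close> and \<open>\<sigma>0 + \<iota> w + g E + V\<close>, where \<open>E\<close> and \<open>V\<close> are independent Gaussian with variances \<open>e\<close> and \<open>v\<close> and \<open>w\<close> is uniform.\<close>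

definition K2 where
  "K2 n e J \<iota> v \<eta>0 \<sigma>0 g z = gd n e (fst z - \<eta>0) * fm n J \<iota> v (snd z - \<sigma>0 - sc g (fst z - \<eta>0))"

lemma K2_measurable: "K2 n e J \<iota> v \<eta>0 \<sigma>0 g \<in> borel_measurable (LL n)"
  unfolding K2_def by (intro borel_measurable_times gd_measurable fm_measurable mvI mv_basic)

text \<open>For a fixed first vector the second one is translated so that only the mixture remains.
  The marginal, residual and moment formulas that follow are all read off from this iterated
  integral or from the one in the opposite order.\<close>

lemma nn_K2:
  assumes e: "0 < e" and v: "0 < v" and G: "G \<in> borel_measurable (LL n)"
  shows "(\<integral>\<^sup>+z. ennreal (K2 n e J \<iota> v \<eta>0 \<sigma>0 g z) * G z \<partial>LL n) =
    (\<integral>\<^sup>+\<eta>. ennreal (gd n e (\<eta> - \<eta>0)) * (\<integral>\<^sup>+s. ennreal (fm n J \<iota> v s) * G (\<eta>, rs n (s + (\<sigma>0 + sc g (\<eta> - \<eta>0)))) \<partial>Lam n) \<partial>Lam n)"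
proof -
  have Km: "(\<lambda>z. ennreal (K2 n e J \<iota> v \<eta>0 \<sigma>0 g z) * G z) \<in> borel_measurable (LL n)"
    using K2_measurable[of n e J \<iota> v \<eta>0 \<sigma>0 g] G by simp
  show ?thesis unfolding nn_LL[OF Km]
  proof (intro nn_integral_cong)
    fix \<eta> assume \<eta>: "\<eta> \<in> space (Lam n)"
    let ?u = "\<sigma>0 + sc g (\<eta> - \<eta>0)"
    have G\<eta>: "(\<lambda>s. G (\<eta>, s)) \<in> borel_measurable (Lam n)"
      using G \<eta> by simp
    have fu: "(\<lambda>s. ennreal (fm n J \<iota> v (s - ?u))) \<in> borel_measurable (Lam n)"
      by (intro fm_measurable_ennreal mv_id_minus)
    have "(\<integral>\<^sup>+s. ennreal (K2 n e J \<iota> v \<eta>0 \<sigma>0 g (\<eta>, s)) * G (\<eta>, s) \<partial>Lam n)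
       = (\<integral>\<^sup>+s. ennreal (gd n e (\<eta> - \<eta>0)) * (ennreal (fm n J \<iota> v (s - ?u)) * G (\<eta>, s)) \<partial>Lam n)"
      using e fm_nonneg[OF v] by (intro nn_integral_cong) (simp add: K2_def ennreal_mult' mult.assoc diff_diff_eq del: sc_simps)
    also have "\<dots> = ennreal (gd n e (\<eta> - \<eta>0)) * (\<integral>\<^sup>+s. ennreal (fm n J \<iota> v (s - ?u)) * G (\<eta>, s) \<partial>Lam n)"
      using G\<eta> fu by (intro nn_integral_cmult borel_measurable_times_ennreal)
    also have "(\<integral>\<^sup>+s. ennreal (fm n J \<iota> v (s - ?u)) * G (\<eta>, s) \<partial>Lam n)
        = (\<integral>\<^sup>+s. ennreal (fm n J \<iota> v (rs n (s + ?u) - ?u)) * G (\<eta>, rs n (s + ?u)) \<partial>Lam n)"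
      using G\<eta> fu by (intro nn_integral_translate[symmetric] borel_measurable_times_ennreal)
    also have "\<dots> = (\<integral>\<^sup>+s. ennreal (fm n J \<iota> v s) * G (\<eta>, rs n (s + ?u)) \<partial>Lam n)"
      by (intro nn_integral_cong arg_cong2[where f="(*)"] arg_cong[where f=ennreal] fm_cong) auto
    finally show "(\<integral>\<^sup>+s. ennreal (K2 n e J \<iota> v \<eta>0 \<sigma>0 g (\<eta>, s)) * G (\<eta>, s) \<partial>Lam n) =
      ennreal (gd n e (\<eta> - \<eta>0)) * (\<integral>\<^sup>+s. ennreal (fm n J \<iota> v s) * G (\<eta>, rs n (s + ?u)) \<partial>Lam n)" .
  qed
qed

lemma K2_pos: "finite J \<Longrightarrow> J \<noteq> {} \<Longrightarrow> 0 < e \<Longrightarrow> 0 < v \<Longrightarrow> 0 < K2 n e J \<iota> v \<eta>0 \<sigma>0 g z"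
  unfolding K2_def by (intro mult_pos_pos gd_pos fm_pos)

lemma nn_K2_fst:
  assumes J: "finite J" "J \<noteq> {}" and e: "0 < e" and v: "0 < v" and F: "F \<in> borel_measurable (Lam n)"
  shows "(\<integral>\<^sup>+z. ennreal (K2 n e J \<iota> v \<eta>0 \<sigma>0 g z) * F (fst z) \<partial>LL n) = (\<integral>\<^sup>+\<eta>. ennreal (gd n e (\<eta> - \<eta>0)) * F \<eta> \<partial>Lam n)"
proof -
  have G: "(\<lambda>z. F (fst z)) \<in> borel_measurable (LL n)" using F by simp
  have f1: "(\<integral>\<^sup>+s. ennreal (fm n J \<iota> v s) \<partial>Lam n) = 1" using nn_integral_fm[OF J v, of n \<iota> 0] by simp
  have fmm: "(\<lambda>s. ennreal (fm n J \<iota> v s)) \<in> borel_measurable (Lam n)" by (intro fm_measurable_ennreal mv_basic)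
  show ?thesis unfolding nn_K2[OF e v G]
    using f1 fmm by (intro nn_integral_cong) (simp add: nn_integral_multc)
qed

lemma nn_K2_snd:
  assumes J: "finite J" "J \<noteq> {}" and e: "0 < e" and v: "0 < v" and F: "F \<in> borel_measurable (Lam n)"
  shows "(\<integral>\<^sup>+z. ennreal (K2 n e J \<iota> v \<eta>0 \<sigma>0 g z) * F (snd z) \<partial>LL n) = (\<integral>\<^sup>+s. ennreal (fm n J \<iota> (v + (cmod g)\<^sup>2 * e) (s - \<sigma>0)) * F s \<partial>Lam n)"
proof -
  have Km: "(\<lambda>z. ennreal (K2 n e J \<iota> v \<eta>0 \<sigma>0 g z) * F (snd z)) \<in> borel_measurable (LL n)"
    using K2_measurable[of n e J \<iota> v \<eta>0 \<sigma>0 g] F by simp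
  show ?thesis unfolding nn_LL'[OF Km]
  proof (intro nn_integral_cong)
    fix s assume s: "s \<in> space (Lam n)"
    have "(\<integral>\<^sup>+x. ennreal (K2 n e J \<iota> v \<eta>0 \<sigma>0 g (x, s)) * F (snd (x, s)) \<partial>Lam n) =
       (\<integral>\<^sup>+x. ennreal (gd n e (x - \<eta>0)) * ennreal (fm n J \<iota> v ((s - \<sigma>0 + sc g \<eta>0) - sc g x)) * F s \<partial>Lam n)"
      using e by (intro nn_integral_cong) (simp add: K2_def ennreal_mult' algebra_simps)
    also have "\<dots> = (\<integral>\<^sup>+x. ennreal (gd n e (x - \<eta>0)) * ennreal (fm n J \<iota> v ((s - \<sigma>0 + sc g \<eta>0) - sc g x)) \<partial>Lam n) * F s"
      by (intro nn_integral_multc borel_measurable_times_ennreal gd_measurable_ennreal fm_measurable_ennreal mvI mv_basic)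
    also have "\<dots> = ennreal (fm n J \<iota> (v + (cmod g)\<^sup>2 * e) (s - \<sigma>0)) * F s"
      by (subst nn_integral_fm_conv[OF J e v]) simp
    finally show "(\<integral>\<^sup>+x. ennreal (K2 n e J \<iota> v \<eta>0 \<sigma>0 g (x, s)) * F (snd (x, s)) \<partial>Lam n) = ennreal (fm n J \<iota> (v + (cmod g)\<^sup>2 * e) (s - \<sigma>0)) * F s" .
  qed
qed

lemma nn_K2_res:
  assumes e: "0 < e" and v: "0 < v" and F: "F \<in> borel_measurable (Lam n)"
  shows "(\<integral>\<^sup>+z. ennreal (K2 n e J \<iota> v \<eta>0 \<sigma>0 g z) * F (rs n (snd z - \<sigma>0 - sc g (fst z - \<eta>0))) \<partial>LL n) = (\<integral>\<^sup>+s. ennreal (fm n J \<iota> v s) * F s \<partial>Lam n)"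
proof -
  have G: "(\<lambda>z. F (rs n (snd z - \<sigma>0 - sc g (fst z - \<eta>0)))) \<in> borel_measurable (LL n)"
    by (intro measurable_compose[OF measurable_Lam_mv F] mvI mv_basic)
  have r: "rs n (rs n (s + (\<sigma>0 + sc g (\<eta> - \<eta>0))) - \<sigma>0 - sc g (\<eta> - \<eta>0)) = rs n s" for s \<eta>
    by (auto simp: fun_eq_iff restrict_def)
  have "(\<integral>\<^sup>+z. ennreal (K2 n e J \<iota> v \<eta>0 \<sigma>0 g z) * F (rs n (snd z - \<sigma>0 - sc g (fst z - \<eta>0))) \<partial>LL n)
    = (\<integral>\<^sup>+\<eta>. ennreal (gd n e (\<eta> - \<eta>0)) * (\<integral>\<^sup>+s. ennreal (fm n J \<iota> v s) * F (rs n s) \<partial>Lam n) \<partial>Lam n)"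
    unfolding nn_K2[OF e v G] by (simp only: fst_conv snd_conv r)
  also have "\<dots> = (\<integral>\<^sup>+s. ennreal (fm n J \<iota> v s) * F (rs n s) \<partial>Lam n)"
    by (subst nn_integral_multc[OF gd_measurable_ennreal[OF mv_id_minus(1)]]) (simp add: nn_integral_gd[OF e])
  also have "\<dots> = (\<integral>\<^sup>+s. ennreal (fm n J \<iota> v s) * F s \<partial>Lam n)"
    by (intro nn_integral_cong) simp
  finally show ?thesis .
qed

text \<open>The combination has noise \<open>(1 + cc * g) E + cc V\<close> and a codebook scaled by
  \<open>cc\<close>. It rebuilds a channel output from a decorrelated pair, so that a decoder for
  the output can be applied to the pair.\<close>

lemma nn_K2_comb:
  assumes J: "finite J" "J \<noteq> {}" and e: "0 < e" and v: "0 < v" and F: "F \<in> borel_measurable (Lam n)" and cc: "cc \<noteq> 0"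
  shows "(\<integral>\<^sup>+z. ennreal (K2 n e J \<iota> v \<eta>0 \<sigma>0 g z) * F (rs n (fst z + sc cc (snd z))) \<partial>LL n) =
    (\<integral>\<^sup>+y. ennreal (fm n J (\<lambda>w. sc cc (\<iota> w)) ((cmod cc)\<^sup>2 * v + (cmod (1 + cc * g))\<^sup>2 * e) (y - (\<eta>0 + sc cc \<sigma>0))) * F y \<partial>Lam n)"
proof -
  let ?f = "fm n J (\<lambda>w. sc cc (\<iota> w)) ((cmod cc)\<^sup>2 * v)"
  have vv: "0 < (cmod cc)\<^sup>2 * v" using cc v by simp
  have G: "(\<lambda>z. F (rs n (fst z + sc cc (snd z)))) \<in> borel_measurable (LL n)"
    by (intro measurable_compose[OF measurable_Lam_mv F] mvI mv_basic)
  let ?y0 = "sc cc \<sigma>0 - sc (cc * g) \<eta>0"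
  have inner: "(\<integral>\<^sup>+s. ennreal (fm n J \<iota> v s) * F (rs n (\<eta> + sc cc (rs n (s + (\<sigma>0 + sc g (\<eta> - \<eta>0)))))) \<partial>Lam n)
     = (\<integral>\<^sup>+y. ennreal (?f ((y - ?y0) - sc (1 + cc * g) \<eta>)) * F y \<partial>Lam n)" for \<eta>
  proof -
    let ?u = "\<eta> + sc cc (\<sigma>0 + sc g (\<eta> - \<eta>0))"
    have Fu: "(\<lambda>y. F (rs n (y + ?u))) \<in> borel_measurable (Lam n)"
      by (intro measurable_compose[OF measurable_Lam_mv F] mvI mv_basic)
    have "rs n (\<eta> + sc cc (rs n (s + (\<sigma>0 + sc g (\<eta> - \<eta>0))))) = rs n (rs n (sc cc s) + ?u)" for s
      by (auto simp: fun_eq_iff restrict_def algebra_simps)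
    then have "(\<integral>\<^sup>+s. ennreal (fm n J \<iota> v s) * F (rs n (\<eta> + sc cc (rs n (s + (\<sigma>0 + sc g (\<eta> - \<eta>0)))))) \<partial>Lam n)
      = (\<integral>\<^sup>+s. ennreal (fm n J \<iota> v s) * (\<lambda>y. F (rs n (y + ?u))) (rs n (sc cc s)) \<partial>Lam n)" by (simp only:)
    also have "\<dots> = (\<integral>\<^sup>+y. ennreal (?f y) * F (rs n (y + ?u)) \<partial>Lam n)"
      by (rule nn_fm_scale[OF cc v Fu])
    also have "\<dots> = (\<integral>\<^sup>+y. (\<lambda>y. ennreal (?f (y - ?u)) * F y) (rs n (y + ?u)) \<partial>Lam n)"
      by (intro nn_integral_cong arg_cong2[where f="(*)"] arg_cong[where f=ennreal] fm_cong) auto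
    also have "\<dots> = (\<integral>\<^sup>+y. ennreal (?f (y - ?u)) * F y \<partial>Lam n)"
      using F by (intro nn_integral_translate borel_measurable_times_ennreal fm_measurable_ennreal mvI mv_basic)
    also have "\<dots> = (\<integral>\<^sup>+y. ennreal (?f ((y - ?y0) - sc (1 + cc * g) \<eta>)) * F y \<partial>Lam n)"
      by (intro nn_integral_cong arg_cong2[where f="(*)"] arg_cong[where f=ennreal] fm_cong) (simp_all add: algebra_simps)
    finally show ?thesis .
  qed
  have "(\<integral>\<^sup>+z. ennreal (K2 n e J \<iota> v \<eta>0 \<sigma>0 g z) * F (rs n (fst z + sc cc (snd z))) \<partial>LL n)
     = (\<integral>\<^sup>+\<eta>. ennreal (gd n e (\<eta> - \<eta>0)) * (\<integral>\<^sup>+y. ennreal (?f ((y - ?y0) - sc (1 + cc * g) \<eta>)) * F y \<partial>Lam n) \<partial>Lam n)"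
    unfolding nn_K2[OF e v G] by (simp only: fst_conv snd_conv inner)
  also have "\<dots> = (\<integral>\<^sup>+\<eta>. \<integral>\<^sup>+y. ennreal (gd n e (\<eta> - \<eta>0)) * ennreal (?f ((y - ?y0) - sc (1 + cc * g) \<eta>)) * F y \<partial>Lam n \<partial>Lam n)"
    using F by (subst nn_integral_cmult[symmetric]) (auto intro!: borel_measurable_times_ennreal fm_measurable_ennreal mvI mv_basic simp: mult.assoc)
  also have "\<dots> = (\<integral>\<^sup>+y. \<integral>\<^sup>+\<eta>. ennreal (gd n e (\<eta> - \<eta>0)) * ennreal (?f ((y - ?y0) - sc (1 + cc * g) \<eta>)) * F y \<partial>Lam n \<partial>Lam n)"
    by (rule pair_sigma_finite.Fubini'[OF pair_Lam, where f="\<lambda>y \<eta>. ennreal (gd n e (\<eta> - \<eta>0)) * ennreal (?f ((y - ?y0) - sc (1 + cc * g) \<eta>)) * F y"])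
      (unfold split_beta', intro borel_measurable_times_ennreal gd_measurable_ennreal fm_measurable_ennreal mvI mv_basic measurable_compose[OF measurable_fst F])
  also have "\<dots> = (\<integral>\<^sup>+y. ennreal (fm n J (\<lambda>w. sc cc (\<iota> w)) ((cmod cc)\<^sup>2 * v + (cmod (1 + cc * g))\<^sup>2 * e) (y - (\<eta>0 + sc cc \<sigma>0))) * F y \<partial>Lam n)"
  proof (intro nn_integral_cong)
    fix y
    have "(\<integral>\<^sup>+\<eta>. ennreal (gd n e (\<eta> - \<eta>0)) * ennreal (?f ((y - ?y0) - sc (1 + cc * g) \<eta>)) * F y \<partial>Lam n)
       = (\<integral>\<^sup>+\<eta>. ennreal (gd n e (\<eta> - \<eta>0)) * ennreal (?f ((y - ?y0) - sc (1 + cc * g) \<eta>)) \<partial>Lam n) * F y"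
      by (intro nn_integral_multc borel_measurable_times_ennreal gd_measurable_ennreal fm_measurable_ennreal mvI mv_basic)
    also have "\<dots> = ennreal (fm n J (\<lambda>w. sc cc (\<iota> w)) ((cmod cc)\<^sup>2 * v + (cmod (1 + cc * g))\<^sup>2 * e) ((y - ?y0) - sc (1 + cc * g) \<eta>0)) * F y"
      by (subst nn_integral_fm_conv[OF J e vv]) simp
    also have "(y - ?y0) - sc (1 + cc * g) \<eta>0 = y - (\<eta>0 + sc cc \<sigma>0)"
      by (simp add: fun_eq_iff algebra_simps)
    finally show "(\<integral>\<^sup>+\<eta>. ennreal (gd n e (\<eta> - \<eta>0)) * ennreal (?f ((y - ?y0) - sc (1 + cc * g) \<eta>)) * F y \<partial>Lam n) =
       ennreal (fm n J (\<lambda>w. sc cc (\<iota> w)) ((cmod cc)\<^sup>2 * v + (cmod (1 + cc * g))\<^sup>2 * e) (y - (\<eta>0 + sc cc \<sigma>0))) * F y" .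
  qed
  finally show ?thesis .
qed

lemma nn_fm_moment:
  assumes "finite J" "J \<noteq> {}" "0 < v"
  shows "(\<integral>\<^sup>+y. ennreal (fm n J c v y) * ennreal (nsq n (sc k y + m)) \<partial>Lam n) = ennreal ((cmod k)\<^sup>2 * real n * v + (\<Sum>w\<in>J. nsq n (sc k (c w) + m)) / real (card J))"
  using fm_moment[OF assms, of n c k m] fm_nonneg[OF assms(3)]
  by (subst ennreal_mult[symmetric]) (auto simp: has_bochner_integral_iff nn_integral_eq_integral)

lemma K2_moment:
  assumes J: "finite J" "J \<noteq> {}" and e: "0 < e" and v: "0 < v"
  shows "has_bochner_integral (LL n) (\<lambda>z. K2 n e J \<iota> v \<eta>0 \<sigma>0 g z * nsq n (sc \<alpha> (fst z) + sc \<beta> (snd z) + m))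
    ((cmod (\<alpha> + \<beta> * g))\<^sup>2 * real n * e + (cmod \<beta>)\<^sup>2 * real n * v + (\<Sum>w\<in>J. nsq n (sc \<alpha> \<eta>0 + sc \<beta> (\<sigma>0 + \<iota> w) + m)) / real (card J))"
    (is "has_bochner_integral _ ?F ?V")
proof (rule has_bochner_integral_nn_integral)
  show Fm: "?F \<in> borel_measurable (LL n)"
    by (intro borel_measurable_times K2_measurable nsq_measurable mvI mv_basic)
  show "AE z in LL n. 0 \<le> ?F z" using K2_pos[OF J e v] by (intro AE_I2 mult_nonneg_nonneg) (auto simp: less_imp_le)
  show "0 \<le> ?V" using e v by (intro add_nonneg_nonneg mult_nonneg_nonneg divide_nonneg_nonneg sum_nonneg) auto
  have G: "(\<lambda>z. ennreal (nsq n (sc \<alpha> (fst z) + sc \<beta> (snd z) + m))) \<in> borel_measurable (LL n)"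
    by (intro measurable_compose[OF nsq_measurable measurable_ennreal] mvI mv_basic)
  let ?h = "\<lambda>\<eta>. (cmod \<beta>)\<^sup>2 * real n * v + (\<Sum>w\<in>J. nsq n (sc (\<alpha> + \<beta> * g) \<eta> + (sc \<beta> (\<iota> w) + sc \<beta> \<sigma>0 - sc (\<beta> * g) \<eta>0 + m))) / real (card J)"
  have inner: "(\<integral>\<^sup>+s. ennreal (fm n J \<iota> v s) * ennreal (nsq n (sc \<alpha> \<eta> + sc \<beta> (rs n (s + (\<sigma>0 + sc g (\<eta> - \<eta>0)))) + m)) \<partial>Lam n) = ennreal (?h \<eta>)" for \<eta>
  proof -
    let ?m = "sc \<alpha> \<eta> + sc \<beta> (\<sigma>0 + sc g (\<eta> - \<eta>0)) + m"
    have "nsq n (sc \<alpha> \<eta> + sc \<beta> (rs n (s + (\<sigma>0 + sc g (\<eta> - \<eta>0)))) + m) = nsq n (sc \<beta> s + ?m)" for s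
      by (rule nsq_cong) (simp add: algebra_simps)
    then have "(\<integral>\<^sup>+s. ennreal (fm n J \<iota> v s) * ennreal (nsq n (sc \<alpha> \<eta> + sc \<beta> (rs n (s + (\<sigma>0 + sc g (\<eta> - \<eta>0)))) + m)) \<partial>Lam n)
      = (\<integral>\<^sup>+s. ennreal (fm n J \<iota> v s) * ennreal (nsq n (sc \<beta> s + ?m)) \<partial>Lam n)" by (simp only:)
    also have "\<dots> = ennreal ((cmod \<beta>)\<^sup>2 * real n * v + (\<Sum>w\<in>J. nsq n (sc \<beta> (\<iota> w) + ?m)) / real (card J))"
      by (rule nn_fm_moment[OF J v])
    also have "(\<Sum>w\<in>J. nsq n (sc \<beta> (\<iota> w) + ?m)) = (\<Sum>w\<in>J. nsq n (sc (\<alpha> + \<beta> * g) \<eta> + (sc \<beta> (\<iota> w) + sc \<beta> \<sigma>0 - sc (\<beta> * g) \<eta>0 + m)))"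
      by (intro sum.cong refl nsq_cong) (simp add: algebra_simps)
    finally show ?thesis .
  qed
  have "(\<integral>\<^sup>+z. ennreal (?F z) \<partial>LL n) = (\<integral>\<^sup>+z. ennreal (K2 n e J \<iota> v \<eta>0 \<sigma>0 g z) * ennreal (nsq n (sc \<alpha> (fst z) + sc \<beta> (snd z) + m)) \<partial>LL n)"
    using K2_pos[OF J e v, of n \<iota> \<eta>0 \<sigma>0 g] by (intro nn_integral_cong ennreal_mult) (auto simp: less_imp_le)
  also have "\<dots> = (\<integral>\<^sup>+\<eta>. ennreal (gd n e (\<eta> - \<eta>0)) * ennreal (?h \<eta>) \<partial>Lam n)"
    unfolding nn_K2[OF e v G] by (simp only: fst_conv snd_conv inner)
  also have "\<dots> = (\<integral>\<^sup>+\<eta>. ennreal ((\<Sum>w\<in>J. (cmod \<beta>)\<^sup>2 * real n * v * gd n e (\<eta> - \<eta>0) + gd n e (\<eta> - \<eta>0) * nsq n (sc (\<alpha> + \<beta> * g) \<eta> + (sc \<beta> (\<iota> w) + sc \<beta> \<sigma>0 - sc (\<beta> * g) \<eta>0 + m))) / real (card J)) \<partial>Lam n)"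
  proof (intro nn_integral_cong)
    fix \<eta>
    have h0: "0 \<le> ?h \<eta>" using v by (intro add_nonneg_nonneg mult_nonneg_nonneg divide_nonneg_nonneg sum_nonneg) auto
    have "gd n e (\<eta> - \<eta>0) * ?h \<eta> = (\<Sum>w\<in>J. (cmod \<beta>)\<^sup>2 * real n * v * gd n e (\<eta> - \<eta>0) + gd n e (\<eta> - \<eta>0) * nsq n (sc (\<alpha> + \<beta> * g) \<eta> + (sc \<beta> (\<iota> w) + sc \<beta> \<sigma>0 - sc (\<beta> * g) \<eta>0 + m))) / real (card J)"
      using J by (simp only: sum.distrib sum_distrib_left[symmetric] sum_constant) (simp add: add_divide_distrib distrib_left)
    then show "ennreal (gd n e (\<eta> - \<eta>0)) * ennreal (?h \<eta>) = ennreal ((\<Sum>w\<in>J. (cmod \<beta>)\<^sup>2 * real n * v * gd n e (\<eta> - \<eta>0) + gd n e (\<eta> - \<eta>0) * nsq n (sc (\<alpha> + \<beta> * g) \<eta> + (sc \<beta> (\<iota> w) + sc \<beta> \<sigma>0 - sc (\<beta> * g) \<eta>0 + m))) / real (card J))"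
      using ennreal_mult[of "gd n e (\<eta> - \<eta>0)" "?h \<eta>"] h0 e by (simp only: gd_nonneg)
  qed
  also have "\<dots> = ennreal ((\<Sum>w\<in>J. (cmod \<beta>)\<^sup>2 * real n * v + ((cmod (\<alpha> + \<beta> * g))\<^sup>2 * real n * e + nsq n (sc (\<alpha> + \<beta> * g) \<eta>0 + (sc \<beta> (\<iota> w) + sc \<beta> \<sigma>0 - sc (\<beta> * g) \<eta>0 + m)))) / real (card J))"
  proof (rule nn_integral_avg)
    fix w
    let ?m = "sc \<beta> (\<iota> w) + sc \<beta> \<sigma>0 - sc (\<beta> * g) \<eta>0 + m"
    show "(\<lambda>\<eta>. (cmod \<beta>)\<^sup>2 * real n * v * gd n e (\<eta> - \<eta>0) + gd n e (\<eta> - \<eta>0) * nsq n (sc (\<alpha> + \<beta> * g) \<eta> + ?m)) \<in> borel_measurable (Lam n)"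
      by (intro borel_measurable_add borel_measurable_times borel_measurable_const gd_measurable nsq_measurable mvI mv_basic)
    have g0: "has_bochner_integral (Lam n) (\<lambda>\<eta>. gd n e (\<eta> - \<eta>0)) 1"
      using nn_integral_gd[OF e, of n \<eta>0] e by (intro has_bochner_integral_nn_integral gd_measurable mvI mv_basic) (auto simp: less_imp_le)
    have "has_bochner_integral (Lam n) (\<lambda>\<eta>. (cmod \<beta>)\<^sup>2 * real n * v * gd n e (\<eta> - \<eta>0) + gd n e (\<eta> - \<eta>0) * nsq n (sc (\<alpha> + \<beta> * g) \<eta> + ?m))
      ((cmod \<beta>)\<^sup>2 * real n * v * 1 + ((cmod (\<alpha> + \<beta> * g))\<^sup>2 * real n * e + nsq n (sc (\<alpha> + \<beta> * g) \<eta>0 + ?m)))"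
      by (intro has_bochner_integral_add has_bochner_integral_mult_right gd_moment e g0)
    then show "(\<integral>\<^sup>+\<eta>. ennreal ((cmod \<beta>)\<^sup>2 * real n * v * gd n e (\<eta> - \<eta>0) + gd n e (\<eta> - \<eta>0) * nsq n (sc (\<alpha> + \<beta> * g) \<eta> + ?m)) \<partial>Lam n) =
      ennreal ((cmod \<beta>)\<^sup>2 * real n * v + ((cmod (\<alpha> + \<beta> * g))\<^sup>2 * real n * e + nsq n (sc (\<alpha> + \<beta> * g) \<eta>0 + ?m)))"
      using e v by (subst nn_integral_eq_integral) (auto simp: has_bochner_integral_iff)
  qed (use J e v in auto)
  also have "(\<Sum>w\<in>J. (cmod \<beta>)\<^sup>2 * real n * v + ((cmod (\<alpha> + \<beta> * g))\<^sup>2 * real n * e + nsq n (sc (\<alpha> + \<beta> * g) \<eta>0 + (sc \<beta> (\<iota> w) + sc \<beta> \<sigma>0 - sc (\<beta> * g) \<eta>0 + m)))) / real (card J)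
     = (cmod \<beta>)\<^sup>2 * real n * v + (cmod (\<alpha> + \<beta> * g))\<^sup>2 * real n * e + (\<Sum>w\<in>J. nsq n (sc (\<alpha> + \<beta> * g) \<eta>0 + (sc \<beta> (\<iota> w) + sc \<beta> \<sigma>0 - sc (\<beta> * g) \<eta>0 + m))) / real (card J)"
    using J by (simp only: sum.distrib sum_constant) (simp add: add_divide_distrib)
  also have "(\<Sum>w\<in>J. nsq n (sc (\<alpha> + \<beta> * g) \<eta>0 + (sc \<beta> (\<iota> w) + sc \<beta> \<sigma>0 - sc (\<beta> * g) \<eta>0 + m))) = (\<Sum>w\<in>J. nsq n (sc \<alpha> \<eta>0 + sc \<beta> (\<sigma>0 + \<iota> w) + m))"
    by (intro sum.cong refl nsq_cong) (simp add: algebra_simps)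
  finally show "(\<integral>\<^sup>+z. ennreal (?F z) \<partial>LL n) = ennreal ?V" by (simp only: add.commute)
qed

lemma integrable_LL_qb:
  assumes K: "K \<in> borel_measurable (LL n)" and K0: "\<And>z. 0 \<le> K z"
    and i: "integrable (LL n) K" "integrable (LL n) (\<lambda>z. K z * nsq n (fst z))" "integrable (LL n) (\<lambda>z. K z * nsq n (snd z))"
    and g: "g \<in> borel_measurable (LL n)" and b: "\<And>z. \<bar>g z\<bar> \<le> C * (1 + nsq n (fst z) + nsq n (snd z))"
  shows "integrable (LL n) (\<lambda>z. K z * g z)"
proof (rule Bochner_Integration.integrable_bound)
  show "integrable (LL n) (\<lambda>z. C * (K z + K z * nsq n (fst z) + K z * nsq n (snd z)))"
    using i by (intro integrable_mult_right Bochner_Integration.integrable_add)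
  show "(\<lambda>z. K z * g z) \<in> borel_measurable (LL n)" using K g by simp
  have "\<bar>K z * g z\<bar> \<le> C * (K z + K z * nsq n (fst z) + K z * nsq n (snd z))" for z
    using mult_left_mono[OF b[of z] K0[of z]] K0[of z] by (simp add: abs_mult algebra_simps)
  then show "AE z in LL n. norm (K z * g z) \<le> norm (C * (K z + K z * nsq n (fst z) + K z * nsq n (snd z)))"
    by (intro AE_I2) (auto intro: order_trans[OF _ abs_ge_self])
qed

lemma K2_bi:
  assumes J: "finite J" "J \<noteq> {}" and e: "0 < e" and v: "0 < v"
  shows "has_bochner_integral (LL n) (K2 n e J \<iota> v \<eta>0 \<sigma>0 g) 1"
proof (rule has_bochner_integral_nn_integral)
  show "(\<integral>\<^sup>+z. ennreal (K2 n e J \<iota> v \<eta>0 \<sigma>0 g z) \<partial>LL n) = ennreal 1"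
    using nn_K2_fst[OF assms, of "\<lambda>_. 1" n \<iota> \<eta>0 \<sigma>0 g] nn_integral_gd[OF e, of n \<eta>0] by simp
qed (use K2_pos[OF assms, of n \<iota> \<eta>0 \<sigma>0 g] K2_measurable in \<open>auto simp: less_imp_le\<close>)

lemma K2_integrable_qb:
  assumes J: "finite J" "J \<noteq> {}" and e: "0 < e" and v: "0 < v"
    and g: "g \<in> borel_measurable (LL n)" and b: "\<And>z. \<bar>g z\<bar> \<le> C * (1 + nsq n (fst z) + nsq n (snd z))"
  shows "integrable (LL n) (\<lambda>z. K2 n e J \<iota> v \<eta>0 \<sigma>0 k z * g z)"
proof (rule integrable_LL_qb[OF K2_measurable _ _ _ _ g b])
  show "integrable (LL n) (\<lambda>z. K2 n e J \<iota> v \<eta>0 \<sigma>0 k z * nsq n (fst z))"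
    using K2_moment[OF J e v, of n \<iota> \<eta>0 \<sigma>0 k 1 0 0] by (simp add: has_bochner_integral_iff)
  show "integrable (LL n) (\<lambda>z. K2 n e J \<iota> v \<eta>0 \<sigma>0 k z * nsq n (snd z))"
    using K2_moment[OF J e v, of n \<iota> \<eta>0 \<sigma>0 k 0 1 0] by (simp add: has_bochner_integral_iff)
qed (use K2_bi[OF J e v, of n \<iota> \<eta>0 \<sigma>0 k] K2_pos[OF J e v, of n \<iota> \<eta>0 \<sigma>0 k] in \<open>auto simp: has_bochner_integral_iff less_imp_le\<close>)

lemma qb_add:
  assumes "\<And>z. \<bar>f z\<bar> \<le> C * (1 + nsq n (fst z) + nsq n (snd z))" "\<And>z. \<bar>g z\<bar> \<le> D * (1 + nsq n (fst z) + nsq n (snd z))"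
  shows "\<bar>f z + g z :: real\<bar> \<le> (C + D) * (1 + nsq n (fst z) + nsq n (snd z))"
  using assms[of z] by (simp add: distrib_right)

lemma nsq_affine_le:
  "nsq n (sc a x + sc b y + m) \<le> (4 * (cmod a)\<^sup>2 + 4 * (cmod b)\<^sup>2 + 2 * nsq n m) * (1 + nsq n x + nsq n y)"
proof -
  define A B X Y M where d: "A = (cmod a)\<^sup>2" "B = (cmod b)\<^sup>2" "X = nsq n x" "Y = nsq n y" "M = nsq n m"
  have nn: "0 \<le> A" "0 \<le> B" "0 \<le> X" "0 \<le> Y" "0 \<le> M" by (simp_all add: d)
  have "nsq n (sc a x + sc b y + m) \<le> 2 * nsq n (sc a x + sc b y) + 2 * nsq n m" by (rule nsq_add_le)
  also have "nsq n (sc a x + sc b y) \<le> 2 * nsq n (sc a x) + 2 * nsq n (sc b y)" by (rule nsq_add_le)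
  finally have "nsq n (sc a x + sc b y + m) \<le> 4 * (A * X) + 4 * (B * Y) + 2 * M" by (simp add: d)
  also have "\<dots> \<le> (4 * A + 4 * B + 2 * M) * (1 + X + Y)"
    using mult_nonneg_nonneg[OF nn(1,4)] mult_nonneg_nonneg[OF nn(2,3)] mult_nonneg_nonneg[OF nn(5,3)] mult_nonneg_nonneg[OF nn(5,4)] nn
    by (simp add: algebra_simps)
  finally show ?thesis by (simp add: d)
qed

lemma ln_fm_qb2:
  assumes J: "finite J" "J \<noteq> {}" and v: "0 < v"
  obtains C where "0 \<le> C" "\<And>z. \<bar>ln (fm n J c v (sc a (fst z) + sc b (snd z) + m))\<bar> \<le> C * (1 + nsq n (fst z) + nsq n (snd z))"
proof -
  obtain C where C: "0 \<le> C" "\<And>y. \<bar>ln (fm n J c v y)\<bar> \<le> C * (1 + nsq n y)" using ln_fm_bound[OF J v, of n c] by blast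
  define D where "D = 4 * (cmod a)\<^sup>2 + 4 * (cmod b)\<^sup>2 + 2 * nsq n m"
  have D0: "0 \<le> D" by (simp add: D_def)
  have "\<bar>ln (fm n J c v (sc a (fst z) + sc b (snd z) + m))\<bar> \<le> C * (1 + D) * (1 + nsq n (fst z) + nsq n (snd z))" for z :: "(nat \<Rightarrow> complex) \<times> (nat \<Rightarrow> complex)"
  proof -
    define Y where "Y = nsq n (fst z) + nsq n (snd z)"
    have Y0: "0 \<le> Y" by (simp add: Y_def)
    have "\<bar>ln (fm n J c v (sc a (fst z) + sc b (snd z) + m))\<bar> \<le> C * (1 + nsq n (sc a (fst z) + sc b (snd z) + m))" by (rule C)
    also have "\<dots> \<le> C * (1 + D * (1 + Y))"
      using C(1) nsq_affine_le[of n a "fst z" b "snd z" m] by (intro mult_left_mono add_left_mono) (auto simp: D_def Y_def add.assoc)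
    also have "\<dots> \<le> C * ((1 + D) * (1 + Y))"
      using C(1) D0 Y0 by (intro mult_left_mono) (auto simp: algebra_simps)
    finally show ?thesis by (simp add: Y_def add.assoc mult.assoc)
  qed
  moreover have "0 \<le> C * (1 + D)" using C D0 by simp
  ultimately show thesis using that by blast
qed

lemma ln_gd_qb2:
  assumes v: "0 < v"
  obtains C where "0 \<le> C" "\<And>z. \<bar>ln (gd n v (sc a (fst z) + sc b (snd z) + m))\<bar> \<le> C * (1 + nsq n (fst z) + nsq n (snd z))"
proof -
  have "gd n v y = fm n {()} (\<lambda>_. 0) v y" for y by (simp add: fm_def)
  then show thesis using ln_fm_qb2[of "{()}" v n "\<lambda>_. 0" a b m thesis] v that by simp
qed

lemma K2_ln_fm:
  assumes J: "finite J" "J \<noteq> {}" and e: "0 < e" and v: "0 < v" and A: "finite A" "A \<noteq> {}" "0 < u"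
  shows "integrable (LL n) (\<lambda>z. K2 n e J \<iota> v \<eta>0 \<sigma>0 g z * ln (fm n A c u (sc a (fst z) + sc b (snd z) + m)))"
proof -
  obtain C where C: "0 \<le> C" "\<And>z. \<bar>ln (fm n A c u (sc a (fst z) + sc b (snd z) + m))\<bar> \<le> C * (1 + nsq n (fst z) + nsq n (snd z))"
    using ln_fm_qb2[OF A, of n c a b m] by blast
  show ?thesis by (rule K2_integrable_qb[OF J e v _ C(2)]) (intro ln_fm_measurable mvI mv_basic)
qed

lemma K2_ln_gd:
  assumes J: "finite J" "J \<noteq> {}" and e: "0 < e" and v: "0 < v" and u: "0 < u"
  shows "has_bochner_integral (LL n) (\<lambda>z. K2 n e J \<iota> v \<eta>0 \<sigma>0 g z * ln (gd n u (sc \<alpha> (fst z) + sc \<beta> (snd z) + m)))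
     (- (((cmod (\<alpha> + \<beta> * g))\<^sup>2 * real n * e + (cmod \<beta>)\<^sup>2 * real n * v + (\<Sum>w\<in>J. nsq n (sc \<alpha> \<eta>0 + sc \<beta> (\<sigma>0 + \<iota> w) + m)) / real (card J)) / u) - real n * ln (pi * u))"
proof -
  let ?K = "K2 n e J \<iota> v \<eta>0 \<sigma>0 g"
  have eq: "?K z * ln (gd n u (sc \<alpha> (fst z) + sc \<beta> (snd z) + m)) = (- 1 / u) * (?K z * nsq n (sc \<alpha> (fst z) + sc \<beta> (snd z) + m)) - real n * ln (pi * u) * ?K z" for z
    using u by (simp add: ln_gd algebra_simps)
  have "has_bochner_integral (LL n) (\<lambda>z. ?K z * ln (gd n u (sc \<alpha> (fst z) + sc \<beta> (snd z) + m)))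
    ((-1 / u) * ((cmod (\<alpha> + \<beta> * g))\<^sup>2 * real n * e + (cmod \<beta>)\<^sup>2 * real n * v + (\<Sum>w\<in>J. nsq n (sc \<alpha> \<eta>0 + sc \<beta> (\<sigma>0 + \<iota> w) + m)) / real (card J)) - real n * ln (pi * u) * 1)"
    unfolding eq by (intro has_bochner_integral_diff has_bochner_integral_mult_right K2_moment K2_bi J e v)
  then show ?thesis by simp
qed

text \<open>Chain rule: subtracting \<open>g\<close> times the first noise from the second
  coordinate leaves a residual independent of it, so the entropies of \<open>E\<close> and of the
  mixture at level \<open>v\<close> add.\<close>

lemma K2_ent:
  assumes J: "finite J" "J \<noteq> {}" and e: "0 < e" and v: "0 < v"
  shows "has_bochner_integral (LL n) (\<lambda>z. K2 n e J \<iota> v \<eta>0 \<sigma>0 g z * ln (K2 n e J \<iota> v \<eta>0 \<sigma>0 g z)) (- real n * ln (pi * exp 1 * e) - H n J \<iota> v)"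
proof -
  let ?K = "K2 n e J \<iota> v \<eta>0 \<sigma>0 g"
  have s: "?K z * ln (?K z) = ?K z * ln (gd n e (sc 1 (fst z) + sc 0 (snd z) + (- \<eta>0))) + ?K z * ln (fm n J \<iota> v (sc (- g) (fst z) + sc 1 (snd z) + (sc g \<eta>0 - \<sigma>0)))" for z
  proof -
    have a: "gd n e (fst z - \<eta>0) = gd n e (sc 1 (fst z) + sc 0 (snd z) + (- \<eta>0))" by (rule gd_cong) simp
    have b: "fm n J \<iota> v (snd z - \<sigma>0 - sc g (fst z - \<eta>0)) = fm n J \<iota> v (sc (- g) (fst z) + sc 1 (snd z) + (sc g \<eta>0 - \<sigma>0))"
      by (rule fm_cong) (simp add: algebra_simps)
    have "ln (?K z) = ln (gd n e (sc 1 (fst z) + sc 0 (snd z) + (- \<eta>0))) + ln (fm n J \<iota> v (sc (- g) (fst z) + sc 1 (snd z) + (sc g \<eta>0 - \<sigma>0)))"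
      unfolding K2_def a b using e fm_pos[OF J v] by (intro ln_mult_pos) auto
    then show ?thesis by (simp only: distrib_left)
  qed
  have 1: "has_bochner_integral (LL n) (\<lambda>z. ?K z * ln (gd n e (sc 1 (fst z) + sc 0 (snd z) + (- \<eta>0)))) (- real n * ln (pi * exp 1 * e))"
    using K2_ln_gd[OF J e v e, of n \<iota> \<eta>0 \<sigma>0 g 1 0 "- \<eta>0"] J e ln_pie[OF e]
    by (simp add: nsq_def algebra_simps)
  have m: "(\<lambda>z. rs n (snd z - \<sigma>0 - sc g (fst z - \<eta>0))) \<in> measurable (LL n) (Lam n)"
    by (intro measurable_Lam_mv mvI mv_basic)
  have "(\<integral>z. ?K z * ln (fm n J \<iota> v (rs n (snd z - \<sigma>0 - sc g (fst z - \<eta>0)))) \<partial>LL n) = (\<integral>y. fm n J \<iota> v y * ln (fm n J \<iota> v y) \<partial>Lam n)"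
    using K2_pos[OF J e v, of n \<iota> \<eta>0 \<sigma>0 g]
    by (intro push_integral(2)[OF m K2_measurable]) (auto intro!: fm_measurable ln_fm_measurable mv_basic fm_nonneg v nn_K2_res[OF e v] simp: less_imp_le simp del: sc_simps)
  moreover have "fm n J \<iota> v (rs n (snd z - \<sigma>0 - sc g (fst z - \<eta>0))) = fm n J \<iota> v (sc (- g) (fst z) + sc 1 (snd z) + (sc g \<eta>0 - \<sigma>0))" for z :: "(nat \<Rightarrow> complex) \<times> (nat \<Rightarrow> complex)"
      by (rule fm_cong) (simp add: algebra_simps)
  ultimately have 2: "has_bochner_integral (LL n) (\<lambda>z. ?K z * ln (fm n J \<iota> v (sc (- g) (fst z) + sc 1 (snd z) + (sc g \<eta>0 - \<sigma>0)))) (- H n J \<iota> v)"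
    using K2_ln_fm[OF J e v J v, of n \<iota> \<eta>0 \<sigma>0 g \<iota> "- g" 1 "sc g \<eta>0 - \<sigma>0"] unfolding has_bochner_integral_iff H_def by (simp only: minus_minus)
  show ?thesis unfolding s using has_bochner_integral_add[OF 1 2] by simp
qed

lemma K2_snd_ln_fm:
  assumes J: "finite J" "J \<noteq> {}" and e: "0 < e" and v: "0 < v" and A: "finite A" "A \<noteq> {}" "0 < u"
  shows "(\<integral>z. K2 n e J \<iota> v \<eta>0 \<sigma>0 g z * ln (fm n A c u (snd z)) \<partial>LL n) = (\<integral>s. fm n J \<iota> (v + (cmod g)\<^sup>2 * e) (s - \<sigma>0) * ln (fm n A c u s) \<partial>Lam n)"
proof -
  have w: "0 < v + (cmod g)\<^sup>2 * e" using e v by (simp add: add_pos_nonneg)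
  show ?thesis
    using K2_pos[OF J e v, of n \<iota> \<eta>0 \<sigma>0 g]
    by (intro push_integral(2)[OF measurable_snd K2_measurable]) (auto intro!: fm_measurable ln_fm_measurable mv_basic mv_id_minus fm_nonneg w nn_K2_snd[OF J e v] simp: less_imp_le)
qed

text \<open>Raise the noise by an independent \<open>E\<close> of variance \<open>v2 - v1\<close>.
  The pair of \<open>E\<close> and the noisier output has entropy \<open>h(E)\<close> plus the
  entropy at level \<open>v1\<close>. By the Gibbs inequality this is at most the entropy at level
  \<open>v2\<close> plus the Gaussian entropy of the error when \<open>E\<close> is estimated
  linearly from the output.\<close>

lemma H_worst_noise:
  assumes J: "finite J" "J \<noteq> {}" and v: "0 < v1" "v1 \<le> v2" and ep: "0 \<le> \<epsilon>" and pw: "(\<Sum>w\<in>J. nsq n (c w)) \<le> real (card J) * (real n * \<epsilon>)"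
  shows "H n J c v1 - real n * ln (pi * exp 1 * (\<epsilon> + v1)) \<le> H n J c v2 - real n * ln (pi * exp 1 * (\<epsilon> + v2))"
proof (cases "v1 = v2")
  case False
  define d where "d = v2 - v1"
  have d: "0 < d" using False v by (simp add: d_def)
  \<comment> \<open>Coefficient and error variance of the linear estimate of \<open>E\<close> from
    an output of total variance \<epsilon> + \<open>v2\<close>.\<close>
  define \<kappa> \<tau> where "\<kappa> = d / (\<epsilon> + v2)" and "\<tau> = d * (\<epsilon> + v1) / (\<epsilon> + v2)"
  have s2: "0 < \<epsilon> + v2" and s1: "0 < \<epsilon> + v1" and v2: "0 < v2" using ep v by auto
  have \<tau>: "0 < \<tau>" using d s1 s2 by (simp add: \<tau>_def)
  let ?K = "K2 n d J c v1 0 0 1"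
  let ?q = "\<lambda>z. fm n J c v2 (snd z) * gd n \<tau> (sc 1 (fst z) + sc (- of_real \<kappa>) (snd z) + 0)"
  have vd: "v1 + (cmod 1)\<^sup>2 * d = v2" by (simp add: d_def)
  have i1: "integrable (LL n) (\<lambda>z. ?K z * ln (fm n J c v2 (snd z)))"
    using K2_ln_fm[OF J d v(1) J v2, of n c 0 0 1 c 0 1 0] by simp
  have e1: "(\<integral>z. ?K z * ln (fm n J c v2 (snd z)) \<partial>LL n) = - H n J c v2"
    unfolding K2_snd_ln_fm[OF J d v(1) J v2] vd by (simp add: H_def)
  define S where "S = (\<Sum>w\<in>J. nsq n (c w)) / real (card J)"
  have S: "S \<le> real n * \<epsilon>" using pw J by (simp add: S_def pos_divide_le_eq card_gt_0_iff mult.commute)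
  define B where "B = (1 - \<kappa>)\<^sup>2 * real n * d + \<kappa>\<^sup>2 * real n * v1 + \<kappa>\<^sup>2 * S"
  have cm: "(cmod (1 + - complex_of_real \<kappa> * 1))\<^sup>2 = (1 - \<kappa>)\<^sup>2"
    by (metis add_uminus_conv_diff mult_1_right norm_of_real of_real_1 of_real_diff power2_abs)
  have b2: "has_bochner_integral (LL n) (\<lambda>z. ?K z * ln (gd n \<tau> (sc 1 (fst z) + sc (- of_real \<kappa>) (snd z) + 0))) (- (B / \<tau>) - real n * ln (pi * \<tau>))"
    using K2_ln_gd[OF J d v(1) \<tau>, of n c 0 0 1 1 "- of_real \<kappa>" 0]
    unfolding cm by (simp add: B_def S_def sum_distrib_left[symmetric])
  have lnq: "?K z * ln (?q z) = ?K z * ln (fm n J c v2 (snd z)) + ?K z * ln (gd n \<tau> (sc 1 (fst z) + sc (- of_real \<kappa>) (snd z) + 0))" for z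
    using fm_pos[OF J v2, of n c "snd z"] \<tau> by (subst ln_mult_pos) (auto simp: distrib_left)
  have "(\<integral>z. ?K z * ln (?q z) \<partial>LL n) \<le> (\<integral>z. ?K z * ln (?K z) \<partial>LL n)"
  proof (rule gibbs)
    show qm: "?q \<in> borel_measurable (LL n)"
      by (intro borel_measurable_times fm_measurable gd_measurable mvI mv_basic)
    have "(\<integral>\<^sup>+z. ennreal (?q z) \<partial>LL n) = (\<integral>\<^sup>+s. \<integral>\<^sup>+x. ennreal (?q (x, s)) \<partial>Lam n \<partial>Lam n)"
      using qm by (intro nn_LL') simp
    also have "\<dots> = (\<integral>\<^sup>+s. ennreal (fm n J c v2 s) * (\<integral>\<^sup>+x. ennreal (gd n \<tau> (x - sc (of_real \<kappa>) s)) \<partial>Lam n) \<partial>Lam n)"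
    proof (intro nn_integral_cong)
      fix s
      have "ennreal (?q (x, s)) = ennreal (fm n J c v2 s) * ennreal (gd n \<tau> (x - sc (of_real \<kappa>) s))" for x
        using fm_nonneg[OF v2, of n J c s] gd_cong[of n "sc 1 x + sc (- of_real \<kappa>) s + 0" "x - sc (of_real \<kappa>) s" \<tau>] \<tau>
        by (simp add: ennreal_mult)
      then show "(\<integral>\<^sup>+x. ennreal (?q (x, s)) \<partial>Lam n) = ennreal (fm n J c v2 s) * (\<integral>\<^sup>+x. ennreal (gd n \<tau> (x - sc (of_real \<kappa>) s)) \<partial>Lam n)"
        by (simp only:) (intro nn_integral_cmult gd_measurable_ennreal mv_id_minus)
    qed
    also have "\<dots> = 1" using nn_integral_fm[OF J v2, of n c 0] by (simp add: nn_integral_gd[OF \<tau>])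
    finally show "(\<integral>\<^sup>+z. ennreal (?q z) \<partial>LL n) \<le> 1" by simp
    show "integrable (LL n) (\<lambda>z. ?K z * ln (?q z))"
      unfolding lnq using i1 b2 by (auto simp: has_bochner_integral_iff)
  qed (use K2_pos[OF J d v(1), of n c 0 0 1] K2_bi[OF J d v(1), of n c 0 0 1] K2_ent[OF J d v(1), of n c 0 0 1] fm_pos[OF J v2, of n c] \<tau> in \<open>auto simp: has_bochner_integral_iff\<close>)
  moreover have "(\<integral>z. ?K z * ln (?q z) \<partial>LL n) = - H n J c v2 + (- (B / \<tau>) - real n * ln (pi * \<tau>))"
    unfolding lnq e1[symmetric] has_bochner_integral_integral_eq[OF b2, symmetric]
    using i1 b2 by (intro Bochner_Integration.integral_add) (simp_all only: has_bochner_integral_iff)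
  ultimately have "- H n J c v2 + (- (B / \<tau>) - real n * ln (pi * \<tau>)) \<le> - real n * ln (pi * exp 1 * d) - H n J c v1"
    using has_bochner_integral_integral_eq[OF K2_ent[OF J d v(1), of n c 0 0 1]] by linarith
  moreover have "B / \<tau> \<le> real n"
  proof -
    have k1: "1 - \<kappa> = (\<epsilon> + v1) / (\<epsilon> + v2)" using s2 by (simp add: \<kappa>_def d_def field_simps)
    have "B \<le> (1 - \<kappa>)\<^sup>2 * real n * d + \<kappa>\<^sup>2 * real n * v1 + \<kappa>\<^sup>2 * (real n * \<epsilon>)"
      using S by (simp add: B_def mult_left_mono)
    also have "\<dots> = real n * ((1 - \<kappa>)\<^sup>2 * d + \<kappa>\<^sup>2 * (\<epsilon> + v1))" by (simp add: algebra_simps)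
    also have "(1 - \<kappa>)\<^sup>2 * d + \<kappa>\<^sup>2 * (\<epsilon> + v1) = \<tau>"
    proof -
      have "(1 - \<kappa>)\<^sup>2 * d + \<kappa>\<^sup>2 * (\<epsilon> + v1) = (\<epsilon> + v1) * d * ((\<epsilon> + v1) + d) / (\<epsilon> + v2)\<^sup>2"
      proof -
        have "(a / s)\<^sup>2 * d + (d / s)\<^sup>2 * a = a * d * (a + d) / s\<^sup>2" for a s :: real
          by (simp add: power_divide add_divide_distrib[symmetric]) (simp add: power2_eq_square algebra_simps)
        from this[of "\<epsilon> + v1" "\<epsilon> + v2"] show ?thesis by (simp only: k1) (simp only: \<kappa>_def)
      qed
      also have "(\<epsilon> + v1) + d = \<epsilon> + v2" by (simp add: d_def)
      finally show ?thesis using s2 by (simp add: \<tau>_def power2_eq_square)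
    qed
    finally show ?thesis using \<tau> by (simp add: pos_divide_le_eq)
  qed
  moreover have "real n * ln (pi * exp 1 * d) + real n * ln (pi * exp 1 * (\<epsilon> + v1)) = real n * ln (pi * \<tau>) + real n + real n * ln (pi * exp 1 * (\<epsilon> + v2))"
  proof -
    have "ln (pi * \<tau>) = ln (pi * d) + ln (\<epsilon> + v1) - ln (\<epsilon> + v2)"
      using d s1 s2 by (simp add: \<tau>_def ln_mult ln_div)
    moreover have "ln (pi * exp 1 * (\<epsilon> + v1)) = ln (\<epsilon> + v1) + ln pi + 1" "ln (pi * exp 1 * (\<epsilon> + v2)) = ln (\<epsilon> + v2) + ln pi + 1"
      using s1 s2 by (simp_all add: ln_mult)
    ultimately have "ln (pi * exp 1 * d) + ln (pi * exp 1 * (\<epsilon> + v1)) = ln (pi * \<tau>) + 1 + ln (pi * exp 1 * (\<epsilon> + v2))"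
      using ln_pie[OF d] by simp
    then have "real n * (ln (pi * exp 1 * d) + ln (pi * exp 1 * (\<epsilon> + v1))) = real n * (ln (pi * \<tau>) + 1 + ln (pi * exp 1 * (\<epsilon> + v2)))" by (simp only:)
    then show ?thesis by (simp only: distrib_left mult_1_right)
  qed
  ultimately show ?thesis by linarith
qed simp

section \<open>Fano bounds\<close>

text \<open>A relative entropy form of Fano's inequality. Here \<open>a\<close> is the message to be
  decoded, \<open>c\<close> is data known to the decoder, and \<open>q c\<close> is any output
  density that does not depend on \<open>a\<close>. The proof applies the Gibbs argument to
  \<open>q c\<close> tilted towards the region decoded as \<open>a\<close>, so neither conditional
  entropies nor posteriors are needed.\<close>

lemma fano:
  fixes p :: "nat \<Rightarrow> 'c \<Rightarrow> 'z \<Rightarrow> real" and q :: "'c \<Rightarrow> 'z \<Rightarrow> real" and \<psi> :: "'c \<Rightarrow> 'z \<Rightarrow> nat"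
  assumes C: "finite C" "C \<noteq> {}" and Mx: "1 \<le> Mx"
    and p0: "\<And>a c z. 0 < p a c z" and q0: "\<And>c z. 0 < q c z"
    and p1: "\<And>a c. has_bochner_integral M (p a c) 1"
    and qm: "\<And>c. q c \<in> borel_measurable M" and q1: "\<And>c. (\<integral>\<^sup>+z. ennreal (q c z) \<partial>M) \<le> 1"
    and \<psi>: "\<And>c. \<psi> c \<in> measurable M (count_space UNIV)"
    and i1: "\<And>a c. integrable M (\<lambda>z. p a c z * ln (p a c z))" and i2: "\<And>a c. integrable M (\<lambda>z. p a c z * ln (q c z))"
    and S: "(1 - e) * (real Mx * real (card C)) \<le> (\<Sum>a<Mx. \<Sum>c\<in>C. \<integral>z. p a c z * indicator {z. \<psi> c z = a} z \<partial>M)"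
  shows "(1 - e) * ln (real Mx) - ln 2 \<le> (\<Sum>a<Mx. \<Sum>c\<in>C. (\<integral>z. p a c z * ln (p a c z) \<partial>M) - (\<integral>z. p a c z * ln (q c z) \<partial>M)) / (real Mx * real (card C))"
proof -
  have indm: "(\<lambda>z. indicator {z. \<psi> c z = a} z :: real) \<in> borel_measurable M" for a c
  proof -
    have "(\<lambda>z. (if \<psi> c z = a then 1 else 0 :: real)) \<in> borel_measurable M"
      by (rule measurable_compose[OF \<psi>[of c], of "\<lambda>i. if i = a then 1 else 0"]) simp
    then show ?thesis by (simp add: indicator_def of_bool_def cong: if_cong)
  qed
  have iq: "integrable M (q c)" for c using q1[of c] q0 qm
    by (intro integrableI_nonneg) (auto simp: less_imp_le intro: le_less_trans)
  have q1': "(\<integral>z. q c z \<partial>M) \<le> 1" for c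
  proof -
    have "ennreal (\<integral>z. q c z \<partial>M) \<le> 1" using q1[of c]
      by (subst nn_integral_eq_integral[symmetric, OF iq]) (auto simp: q0 less_imp_le)
    then show ?thesis by (simp add: ennreal_le_1)
  qed
  have ind_int: "integrable M (\<lambda>z. f z * indicator {z. \<psi> c z = a} z)" if "integrable M f" for f :: "'z \<Rightarrow> real" and a c
    using that indm by (intro Bochner_Integration.integrable_bound[OF that]) (auto simp: indicator_def)
  define Sa where "Sa a c = (\<integral>z. p a c z * indicator {z. \<psi> c z = a} z \<partial>M)" for a c
  define Qa where "Qa a c = (\<integral>z. q c z * indicator {z. \<psi> c z = a} z \<partial>M)" for a c
  define P Q where "P a c = (\<integral>z. p a c z * ln (p a c z) \<partial>M)" and "Q a c = (\<integral>z. p a c z * ln (q c z) \<partial>M)" for a c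
  have one: "Q a c + ln (real Mx) * Sa a c - ln 2 - P a c \<le> (1/2) * (\<integral>z. q c z \<partial>M) + real Mx / 2 * Qa a c - 1" for a c
  proof -
    let ?I = "indicator {z. \<psi> c z = a} :: 'z \<Rightarrow> real"
    have pt: "p a c z * ln (q c z) + ln (real Mx) * (p a c z * ?I z) - ln 2 * p a c z - p a c z * ln (p a c z)
       \<le> (1/2) * q c z + real Mx / 2 * (q c z * ?I z) - p a c z" for z
    proof -
      \<comment> \<open>The half with weight 1/2 keeps the tilted density within a factor 2 of
        \<open>q\<close>, which costs the term \<open>ln 2\<close>; the other half gains
        \<open>ln Mx\<close> where the decision is right.\<close>
      define s where "s = q c z * (1/2 + real Mx / 2 * ?I z)"
      have r: "0 < 1/2 + real Mx / 2 * ?I z" using Mx by (auto simp: indicator_def)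
      have s0: "0 < s" using r q0 by (simp add: s_def)
      have "ln (real Mx) * ?I z - ln 2 \<le> ln (1/2 + real Mx / 2 * ?I z)"
      proof (cases "\<psi> c z = a")
        case True
        have "ln (real Mx / 2) \<le> ln (1/2 + real Mx / 2)" using Mx by simp
        then show ?thesis using True Mx by (simp add: ln_div)
      qed (simp add: ln_div)
      then have "ln (q c z) + (ln (real Mx) * ?I z - ln 2) \<le> ln s"
        using r q0[of c z] by (simp add: s_def ln_mult)
      then have 1: "p a c z * (ln (q c z) + (ln (real Mx) * ?I z - ln 2)) \<le> p a c z * ln s"
        using p0[of a c z] by (intro mult_left_mono) auto
      have "ln (s / p a c z) \<le> s / p a c z - 1" using s0 p0 by (intro ln_le_minus_one) simp
      then have "p a c z * ln (s / p a c z) \<le> p a c z * (s / p a c z - 1)" using p0[of a c z] by (intro mult_left_mono) auto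
      then have "p a c z * ln s - p a c z * ln (p a c z) \<le> s - p a c z" using p0[of a c z] s0 by (simp add: ln_div algebra_simps)
      with 1 show ?thesis by (simp add: s_def algebra_simps)
    qed
    have ip: "integrable M (p a c)" "(\<integral>z. p a c z \<partial>M) = 1" using p1 by (auto simp: has_bochner_integral_iff)
    have "(\<integral>z. p a c z * ln (q c z) + ln (real Mx) * (p a c z * ?I z) - ln 2 * p a c z - p a c z * ln (p a c z) \<partial>M)
       \<le> (\<integral>z. (1/2) * q c z + real Mx / 2 * (q c z * ?I z) - p a c z \<partial>M)"
      using pt i1 i2 iq ip ind_int[OF ip(1)] ind_int[OF iq] by (intro integral_mono) auto
    also have "(\<integral>z. p a c z * ln (q c z) + ln (real Mx) * (p a c z * ?I z) - ln 2 * p a c z - p a c z * ln (p a c z) \<partial>M) = Q a c + ln (real Mx) * Sa a c - ln 2 * 1 - P a c"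
      unfolding Q_def Sa_def P_def ip(2)[symmetric] using i1 i2 ip ind_int[OF ip(1)] by simp
    also have "(\<integral>z. (1/2) * q c z + real Mx / 2 * (q c z * ?I z) - p a c z \<partial>M) = (1/2) * (\<integral>z. q c z \<partial>M) + real Mx / 2 * Qa a c - 1"
      unfolding Qa_def ip(2)[symmetric] using iq ip ind_int[OF iq] by simp
    finally show ?thesis by simp
  qed
  \<comment> \<open>The decision regions are disjoint, so the tilted densities have total mass at
    most \<open>Mx\<close> when summed over all messages.\<close>
  have Qs: "(\<Sum>a<Mx. Qa a c) \<le> 1" for c
  proof -
    have "(\<Sum>a<Mx. Qa a c) = (\<integral>z. (\<Sum>a<Mx. q c z * indicator {z. \<psi> c z = a} z) \<partial>M)"
      unfolding Qa_def using ind_int[OF iq] by (subst Bochner_Integration.integral_sum) auto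
    also have "\<dots> \<le> (\<integral>z. q c z \<partial>M)"
    proof (rule integral_mono)
      show "integrable M (\<lambda>z. \<Sum>a<Mx. q c z * indicator {z. \<psi> c z = a} z)" by (intro Bochner_Integration.integrable_sum ind_int iq)
      fix z
      have "(\<Sum>a<Mx. q c z * indicator {z. \<psi> c z = a} z) = (\<Sum>a<Mx. if a = \<psi> c z then q c z else 0)"
        by (intro sum.cong) (auto simp: indicator_def)
      also have "\<dots> \<le> q c z" using q0[of c z] by (auto simp: sum.delta)
      finally show "(\<Sum>a<Mx. q c z * indicator {z. \<psi> c z = a} z) \<le> q c z" .
    qed (rule iq)
    finally show ?thesis using q1'[of c] by linarith
  qed
  have rhs: "(\<Sum>a<Mx. (1/2) * (\<integral>z. q c z \<partial>M) + real Mx / 2 * Qa a c - 1) \<le> 0" for c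
  proof -
    have "(\<Sum>a<Mx. (1/2) * (\<integral>z. q c z \<partial>M) + real Mx / 2 * Qa a c - 1) = real Mx * ((1/2) * (\<integral>z. q c z \<partial>M)) + real Mx / 2 * (\<Sum>a<Mx. Qa a c) - real Mx"
      by (simp add: sum.distrib sum_subtractf sum_distrib_left)
    also have "\<dots> \<le> real Mx * ((1/2) * 1) + real Mx / 2 * 1 - real Mx"
      using q1'[of c] Qs[of c] by (intro diff_right_mono add_mono mult_left_mono) auto
    finally show ?thesis by simp
  qed
  define T where "T = real Mx * real (card C)"
  have Tpos: "0 < T" using Mx C by (simp add: T_def card_gt_0_iff)
  have "(\<Sum>a<Mx. \<Sum>c\<in>C. Q a c + ln (real Mx) * Sa a c - ln 2 - P a c) \<le> (\<Sum>a<Mx. \<Sum>c\<in>C. (1/2) * (\<integral>z. q c z \<partial>M) + real Mx / 2 * Qa a c - 1)"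
    by (intro sum_mono one)
  also have "\<dots> \<le> 0" by (subst sum.swap) (intro sum_nonpos rhs)
  finally have "ln (real Mx) * (\<Sum>a<Mx. \<Sum>c\<in>C. Sa a c) - T * ln 2 \<le> (\<Sum>a<Mx. \<Sum>c\<in>C. P a c - Q a c)"
    by (simp add: sum.distrib sum_subtractf sum_distrib_left T_def)
  moreover have "ln (real Mx) * ((1 - e) * T) \<le> ln (real Mx) * (\<Sum>a<Mx. \<Sum>c\<in>C. Sa a c)"
    using S Mx by (intro mult_left_mono) (auto simp: Sa_def T_def)
  ultimately have "((1 - e) * ln (real Mx) - ln 2) * T \<le> (\<Sum>a<Mx. \<Sum>c\<in>C. P a c - Q a c)" by (simp add: algebra_simps)
  then show ?thesis using Tpos by (simp add: pos_le_divide_eq P_def Q_def T_def)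
qed

text \<open>With a centred codebook mixed terms between different users average to 0, so that powers
  of interfering codewords add. \<open>code_reduction\<close> provides centred codebooks for every
  code.\<close>

definition zm :: "nat \<Rightarrow> 'w set \<Rightarrow> ('w \<Rightarrow> nat \<Rightarrow> complex) \<Rightarrow> bool" where
  "zm n A x \<longleftrightarrow> (\<forall>t<n. (\<Sum>a\<in>A. x a t) = 0)"

lemma zm_ip: assumes "zm n A x" shows "(\<Sum>a\<in>A. ip n m (sc k (x a))) = 0"
proof -
  have "(\<Sum>a\<in>A. ip n m (sc k (x a))) = (\<Sum>t<n. Re (m t * cnj (k * (\<Sum>a\<in>A. x a t))))"
    unfolding ip_def by (subst sum.swap) (simp only: sum_distrib_left cnj_sum Re_sum sc_apply)
  also have "\<dots> = 0" using assms by (intro sum.neutral) (auto simp: zm_def)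
  finally show ?thesis .
qed

lemma zm_nsq: assumes "zm n A x"
  shows "(\<Sum>a\<in>A. nsq n (m + sc k (x a))) = real (card A) * nsq n m + (cmod k)\<^sup>2 * (\<Sum>a\<in>A. nsq n (x a))"
  by (simp add: nsq_add sum.distrib zm_ip[OF assms] sum_distrib_left[symmetric])

definition pwr :: "nat \<Rightarrow> 'w set \<Rightarrow> ('w \<Rightarrow> nat \<Rightarrow> complex) \<Rightarrow> real \<Rightarrow> bool" where
  "pwr n A x P \<longleftrightarrow> finite A \<and> A \<noteq> {} \<and> zm n A x \<and> 0 \<le> P \<and> (\<Sum>a\<in>A. nsq n (x a)) \<le> real (card A) * (real n * P)"

lemma pwr_pair:
  assumes A: "pwr n A x P" and B: "pwr n B y R"
  shows "pwr n (A \<times> B) (\<lambda>(a, b). sc j (x a) + sc k (y b)) ((cmod j)\<^sup>2 * P + (cmod k)\<^sup>2 * R)"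
    and "(\<Sum>a\<in>A. \<Sum>b\<in>B. nsq n (sc j (x a) + sc k (y b))) \<le> real (card A) * real (card B) * (real n * ((cmod j)\<^sup>2 * P + (cmod k)\<^sup>2 * R))"
proof -
  have "(\<Sum>a\<in>A. \<Sum>b\<in>B. nsq n (sc j (x a) + sc k (y b))) = (cmod j)\<^sup>2 * (real (card B) * (\<Sum>a\<in>A. nsq n (x a))) + (cmod k)\<^sup>2 * (real (card A) * (\<Sum>b\<in>B. nsq n (y b)))"
    using B by (simp add: pwr_def zm_nsq sum.distrib sum_distrib_left mult_ac)
  also have "\<dots> \<le> (cmod j)\<^sup>2 * (real (card B) * (real (card A) * (real n * P))) + (cmod k)\<^sup>2 * (real (card A) * (real (card B) * (real n * R)))"
    using A B by (intro add_mono mult_left_mono) (auto simp: pwr_def)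
  finally show s: "(\<Sum>a\<in>A. \<Sum>b\<in>B. nsq n (sc j (x a) + sc k (y b))) \<le> real (card A) * real (card B) * (real n * ((cmod j)\<^sup>2 * P + (cmod k)\<^sup>2 * R))"
    by (simp add: algebra_simps)
  have z: "zm n (A \<times> B) (\<lambda>(a, b). sc j (x a) + sc k (y b))"
    unfolding zm_def
  proof (intro allI impI)
    fix t assume t: "t < n"
    have "(\<Sum>p\<in>A \<times> B. (case p of (a, b) \<Rightarrow> sc j (x a) + sc k (y b)) t) = (\<Sum>a\<in>A. \<Sum>b\<in>B. j * x a t + k * y b t)"
      by (simp add: sum.cartesian_product split_beta')
    also have "\<dots> = (\<Sum>a\<in>A. of_nat (card B) * (j * x a t) + k * (\<Sum>b\<in>B. y b t))"
      by (simp add: sum.distrib sum_distrib_left)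
    also have "\<dots> = of_nat (card B) * j * (\<Sum>a\<in>A. x a t)"
      using B t by (simp add: pwr_def zm_def sum_distrib_left mult.assoc)
    also have "\<dots> = 0" using A t by (simp add: pwr_def zm_def)
    finally show "(\<Sum>p\<in>A \<times> B. (case p of (a, b) \<Rightarrow> sc j (x a) + sc k (y b)) t) = 0" .
  qed
  show "pwr n (A \<times> B) (\<lambda>(a, b). sc j (x a) + sc k (y b)) ((cmod j)\<^sup>2 * P + (cmod k)\<^sup>2 * R)"
    using A B z s by (auto simp: pwr_def sum.cartesian_product split_beta' card_cartesian_product)
qed

definition Dd :: "nat \<Rightarrow> 'w set \<Rightarrow> ('w \<Rightarrow> nat \<Rightarrow> complex) \<Rightarrow> real \<Rightarrow> real \<Rightarrow> real" where
  "Dd n J c v \<epsilon> = real n * ln (pi * exp 1 * (\<epsilon> + v)) - H n J c v"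

lemma Dd_nonneg: "pwr n J c \<epsilon> \<Longrightarrow> 0 < v \<Longrightarrow> 0 \<le> Dd n J c v \<epsilon>"
  using H_le[of J v \<epsilon> n c] by (simp add: Dd_def pwr_def)

lemma Dd_mono: "pwr n J c \<epsilon> \<Longrightarrow> 0 < v1 \<Longrightarrow> v1 \<le> v2 \<Longrightarrow> Dd n J c v2 \<epsilon> \<le> Dd n J c v1 \<epsilon>"
  using H_worst_noise[of J v1 v2 \<epsilon> n c] by (simp add: Dd_def pwr_def)

lemma Dd_zero: assumes "pwr n J c 0" "0 < v" shows "Dd n J c v 0 = 0"
proof -
  have "(\<Sum>w\<in>J. nsq n (c w)) \<le> 0" using assms by (simp add: pwr_def)
  then have "(\<Sum>w\<in>J. nsq n (c w)) = 0" using sum_nonneg[of J "\<lambda>w. nsq n (c w)"] by simp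
  then have "nsq n (c w) = 0" if "w \<in> J" for w using assms that by (subst (asm) sum_nonneg_eq_0_iff) (auto simp: pwr_def)
  then show ?thesis using H_zero[of J v n c] assms by (simp add: Dd_def pwr_def)
qed

text \<open>Both entropies in the gap gain the same logarithm of the Jacobian. This moves gaps
  between the noise level of a signal and that of its scaled version at another receiver.\<close>

lemma Dd_scale: assumes "finite J" "J \<noteq> {}" "0 < v" "k \<noteq> 0" "0 \<le> \<epsilon>"
  shows "Dd n J (\<lambda>w. sc k (c w)) ((cmod k)\<^sup>2 * v) ((cmod k)\<^sup>2 * \<epsilon>) = Dd n J c v \<epsilon>"
proof -
  have e: "(cmod k)\<^sup>2 * \<epsilon> + (cmod k)\<^sup>2 * v = (cmod k)\<^sup>2 * (\<epsilon> + v)" by (simp only: distrib_left)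
  have "ln (pi * exp 1 * ((cmod k)\<^sup>2 * (\<epsilon> + v))) = ln ((cmod k)\<^sup>2) + ln (pi * exp 1 * (\<epsilon> + v))"
    using assms by (simp add: ln_mult)
  then show ?thesis unfolding Dd_def e H_scale[OF assms(1-4)] by (simp only: distrib_left)
qed

lemma H_cong: "(\<And>w t. w \<in> J \<Longrightarrow> t < n \<Longrightarrow> c w t = c' w t) \<Longrightarrow> H n J c v = H n J c' v"
proof -
  assume a: "\<And>w t. w \<in> J \<Longrightarrow> t < n \<Longrightarrow> c w t = c' w t"
  have "fm n J c v = fm n J c' v"
    unfolding fm_def by (intro ext arg_cong2[where f="(/)"] sum.cong gd_cong) (auto simp: a)
  then show ?thesis by (simp add: H_def)
qed

lemma pwr_zero: assumes "pwr n A x 0" "a \<in> A" "t < n" shows "x a t = 0"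
proof -
  have "(\<Sum>w\<in>A. nsq n (x w)) \<le> 0" using assms by (simp add: pwr_def)
  then have "(\<Sum>w\<in>A. nsq n (x w)) = 0" using sum_nonneg[of A "\<lambda>w. nsq n (x w)"] by simp
  then have "nsq n (x a) = 0" using assms by (subst (asm) sum_nonneg_eq_0_iff) (auto simp: pwr_def)
  then show ?thesis using assms(3) by (auto simp: nsq_def sum_nonneg_eq_0_iff)
qed

lemma gd_bi_shift: "0 < v \<Longrightarrow> has_bochner_integral (Lam n) (\<lambda>y. gd n v (y - m)) 1"
  using nn_integral_gd[of v n m] gd_measurable[OF mv_id_minus(1), of n v m]
  by (intro has_bochner_integral_nn_integral) (auto simp: less_imp_le)

lemma fm_bi_shift: assumes "finite J" "J \<noteq> {}" "0 < v" shows "has_bochner_integral (Lam n) (\<lambda>y. fm n J c v (y - m)) 1"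
  unfolding fm_shift using fm_bi[OF assms] by blast

lemma ind_measurable:
  assumes "\<psi> \<in> measurable M (count_space UNIV)"
  shows "(\<lambda>z. indicator {z. \<psi> z = a} z :: real) \<in> borel_measurable M"
proof -
  have "(\<lambda>z. (if \<psi> z = a then 1 else 0 :: real)) \<in> borel_measurable M"
    by (rule measurable_compose[OF assms, of "\<lambda>i. if i = a then 1 else 0"]) simp
  then show ?thesis by (simp add: indicator_def of_bool_def cong: if_cong)
qed

lemma gd_ind_integrable:
  assumes v: "0 < v" and \<psi>: "\<psi> \<in> measurable (Lam n) (count_space UNIV)"
  shows "integrable (Lam n) (\<lambda>y. gd n v (y - m) * indicator {y. \<psi> y = a} y)"
proof (rule Bochner_Integration.integrable_bound)
  show "integrable (Lam n) (\<lambda>y. gd n v (y - m))" using gd_bi_shift[OF v] by (simp add: has_bochner_integral_iff)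
  show "(\<lambda>y. gd n v (y - m) * indicator {y. \<psi> y = a} y) \<in> borel_measurable (Lam n)"
    by (intro borel_measurable_times gd_measurable mv_id_minus ind_measurable[OF \<psi>])
qed (auto simp: indicator_def)

text \<open>\<open>1 - e\<close> bounds the success probability from below, averaged over the own
  message and over the interference indices; the receiver noise is normalised to variance 1.\<close>

definition succ :: "nat \<Rightarrow> nat \<Rightarrow> (nat \<Rightarrow> nat \<Rightarrow> complex) \<Rightarrow> 'w set \<Rightarrow> ('w \<Rightarrow> nat \<Rightarrow> complex) \<Rightarrow> ((nat \<Rightarrow> complex) \<Rightarrow> nat) \<Rightarrow> real \<Rightarrow> bool" where
  "succ n Ma x J \<iota> \<psi> e \<longleftrightarrow> \<psi> \<in> measurable (Lam n) (count_space UNIV) \<and>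
     (1 - e) * (real Ma * real (card J)) \<le> (\<Sum>a<Ma. \<Sum>b\<in>J. \<integral>y. gd n 1 (y - (x a + \<iota> b)) * indicator {y. \<psi> y = a} y \<partial>Lam n)"

lemma fm_ind:
  assumes v: "0 < v" and \<psi>: "\<psi> \<in> measurable (Lam n) (count_space UNIV)"
  shows "(\<integral>y. fm n J \<iota> v (y - m) * indicator {y. \<psi> y = a} y \<partial>Lam n) = (\<Sum>b\<in>J. \<integral>y. gd n v (y - (m + \<iota> b)) * indicator {y. \<psi> y = a} y \<partial>Lam n) / real (card J)"
proof -
  have "fm n J \<iota> v (y - m) * indicator {y. \<psi> y = a} y = (\<Sum>b\<in>J. gd n v (y - (m + \<iota> b)) * indicator {y. \<psi> y = a} y) / real (card J)" for y
    unfolding fm_def by (simp add: sum_distrib_right diff_diff_eq)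
  then show ?thesis using gd_ind_integrable[OF assms] by (simp add: Bochner_Integration.integral_sum)
qed

lemma fm_pair:
  assumes "finite A" "finite B"
  shows "(\<Sum>a\<in>A. fm n B c v (y - d a)) = real (card A) * fm n (A \<times> B) (\<lambda>(a, b). d a + c b) v y"
proof (cases "A = {} \<or> B = {}")
  case False
  have "fm n (A \<times> B) (\<lambda>(a, b). d a + c b) v y = (\<Sum>a\<in>A. \<Sum>b\<in>B. gd n v (y - (d a + c b))) / (real (card A) * real (card B))"
    unfolding fm_def by (simp add: sum.cartesian_product split_beta' card_cartesian_product)
  moreover have "(\<Sum>a\<in>A. fm n B c v (y - d a)) = (\<Sum>a\<in>A. \<Sum>b\<in>B. gd n v (y - (d a + c b))) / real (card B)"
    unfolding fm_def by (simp add: sum_divide_distrib[symmetric] diff_diff_eq)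
  moreover have "real (card A) \<noteq> 0" using False assms by simp
  ultimately show ?thesis by simp
qed (auto simp: fm_def)

text \<open>Interference is split into a part \<beta> unknown to the receiver and an offset
  \<open>d c\<close> that it knows. With \<open>q c\<close> the exact output law for known
  \<open>c\<close>, both entropies are invariant under the offset and the relative entropy becomes a
  difference of two mixture entropies.\<close>

lemma fano_1d:
  fixes \<eta> :: "nat \<Rightarrow> 'c \<Rightarrow> nat \<Rightarrow> complex"
  assumes C: "finite C" "C \<noteq> {}" and Ma: "1 \<le> Ma" and B: "finite B" "B \<noteq> {}" and \<psi>: "\<psi> \<in> measurable (Lam n) (count_space UNIV)"
    and S: "(1 - e) * (real Ma * (real (card B) * real (card C))) \<le> (\<Sum>a<Ma. \<Sum>c\<in>C. \<Sum>b\<in>B. \<integral>y. gd n 1 (y - ((x a + d c) + \<beta> b)) * indicator {y. \<psi> y = a} y \<partial>Lam n)"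
  shows "(1 - e) * ln (real Ma) - ln 2 \<le> H n ({..<Ma} \<times> B) (\<lambda>(a, b). x a + \<beta> b) 1 - H n B \<beta> 1"
proof -
  have c0: "0 < real (card B)" "0 < real (card C)" using B C by (auto simp: card_gt_0_iff)
  let ?f = "fm n ({..<Ma} \<times> B) (\<lambda>(a, b). x a + \<beta> b) 1"
  have AB: "finite ({..<Ma} \<times> B)" "{..<Ma} \<times> B \<noteq> {}" using B Ma by (auto simp: lessThan_empty_iff)
  let ?p = "\<lambda>a c y. fm n B \<beta> 1 (y - (x a + d c))" and ?q = "\<lambda>c y. ?f (y - d c)"
  have i2: "integrable (Lam n) (\<lambda>y. ?p a c y * ln (?q c y))" for a c
  proof -
    obtain D where D: "0 \<le> D" "\<And>y. \<bar>ln (fm n ({..<Ma} \<times> B) (\<lambda>w. (case w of (a, b) \<Rightarrow> x a + \<beta> b) + d c) 1 y)\<bar> \<le> D * (1 + nsq n y)"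
      using ln_fm_bound[OF AB zero_less_one] by blast
    show ?thesis unfolding fm_shift using D
      by (intro integrable_fm_qb[OF B zero_less_one, where C=D] ln_fm_measurable mv_basic) auto
  qed
  have "(1 - e) * real Ma * real (card C) * real (card B) \<le> (\<Sum>a<Ma. \<Sum>c\<in>C. \<Sum>b\<in>B. \<integral>y. gd n 1 (y - ((x a + d c) + \<beta> b)) * indicator {y. \<psi> y = a} y \<partial>Lam n)"
    using S by (simp add: mult_ac)
  then have "(1 - e) * real Ma * real (card C) \<le> (\<Sum>a<Ma. \<Sum>c\<in>C. \<Sum>b\<in>B. \<integral>y. gd n 1 (y - ((x a + d c) + \<beta> b)) * indicator {y. \<psi> y = a} y \<partial>Lam n) / real (card B)"
    using c0 by (simp only: pos_le_divide_eq)
  then have S': "(1 - e) * (real Ma * real (card C)) \<le> (\<Sum>a<Ma. \<Sum>c\<in>C. \<integral>z. ?p a c z * indicator {z. \<psi> z = a} z \<partial>Lam n)"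
    by (simp only: fm_ind[OF zero_less_one \<psi>] sum_divide_distrib mult.assoc)
  have "(1 - e) * ln (real Ma) - ln 2 \<le> (\<Sum>a<Ma. \<Sum>c\<in>C. (\<integral>z. ?p a c z * ln (?p a c z) \<partial>Lam n) - (\<integral>z. ?p a c z * ln (?q c z) \<partial>Lam n)) / (real Ma * real (card C))"
  proof (rule fano[OF C Ma])
    show "\<And>c. ?q c \<in> borel_measurable (Lam n)" by (intro fm_measurable mvI mv_basic)
    show "\<And>c. (\<integral>\<^sup>+z. ennreal (?q c z) \<partial>Lam n) \<le> 1" using nn_integral_fm[OF AB, of 1 n] by simp
    show "(1 - e) * (real Ma * real (card C)) \<le> (\<Sum>a<Ma. \<Sum>c\<in>C. \<integral>z. ?p a c z * indicator {z. \<psi> z = a} z \<partial>Lam n)" by (rule S')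
    show "\<And>a c. integrable (Lam n) (\<lambda>z. ?p a c z * ln (?p a c z))"
      using integral_H_shift[OF B zero_less_one, of n \<beta>] unfolding has_bochner_integral_iff by blast
  qed (use fm_pos[OF B, of 1 n \<beta>] fm_pos[OF AB, of 1 n] fm_bi_shift[OF B, of 1 n \<beta>] i2 \<psi> in auto)
  also have "(\<Sum>a<Ma. \<Sum>c\<in>C. (\<integral>z. ?p a c z * ln (?p a c z) \<partial>Lam n) - (\<integral>z. ?p a c z * ln (?q c z) \<partial>Lam n)) = - (real Ma * real (card C)) * H n B \<beta> 1 - (\<Sum>c\<in>C. \<Sum>a<Ma. \<integral>z. ?p a c z * ln (?q c z) \<partial>Lam n)"
  proof -
    have h: "(\<integral>z. ?p a c z * ln (?p a c z) \<partial>Lam n) = - H n B \<beta> 1" for a c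
      by (rule has_bochner_integral_integral_eq[OF integral_H_shift[OF B zero_less_one]])
    show ?thesis unfolding h by (simp add: sum_subtractf sum.swap[of _ C])
  qed
  also have "(\<Sum>c\<in>C. \<Sum>a<Ma. \<integral>z. ?p a c z * ln (?q c z) \<partial>Lam n) = (\<Sum>c\<in>C. - real Ma * H n ({..<Ma} \<times> B) (\<lambda>(a, b). x a + \<beta> b) 1)"
  proof (intro sum.cong refl)
    fix c
    have "(\<Sum>a<Ma. \<integral>z. ?p a c z * ln (?q c z) \<partial>Lam n) = (\<integral>z. (\<Sum>a<Ma. ?p a c z * ln (?q c z)) \<partial>Lam n)"
      using i2 by (simp add: Bochner_Integration.integral_sum)
    also have "\<dots> = (\<integral>z. real Ma * (?f (z - d c) * ln (?f (z - d c))) \<partial>Lam n)"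
    proof (intro Bochner_Integration.integral_cong refl)
      fix z
      have "(\<Sum>a<Ma. ?p a c z) = (\<Sum>a<Ma. fm n B \<beta> 1 ((z - d c) - x a))" by (simp add: diff_diff_eq add.commute)
      also have "\<dots> = real Ma * ?f (z - d c)" using B by (subst fm_pair) simp_all
      finally show "(\<Sum>a<Ma. ?p a c z * ln (?q c z)) = real Ma * (?f (z - d c) * ln (?f (z - d c)))"
        by (simp only: sum_distrib_right[symmetric] mult.assoc)
    qed
    also have "\<dots> = - real Ma * H n ({..<Ma} \<times> B) (\<lambda>(a, b). x a + \<beta> b) 1"
      using has_bochner_integral_integral_eq[OF integral_H_shift[OF AB zero_less_one, of n "\<lambda>(a, b). x a + \<beta> b" "d c"]] by simp
    finally show "(\<Sum>a<Ma. \<integral>z. ?p a c z * ln (?q c z) \<partial>Lam n) = - real Ma * H n ({..<Ma} \<times> B) (\<lambda>(a, b). x a + \<beta> b) 1" .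
  qed
  also have "(- (real Ma * real (card C)) * H n B \<beta> 1 - (\<Sum>c\<in>C. - real Ma * H n ({..<Ma} \<times> B) (\<lambda>(a, b). x a + \<beta> b) 1))
     = (real Ma * real (card C)) * (H n ({..<Ma} \<times> B) (\<lambda>(a, b). x a + \<beta> b) 1 - H n B \<beta> 1)"
    by (simp only: sum_constant right_diff_distrib) simp
  also have "\<dots> / (real Ma * real (card C)) = H n ({..<Ma} \<times> B) (\<lambda>(a, b). x a + \<beta> b) 1 - H n B \<beta> 1"
    using Ma c0 by simp
  finally show ?thesis .
qed

lemma ln_avg_bound:
  assumes A: "finite A" "A \<noteq> {}" and f: "\<And>a. a \<in> A \<Longrightarrow> 0 < f a" and b: "\<And>a. a \<in> A \<Longrightarrow> \<bar>ln (f a)\<bar> \<le> (B::real)"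
  shows "\<bar>ln ((\<Sum>a\<in>A. f a) / real (card A))\<bar> \<le> B"
proof -
  have c0: "0 < real (card A)" using A by (simp add: card_gt_0_iff)
  have u: "f a \<le> exp B" and l: "exp (- B) \<le> f a" if "a \<in> A" for a
  proof -
    have "ln (f a) \<le> B" "- B \<le> ln (f a)" using b[OF that] by auto
    then show "f a \<le> exp B" "exp (- B) \<le> f a" using f[OF that] by (metis exp_le_cancel_iff exp_ln)+
  qed
  have "(\<Sum>a\<in>A. f a) \<le> real (card A) * exp B" using u by (intro sum_bounded_above) auto
  then have 1: "(\<Sum>a\<in>A. f a) / real (card A) \<le> exp B" using c0 by (simp add: pos_divide_le_eq mult.commute)
  have "real (card A) * exp (- B) \<le> (\<Sum>a\<in>A. f a)" using l by (intro sum_bounded_below) auto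
  then have 2: "exp (- B) \<le> (\<Sum>a\<in>A. f a) / real (card A)" using c0 by (simp only: pos_le_divide_eq) (simp only: mult.commute)
  have p: "0 < (\<Sum>a\<in>A. f a) / real (card A)" using 2 exp_gt_zero[of "- B"] by linarith
  have "ln ((\<Sum>a\<in>A. f a) / real (card A)) \<le> B" using 1 p by (metis ln_exp ln_le_cancel_iff exp_gt_zero)
  moreover have "- B \<le> ln ((\<Sum>a\<in>A. f a) / real (card A))" using 2 p by (metis ln_exp ln_le_cancel_iff exp_gt_zero)
  ultimately show ?thesis by simp
qed

text \<open>The law of \<open>(X + E, I + g E + V)\<close> with \<open>X\<close> uniform in the
  codebook \<open>x\<close> and \<open>I\<close> in \<iota>: the two coordinates are coupled through
  the noise \<open>E\<close> alone. With \<open>E = Z - W\<close> this is the law of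
  \<open>(Y - U, U)\<close>.\<close>

definition Jd where
  "Jd n A x J \<iota> e v g z = (\<Sum>a\<in>A. K2 n e J \<iota> v (x a) 0 g z) / real (card A)"

definition Jent where
  "Jent n A x J \<iota> e v g = - (\<integral>z. Jd n A x J \<iota> e v g z * ln (Jd n A x J \<iota> e v g z) \<partial>LL n)"

lemma Jd_measurable: "Jd n A x J \<iota> e v g \<in> borel_measurable (LL n)"
  unfolding Jd_def by (intro borel_measurable_divide borel_measurable_sum K2_measurable borel_measurable_const)

lemma Jd_pos: "finite A \<Longrightarrow> A \<noteq> {} \<Longrightarrow> finite J \<Longrightarrow> J \<noteq> {} \<Longrightarrow> 0 < e \<Longrightarrow> 0 < v \<Longrightarrow> 0 < Jd n A x J \<iota> e v g z"
  unfolding Jd_def by (intro divide_pos_pos sum_pos K2_pos) (auto simp: card_gt_0_iff)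

lemma ln_K2_qb:
  assumes J: "finite J" "J \<noteq> {}" and e: "0 < e" and v: "0 < v"
  shows "\<exists>C\<ge>0. \<forall>z. \<bar>ln (K2 n e J \<iota> v \<eta>0 \<sigma>0 g z)\<bar> \<le> C * (1 + nsq n (fst z) + nsq n (snd z))"
proof -
  obtain C1 where C1: "0 \<le> C1" "\<And>z. \<bar>ln (gd n e (sc 1 (fst z) + sc 0 (snd z) + (- \<eta>0)))\<bar> \<le> C1 * (1 + nsq n (fst z) + nsq n (snd z))"
    using ln_gd_qb2[OF e, of n 1 0 "- \<eta>0"] by blast
  obtain C2 where C2: "0 \<le> C2" "\<And>z. \<bar>ln (fm n J \<iota> v (sc (- g) (fst z) + sc 1 (snd z) + (sc g \<eta>0 - \<sigma>0)))\<bar> \<le> C2 * (1 + nsq n (fst z) + nsq n (snd z))"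
    using ln_fm_qb2[OF J v, of n \<iota> "- g" 1 "sc g \<eta>0 - \<sigma>0"] by blast
  have "ln (K2 n e J \<iota> v \<eta>0 \<sigma>0 g z) = ln (gd n e (sc 1 (fst z) + sc 0 (snd z) + (- \<eta>0))) + ln (fm n J \<iota> v (sc (- g) (fst z) + sc 1 (snd z) + (sc g \<eta>0 - \<sigma>0)))" for z
  proof -
    have a: "gd n e (fst z - \<eta>0) = gd n e (sc 1 (fst z) + sc 0 (snd z) + (- \<eta>0))" by (rule gd_cong) simp
    have b: "fm n J \<iota> v (snd z - \<sigma>0 - sc g (fst z - \<eta>0)) = fm n J \<iota> v (sc (- g) (fst z) + sc 1 (snd z) + (sc g \<eta>0 - \<sigma>0))"
      by (rule fm_cong) (simp add: algebra_simps)
    show ?thesis unfolding K2_def a b using e fm_pos[OF J v] by (intro ln_mult_pos) auto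
  qed
  then have "\<bar>ln (K2 n e J \<iota> v \<eta>0 \<sigma>0 g z)\<bar> \<le> (C1 + C2) * (1 + nsq n (fst z) + nsq n (snd z))" for z
    using qb_add[OF C1(2) C2(2), of z] by (simp only:)
  then show ?thesis using C1(1) C2(1) by (intro exI[of _ "C1 + C2"]) auto
qed

lemma ln_Jd_qb:
  assumes A: "finite A" "A \<noteq> {}" and J: "finite J" "J \<noteq> {}" and e: "0 < e" and v: "0 < v"
  shows "\<exists>C\<ge>0. \<forall>z. \<bar>ln (Jd n A x J \<iota> e v g z)\<bar> \<le> C * (1 + nsq n (fst z) + nsq n (snd z))"
proof -
  have "\<forall>a. \<exists>C\<ge>0. \<forall>z. \<bar>ln (K2 n e J \<iota> v (x a) 0 g z)\<bar> \<le> C * (1 + nsq n (fst z) + nsq n (snd z))"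
    using ln_K2_qb[OF J e v] by blast
  then obtain C where C: "\<And>a. 0 \<le> C a" "\<And>a z. \<bar>ln (K2 n e J \<iota> v (x a) 0 g z)\<bar> \<le> C a * (1 + nsq n (fst z) + nsq n (snd z))" by metis
  have "\<bar>ln (Jd n A x J \<iota> e v g z)\<bar> \<le> (\<Sum>a\<in>A. C a) * (1 + nsq n (fst z) + nsq n (snd z))" for z
    unfolding Jd_def
  proof (rule ln_avg_bound[OF A])
    fix a assume a: "a \<in> A"
    have "C a \<le> (\<Sum>a\<in>A. C a)" using C(1) A a by (intro member_le_sum) auto
    then have "C a * (1 + nsq n (fst z) + nsq n (snd z)) \<le> (\<Sum>a\<in>A. C a) * (1 + nsq n (fst z) + nsq n (snd z))"
      by (intro mult_right_mono) (auto simp: add_nonneg_nonneg)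
    then show "\<bar>ln (K2 n e J \<iota> v (x a) 0 g z)\<bar> \<le> (\<Sum>a\<in>A. C a) * (1 + nsq n (fst z) + nsq n (snd z))" using C(2)[of a z] by linarith
  qed (use K2_pos[OF J e v] in auto)
  then show ?thesis using C(1) by (intro exI[of _ "\<Sum>a\<in>A. C a"]) (auto intro: sum_nonneg)
qed

text \<open>The decoder acts on \<open>fst + cc * snd\<close>, which by the hypothesis
  \<open>one\<close> has unit noise and is the original channel output. The pair carries at least as
  much information, and its entropy for a given message splits into that of a Gaussian and that of
  the interference at level \<open>v\<close>.\<close>

lemma fano_2d:
  fixes \<eta> \<sigma> :: "nat \<Rightarrow> 'c \<Rightarrow> nat \<Rightarrow> complex" and q :: "'c \<Rightarrow> _"
  assumes C: "finite C" "C \<noteq> {}" and Ma: "1 \<le> Ma" and B: "finite B" "B \<noteq> {}" and \<psi>: "\<psi> \<in> measurable (Lam n) (count_space UNIV)"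
    and e: "0 < ee" and v: "0 < v" and cc: "cc \<noteq> 0" and one: "(cmod cc)\<^sup>2 * v + (cmod (1 + cc * g))\<^sup>2 * ee = 1"
    and S: "(1 - e) * (real Ma * (real (card B) * real (card C))) \<le> (\<Sum>a<Ma. \<Sum>c\<in>C. \<Sum>b\<in>B. \<integral>y. gd n 1 (y - ((\<eta> a c + sc cc (\<sigma> a c)) + sc cc (\<beta> b))) * indicator {y. \<psi> y = a} y \<partial>Lam n)"
    and qm: "\<And>c. q c \<in> borel_measurable (LL n)" and q0: "\<And>c z. 0 < q c z" and q1: "\<And>c. (\<integral>\<^sup>+z. ennreal (q c z) \<partial>LL n) \<le> 1"
    and i2: "\<And>a c. integrable (LL n) (\<lambda>z. K2 n ee B \<beta> v (\<eta> a c) (\<sigma> a c) g z * ln (q c z))"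
  shows "(1 - e) * ln (real Ma) - ln 2 \<le> - real n * ln (pi * exp 1 * ee) - H n B \<beta> v - (\<Sum>a<Ma. \<Sum>c\<in>C. \<integral>z. K2 n ee B \<beta> v (\<eta> a c) (\<sigma> a c) g z * ln (q c z) \<partial>LL n) / (real Ma * real (card C))"
proof -
  have c0: "0 < real (card B)" "0 < real (card C)" using B C by (auto simp: card_gt_0_iff)
  let ?p = "\<lambda>a c. K2 n ee B \<beta> v (\<eta> a c) (\<sigma> a c) g" and ?\<psi> = "\<lambda>z. \<psi> (rs n (fst z + sc cc (snd z)))"
  have m: "(\<lambda>z. rs n (fst z + sc cc (snd z))) \<in> measurable (LL n) (Lam n)" by (intro measurable_Lam_mv mvI mv_basic)
  have dec: "(\<integral>z. ?p a c z * indicator {z. ?\<psi> z = a} z \<partial>LL n) = (\<Sum>b\<in>B. \<integral>y. gd n 1 (y - ((\<eta> a c + sc cc (\<sigma> a c)) + sc cc (\<beta> b))) * indicator {y. \<psi> y = a} y \<partial>Lam n) / real (card B)" for a c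
  proof -
    have nn: "F \<in> borel_measurable (Lam n) \<Longrightarrow> (\<integral>\<^sup>+z. ennreal (?p a c z) * F (rs n (fst z + sc cc (snd z))) \<partial>LL n) =
      (\<integral>\<^sup>+y. ennreal (fm n B (\<lambda>w. sc cc (\<beta> w)) 1 (y - (\<eta> a c + sc cc (\<sigma> a c)))) * F y \<partial>Lam n)" for F
      using nn_K2_comb[OF B e v _ cc, of F n \<beta> "\<eta> a c" "\<sigma> a c" g] unfolding one .
    have "(\<integral>z. ?p a c z * indicator {z. ?\<psi> z = a} z \<partial>LL n) = (\<integral>z. ?p a c z * indicator {y. \<psi> y = a} (rs n (fst z + sc cc (snd z))) \<partial>LL n)"
      by (simp add: indicator_def)
    also have "\<dots> = (\<integral>y. fm n B (\<lambda>b. sc cc (\<beta> b)) 1 (y - (\<eta> a c + sc cc (\<sigma> a c))) * indicator {y. \<psi> y = a} y \<partial>Lam n)"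
      using K2_pos[OF B e v, of n \<beta> "\<eta> a c" "\<sigma> a c" g]
      by (intro push_integral(2)[OF m K2_measurable]) (auto intro!: fm_measurable mvI mv_basic fm_nonneg nn ind_measurable[OF \<psi>] simp: less_imp_le simp del: sc_simps)
    also have "\<dots> = (\<Sum>b\<in>B. \<integral>y. gd n 1 (y - ((\<eta> a c + sc cc (\<sigma> a c)) + sc cc (\<beta> b))) * indicator {y. \<psi> y = a} y \<partial>Lam n) / real (card B)"
      by (rule fm_ind[OF zero_less_one \<psi>])
    finally show ?thesis .
  qed
  have "(1 - e) * real Ma * real (card C) * real (card B) \<le> (\<Sum>a<Ma. \<Sum>c\<in>C. \<Sum>b\<in>B. \<integral>y. gd n 1 (y - ((\<eta> a c + sc cc (\<sigma> a c)) + sc cc (\<beta> b))) * indicator {y. \<psi> y = a} y \<partial>Lam n)"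
    using S by (simp only: mult_ac)
  then have "(1 - e) * real Ma * real (card C) \<le> (\<Sum>a<Ma. \<Sum>c\<in>C. \<Sum>b\<in>B. \<integral>y. gd n 1 (y - ((\<eta> a c + sc cc (\<sigma> a c)) + sc cc (\<beta> b))) * indicator {y. \<psi> y = a} y \<partial>Lam n) / real (card B)"
    using c0 by (simp only: pos_le_divide_eq)
  then have S': "(1 - e) * (real Ma * real (card C)) \<le> (\<Sum>a<Ma. \<Sum>c\<in>C. \<integral>z. ?p a c z * indicator {z. ?\<psi> z = a} z \<partial>LL n)"
    by (simp only: dec sum_divide_distrib mult.assoc)
  have "(1 - e) * ln (real Ma) - ln 2 \<le> (\<Sum>a<Ma. \<Sum>c\<in>C. (\<integral>z. ?p a c z * ln (?p a c z) \<partial>LL n) - (\<integral>z. ?p a c z * ln (q c z) \<partial>LL n)) / (real Ma * real (card C))"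
  proof (rule fano[OF C Ma _ q0 _ qm q1 _ _ i2 S'])
    show "\<And>c::'c. ?\<psi> \<in> measurable (LL n) (count_space UNIV)" by (rule measurable_compose[OF m \<psi>])
    show "\<And>a c. integrable (LL n) (\<lambda>z. ?p a c z * ln (?p a c z))"
      using K2_ent[OF B e v, of n \<beta>] unfolding has_bochner_integral_iff by blast
  qed (use K2_pos[OF B e v] K2_bi[OF B e v] in auto)
  also have "\<dots> = - real n * ln (pi * exp 1 * ee) - H n B \<beta> v - (\<Sum>a<Ma. \<Sum>c\<in>C. \<integral>z. ?p a c z * ln (q c z) \<partial>LL n) / (real Ma * real (card C))"
  proof -
    have h: "(\<integral>z. ?p a c z * ln (?p a c z) \<partial>LL n) = - real n * ln (pi * exp 1 * ee) - H n B \<beta> v" for a c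
      by (rule has_bochner_integral_integral_eq[OF K2_ent[OF B e v]])
    define X where "X = - real n * ln (pi * exp 1 * ee) - H n B \<beta> v"
    have "(\<Sum>a<Ma. \<Sum>c\<in>C. X - (\<integral>z. ?p a c z * ln (q c z) \<partial>LL n)) = (real Ma * real (card C)) * X - (\<Sum>a<Ma. \<Sum>c\<in>C. \<integral>z. ?p a c z * ln (q c z) \<partial>LL n)"
      by (simp add: sum_subtractf)
    moreover have "((real Ma * real (card C)) * X - Y) / (real Ma * real (card C)) = X - Y / (real Ma * real (card C))" for Y
      using Ma c0 by (simp add: diff_divide_distrib)
    ultimately show ?thesis unfolding h X_def[symmetric] by (simp only:)
  qed
  finally show ?thesis .
qed

text \<open>The receiver sees \<open>Y\<close> with the interference \<open>d c\<close> known, and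
  \<open>S = h31 x + h32 \<beta> + N\<close>. The pair \<open>(Y - cc S, S)\<close> is used, because
  \<open>cc * h32\<close> is the coefficient of \<beta> in \<open>Y\<close>: the first coordinate is
  then free of \<beta>, its noise is \<open>E = Z - cc N\<close>, and \<open>N = g E + V\<close>
  with \<open>V\<close> independent of \<open>E\<close>. The test density is exact in
  \<open>S\<close> and Gaussian for \<open>Y\<close> given \<open>S\<close>, which keeps the entropy
  of \<open>S\<close>.\<close>

lemma rate_le_side_info_entropy:
  fixes h31 h32 cc g \<kappa> :: complex and d :: "'c \<Rightarrow> nat \<Rightarrow> complex"
  assumes x: "pwr n {..<Ma} x P" and xb: "pwr n B \<beta> Pb" and C: "finite C" "C \<noteq> {}"
    and s: "succ n Ma x (B \<times> C) (\<lambda>(b, c). sc (cc * h32) (\<beta> b) + d c) \<psi> e"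
    and e: "0 < ee" and v: "0 < VN" and h32: "h32 \<noteq> 0" and cc: "cc \<noteq> 0"
    and one: "(cmod cc)\<^sup>2 * VN + (cmod (1 + cc * g))\<^sup>2 * ee = 1"
    and sN: "VN + (cmod g)\<^sup>2 * ee = sN2"
    and \<tau>: "\<tau> = (cmod (1 + (cc - \<kappa>) * g))\<^sup>2 * ee + (cmod (cc - \<kappa>))\<^sup>2 * VN + (cmod (1 - \<kappa> * h31))\<^sup>2 * P + (cmod (cc * h32 - \<kappa> * h32))\<^sup>2 * Pb" and \<tau>0: "0 < \<tau>"
  shows "(1 - e) * ln (real Ma) - ln 2 \<le> H n ({..<Ma} \<times> B) (\<lambda>(a, b). sc h31 (x a) + sc h32 (\<beta> b)) sN2 - H n B (\<lambda>b. sc h32 (\<beta> b)) VN + real n * ln (pi * exp 1 * \<tau>) - real n * ln (pi * exp 1 * ee)"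
proof -
  have B: "finite B" "B \<noteq> {}" and Ma: "1 \<le> Ma" and P0: "0 \<le> P" "0 \<le> Pb" and \<psi>: "\<psi> \<in> measurable (Lam n) (count_space UNIV)"
    using x xb s by (auto simp: pwr_def succ_def lessThan_empty_iff)
  have c0: "0 < real (card B)" "0 < real (card C)" using B C by (auto simp: card_gt_0_iff)
  have AB: "finite ({..<Ma} \<times> B)" "{..<Ma} \<times> B \<noteq> {}" using B Ma by (auto simp: lessThan_empty_iff)
  have sN0: "0 < sN2" using v e sN by (metis add_pos_nonneg mult_nonneg_nonneg less_imp_le zero_le_power2)
  \<comment> \<open>\<eta> and \<sigma> are the contributions of the message and of the known
    interference to \<open>Y - cc S\<close> and to \<open>S\<close>.\<close>
  define \<eta> where "\<eta> a c = sc (1 - cc * h31) (x a) + d c" for a c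
  define \<sigma> where "\<sigma> a c = sc h31 (x a)" for a and c :: 'c
  let ?\<beta> = "\<lambda>b. sc h32 (\<beta> b)"
  let ?f = "fm n ({..<Ma} \<times> B) (\<lambda>(a, b). sc h31 (x a) + sc h32 (\<beta> b)) sN2"
  \<comment> \<open>The argument of the Gaussian is \<open>Y - \<kappa> S - d c\<close>, expressed
    in the coordinates \<open>Y - cc S\<close> and \<open>S\<close>; \<tau> bounds its variance per
    symbol.\<close>
  let ?k = "\<lambda>c z. gd n \<tau> (sc 1 (fst z) + sc (cc - \<kappa>) (snd z) + (- d c))"
  let ?q = "\<lambda>c z. ?f (snd z) * ?k c z"
  let ?K = "\<lambda>a c. K2 n ee B ?\<beta> VN (\<eta> a c) (\<sigma> a c) g"
  have i1: "integrable (LL n) (\<lambda>z. ?K a c z * ln (?f (snd z)))" for a c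
    using K2_ln_fm[OF B e v AB sN0, of n ?\<beta> "\<eta> a c" "\<sigma> a c" g _ 0 1 0] by simp
  define N2 where "N2 a = (\<Sum>b\<in>B. nsq n (sc (1 - \<kappa> * h31) (x a) + sc (cc * h32 - \<kappa> * h32) (\<beta> b))) / real (card B)" for a
  define W where "W = (cmod (1 + (cc - \<kappa>) * g))\<^sup>2 * real n * ee + (cmod (cc - \<kappa>))\<^sup>2 * real n * VN"
  have b2: "has_bochner_integral (LL n) (\<lambda>z. ?K a c z * ln (?k c z)) (- ((W + N2 a) / \<tau>) - real n * ln (pi * \<tau>))" for a c
  proof -
    have "(\<Sum>b\<in>B. nsq n (sc 1 (\<eta> a c) + sc (cc - \<kappa>) (\<sigma> a c + ?\<beta> b) + - d c)) = (\<Sum>b\<in>B. nsq n (sc (1 - \<kappa> * h31) (x a) + sc (cc * h32 - \<kappa> * h32) (\<beta> b)))"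
      by (intro sum.cong refl nsq_cong) (simp add: \<eta>_def \<sigma>_def algebra_simps)
    then show ?thesis using K2_ln_gd[OF B e v \<tau>0, of n ?\<beta> "\<eta> a c" "\<sigma> a c" g 1 "cc - \<kappa>" "- d c"] by (simp only: W_def N2_def)
  qed
  have lnq: "?K a c z * ln (?q c z) = ?K a c z * ln (?f (snd z)) + ?K a c z * ln (?k c z)" for a c z
    using fm_pos[OF AB sN0, of n _ "snd z"] \<tau>0 by (subst ln_mult_pos) (auto simp: distrib_left)
  have i2: "integrable (LL n) (\<lambda>z. ?K a c z * ln (?q c z))" for a c
    unfolding lnq using i1[of a c] b2[of a c] by (intro Bochner_Integration.integrable_add) (simp_all only: has_bochner_integral_iff)
  have S: "(1 - e) * (real Ma * (real (card B) * real (card C))) \<le> (\<Sum>a<Ma. \<Sum>c\<in>C. \<Sum>b\<in>B. \<integral>y. gd n 1 (y - ((\<eta> a c + sc cc (\<sigma> a c)) + sc cc (?\<beta> b))) * indicator {y. \<psi> y = a} y \<partial>Lam n)"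
  proof -
    have "x a + (sc (cc * h32) (\<beta> b) + d c) = (\<eta> a c + sc cc (\<sigma> a c)) + sc cc (?\<beta> b)" for a b c
      by (simp add: \<eta>_def \<sigma>_def fun_eq_iff algebra_simps)
    then have "(\<Sum>bc\<in>B \<times> C. \<integral>y. gd n 1 (y - (x a + (\<lambda>(b, c). sc (cc * h32) (\<beta> b) + d c) bc)) * indicator {y. \<psi> y = a} y \<partial>Lam n)
      = (\<Sum>c\<in>C. \<Sum>b\<in>B. \<integral>y. gd n 1 (y - ((\<eta> a c + sc cc (\<sigma> a c)) + sc cc (?\<beta> b))) * indicator {y. \<psi> y = a} y \<partial>Lam n)" for a
      by (subst sum.swap) (simp only: sum.cartesian_product split_beta')
    then show ?thesis using s unfolding succ_def by (simp only: card_cartesian_product of_nat_mult)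
  qed
  have "(1 - e) * ln (real Ma) - ln 2 \<le> - real n * ln (pi * exp 1 * ee) - H n B ?\<beta> VN - (\<Sum>a<Ma. \<Sum>c\<in>C. \<integral>z. ?K a c z * ln (?q c z) \<partial>LL n) / (real Ma * real (card C))"
  proof (rule fano_2d[OF C Ma B \<psi> e v cc one S _ _ _ i2])
    show qm: "?q c \<in> borel_measurable (LL n)" for c
      by (intro borel_measurable_times fm_measurable gd_measurable mvI mv_basic)
    show "0 < ?q c z" for c z using fm_pos[OF AB sN0] \<tau>0 by (intro mult_pos_pos gd_pos) auto
    fix c
    have "(\<integral>\<^sup>+z. ennreal (?q c z) \<partial>LL n) = (\<integral>\<^sup>+s. \<integral>\<^sup>+y. ennreal (?q c (y, s)) \<partial>Lam n \<partial>Lam n)"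
      using qm by (intro nn_LL') simp
    also have "\<dots> = (\<integral>\<^sup>+s. ennreal (?f s) * (\<integral>\<^sup>+y. ennreal (gd n \<tau> (y - (d c - sc (cc - \<kappa>) s))) \<partial>Lam n) \<partial>Lam n)"
    proof (intro nn_integral_cong)
      fix s
      have "ennreal (?q c (y, s)) = ennreal (?f s) * ennreal (gd n \<tau> (y - (d c - sc (cc - \<kappa>) s)))" for y
        using fm_nonneg[OF sN0, of n _ _ s] gd_cong[of n "sc 1 y + sc (cc - \<kappa>) s + (- d c)" "y - (d c - sc (cc - \<kappa>) s)" \<tau>] \<tau>0
        by (simp add: ennreal_mult' algebra_simps)
      then show "(\<integral>\<^sup>+y. ennreal (?q c (y, s)) \<partial>Lam n) = ennreal (?f s) * (\<integral>\<^sup>+y. ennreal (gd n \<tau> (y - (d c - sc (cc - \<kappa>) s))) \<partial>Lam n)"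
        by (simp only:) (intro nn_integral_cmult gd_measurable_ennreal mv_id_minus)
    qed
    also have "\<dots> = 1" using nn_integral_fm[OF AB sN0, of n _ 0] by (simp add: nn_integral_gd[OF \<tau>0])
    finally show "(\<integral>\<^sup>+z. ennreal (?q c z) \<partial>LL n) \<le> 1" by simp
  qed
  also have "(\<Sum>a<Ma. \<Sum>c\<in>C. \<integral>z. ?K a c z * ln (?q c z) \<partial>LL n) = (\<Sum>a<Ma. \<Sum>c\<in>C. (\<integral>z. ?K a c z * ln (?f (snd z)) \<partial>LL n) + (- ((W + N2 a) / \<tau>) - real n * ln (pi * \<tau>)))"
    unfolding lnq using i1 b2 by (intro sum.cong refl, subst Bochner_Integration.integral_add) (simp_all only: has_bochner_integral_iff)
  also have "\<dots> = (\<Sum>a<Ma. \<Sum>c\<in>C. \<integral>z. ?K a c z * ln (?f (snd z)) \<partial>LL n) + real (card C) * (\<Sum>a<Ma. - ((W + N2 a) / \<tau>) - real n * ln (pi * \<tau>))"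
    by (simp add: sum.distrib sum_distrib_left)
  also have "(\<Sum>a<Ma. \<Sum>c\<in>C. \<integral>z. ?K a c z * ln (?f (snd z)) \<partial>LL n) = real (card C) * (- real Ma * H n ({..<Ma} \<times> B) (\<lambda>(a, b). sc h31 (x a) + sc h32 (\<beta> b)) sN2)"
  proof -
    have isb: "integrable (Lam n) (\<lambda>y. fm n B ?\<beta> sN2 (y - sc h31 (x a)) * ln (?f y))" for a
    proof -
      obtain D where D: "0 \<le> D" "\<And>y. \<bar>ln (?f y)\<bar> \<le> D * (1 + nsq n y)" using ln_fm_bound[OF AB sN0] by blast
      show ?thesis unfolding fm_shift using D
        by (intro integrable_fm_qb[OF B sN0, where C=D] ln_fm_measurable mv_basic) auto
    qed
    have k: "(\<integral>z. ?K a c z * ln (?f (snd z)) \<partial>LL n) = (\<integral>y. fm n B ?\<beta> sN2 (y - sc h31 (x a)) * ln (?f y) \<partial>Lam n)" for a c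
      unfolding K2_snd_ln_fm[OF B e v AB sN0] sN \<sigma>_def ..
    have "(\<Sum>a<Ma. \<integral>y. fm n B ?\<beta> sN2 (y - sc h31 (x a)) * ln (?f y) \<partial>Lam n) = (\<integral>y. (\<Sum>a<Ma. fm n B ?\<beta> sN2 (y - sc h31 (x a)) * ln (?f y)) \<partial>Lam n)"
      using isb by (simp add: Bochner_Integration.integral_sum)
    also have "\<dots> = (\<integral>y. real Ma * (?f y * ln (?f y)) \<partial>Lam n)"
    proof (intro Bochner_Integration.integral_cong refl)
      fix y
      have "(\<Sum>a<Ma. fm n B ?\<beta> sN2 (y - sc h31 (x a))) = real Ma * ?f y" using B by (subst fm_pair) simp_all
      then show "(\<Sum>a<Ma. fm n B ?\<beta> sN2 (y - sc h31 (x a)) * ln (?f y)) = real Ma * (?f y * ln (?f y))"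
        by (simp only: sum_distrib_right[symmetric] mult.assoc)
    qed
    also have "\<dots> = - real Ma * H n ({..<Ma} \<times> B) (\<lambda>(a, b). sc h31 (x a) + sc h32 (\<beta> b)) sN2"
      by (simp add: H_def)
    finally show ?thesis unfolding k by (simp add: sum_distrib_left[symmetric])
  qed
  finally have "(1 - e) * ln (real Ma) - ln 2 \<le> - real n * ln (pi * exp 1 * ee) - H n B ?\<beta> VN - (real (card C) * (- real Ma * H n ({..<Ma} \<times> B) (\<lambda>(a, b). sc h31 (x a) + sc h32 (\<beta> b)) sN2) + real (card C) * (\<Sum>a<Ma. - ((W + N2 a) / \<tau>) - real n * ln (pi * \<tau>))) / (real Ma * real (card C))" .
  moreover have "(real (card C) * (- real Ma * h) + real (card C) * (\<Sum>a<Ma. - ((W + N2 a) / \<tau>) - real n * ln (pi * \<tau>))) / (real Ma * real (card C)) = - h - (W + (\<Sum>a<Ma. N2 a) / real Ma) / \<tau> - real n * ln (pi * \<tau>)" for h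
  proof -
    have "(\<Sum>a<Ma. - ((W + N2 a) / \<tau>) - real n * ln (pi * \<tau>)) = real Ma * (- (W / \<tau>) - real n * ln (pi * \<tau>)) - (\<Sum>a<Ma. N2 a) / \<tau>"
      by (simp add: sum_subtractf sum_negf sum.distrib add_divide_distrib sum_divide_distrib[symmetric] algebra_simps)
    also have "\<dots> = real Ma * (- (W / \<tau>) - real n * ln (pi * \<tau>) - (\<Sum>a<Ma. N2 a) / real Ma / \<tau>)"
      using Ma by (simp add: right_diff_distrib)
    finally have "real (card C) * (- real Ma * h) + real (card C) * (\<Sum>a<Ma. - ((W + N2 a) / \<tau>) - real n * ln (pi * \<tau>)) = (real Ma * real (card C)) * (- h - (W / \<tau>) - real n * ln (pi * \<tau>) - (\<Sum>a<Ma. N2 a) / real Ma / \<tau>)"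
      by (simp only:) (simp add: algebra_simps)
    then show ?thesis using Ma c0 by (simp add: add_divide_distrib)
  qed
  moreover have "(W + (\<Sum>a<Ma. N2 a) / real Ma) / \<tau> \<le> real n"
  proof -
    have "(\<Sum>a<Ma. N2 a) / real Ma = (\<Sum>a<Ma. \<Sum>b\<in>B. nsq n (sc (1 - \<kappa> * h31) (x a) + sc (cc * h32 - \<kappa> * h32) (\<beta> b))) / (real Ma * real (card B))"
      by (simp add: N2_def sum_divide_distrib[symmetric] mult.commute)
    also have "\<dots> \<le> real n * ((cmod (1 - \<kappa> * h31))\<^sup>2 * P + (cmod (cc * h32 - \<kappa> * h32))\<^sup>2 * Pb)"
      using pwr_pair(2)[OF x xb, of "1 - \<kappa> * h31" "cc * h32 - \<kappa> * h32"] Ma c0 by (simp add: pos_divide_le_eq mult_ac)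
    finally have "W + (\<Sum>a<Ma. N2 a) / real Ma \<le> real n * \<tau>" unfolding \<tau> W_def by (simp add: algebra_simps)
    then show ?thesis using \<tau>0 by (simp add: pos_divide_le_eq)
  qed
  moreover have "real n * ln (pi * exp 1 * \<tau>) = real n * ln (pi * \<tau>) + real n" using ln_pie[OF \<tau>0] by (simp add: distrib_left)
  ultimately show ?thesis by simp
qed

lemma fm_unit: "fm n (A \<times> {()}) (\<lambda>(a, b). x a + 0) v = fm n A x v"
proof -
  have "(\<Sum>w\<in>A \<times> {()}. gd n v (y - (\<lambda>(a, b). x a + 0) w)) = (\<Sum>w\<in>A. gd n v (y - x w))" for y
    by (rule sum.reindex_bij_witness[of _ "\<lambda>a. (a, ())" fst]) auto
  then show ?thesis by (simp add: fm_def fun_eq_iff card_cartesian_product)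
qed

text \<open>All interference indices go into the known data \<open>c\<close> of
  \<open>fano_1d\<close>; the unknown interference is a single zero vector, whose noise entropy is
  exactly Gaussian.\<close>

lemma rate_le_known_interference:
  assumes x: "pwr n {..<Ma} x P" and J: "finite J" "J \<noteq> {}" and s: "succ n Ma x J \<iota> \<psi> e"
  shows "(1 - e) * ln (real Ma) - ln 2 \<le> - Dd n {..<Ma} x 1 P + real n * ln (P + 1)"
proof -
  have Ma: "1 \<le> Ma" and \<psi>: "\<psi> \<in> measurable (Lam n) (count_space UNIV)" and P: "0 \<le> P" using x s by (auto simp: pwr_def succ_def lessThan_empty_iff)
  have "(1 - e) * ln (real Ma) - ln 2 \<le> H n ({..<Ma} \<times> {()}) (\<lambda>(a, b). x a + 0) 1 - H n {()} (\<lambda>_. 0) 1"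
    using s by (intro fano_1d[OF J Ma _ _ \<psi>, where d=\<iota>]) (auto simp: succ_def)
  also have "H n ({..<Ma} \<times> {()}) (\<lambda>(a, b). x a + 0) 1 = H n {..<Ma} x 1" by (simp only: H_def fm_unit)
  also have "H n {()} (\<lambda>_. 0) 1 = real n * ln (pi * exp 1 * 1)" by (rule H_zero) (auto simp: nsq_def)
  also have "H n {..<Ma} x 1 - real n * ln (pi * exp 1 * 1) = - Dd n {..<Ma} x 1 P + real n * ln (P + 1)"
  proof -
    have "ln (pi * exp 1 * (P + 1)) = ln (pi * exp 1 * 1) + ln (P + 1)" using P by (subst ln_mult_pos[symmetric]) auto
    then show ?thesis by (simp add: Dd_def distrib_left)
  qed
  finally show ?thesis .
qed

text \<open>The output entropy is bounded by its Gaussian value, while the entropy of interference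
  plus noise is kept and leaves the gap of the interference.\<close>

lemma rate_le_interference_as_noise:
  assumes x: "pwr n {..<Ma} x P" and \<iota>: "pwr n J \<iota> \<epsilon>" and s: "succ n Ma x J \<iota> \<psi> e"
  shows "(1 - e) * ln (real Ma) - ln 2 \<le> Dd n J \<iota> 1 \<epsilon> + real n * ln ((P + \<epsilon> + 1) / (\<epsilon> + 1))"
proof -
  have J: "finite J" "J \<noteq> {}" and Ma: "1 \<le> Ma" and PE: "0 \<le> P" "0 \<le> \<epsilon>" and \<psi>: "\<psi> \<in> measurable (Lam n) (count_space UNIV)"
    using x \<iota> s by (auto simp: pwr_def succ_def lessThan_empty_iff)
  have "(1 - e) * ln (real Ma) - ln 2 \<le> H n ({..<Ma} \<times> J) (\<lambda>(a, b). x a + \<iota> b) 1 - H n J \<iota> 1"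
    using s by (intro fano_1d[where C="{()}" and d="\<lambda>_. 0", OF _ _ Ma J \<psi>]) (auto simp: succ_def)
  moreover have "H n ({..<Ma} \<times> J) (\<lambda>(a, b). x a + \<iota> b) 1 \<le> real n * ln (pi * exp 1 * ((P + \<epsilon>) + 1))"
    using pwr_pair(1)[OF x \<iota>, of 1 1] by (intro H_le) (auto simp: pwr_def)
  moreover have "ln (pi * exp 1 * ((P + \<epsilon>) + 1)) = ln (pi * exp 1 * (\<epsilon> + 1)) + ln ((P + \<epsilon> + 1) / (\<epsilon> + 1))"
    using PE by (subst ln_mult_pos[symmetric]) (auto simp: add_nonneg_pos)
  ultimately show ?thesis unfolding Dd_def by (simp add: distrib_left)
qed

lemma rate_le_zero_power:
  assumes x: "pwr n {..<Ma} x 0" and \<iota>: "finite J" "J \<noteq> {}" and s: "succ n Ma x J \<iota> \<psi> e"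
  shows "(1 - e) * ln (real Ma) - ln 2 \<le> 0"
  using rate_le_known_interference[OF x \<iota> s] Dd_zero[OF x] by simp

text \<open>This serves the case \<open>N = b0 Z\<close>, in which \<open>S\<close> is
  \<open>b0\<close> times the output without its known part and so adds no information. Fano is
  applied to the output alone, and rescaling by \<open>b0\<close> writes its entropy as that of the
  signal in \<open>S\<close> at noise level \<open>(cmod b0)\<^sup>2\<close>. For users of zero
  power the coefficients need not match.\<close>

lemma rate_le_side_info_degenerate:
  fixes b0 h31 h32 h12 :: complex and d :: "'c \<Rightarrow> nat \<Rightarrow> complex"
  assumes x: "pwr n {..<Ma} x P" and xb: "pwr n B \<beta> Pb" and C: "finite C" "C \<noteq> {}"
    and s: "succ n Ma x (B \<times> C) (\<lambda>(b, c). sc h12 (\<beta> b) + d c) \<psi> e"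
    and b0: "b0 \<noteq> 0" and h12: "h12 \<noteq> 0" and c1: "P = 0 \<or> h31 = b0" and c2: "Pb = 0 \<or> h32 = b0 * h12"
  shows "(1 - e) * ln (real Ma) - ln 2 \<le> - Dd n ({..<Ma} \<times> B) (\<lambda>(a, b). sc h31 (x a) + sc h32 (\<beta> b)) ((cmod b0)\<^sup>2) ((cmod h31)\<^sup>2 * P + (cmod h32)\<^sup>2 * Pb)
      + Dd n B \<beta> (1 / (cmod h12)\<^sup>2) Pb + real n * ln ((P + (cmod h12)\<^sup>2 * Pb + 1) / ((cmod h12)\<^sup>2 * Pb + 1))"
proof -
  have B: "finite B" "B \<noteq> {}" and Ma: "1 \<le> Ma" and P0: "0 \<le> P" "0 \<le> Pb" and \<psi>: "\<psi> \<in> measurable (Lam n) (count_space UNIV)"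
    using x xb s by (auto simp: pwr_def succ_def lessThan_empty_iff)
  have AB: "finite ({..<Ma} \<times> B)" "{..<Ma} \<times> B \<noteq> {}" using B Ma by (auto simp: lessThan_empty_iff)
  have hp: "0 < (cmod h12)\<^sup>2" "0 < (cmod b0)\<^sup>2" using h12 b0 by auto
  have S: "(1 - e) * (real Ma * (real (card B) * real (card C))) \<le> (\<Sum>a<Ma. \<Sum>c\<in>C. \<Sum>b\<in>B. \<integral>y. gd n 1 (y - ((x a + d c) + sc h12 (\<beta> b))) * indicator {y. \<psi> y = a} y \<partial>Lam n)"
  proof -
    have "(\<Sum>bc\<in>B \<times> C. \<integral>y. gd n 1 (y - (x a + (\<lambda>(b, c). sc h12 (\<beta> b) + d c) bc)) * indicator {y. \<psi> y = a} y \<partial>Lam n)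
      = (\<Sum>c\<in>C. \<Sum>b\<in>B. \<integral>y. gd n 1 (y - ((x a + d c) + sc h12 (\<beta> b))) * indicator {y. \<psi> y = a} y \<partial>Lam n)" for a
      by (subst sum.swap) (simp only: sum.cartesian_product split_beta' add_ac)
    then show ?thesis using s unfolding succ_def by (simp only: card_cartesian_product of_nat_mult)
  qed
  have "(1 - e) * ln (real Ma) - ln 2 \<le> H n ({..<Ma} \<times> B) (\<lambda>(a, b). x a + sc h12 (\<beta> b)) 1 - H n B (\<lambda>b. sc h12 (\<beta> b)) 1"
    by (rule fano_1d[OF C Ma B \<psi> S])
  also have "H n ({..<Ma} \<times> B) (\<lambda>(a, b). x a + sc h12 (\<beta> b)) 1 = H n ({..<Ma} \<times> B) (\<lambda>(a, b). sc h31 (x a) + sc h32 (\<beta> b)) ((cmod b0)\<^sup>2) - real n * ln ((cmod b0)\<^sup>2)"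
  proof -
    have "H n ({..<Ma} \<times> B) (\<lambda>w. sc b0 ((\<lambda>(a, b). x a + sc h12 (\<beta> b)) w)) ((cmod b0)\<^sup>2 * 1) = H n ({..<Ma} \<times> B) (\<lambda>(a, b). x a + sc h12 (\<beta> b)) 1 + real n * ln ((cmod b0)\<^sup>2)"
      by (rule H_scale[OF AB zero_less_one b0])
    moreover have "H n ({..<Ma} \<times> B) (\<lambda>w. sc b0 ((\<lambda>(a, b). x a + sc h12 (\<beta> b)) w)) ((cmod b0)\<^sup>2 * 1) = H n ({..<Ma} \<times> B) (\<lambda>(a, b). sc h31 (x a) + sc h32 (\<beta> b)) ((cmod b0)\<^sup>2)"
    proof -
      have "b0 * x a t + b0 * h12 * \<beta> b t = h31 * x a t + h32 * \<beta> b t" if "a < Ma" "b \<in> B" "t < n" for a b t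
      proof -
        have "b0 * x a t = h31 * x a t" using c1 pwr_zero[of n "{..<Ma}" x a t] x that by auto
        moreover have "b0 * h12 * \<beta> b t = h32 * \<beta> b t" using c2 pwr_zero[of n B \<beta> b t] xb that by auto
        ultimately show ?thesis by (simp only:)
      qed
      then show ?thesis by (simp only: mult_1_right) (rule H_cong, auto simp: algebra_simps)
    qed
    ultimately show ?thesis by linarith
  qed
  also have "H n B (\<lambda>b. sc h12 (\<beta> b)) 1 = H n B \<beta> (1 / (cmod h12)\<^sup>2) + real n * ln ((cmod h12)\<^sup>2)"
    using H_scale[OF B, of "1 / (cmod h12)\<^sup>2" h12 n \<beta>] hp h12 by simp
  finally have 1: "(1 - e) * ln (real Ma) - ln 2 \<le> H n ({..<Ma} \<times> B) (\<lambda>(a, b). sc h31 (x a) + sc h32 (\<beta> b)) ((cmod b0)\<^sup>2) - real n * ln ((cmod b0)\<^sup>2) - (H n B \<beta> (1 / (cmod h12)\<^sup>2) + real n * ln ((cmod h12)\<^sup>2))" .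
  define h q where "h = (cmod h12)\<^sup>2" and "q = (cmod b0)\<^sup>2"
  have hq: "0 < h" "0 < q" using hp by (simp_all add: h_def q_def)
  have e3: "(cmod h31)\<^sup>2 * P + (cmod h32)\<^sup>2 * Pb + q = q * (P + h * Pb + 1)"
    using c1 c2 by (auto simp: h_def q_def norm_mult power_mult_distrib algebra_simps)
  have p1: "0 < P + h * Pb + 1" "0 < h * Pb + 1" using P0 hq by (auto simp: add_nonneg_pos add_pos_pos)
  have "ln (pi * exp 1 * (q * (P + h * Pb + 1))) = ln q + ln (pi * exp 1) + ln (P + h * Pb + 1)"
    using hq p1 by (simp add: ln_mult)
  moreover have "ln (pi * exp 1 * (Pb + 1 / h)) = ln (pi * exp 1) + ln (h * Pb + 1) - ln h"
  proof -
    have "Pb + 1 / h = (h * Pb + 1) / h" using hq by (simp add: field_simps)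
    then show ?thesis using hq p1 by (simp add: ln_mult ln_div)
  qed
  moreover have "ln ((P + h * Pb + 1) / (h * Pb + 1)) = ln (P + h * Pb + 1) - ln (h * Pb + 1)" using p1 by (simp add: ln_div)
  ultimately have 2: "ln (pi * exp 1 * (q * (P + h * Pb + 1))) - ln q = ln ((P + h * Pb + 1) / (h * Pb + 1)) + ln (pi * exp 1 * (Pb + 1 / h)) + ln h" by simp
  have 2: "real n * ln (pi * exp 1 * (q * (P + h * Pb + 1))) - real n * ln q = real n * ln ((P + h * Pb + 1) / (h * Pb + 1)) + real n * ln (pi * exp 1 * (Pb + 1 / h)) + real n * ln h"
    unfolding right_diff_distrib[symmetric] 2 by (simp only: distrib_left)
  show ?thesis using 1 2 unfolding Dd_def h_def[symmetric] q_def[symmetric] e3 by linarith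
qed

text \<open>\<open>fano_2d\<close> for the pair \<open>(Y - U, U)\<close>, whose sum is the output,
  hence \<open>cc = 1\<close>. The test density is the exact mixture of the pair, so its joint
  entropy stays and is treated separately.\<close>

lemma rate_le_genie_entropy:
  assumes x: "pwr n {..<Ma} x P" and J: "finite J" "J \<noteq> {}" and s: "succ n Ma x J \<iota> \<psi> e"
    and sT: "0 < sT" and VW: "0 < VW" and one: "VW + (cmod (1 + g))\<^sup>2 * sT = 1"
  shows "(1 - e) * ln (real Ma) - ln 2 \<le> Jent n {..<Ma} x J \<iota> sT VW g - real n * ln (pi * exp 1 * sT) - H n J \<iota> VW"
proof -
  have Ma: "1 \<le> Ma" and \<psi>: "\<psi> \<in> measurable (Lam n) (count_space UNIV)" using x s by (auto simp: pwr_def succ_def lessThan_empty_iff)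
  have A: "finite {..<Ma}" "{..<Ma} \<noteq> {}" using Ma by (auto simp: lessThan_empty_iff)
  let ?J = "Jd n {..<Ma} x J \<iota> sT VW g" and ?K = "\<lambda>a (c::unit). K2 n sT J \<iota> VW (x a) 0 g"
  obtain D where D: "0 \<le> D" "\<And>z. \<bar>ln (?J z)\<bar> \<le> D * (1 + nsq n (fst z) + nsq n (snd z))" using ln_Jd_qb[OF A J sT VW] by blast
  have Jm: "(\<lambda>z. ln (?J z)) \<in> borel_measurable (LL n)" using Jd_measurable[of n "{..<Ma}" x J \<iota> sT VW g] by simp
  have i2: "integrable (LL n) (\<lambda>z. ?K a c z * ln (?J z))" for a c
    by (rule K2_integrable_qb[OF J sT VW Jm D(2)])
  have K1: "has_bochner_integral (LL n) (?K a c) 1" for a c by (rule K2_bi[OF J sT VW])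
  have "has_bochner_integral (LL n) (\<lambda>z. (\<Sum>a<Ma. ?K a () z) / real Ma) ((\<Sum>a<Ma. 1) / real Ma)"
    by (intro has_bochner_integral_divide_zero has_bochner_integral_sum K1)
  then have J1: "has_bochner_integral (LL n) ?J 1" using Ma by (simp add: Jd_def[abs_def])
  have Jn: "(\<integral>\<^sup>+z. ennreal (?J z) \<partial>LL n) \<le> 1"
    using J1 Jd_pos[OF A J sT VW] by (subst nn_integral_eq_integral) (auto simp: has_bochner_integral_iff less_imp_le)
  have "(1 - e) * ln (real Ma) - ln 2 \<le> - real n * ln (pi * exp 1 * sT) - H n J \<iota> VW - (\<Sum>a<Ma. \<Sum>c\<in>{()}. \<integral>z. K2 n sT J \<iota> VW (x a) 0 g z * ln (?J z) \<partial>LL n) / (real Ma * real (card {()}))"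
  proof (rule fano_2d[OF _ _ Ma J \<psi> sT VW, where cc=1])
    show "(cmod 1)\<^sup>2 * VW + (cmod (1 + 1 * g))\<^sup>2 * sT = 1" using one by simp
    show "(1 - e) * (real Ma * (real (card J) * real (card {()}))) \<le> (\<Sum>a<Ma. \<Sum>c\<in>{()}. \<Sum>b\<in>J. \<integral>y. gd n 1 (y - ((x a + sc 1 0) + sc 1 (\<iota> b))) * indicator {y. \<psi> y = a} y \<partial>Lam n)"
      using s by (simp add: succ_def)
  qed (use i2 Jn Jd_pos[OF A J sT VW] Jd_measurable in auto)
  also have "(\<Sum>a<Ma. \<Sum>c\<in>{()}. \<integral>z. K2 n sT J \<iota> VW (x a) 0 g z * ln (?J z) \<partial>LL n) = (\<integral>z. (\<Sum>a<Ma. ?K a () z * ln (?J z)) \<partial>LL n)"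
    using i2 by (simp add: Bochner_Integration.integral_sum)
  also have "\<dots> = (\<integral>z. real Ma * (?J z * ln (?J z)) \<partial>LL n)"
    using Ma by (intro Bochner_Integration.integral_cong refl) (simp add: Jd_def sum_distrib_right[symmetric])
  also have "\<dots> = - real Ma * Jent n {..<Ma} x J \<iota> sT VW g" by (simp add: Jent_def)
  finally show ?thesis using Ma by simp
qed

section \<open>Gaussian codebooks minimise the information through correlated noise\<close>

lemma mv_compose: "mv N n f \<Longrightarrow> h \<in> measurable M N \<Longrightarrow> mv M n (\<lambda>x. f (h x))"
  unfolding mv_def by (auto intro: measurable_compose)

lemma Jd_hbi:
  assumes "\<And>a. a \<in> A \<Longrightarrow> has_bochner_integral (LL n) (\<lambda>z. K2 n e J \<iota> v (x a) 0 g z * \<phi> z) (V a)"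
  shows "has_bochner_integral (LL n) (\<lambda>z. Jd n A x J \<iota> e v g z * \<phi> z) ((\<Sum>a\<in>A. V a) / real (card A))"
proof -
  have "has_bochner_integral (LL n) (\<lambda>z. (\<Sum>a\<in>A. K2 n e J \<iota> v (x a) 0 g z * \<phi> z) / real (card A)) ((\<Sum>a\<in>A. V a) / real (card A))"
    by (intro has_bochner_integral_divide_zero has_bochner_integral_sum assms)
  then show ?thesis by (simp add: Jd_def sum_distrib_right)
qed

lemma Jd_bi:
  assumes A: "finite A" "A \<noteq> {}" and J: "finite J" "J \<noteq> {}" and e: "0 < e" and v: "0 < v"
  shows "has_bochner_integral (LL n) (Jd n A x J \<iota> e v g) 1"
  using Jd_hbi[of A n e J \<iota> v x g "\<lambda>_. 1" "\<lambda>_. 1"] K2_bi[OF J e v] A by simp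

lemma Jd_integrable_qb:
  assumes A: "finite A" "A \<noteq> {}" and J: "finite J" "J \<noteq> {}" and e: "0 < e" and v: "0 < v"
    and \<phi>: "\<phi> \<in> borel_measurable (LL n)" and b: "\<And>z. \<bar>\<phi> z\<bar> \<le> C * (1 + nsq n (fst z) + nsq n (snd z))"
  shows "integrable (LL n) (\<lambda>z. Jd n A x J \<iota> e v g z * \<phi> z)"
  using Jd_hbi[of A n e J \<iota> v x g \<phi> "\<lambda>a. \<integral>z. K2 n e J \<iota> v (x a) 0 g z * \<phi> z \<partial>LL n"] K2_integrable_qb[OF J e v \<phi> b]
  by (auto simp: has_bochner_integral_iff)

lemma nn_Jd:
  assumes A: "finite A" "A \<noteq> {}" and J: "finite J" "J \<noteq> {}" and e: "0 < e" and v: "0 < v" and F: "F \<in> borel_measurable (LL n)"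
  shows "(\<integral>\<^sup>+z. ennreal (Jd n A x J \<iota> e v g z) * F z \<partial>LL n) = ennreal (1 / real (card A)) * (\<Sum>a\<in>A. \<integral>\<^sup>+z. ennreal (K2 n e J \<iota> v (x a) 0 g z) * F z \<partial>LL n)"
proof -
  have K0: "0 \<le> K2 n e J \<iota> v (x a) 0 g z" for a z using K2_pos[OF J e v, of n \<iota> "x a" 0 g z] by simp
  have Km: "(\<lambda>z. ennreal (K2 n e J \<iota> v (x a) 0 g z)) \<in> borel_measurable (LL n)" for a
    using K2_measurable[of n e J \<iota> v "x a" 0 g] by simp
  have "ennreal (Jd n A x J \<iota> e v g z) * F z = ennreal (1 / real (card A)) * (\<Sum>a\<in>A. ennreal (K2 n e J \<iota> v (x a) 0 g z) * F z)" for z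
  proof -
    have "ennreal (Jd n A x J \<iota> e v g z) = ennreal (1 / real (card A)) * (\<Sum>a\<in>A. ennreal (K2 n e J \<iota> v (x a) 0 g z))"
      unfolding Jd_def using K0 by (simp add: sum_ennreal ennreal_mult[symmetric] sum_nonneg)
    then show ?thesis by (simp only: mult.assoc sum_distrib_right)
  qed
  then have "(\<integral>\<^sup>+z. ennreal (Jd n A x J \<iota> e v g z) * F z \<partial>LL n) = (\<integral>\<^sup>+z. ennreal (1 / real (card A)) * (\<Sum>a\<in>A. ennreal (K2 n e J \<iota> v (x a) 0 g z) * F z) \<partial>LL n)" by (simp only:)
  also have "\<dots> = ennreal (1 / real (card A)) * (\<Sum>a\<in>A. \<integral>\<^sup>+z. ennreal (K2 n e J \<iota> v (x a) 0 g z) * F z \<partial>LL n)"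
    using Km F by (subst nn_integral_cmult) (auto intro!: borel_measurable_sum nn_integral_sum arg_cong2[where f="(*)"])
  finally show ?thesis .
qed

lemma ennreal_fm: "0 < v \<Longrightarrow> ennreal (fm n A x v y) = ennreal (1 / real (card A)) * (\<Sum>a\<in>A. ennreal (gd n v (y - x a)))"
  unfolding fm_def by (simp add: sum_ennreal ennreal_mult[symmetric] sum_nonneg)

lemma nn_Jd_fst:
  assumes A: "finite A" "A \<noteq> {}" and J: "finite J" "J \<noteq> {}" and e: "0 < e" and v: "0 < v" and F: "F \<in> borel_measurable (Lam n)"
  shows "(\<integral>\<^sup>+z. ennreal (Jd n A x J \<iota> e v g z) * F (fst z) \<partial>LL n) = (\<integral>\<^sup>+y. ennreal (fm n A x e y) * F y \<partial>Lam n)"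
proof -
  have "(\<integral>\<^sup>+z. ennreal (Jd n A x J \<iota> e v g z) * F (fst z) \<partial>LL n) = ennreal (1 / real (card A)) * (\<Sum>a\<in>A. \<integral>\<^sup>+y. ennreal (gd n e (y - x a)) * F y \<partial>Lam n)"
    using F by (subst nn_Jd[OF A J e v]) (simp_all add: nn_K2_fst[OF J e v F])
  also have "\<dots> = (\<integral>\<^sup>+y. ennreal (1 / real (card A)) * (\<Sum>a\<in>A. ennreal (gd n e (y - x a)) * F y) \<partial>Lam n)"
    using F by (subst nn_integral_cmult) (auto intro!: borel_measurable_sum borel_measurable_times_ennreal gd_measurable_ennreal mv_id_minus nn_integral_sum[symmetric] arg_cong2[where f="(*)"])
  also have "\<dots> = (\<integral>\<^sup>+y. ennreal (fm n A x e y) * F y \<partial>Lam n)"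
    unfolding ennreal_fm[OF e] by (simp only: mult.assoc sum_distrib_right)
  finally show ?thesis .
qed

lemma nn_Jd_snd:
  assumes A: "finite A" "A \<noteq> {}" and J: "finite J" "J \<noteq> {}" and e: "0 < e" and v: "0 < v" and F: "F \<in> borel_measurable (Lam n)"
  shows "(\<integral>\<^sup>+z. ennreal (Jd n A x J \<iota> e v g z) * F (snd z) \<partial>LL n) = (\<integral>\<^sup>+y. ennreal (fm n J \<iota> (v + (cmod g)\<^sup>2 * e) y) * F y \<partial>Lam n)"
proof -
  have G: "(\<lambda>z. F (snd z)) \<in> borel_measurable (LL n)" using F by simp
  have "ennreal (1 / real (card A)) * of_nat (card A) = 1"
    using A by (simp add: ennreal_of_nat_eq_real_of_nat ennreal_mult[symmetric])
  then show ?thesis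
    unfolding nn_Jd[OF A J e v G] nn_K2_snd[OF J e v F] by (simp add: mult.assoc[symmetric])
qed

lemma Jd_push_fst:
  assumes A: "finite A" "A \<noteq> {}" and J: "finite J" "J \<noteq> {}" and e: "0 < e" and v: "0 < v" and \<phi>: "\<phi> \<in> borel_measurable (Lam n)"
  shows "(\<integral>z. Jd n A x J \<iota> e v g z * \<phi> (fst z) \<partial>LL n) = (\<integral>y. fm n A x e y * \<phi> y \<partial>Lam n)"
  using Jd_pos[OF A J e v, of n x \<iota> g] \<phi>
  by (intro push_integral(2)[OF measurable_fst Jd_measurable]) (auto intro!: fm_measurable mv_basic fm_nonneg e nn_Jd_fst[OF A J e v] simp: less_imp_le)

lemma Jd_push_snd:
  assumes A: "finite A" "A \<noteq> {}" and J: "finite J" "J \<noteq> {}" and e: "0 < e" and v: "0 < v" and \<phi>: "\<phi> \<in> borel_measurable (Lam n)"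
  shows "(\<integral>z. Jd n A x J \<iota> e v g z * \<phi> (snd z) \<partial>LL n) = (\<integral>y. fm n J \<iota> (v + (cmod g)\<^sup>2 * e) y * \<phi> y \<partial>Lam n)"
proof -
  have w: "0 < v + (cmod g)\<^sup>2 * e" using e v by (simp add: add_pos_nonneg)
  show ?thesis
  using Jd_pos[OF A J e v, of n x \<iota> g] \<phi>
  by (intro push_integral(2)[OF measurable_snd Jd_measurable]) (auto intro!: fm_measurable mv_basic fm_nonneg w nn_Jd_snd[OF A J e v] simp: less_imp_le)
qed

text \<open>Noises \<open>C + B\<close> and \<open>g C + A\<close> with independent Gaussian parts:
  given \<open>C + B\<close>, the common part has mean \<open>c / (b + c)\<close> times this sum and
  variance \<open>c * b / (b + c)\<close>. The integral over \<open>C\<close> makes the two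
  coordinates conditionally independent, a form in which sums and differences can be
  followed.\<close>

lemma Jd_common:
  assumes A: "finite A" "A \<noteq> {}" and J: "finite J" "J \<noteq> {}" and c: "0 < c" and b: "0 < b" and a: "0 < a"
  shows "ennreal (Jd n A x J \<iota> (b + c) (a + (cmod g)\<^sup>2 * (c * b / (b + c))) (g * of_real (c / (b + c))) (t, u)) =
    (\<integral>\<^sup>+y. ennreal (gd n c y) * (ennreal (fm n A x b (t - y)) * ennreal (fm n J \<iota> a (u - sc g y))) \<partial>Lam n)"
proof -
  define w k' where "w = b + c" and "k' = complex_of_real (c / w)"
  have w: "0 < w" and cb: "0 < c * b / w" using b c by (auto simp: w_def)
  have vv: "0 < a + (cmod g)\<^sup>2 * (c * b / w)" using a cb by (intro add_pos_nonneg mult_nonneg_nonneg) auto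
  have one: "(\<integral>\<^sup>+y. ennreal (gd n c y) * (ennreal (gd n b (t - y - m)) * ennreal (fm n J \<iota> a (u - sc g y))) \<partial>Lam n)
     = ennreal (gd n w (t - m) * fm n J \<iota> (a + (cmod g)\<^sup>2 * (c * b / w)) (u - sc (g * k') (t - m)))" for m
  proof -
    have sw: "gd n c y * gd n b (t - y - m) = gd n w (t - m) * gd n (c * b / w) (y - sc k' (t - m))" for y
    proof -
      have "gd n c y * gd n b ((t - m) - sc 1 y) = gd n w (t - m) * gd n (c * b / w) (y - sc k' (t - m))"
        by (rule gd_swap[OF c b]) (simp_all add: w_def k'_def)
      moreover have "(t - m) - sc 1 y = t - y - m" by simp
      ultimately show ?thesis by (simp only:)
    qed
    have "(\<integral>\<^sup>+y. ennreal (gd n c y) * (ennreal (gd n b (t - y - m)) * ennreal (fm n J \<iota> a (u - sc g y))) \<partial>Lam n)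
      = (\<integral>\<^sup>+y. ennreal (gd n w (t - m)) * (ennreal (gd n (c * b / w) (y - sc k' (t - m))) * ennreal (fm n J \<iota> a (u - sc g y))) \<partial>Lam n)"
      using b c w cb by (simp only: mult.assoc[symmetric] ennreal_mult[symmetric, OF gd_nonneg gd_nonneg] sw)
    also have "\<dots> = ennreal (gd n w (t - m)) * (\<integral>\<^sup>+y. (ennreal (gd n (c * b / w) (y - sc k' (t - m))) * ennreal (fm n J \<iota> a (u - sc g y))) \<partial>Lam n)"
      by (intro nn_integral_cmult borel_measurable_times_ennreal gd_measurable_ennreal fm_measurable_ennreal mvI mv_basic)
    also have "\<dots> = ennreal (gd n w (t - m)) * ennreal (fm n J \<iota> (a + (cmod g)\<^sup>2 * (c * b / w)) (u - sc g (sc k' (t - m))))"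
      by (subst nn_integral_fm_conv[OF J cb a]) simp
    also have "\<dots> = ennreal (gd n w (t - m) * fm n J \<iota> (a + (cmod g)\<^sup>2 * (c * b / w)) (u - sc (g * k') (t - m)))"
      using w fm_nonneg[OF vv] by (simp only: sc_simps(3)) (intro ennreal_mult[symmetric] gd_nonneg)
    finally show ?thesis .
  qed
  have "(\<integral>\<^sup>+y. ennreal (gd n c y) * (ennreal (fm n A x b (t - y)) * ennreal (fm n J \<iota> a (u - sc g y))) \<partial>Lam n)
    = (\<integral>\<^sup>+y. ennreal (1 / real (card A)) * (\<Sum>m\<in>A. ennreal (gd n c y) * (ennreal (gd n b (t - y - x m)) * ennreal (fm n J \<iota> a (u - sc g y)))) \<partial>Lam n)"
    unfolding ennreal_fm[OF b] by (simp only: sum_distrib_left sum_distrib_right mult_ac)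
  also have "\<dots> = ennreal (1 / real (card A)) * (\<Sum>m\<in>A. \<integral>\<^sup>+y. ennreal (gd n c y) * (ennreal (gd n b (t - y - x m)) * ennreal (fm n J \<iota> a (u - sc g y))) \<partial>Lam n)"
    by (subst nn_integral_cmult) (auto intro!: borel_measurable_sum borel_measurable_times_ennreal gd_measurable_ennreal fm_measurable_ennreal mvI mv_basic nn_integral_sum arg_cong2[where f="(*)"])
  also have "\<dots> = ennreal (1 / real (card A)) * (\<Sum>m\<in>A. ennreal (K2 n w J \<iota> (a + (cmod g)\<^sup>2 * (c * b / w)) (x m) 0 (g * k') (t, u)))"
    unfolding one by (simp only: K2_def fst_conv snd_conv diff_zero)
  also have "\<dots> = ennreal (Jd n A x J \<iota> w (a + (cmod g)\<^sup>2 * (c * b / w)) (g * k') (t, u))"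
    unfolding Jd_def using K2_pos[OF J w vv] by (simp add: sum_ennreal ennreal_mult[symmetric] sum_nonneg less_imp_le)
  finally show ?thesis by (simp add: w_def k'_def)
qed

lemma nn_integral_affine:
  assumes L: "L \<in> borel_measurable (Lam n)" and k: "k \<noteq> 0"
  shows "(\<integral>\<^sup>+m. L m \<partial>Lam n) = ennreal ((cmod k)^(2*n)) * (\<integral>\<^sup>+s. L (rs n (p + sc k s)) \<partial>Lam n)"
proof -
  have L': "(\<lambda>y. L (rs n (y + p))) \<in> borel_measurable (Lam n)"
    by (intro measurable_compose[OF measurable_Lam_mv L] mvI mv_basic)
  have r: "rs n (rs n (sc k s) + p) = rs n (p + sc k s)" for s by (auto simp: fun_eq_iff restrict_def add.commute)
  have "ennreal ((cmod k)^(2*n)) * (\<integral>\<^sup>+s. L (rs n (p + sc k s)) \<partial>Lam n) = ennreal ((cmod k)^(2*n)) * (\<integral>\<^sup>+s. (\<lambda>y. L (rs n (y + p))) (rs n (sc k s)) \<partial>Lam n)"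
    by (simp only: r)
  also have "\<dots> = ennreal ((cmod k)^(2*n)) * (ennreal (1 / (cmod k)^(2*n)) * (\<integral>\<^sup>+y. L (rs n (y + p)) \<partial>Lam n))"
    by (subst nn_integral_Lam_scale[OF L' k]) (rule refl)
  also have "\<dots> = (\<integral>\<^sup>+y. L (rs n (y + p)) \<partial>Lam n)"
    using k by (simp add: mult.assoc[symmetric] ennreal_mult'[symmetric])
  also have "\<dots> = (\<integral>\<^sup>+m. L m \<partial>Lam n)" by (rule nn_integral_translate[OF L])
  finally show ?thesis ..
qed

section \<open>Sums and differences of two independent pairs\<close>

definition hf :: "nat \<Rightarrow> (nat \<Rightarrow> complex) \<times> (nat \<Rightarrow> complex) \<Rightarrow> (nat \<Rightarrow> complex) \<times> (nat \<Rightarrow> complex)" where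
  "hf n z = (rs n (sc (1/2) (fst z + snd z)), rs n (sc (1/2) (fst z - snd z)))"

lemma hf_measurable: "hf n \<in> measurable (LL n) (LL n)"
  unfolding hf_def by (intro measurable_Pair measurable_Lam_mv mvI mv_basic)

text \<open>The half-sum and half-difference map has complex determinant of modulus 1/2, hence real
  Jacobian 1/4, per coordinate.\<close>

lemma nn_integral_hf:
  assumes K: "K \<in> borel_measurable (LL n)"
  shows "(\<integral>\<^sup>+z. K (hf n z) \<partial>LL n) = ennreal (4^n) * (\<integral>\<^sup>+z. K z \<partial>LL n)"
proof -
  have Kh: "(\<lambda>z. K (hf n z)) \<in> borel_measurable (LL n)" by (rule measurable_compose[OF hf_measurable K])
  have Ks: "(\<lambda>z. K (rs n (fst z - snd z), snd z)) \<in> borel_measurable (LL n)"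
    by (intro measurable_compose[OF _ K] measurable_Pair measurable_Lam_mv mvI mv_basic measurable_snd)
  have inner: "(\<integral>\<^sup>+m. K (hf n (p, m)) \<partial>Lam n) = ennreal (4^n) * (\<integral>\<^sup>+s. K (rs n (p - s), s) \<partial>Lam n)" if p: "p \<in> space (Lam n)" for p
  proof -
    have L: "(\<lambda>m. K (hf n (p, m))) \<in> borel_measurable (Lam n)" using Kh p by simp
    have "(\<integral>\<^sup>+m. K (hf n (p, m)) \<partial>Lam n) = ennreal ((cmod (- 2))^(2*n)) * (\<integral>\<^sup>+s. K (hf n (p, rs n (p + sc (- 2) s))) \<partial>Lam n)"
      by (rule nn_integral_affine[OF L]) simp
    also have "(\<integral>\<^sup>+s. K (hf n (p, rs n (p + sc (- 2) s))) \<partial>Lam n) = (\<integral>\<^sup>+s. K (rs n (p - s), s) \<partial>Lam n)"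
    proof (intro nn_integral_cong arg_cong[where f=K])
      fix s assume s: "s \<in> space (Lam n)"
      have "rs n (sc (1/2) (p - rs n (p + sc (- 2) s))) = rs n s" by (auto simp: fun_eq_iff restrict_def field_simps)
      moreover have "rs n (sc (1/2) (p + rs n (p + sc (- 2) s))) = rs n (p - s)" by (auto simp: fun_eq_iff restrict_def algebra_simps)
      ultimately show "hf n (p, rs n (p + sc (- 2) s)) = (rs n (p - s), s)" using s by (simp only: hf_def fst_conv snd_conv rs_space_Lam)
    qed
    finally show ?thesis by (simp add: power_mult)
  qed
  have Ksm: "(\<lambda>p. \<integral>\<^sup>+s. K (rs n (p - s), s) \<partial>Lam n) \<in> borel_measurable (Lam n)"
    using sigma_finite_measure.borel_measurable_nn_integral[OF sigma_finite_Lam, of "\<lambda>p s. K (rs n (p - s), s)" "Lam n" n] Ks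
    by (simp add: split_beta')
  have "(\<integral>\<^sup>+z. K (hf n z) \<partial>LL n) = (\<integral>\<^sup>+p. ennreal (4^n) * (\<integral>\<^sup>+s. K (rs n (p - s), s) \<partial>Lam n) \<partial>Lam n)"
    unfolding nn_LL[OF Kh] by (intro nn_integral_cong inner)
  also have "\<dots> = ennreal (4^n) * (\<integral>\<^sup>+p. \<integral>\<^sup>+s. K (rs n (p - s), s) \<partial>Lam n \<partial>Lam n)"
    by (rule nn_integral_cmult[OF Ksm])
  also have "(\<integral>\<^sup>+p. \<integral>\<^sup>+s. K (rs n (p - s), s) \<partial>Lam n \<partial>Lam n) = (\<integral>\<^sup>+s. \<integral>\<^sup>+p. K (rs n (p - s), s) \<partial>Lam n \<partial>Lam n)"
    using nn_LL[OF Ks] nn_LL'[OF Ks] by simp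
  also have "\<dots> = (\<integral>\<^sup>+s. \<integral>\<^sup>+p. K (p, s) \<partial>Lam n \<partial>Lam n)"
  proof (rule nn_integral_cong)
    fix s assume s: "s \<in> space (Lam n)"
    have "(\<lambda>p. K (p, s)) \<in> borel_measurable (Lam n)" using K s by simp
    from nn_integral_translate[OF this, of "- s"] show "(\<integral>\<^sup>+p. K (rs n (p - s), s) \<partial>Lam n) = (\<integral>\<^sup>+p. K (p, s) \<partial>Lam n)" by simp
  qed
  also have "\<dots> = (\<integral>\<^sup>+z. K z \<partial>LL n)" by (rule nn_LL'[OF K, symmetric])
  finally show ?thesis .
qed

text \<open>The density of \<open>(Y\<^sub>1 + Y\<^sub>2, Y\<^sub>1 - Y\<^sub>2)\<close> for independent \<open>Y\<^sub>1\<close>, \<open>Y\<^sub>2\<close>, the first a noisy codeword and the second Gaussian.\<close>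

definition FA where
  "FA n A x b1 b2 z = fm n A x b1 (sc (1/2) (fst z + snd z)) * gd n b2 (sc (1/2) (fst z - snd z)) / 4^n"

lemma FA_measurable: "mv M n f \<Longrightarrow> mv M n h \<Longrightarrow> (\<lambda>z. FA n A x b1 b2 (f z, h z)) \<in> borel_measurable M"
  unfolding FA_def fst_conv snd_conv by (intro borel_measurable_times borel_measurable_divide fm_measurable gd_measurable mvI borel_measurable_const)

lemma FA_pos: "finite A \<Longrightarrow> A \<noteq> {} \<Longrightarrow> 0 < b1 \<Longrightarrow> 0 < b2 \<Longrightarrow> 0 < FA n A x b1 b2 z"
  unfolding FA_def by (intro divide_pos_pos mult_pos_pos fm_pos gd_pos) auto

lemma nn_FA_snd:
  assumes A: "finite A" "A \<noteq> {}" and b: "0 < b1" "0 < b2"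
  shows "(\<integral>\<^sup>+m. ennreal (FA n A x b1 b2 (p, m)) \<partial>Lam n) = ennreal (fm n A x (b1 + b2) p)"
proof -
  have L: "(\<lambda>m. ennreal (FA n A x b1 b2 (p, m))) \<in> borel_measurable (Lam n)"
    using FA_measurable[of "Lam n" n "\<lambda>_. p" "\<lambda>m. m" A x b1 b2] by (simp add: mvI mv_basic)
  have F4: "(4::real)^n = (2^n)^2" by (simp add: power2_eq_square power_mult_distrib[symmetric])
  have "(\<integral>\<^sup>+m. ennreal (FA n A x b1 b2 (p, m)) \<partial>Lam n) = ennreal ((cmod (- 2))^(2*n)) * (\<integral>\<^sup>+s. ennreal (FA n A x b1 b2 (p, rs n (p + sc (- 2) s))) \<partial>Lam n)"
    by (rule nn_integral_affine[OF L]) simp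
  also have "\<dots> = (\<integral>\<^sup>+s. ennreal ((cmod (- 2))^(2*n)) * ennreal (FA n A x b1 b2 (p, rs n (p + sc (- 2) s))) \<partial>Lam n)"
    by (rule nn_integral_cmult[symmetric]) (use FA_measurable[of "Lam n" n "\<lambda>_. p" "\<lambda>s. rs n (p + sc (- 2) s)" A x b1 b2] in \<open>simp add: mvI mv_basic\<close>)
  also have "\<dots> = (\<integral>\<^sup>+s. ennreal (gd n b2 (s - 0)) * ennreal (fm n A x b1 (p - sc 1 s)) \<partial>Lam n)"
  proof (intro nn_integral_cong)
    fix s
    have 1: "fm n A x b1 (sc (1/2) (p + rs n (p + sc (- 2) s))) = fm n A x b1 (p - sc 1 s)" by (rule fm_cong) (simp add: algebra_simps)
    have 2: "gd n b2 (sc (1/2) (p - rs n (p + sc (- 2) s))) = gd n b2 (s - 0)" by (rule gd_cong) (simp add: field_simps)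
    have 4: "(cmod (- 2))^(2*n) = 4^n" by (simp add: power_mult)
    show "ennreal ((cmod (- 2))^(2*n)) * ennreal (FA n A x b1 b2 (p, rs n (p + sc (- 2) s))) = ennreal (gd n b2 (s - 0)) * ennreal (fm n A x b1 (p - sc 1 s))"
      unfolding FA_def fst_conv snd_conv 1 2 4 using fm_nonneg[OF b(1)] gd_nonneg[OF b(2)]
      by (subst (1 2) ennreal_mult[symmetric]) (auto intro!: divide_nonneg_nonneg mult_nonneg_nonneg simp: mult.commute)
  qed
  also have "\<dots> = ennreal (fm n A x (b1 + (cmod 1)\<^sup>2 * b2) (p - sc 1 0))" by (rule nn_integral_fm_conv[OF A b(2,1)])
  finally show ?thesis by simp
qed

text \<open>Exchanging sum and difference only reflects the Gaussian summand, whose density is even.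
  Thus the difference has the same law as the sum.\<close>

lemma FA_swap: "FA n A x b1 b2 (p, m) = FA n A x b1 b2 (m, p)"
proof -
  have "sc (1/2) (p - m) = - sc (1/2) (m - p)" by (auto simp: fun_eq_iff algebra_simps)
  then show ?thesis unfolding FA_def fst_conv snd_conv by (simp only: gd_uminus add.commute)
qed

lemma nn_FA_fst:
  assumes A: "finite A" "A \<noteq> {}" and b: "0 < b1" "0 < b2"
  shows "(\<integral>\<^sup>+p. ennreal (FA n A x b1 b2 (p, m)) \<partial>Lam n) = ennreal (fm n A x (b1 + b2) m)"
  using nn_FA_snd[OF A b, of n x m] by (simp only: FA_swap[of _ _ _ _ _ _ m])

lemma gd_le: "0 < v \<Longrightarrow> gd n v y \<le> 1 / (pi * v)^n"
  unfolding gd_def by (intro divide_right_mono) auto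

lemma fm_le: assumes "finite A" "A \<noteq> {}" "0 < v" shows "fm n A x v y \<le> 1 / (pi * v)^n"
proof -
  have "(\<Sum>a\<in>A. gd n v (y - x a)) \<le> real (card A) * (1 / (pi * v)^n)"
    using gd_le[OF assms(3)] by (intro sum_bounded_above) auto
  then show ?thesis using assms unfolding fm_def by (simp add: pos_divide_le_eq card_gt_0_iff mult.commute)
qed

lemma sigma_finite_LL: "sigma_finite_measure (LL n)"
  by (rule sigma_finite_pair_measure) simp_all

lemma pair_LL_Lam: "pair_sigma_finite (LL n) (Lam n)" "pair_sigma_finite (LL n) (LL n)"
  using sigma_finite_LL by (auto intro!: pair_sigma_finite.intro)

lemma swap_LL_Lam:
  assumes "(\<lambda>p. f (fst p) (snd p)) \<in> borel_measurable (LL n \<Otimes>\<^sub>M Lam n)"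
  shows "(\<integral>\<^sup>+y. \<integral>\<^sup>+c. f c y \<partial>LL n \<partial>Lam n) = (\<integral>\<^sup>+c. \<integral>\<^sup>+y. f c y \<partial>Lam n \<partial>LL n)"
  using pair_sigma_finite.Fubini'[OF pair_LL_Lam(1), of f n] assms by (simp add: split_beta')

lemma swap_Lam:
  assumes "(\<lambda>p. f (fst p) (snd p)) \<in> borel_measurable (LL n)"
  shows "(\<integral>\<^sup>+y. \<integral>\<^sup>+c. f c y \<partial>Lam n \<partial>Lam n) = (\<integral>\<^sup>+c. \<integral>\<^sup>+y. f c y \<partial>Lam n \<partial>Lam n)"
  using pair_sigma_finite.Fubini'[OF pair_Lam, of f n] assms by (simp add: split_beta')

lemma Jd_cong: "(\<And>t. t < n \<Longrightarrow> fst z t = fst z' t) \<Longrightarrow> (\<And>t. t < n \<Longrightarrow> snd z t = snd z' t) \<Longrightarrow> Jd n A x J \<iota> e v g z = Jd n A x J \<iota> e v g z'"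
  unfolding Jd_def K2_def by (intro arg_cong2[where f="(/)"] sum.cong arg_cong2[where f="(*)"] gd_cong fm_cong) auto

lemma FA_cong: "(\<And>t. t < n \<Longrightarrow> fst z t = fst z' t) \<Longrightarrow> (\<And>t. t < n \<Longrightarrow> snd z t = snd z' t) \<Longrightarrow> FA n A x b1 b2 z = FA n A x b1 b2 z'"
  unfolding FA_def by (intro arg_cong2[where f="(/)"] arg_cong2[where f="(*)"] gd_cong fm_cong) auto

lemma Jd_mv: "mv M n f \<Longrightarrow> mv M n h \<Longrightarrow> (\<lambda>z. Jd n A x J \<iota> e v g (f z, h z)) \<in> borel_measurable M"
  unfolding Jd_def K2_def fst_conv snd_conv
  by (intro borel_measurable_times borel_measurable_divide borel_measurable_sum fm_measurable gd_measurable mvI borel_measurable_const)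

lemma nn_FA_shift:
  assumes A: "finite A" "A \<noteq> {}" and b: "0 < b1" "0 < b2"
  shows "(\<integral>\<^sup>+p. ennreal (FA n A x b1 b2 (p - s, m)) \<partial>Lam n) = ennreal (fm n A x (b1 + b2) m)"
    and "(\<integral>\<^sup>+m. ennreal (FA n A x b1 b2 (p, m - s)) \<partial>Lam n) = ennreal (fm n A x (b1 + b2) p)"
proof -
  have L: "(\<lambda>p. ennreal (FA n A x b1 b2 (p, m))) \<in> borel_measurable (Lam n)"
    using FA_measurable[of "Lam n" n "\<lambda>p. p" "\<lambda>_. m" A x b1 b2] by (simp add: mvI mv_basic)
  have "(\<integral>\<^sup>+p. ennreal (FA n A x b1 b2 (p - s, m)) \<partial>Lam n) = (\<integral>\<^sup>+p. ennreal (FA n A x b1 b2 (rs n (p + (- s)), m)) \<partial>Lam n)"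
    by (intro nn_integral_cong arg_cong[where f=ennreal] FA_cong) auto
  also have "\<dots> = (\<integral>\<^sup>+p. ennreal (FA n A x b1 b2 (p, m)) \<partial>Lam n)" by (rule nn_integral_translate[OF L])
  finally show "(\<integral>\<^sup>+p. ennreal (FA n A x b1 b2 (p - s, m)) \<partial>Lam n) = ennreal (fm n A x (b1 + b2) m)" by (simp only: nn_FA_fst[OF A b])
  have L: "(\<lambda>m. ennreal (FA n A x b1 b2 (p, m))) \<in> borel_measurable (Lam n)"
    using FA_measurable[of "Lam n" n "\<lambda>_. p" "\<lambda>m. m" A x b1 b2] by (simp add: mvI mv_basic)
  have "(\<integral>\<^sup>+m. ennreal (FA n A x b1 b2 (p, m - s)) \<partial>Lam n) = (\<integral>\<^sup>+m. ennreal (FA n A x b1 b2 (p, rs n (m + (- s)))) \<partial>Lam n)"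
    by (intro nn_integral_cong arg_cong[where f=ennreal] FA_cong) auto
  also have "\<dots> = (\<integral>\<^sup>+m. ennreal (FA n A x b1 b2 (p, m)) \<partial>Lam n)" by (rule nn_integral_translate[OF L])
  finally show "(\<integral>\<^sup>+m. ennreal (FA n A x b1 b2 (p, m - s)) \<partial>Lam n) = ennreal (fm n A x (b1 + b2) p)" by (simp only: nn_FA_snd[OF A b])
qed

text \<open>The two noises are \<open>C + B'\<close> and \<open>g C + A'\<close> with independent components of variances \<open>c\<close>, \<open>b\<close>, \<open>a\<close>.\<close>

abbreviation JC where
  "JC n A x J \<iota> c b a g \<equiv> Jd n A x J \<iota> (b + c) (a + (cmod g)\<^sup>2 * (c * b / (b + c))) (g * of_real (c / (b + c)))"

text \<open>The law of sum and difference of two independent Gaussian vectors of equal variance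
  \<open>c\<close>: they are again independent, with variance \<open>2 * c\<close>.\<close>

definition GG where "GG n c z = gd n (2 * c) (fst z) * gd n (2 * c) (snd z)"

lemma GG_pos: "0 < c \<Longrightarrow> 0 < GG n c z"
  by (simp add: GG_def)

lemma GG_mv: "mv M n f \<Longrightarrow> mv M n h \<Longrightarrow> (\<lambda>z. GG n c (f z, h z)) \<in> borel_measurable M"
  unfolding GG_def fst_conv snd_conv by (intro borel_measurable_times gd_measurable)

text \<open>In \<open>T\<close> and \<open>U\<close> the first vector belongs to the sums and the
  second to the differences. Conditioned on the sum and difference of the two common noises,
  \<open>T\<close> and \<open>U\<close> are independent, and this integral averages over the
  condition.\<close>

definition pE where
  "pE n A x b1 b2 J \<iota> a1 a2 c g T U = (\<integral>\<^sup>+z. ennreal (GG n c z) * (ennreal (FA n A x b1 b2 (fst T - fst z, snd T - snd z)) * ennreal (FA n J \<iota> a1 a2 (fst U - sc g (fst z), snd U - sc g (snd z)))) \<partial>LL n)"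

text \<open>Parallelogram law in the exponent.\<close>

lemma gd_half: assumes "0 < c" shows "gd n c (sc (1/2) (p + m)) * gd n c (sc (1/2) (p - m)) = 4^n * (gd n (2*c) p * gd n (2*c) m)"
proof -
  have E: "exp (- X / c) * exp (- Y / c) = exp (- u / (2*c)) * exp (- w / (2*c))" if "X + Y = (u + w) / 2" for X Y u w :: real
  proof -
    have "- X / c + - Y / c = - (X + Y) / c" by (simp add: add_divide_distrib diff_divide_distrib)
    also have "\<dots> = - u / (2*c) + - w / (2*c)" unfolding that using assms by (simp add: field_simps)
    finally show ?thesis by (simp only: exp_add[symmetric])
  qed
  have "nsq n (sc (1/2) (p + m)) + nsq n (sc (1/2) (p - m)) = (nsq n p + nsq n m) / 2"
    unfolding nsq_sc nsq_add nsq_diff by (simp add: power2_eq_square field_simps)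
  then have 1: "exp (- nsq n (sc (1/2) (p + m)) / c) * exp (- nsq n (sc (1/2) (p - m)) / c) = exp (- nsq n p / (2*c)) * exp (- nsq n m / (2*c))"
    by (rule E)
  have 2: "(pi * (2 * c))^n * (pi * (2 * c))^n = 4^n * ((pi * c)^n * (pi * c)^n)"
    unfolding power_mult_distrib[symmetric] by (simp add: mult_ac)
  have "gd n c (sc (1/2) (p + m)) * gd n c (sc (1/2) (p - m)) = exp (- nsq n p / (2*c)) * exp (- nsq n m / (2*c)) / ((pi * c)^n * (pi * c)^n)"
    unfolding gd_def times_divide_times_eq 1 ..
  also have "\<dots> = 4^n * (exp (- nsq n p / (2*c)) * exp (- nsq n m / (2*c)) / ((pi * (2 * c))^n * (pi * (2 * c))^n))"
    unfolding 2 by simp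
  finally show ?thesis unfolding gd_def times_divide_times_eq .
qed

lemma nn_prod_LL:
  assumes "P \<in> borel_measurable (Lam n)" "Q \<in> borel_measurable (Lam n)"
  shows "(\<integral>\<^sup>+z. P (fst z) * Q (snd z) \<partial>LL n) = (\<integral>\<^sup>+y. P y \<partial>Lam n) * (\<integral>\<^sup>+y. Q y \<partial>Lam n)"
  using assms by (subst nn_LL) (auto simp: nn_integral_cmult nn_integral_multc)

text \<open>Index 1 is the pair with codebooks, index 2 a purely Gaussian pair. Both share
  \<open>g\<close> and the variance \<open>c\<close> of the common noise: only for equal variances
  are the sum and the difference of the common noises independent, on which the whole argument
  rests.\<close>

locale two_copies =
  fixes n :: nat and A :: "'a set" and x :: "'a \<Rightarrow> nat \<Rightarrow> complex" and J :: "'w set" and \<iota> :: "'w \<Rightarrow> nat \<Rightarrow> complex" and b1 b2 a1 a2 c :: real and g :: complex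
  assumes A: "finite A" "A \<noteq> {}" and J: "finite J" "J \<noteq> {}"
    and b: "0 < b1" "0 < b2" and a: "0 < a1" "0 < a2" and c: "0 < c"
begin

abbreviation "\<phi>1 \<equiv> JC n A x J \<iota> c b1 a1 g"
abbreviation "\<phi>2 \<equiv> JC n {()} (\<lambda>_. 0) {()} (\<lambda>_. 0) c b2 a2 g"
abbreviation "\<phi>' \<equiv> JC n A x J \<iota> (2 * c) (b1 + b2) (a1 + a2) g"
abbreviation "PE \<equiv> pE n A x b1 b2 J \<iota> a1 a2 c g"

text \<open>The density of the sums and differences of the pair \<open>\<phi>1\<close> and an independent Gaussian pair \<open>\<phi>2\<close>.\<close>

definition P4 where
  "P4 T U = \<phi>1 (sc (1/2) (fst T + snd T), sc (1/2) (fst U + snd U)) * \<phi>2 (sc (1/2) (fst T - snd T), sc (1/2) (fst U - snd U)) / 16^n"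

lemma vpos: "0 < a' \<Longrightarrow> 0 < b' \<Longrightarrow> 0 < c' \<Longrightarrow> 0 < a' + (cmod g)\<^sup>2 * (c' * b' / (b' + c'))"
  by (intro add_pos_nonneg mult_nonneg_nonneg divide_nonneg_nonneg) auto

lemma JC_pos: "0 < \<phi>1 z" "0 < \<phi>2 z" "0 < \<phi>' z"
  using A J a b c by (intro Jd_pos vpos; simp)+

lemma P4_pos: "0 < P4 T U"
  unfolding P4_def using JC_pos by simp

lemma JC_rep:
  "ennreal (\<phi>1 (t, u)) = (\<integral>\<^sup>+y. ennreal (gd n c y) * (ennreal (fm n A x b1 (t - y)) * ennreal (fm n J \<iota> a1 (u - sc g y))) \<partial>Lam n)"
  "ennreal (\<phi>2 (t, u)) = (\<integral>\<^sup>+y. ennreal (gd n c y) * (ennreal (gd n b2 (t - y)) * ennreal (gd n a2 (u - sc g y))) \<partial>Lam n)"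
  "ennreal (\<phi>' (t, u)) = (\<integral>\<^sup>+y. ennreal (gd n (2 * c) y) * (ennreal (fm n A x (b1 + b2) (t - y)) * ennreal (fm n J \<iota> (a1 + a2) (u - sc g y))) \<partial>Lam n)"
  using Jd_common[OF A J c b(1) a(1), of n x \<iota> g t u] Jd_common[of "{()}" "{()}" c b2 a2 n "\<lambda>_. 0" "\<lambda>_. 0" g t u]
    Jd_common[OF A J, of "2 * c" "b1 + b2" "a1 + a2" n x \<iota> g t u] a b c
  by (auto simp: fm_def)

text \<open>Change of variables under the integrals over the two common noises. All Jacobians are
  powers of 4 and cancel. The gain is a formula in which each marginal can be computed by
  integrating one factor at a time.\<close>

lemma P4_PE: "ennreal (P4 T U) = PE T U"
proof -
  let ?t1 = "sc (1/2) (fst T + snd T)" and ?t2 = "sc (1/2) (fst T - snd T)" and ?u1 = "sc (1/2) (fst U + snd U)" and ?u2 = "sc (1/2) (fst U - snd U)"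
  let ?P = "\<lambda>y. ennreal (gd n c y) * (ennreal (fm n A x b1 (?t1 - y)) * ennreal (fm n J \<iota> a1 (?u1 - sc g y)))"
  let ?Q = "\<lambda>y. ennreal (gd n c y) * (ennreal (gd n b2 (?t2 - y)) * ennreal (gd n a2 (?u2 - sc g y)))"
  let ?K = "\<lambda>z. ?P (fst z) * ?Q (snd z)"
  let ?I = "\<lambda>z. ennreal (GG n c z) * (ennreal (FA n A x b1 b2 (fst T - fst z, snd T - snd z)) * ennreal (FA n J \<iota> a1 a2 (fst U - sc g (fst z), snd U - sc g (snd z))))"
  have PQ: "?P \<in> borel_measurable (Lam n)" "?Q \<in> borel_measurable (Lam n)"
    by (intro borel_measurable_times_ennreal gd_measurable_ennreal fm_measurable_ennreal mvI mv_basic)+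
  have Km: "?K \<in> borel_measurable (LL n)"
    by (intro borel_measurable_times_ennreal gd_measurable_ennreal fm_measurable_ennreal mvI mv_basic)
  have Im: "?I \<in> borel_measurable (LL n)"
  proof -
    have "(\<lambda>z. GG n c (fst z, snd z)) \<in> borel_measurable (LL n)" by (intro GG_mv mv_basic)
    moreover have "(\<lambda>z. FA n A x b1 b2 (fst T - fst z, snd T - snd z)) \<in> borel_measurable (LL n)" by (intro FA_measurable mvI mv_basic)
    moreover have "(\<lambda>z. FA n J \<iota> a1 a2 (fst U - sc g (fst z), snd U - sc g (snd z))) \<in> borel_measurable (LL n)" by (intro FA_measurable mvI mv_basic)
    ultimately show ?thesis by simp
  qed
  have KI: "?K (hf n z) = ennreal (64^n) * ?I z" for z
  proof -
    have 1: "gd n c (fst (hf n z)) * gd n c (snd (hf n z)) = 4^n * GG n c z"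
    proof -
      have "gd n c (fst (hf n z)) = gd n c (sc (1/2) (fst z + snd z))" "gd n c (snd (hf n z)) = gd n c (sc (1/2) (fst z - snd z))"
        unfolding hf_def fst_conv snd_conv by (intro gd_cong; simp)+
      then show ?thesis using gd_half[OF c, of n "fst z" "snd z"] by (simp only: GG_def)
    qed
    have 2: "fm n A x b1 (?t1 - fst (hf n z)) * gd n b2 (?t2 - snd (hf n z)) = 4^n * FA n A x b1 b2 (fst T - fst z, snd T - snd z)"
    proof -
      have "fm n A x b1 (?t1 - fst (hf n z)) = fm n A x b1 (sc (1/2) ((fst T - fst z) + (snd T - snd z)))"
        unfolding hf_def fst_conv by (rule fm_cong) (simp add: field_simps)
      moreover have "gd n b2 (?t2 - snd (hf n z)) = gd n b2 (sc (1/2) ((fst T - fst z) - (snd T - snd z)))"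
        unfolding hf_def snd_conv by (rule gd_cong) (simp add: field_simps)
      ultimately show ?thesis by (simp only: FA_def fst_conv snd_conv) simp
    qed
    have 3: "fm n J \<iota> a1 (?u1 - sc g (fst (hf n z))) * gd n a2 (?u2 - sc g (snd (hf n z))) = 4^n * FA n J \<iota> a1 a2 (fst U - sc g (fst z), snd U - sc g (snd z))"
    proof -
      have "fm n J \<iota> a1 (?u1 - sc g (fst (hf n z))) = fm n J \<iota> a1 (sc (1/2) ((fst U - sc g (fst z)) + (snd U - sc g (snd z))))"
        unfolding hf_def fst_conv by (rule fm_cong) (simp add: field_simps)
      moreover have "gd n a2 (?u2 - sc g (snd (hf n z))) = gd n a2 (sc (1/2) ((fst U - sc g (fst z)) - (snd U - sc g (snd z))))"
        unfolding hf_def snd_conv by (rule gd_cong) (simp add: field_simps)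
      ultimately show ?thesis by (simp only: FA_def fst_conv snd_conv) simp
    qed
    have nn: "0 \<le> FA n A x b1 b2 w" "0 \<le> FA n J \<iota> a1 a2 w" "0 \<le> GG n c w" for w
      using FA_pos[OF A b] FA_pos[OF J a] GG_pos[OF c] by (auto simp: less_imp_le)
    have "?K (hf n z) = ennreal (gd n c (fst (hf n z)) * gd n c (snd (hf n z))) * (ennreal (fm n A x b1 (?t1 - fst (hf n z)) * gd n b2 (?t2 - snd (hf n z))) * ennreal (fm n J \<iota> a1 (?u1 - sc g (fst (hf n z))) * gd n a2 (?u2 - sc g (snd (hf n z)))))"
      using c b a by (simp only: ennreal_mult gd_nonneg fm_nonneg) (simp only: mult_ac)
    also have "\<dots> = ennreal (4^n) * ennreal (GG n c z) * (ennreal (4^n) * ennreal (FA n A x b1 b2 (fst T - fst z, snd T - snd z)) * (ennreal (4^n) * ennreal (FA n J \<iota> a1 a2 (fst U - sc g (fst z), snd U - sc g (snd z)))))"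
      unfolding 1 2 3 using nn by (simp only: ennreal_mult zero_le_power zero_le_numeral)
    also have "\<dots> = (ennreal (4^n) * ennreal (4^n) * ennreal (4^n)) * ?I z" by (simp only: mult_ac)
    also have "ennreal (4^n) * ennreal (4^n) * ennreal (4^n) = ennreal (64^n)"
      by (simp add: ennreal_mult'[symmetric] power_mult_distrib[symmetric])
    finally show ?thesis .
  qed
  have "ennreal (4^n) * (\<integral>\<^sup>+z. ?K z \<partial>LL n) = (\<integral>\<^sup>+z. ?K (hf n z) \<partial>LL n)" by (rule nn_integral_hf[OF Km, symmetric])
  also have "\<dots> = ennreal (64^n) * PE T U" unfolding KI pE_def by (rule nn_integral_cmult[OF Im])
  finally have 4: "ennreal (4^n) * (\<integral>\<^sup>+z. ?K z \<partial>LL n) = ennreal (64^n) * PE T U" .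
  have "(\<integral>\<^sup>+z. ?K z \<partial>LL n) = ennreal (\<phi>1 (?t1, ?u1)) * ennreal (\<phi>2 (?t2, ?u2))"
    unfolding JC_rep by (rule nn_prod_LL[OF PQ])
  also have "\<dots> = ennreal (16^n) * ennreal (P4 T U)"
    using JC_pos by (simp add: P4_def ennreal_mult[symmetric] less_imp_le)
  finally have "ennreal (4^n) * (ennreal (16^n) * ennreal (P4 T U)) = ennreal (64^n) * PE T U" using 4 by simp
  then have "ennreal (64^n) * ennreal (P4 T U) = ennreal (64^n) * PE T U"
    by (simp add: mult.assoc[symmetric] ennreal_mult'[symmetric] power_mult_distrib[symmetric])
  then have "ennreal (1 / 64^n) * (ennreal (64^n) * ennreal (P4 T U)) = ennreal (1 / 64^n) * (ennreal (64^n) * PE T U)" by (simp only:)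
  then show ?thesis by (simp add: mult.assoc[symmetric] ennreal_mult'[symmetric])
qed

text \<open>The marginal density of \<open>T\<close> together with the difference coordinate of
  \<open>U\<close>.\<close>

definition mE where
  "mE T u = (\<integral>\<^sup>+z. ennreal (GG n c z) * (ennreal (FA n A x b1 b2 (fst T - fst z, snd T - snd z)) * ennreal (fm n J \<iota> (a1 + a2) (u - sc g (snd z)))) \<partial>LL n)"

lemma mvs: "mv (LL n \<Otimes>\<^sub>M M') n (\<lambda>p. fst (fst p))" "mv (LL n \<Otimes>\<^sub>M M') n (\<lambda>p. snd (fst p))"
  "mv (M' \<Otimes>\<^sub>M LL n) n (\<lambda>p. fst (snd p))" "mv (M' \<Otimes>\<^sub>M LL n) n (\<lambda>p. snd (snd p))"
  by (auto intro: mv_compose[OF mv_basic(2)] mv_compose[OF mv_basic(3)])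

lemma GGp_measurable: "(\<lambda>p. ennreal (GG n c (fst p))) \<in> borel_measurable (LL n \<Otimes>\<^sub>M M')"
proof -
  have "(\<lambda>p. GG n c (fst (fst p), snd (fst p))) \<in> borel_measurable (LL n \<Otimes>\<^sub>M M')" by (intro GG_mv mvs)
  then show ?thesis by simp
qed

lemma GG1_measurable: "(\<lambda>z. ennreal (GG n c z)) \<in> borel_measurable (LL n)"
  using GG_mv[OF mv_basic(2) mv_basic(3), of n c] by simp

lemma FA_ennreal_measurable: "mv M n f \<Longrightarrow> mv M n h \<Longrightarrow> (\<lambda>z. ennreal (FA n A' x' b1' b2' (f z, h z))) \<in> borel_measurable M"
  using FA_measurable by (intro measurable_compose[OF _ measurable_ennreal])

lemma PE_fst: "(\<integral>\<^sup>+u. PE T (u, m) \<partial>Lam n) = mE T m"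
proof -
  have "(\<integral>\<^sup>+u. PE T (u, m) \<partial>Lam n) = (\<integral>\<^sup>+z. \<integral>\<^sup>+u. ennreal (GG n c z) * (ennreal (FA n A x b1 b2 (fst T - fst z, snd T - snd z)) * ennreal (FA n J \<iota> a1 a2 (u - sc g (fst z), m - sc g (snd z)))) \<partial>Lam n \<partial>LL n)"
    unfolding pE_def fst_conv snd_conv
    by (rule swap_LL_Lam) (intro borel_measurable_times_ennreal GGp_measurable FA_ennreal_measurable mvI mvs mv_basic)
  also have "\<dots> = mE T m" unfolding mE_def
  proof (intro nn_integral_cong)
    fix z
    show "(\<integral>\<^sup>+u. ennreal (GG n c z) * (ennreal (FA n A x b1 b2 (fst T - fst z, snd T - snd z)) * ennreal (FA n J \<iota> a1 a2 (u - sc g (fst z), m - sc g (snd z)))) \<partial>Lam n)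
       = ennreal (GG n c z) * (ennreal (FA n A x b1 b2 (fst T - fst z, snd T - snd z)) * ennreal (fm n J \<iota> (a1 + a2) (m - sc g (snd z))))"
      unfolding mult.assoc[symmetric]
      by (subst nn_integral_cmult) (auto simp: nn_FA_shift[OF J a] intro!: FA_ennreal_measurable mvI mv_basic)
  qed
  finally show ?thesis .
qed

lemma c2: "0 < 2 * c" and ab2: "0 < b1 + b2" "0 < a1 + a2" using c a b by auto

text \<open>The sum coordinate of \<open>T\<close> contains only the sum of the common noises and
  the difference coordinate of \<open>U\<close> only their difference. These are independent, so the
  density becomes a product; this independence drives the two-copies inequality.\<close>

lemma mE_snd: "(\<integral>\<^sup>+m. mE (t, m) u \<partial>Lam n) = ennreal (fm n A x (b1 + b2 + 2 * c) t) * ennreal (fm n J \<iota> (a1 + a2 + (cmod g)\<^sup>2 * (2 * c)) u)"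
proof -
  have "(\<integral>\<^sup>+m. mE (t, m) u \<partial>Lam n) = (\<integral>\<^sup>+z. \<integral>\<^sup>+m. ennreal (GG n c z) * (ennreal (FA n A x b1 b2 (t - fst z, m - snd z)) * ennreal (fm n J \<iota> (a1 + a2) (u - sc g (snd z)))) \<partial>Lam n \<partial>LL n)"
    unfolding mE_def fst_conv snd_conv
    by (rule swap_LL_Lam) (intro borel_measurable_times_ennreal GGp_measurable FA_ennreal_measurable fm_measurable_ennreal mvI mvs mv_basic)
  also have "\<dots> = (\<integral>\<^sup>+z. (ennreal (gd n (2 * c) (fst z - 0)) * ennreal (fm n A x (b1 + b2) (t - sc 1 (fst z)))) * (ennreal (gd n (2 * c) (snd z - 0)) * ennreal (fm n J \<iota> (a1 + a2) (u - sc g (snd z)))) \<partial>LL n)"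
  proof (intro nn_integral_cong)
    fix z
    have "(\<integral>\<^sup>+m. ennreal (GG n c z) * (ennreal (FA n A x b1 b2 (t - fst z, m - snd z)) * ennreal (fm n J \<iota> (a1 + a2) (u - sc g (snd z)))) \<partial>Lam n)
       = (\<integral>\<^sup>+m. (ennreal (GG n c z) * ennreal (fm n J \<iota> (a1 + a2) (u - sc g (snd z)))) * ennreal (FA n A x b1 b2 (t - fst z, m - snd z)) \<partial>Lam n)"
      by (simp only: mult_ac)
    also have "\<dots> = (ennreal (GG n c z) * ennreal (fm n J \<iota> (a1 + a2) (u - sc g (snd z)))) * ennreal (fm n A x (b1 + b2) (t - fst z))"
      by (subst nn_integral_cmult) (auto simp: nn_FA_shift[OF A b] intro!: FA_ennreal_measurable mvI mv_basic)
    finally show "(\<integral>\<^sup>+m. ennreal (GG n c z) * (ennreal (FA n A x b1 b2 (t - fst z, m - snd z)) * ennreal (fm n J \<iota> (a1 + a2) (u - sc g (snd z)))) \<partial>Lam n)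
      = (ennreal (gd n (2 * c) (fst z - 0)) * ennreal (fm n A x (b1 + b2) (t - sc 1 (fst z)))) * (ennreal (gd n (2 * c) (snd z - 0)) * ennreal (fm n J \<iota> (a1 + a2) (u - sc g (snd z))))"
      using c by (simp add: GG_def ennreal_mult mult_ac)
  qed
  also have "\<dots> = (\<integral>\<^sup>+y. ennreal (gd n (2 * c) (y - 0)) * ennreal (fm n A x (b1 + b2) (t - sc 1 y)) \<partial>Lam n) * (\<integral>\<^sup>+y. ennreal (gd n (2 * c) (y - 0)) * ennreal (fm n J \<iota> (a1 + a2) (u - sc g y)) \<partial>Lam n)"
    by (rule nn_prod_LL) (intro borel_measurable_times_ennreal gd_measurable_ennreal fm_measurable_ennreal mvI mv_basic)+
  also have "\<dots> = ennreal (fm n A x (b1 + b2 + (cmod 1)\<^sup>2 * (2 * c)) (t - sc 1 0)) * ennreal (fm n J \<iota> (a1 + a2 + (cmod g)\<^sup>2 * (2 * c)) (u - sc g 0))"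
    by (simp only: nn_integral_fm_conv[OF A c2 ab2(1)] nn_integral_fm_conv[OF J c2 ab2(2)])
  finally show ?thesis by simp
qed

lemma gd1: "(\<integral>\<^sup>+y. ennreal (gd n (2 * c) y) \<partial>Lam n) = 1"
  using nn_integral_gd[OF c2, of n 0] by simp

text \<open>In the differences the codebooks appear once, with a common noise of variance
  \<open>2 * c\<close> and private noises of added variances, so their pair has the law
  \<open>\<phi>'\<close>.\<close>

lemma mE_fst: "(\<integral>\<^sup>+p. mE (p, t) u \<partial>Lam n) = ennreal (\<phi>' (t, u))"
proof -
  have "(\<integral>\<^sup>+p. mE (p, t) u \<partial>Lam n) = (\<integral>\<^sup>+z. \<integral>\<^sup>+p. ennreal (GG n c z) * (ennreal (FA n A x b1 b2 (p - fst z, t - snd z)) * ennreal (fm n J \<iota> (a1 + a2) (u - sc g (snd z)))) \<partial>Lam n \<partial>LL n)"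
    unfolding mE_def fst_conv snd_conv
    by (rule swap_LL_Lam) (intro borel_measurable_times_ennreal GGp_measurable FA_ennreal_measurable fm_measurable_ennreal mvI mvs mv_basic)
  also have "\<dots> = (\<integral>\<^sup>+z. ennreal (gd n (2 * c) (fst z)) * (ennreal (gd n (2 * c) (snd z)) * (ennreal (fm n A x (b1 + b2) (t - snd z)) * ennreal (fm n J \<iota> (a1 + a2) (u - sc g (snd z))))) \<partial>LL n)"
  proof (intro nn_integral_cong)
    fix z
    have "(\<integral>\<^sup>+p. ennreal (GG n c z) * (ennreal (FA n A x b1 b2 (p - fst z, t - snd z)) * ennreal (fm n J \<iota> (a1 + a2) (u - sc g (snd z)))) \<partial>Lam n)
       = (\<integral>\<^sup>+p. (ennreal (GG n c z) * ennreal (fm n J \<iota> (a1 + a2) (u - sc g (snd z)))) * ennreal (FA n A x b1 b2 (p - fst z, t - snd z)) \<partial>Lam n)"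
      by (simp only: mult_ac)
    also have "\<dots> = (ennreal (GG n c z) * ennreal (fm n J \<iota> (a1 + a2) (u - sc g (snd z)))) * ennreal (fm n A x (b1 + b2) (t - snd z))"
      by (subst nn_integral_cmult) (auto simp: nn_FA_shift[OF A b] intro!: FA_ennreal_measurable mvI mv_basic)
    finally show "(\<integral>\<^sup>+p. ennreal (GG n c z) * (ennreal (FA n A x b1 b2 (p - fst z, t - snd z)) * ennreal (fm n J \<iota> (a1 + a2) (u - sc g (snd z)))) \<partial>Lam n)
      = ennreal (gd n (2 * c) (fst z)) * (ennreal (gd n (2 * c) (snd z)) * (ennreal (fm n A x (b1 + b2) (t - snd z)) * ennreal (fm n J \<iota> (a1 + a2) (u - sc g (snd z)))))"
      using c by (simp add: GG_def ennreal_mult mult_ac)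
  qed
  also have "\<dots> = (\<integral>\<^sup>+y. ennreal (gd n (2 * c) y) \<partial>Lam n) * (\<integral>\<^sup>+y. ennreal (gd n (2 * c) y) * (ennreal (fm n A x (b1 + b2) (t - y)) * ennreal (fm n J \<iota> (a1 + a2) (u - sc g y))) \<partial>Lam n)"
    by (rule nn_prod_LL) (intro borel_measurable_times_ennreal gd_measurable_ennreal fm_measurable_ennreal mvI mv_basic)+
  finally show ?thesis by (simp only: gd1 JC_rep mult_1_left)
qed

end

text \<open>Law of total variance for the common noise given the first noise: explained part plus
  residual part is \<open>c\<close>.\<close>

lemma JC_snd_var:
  assumes "0 < b" "0 < c"
  shows "a + (cmod g)\<^sup>2 * (c * b / (b + c)) + (cmod (g * of_real (c / (b + c))))\<^sup>2 * (b + c) = a + (cmod g)\<^sup>2 * c"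
proof -
  have "(cmod (g * of_real (c / (b + c))))\<^sup>2 * (b + c) = (cmod g)\<^sup>2 * (c * c / (b + c))"
  proof -
    have "cmod (g * of_real (c / (b + c))) = cmod g * (c / (b + c))" using assms by (simp only: norm_mult norm_of_real) simp
    then show ?thesis using assms by (simp add: power_mult_distrib power_divide power2_eq_square)
  qed
  moreover have "c * b / (b + c) + c * c / (b + c) = c" using assms by (simp add: add_divide_distrib[symmetric] field_simps)
  ultimately show ?thesis by (simp only: add.assoc distrib_left[symmetric])
qed

lemma Jd_ent_integrable:
  assumes A: "finite A" "A \<noteq> {}" and J: "finite J" "J \<noteq> {}" and e: "0 < e" and v: "0 < v"
  shows "integrable (LL n) (\<lambda>z. Jd n A x J \<iota> e v g z * ln (Jd n A x J \<iota> e v g z))"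
proof -
  obtain C where "\<And>z. \<bar>ln (Jd n A x J \<iota> e v g z)\<bar> \<le> C * (1 + nsq n (fst z) + nsq n (snd z))" using ln_Jd_qb[OF A J e v] by blast
  then show ?thesis using Jd_measurable[of n A x J \<iota> e v g] by (intro Jd_integrable_qb[OF A J e v]) auto
qed

lemma Jd_fst_ln:
  assumes A: "finite A" "A \<noteq> {}" and J: "finite J" "J \<noteq> {}" and e: "0 < e" and v: "0 < v"
  shows "has_bochner_integral (LL n) (\<lambda>z. Jd n A x J \<iota> e v g z * ln (fm n A x e (fst z))) (- H n A x e)"
proof -
  have m: "(\<lambda>y. ln (fm n A x e y)) \<in> borel_measurable (Lam n)" by (intro ln_fm_measurable mv_basic)
  then have "integrable (LL n) (\<lambda>z. Jd n A x J \<iota> e v g z * ln (fm n A x e (fst z))) \<longleftrightarrow> integrable (Lam n) (\<lambda>y. fm n A x e y * ln (fm n A x e y))"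
    using Jd_pos[OF A J e v, of n x \<iota> g]
    by (intro push_integral(1)[OF measurable_fst Jd_measurable]) (auto intro!: fm_measurable mv_basic fm_nonneg e nn_Jd_fst[OF A J e v] simp: less_imp_le)
  with Jd_push_fst[OF A J e v m, of x \<iota> g] show ?thesis unfolding has_bochner_integral_iff H_def minus_minus
    using H_integrable[OF A e, of n x] by simp
qed

lemma Jd_snd_ln:
  assumes A: "finite A" "A \<noteq> {}" and J: "finite J" "J \<noteq> {}" and e: "0 < e" and v: "0 < v" and w: "w = v + (cmod g)\<^sup>2 * e"
  shows "has_bochner_integral (LL n) (\<lambda>z. Jd n A x J \<iota> e v g z * ln (fm n J \<iota> w (snd z))) (- H n J \<iota> w)"
proof -
  have w0: "0 < w" using e v by (simp add: w add_pos_nonneg)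
  have m: "(\<lambda>y. ln (fm n J \<iota> w y)) \<in> borel_measurable (Lam n)" by (intro ln_fm_measurable mv_basic)
  then have "integrable (LL n) (\<lambda>z. Jd n A x J \<iota> e v g z * ln (fm n J \<iota> w (snd z))) \<longleftrightarrow> integrable (Lam n) (\<lambda>y. fm n J \<iota> w y * ln (fm n J \<iota> w y))"
    using Jd_pos[OF A J e v, of n x \<iota> g]
    by (intro push_integral(1)[OF measurable_snd Jd_measurable]) (auto intro!: fm_measurable mv_basic fm_nonneg w0 nn_Jd_snd[OF A J e v, of _ _ _ _ g, folded w] simp: less_imp_le)
  with Jd_push_snd[OF A J e v m, of x \<iota> g, folded w] show ?thesis unfolding has_bochner_integral_iff H_def minus_minus
    using H_integrable[OF J w0, of n \<iota>] by simp
qed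

section \<open>The two-copies inequality\<close>

context two_copies begin

abbreviation "MM \<equiv> LL n \<Otimes>\<^sub>M LL n"
definition "P4' w = P4 (fst w) (snd w)"
abbreviation "gA \<equiv> fm n A x (b1 + b2 + 2 * c)"
abbreviation "gB \<equiv> fm n J \<iota> (a1 + a2 + (cmod g)\<^sup>2 * (2 * c))"
abbreviation "vB1 \<equiv> a1 + (cmod g)\<^sup>2 * c"
abbreviation "vB2 \<equiv> a2 + (cmod g)\<^sup>2 * c"

lemma vB: "0 < vB1" "0 < vB2" "0 < a1 + a2 + (cmod g)\<^sup>2 * (2 * c)" "0 < b1 + c" "0 < b2 + c" "0 < b1 + b2 + 2 * c"
  using a b c by (auto intro!: add_pos_nonneg)

lemma P4_mv:
  assumes "mv N n f1" "mv N n f2" "mv N n f3" "mv N n f4"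
  shows "(\<lambda>z. P4 (f1 z, f2 z) (f3 z, f4 z)) \<in> borel_measurable N"
  unfolding P4_def fst_conv snd_conv using assms by (intro borel_measurable_times borel_measurable_divide Jd_mv mvI borel_measurable_const)

lemma P4'_measurable: "P4' \<in> borel_measurable MM"
proof -
  have "(\<lambda>w. P4 (fst (fst w), snd (fst w)) (fst (snd w), snd (snd w))) \<in> borel_measurable MM"
    by (intro P4_mv mvs)
  then show ?thesis by (simp add: P4'_def[abs_def])
qed

lemma P4_pair_measurable: "(\<lambda>w. P4 (fst w) (snd w)) \<in> borel_measurable MM"
  using P4'_measurable by (simp add: P4'_def[abs_def])

lemma mE_P4: "mE T m = (\<integral>\<^sup>+u. ennreal (P4 T (u, m)) \<partial>Lam n)"
  unfolding P4_PE PE_fst ..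

lemma mv3: "mv ((LL n \<Otimes>\<^sub>M M') \<Otimes>\<^sub>M M'') n (\<lambda>q. fst (fst (fst q)))" "mv ((LL n \<Otimes>\<^sub>M M') \<Otimes>\<^sub>M M'') n (\<lambda>q. snd (fst (fst q)))"
  "mv ((M' \<Otimes>\<^sub>M Lam n) \<Otimes>\<^sub>M M'') n (\<lambda>q. snd (fst q))"
proof -
  show "mv ((LL n \<Otimes>\<^sub>M M') \<Otimes>\<^sub>M M'') n (\<lambda>q. fst (fst (fst q)))" by (rule mv_compose[OF mv_basic(2)[where M'="Lam n"], where h="\<lambda>q. fst (fst q)"]) simp
  show "mv ((LL n \<Otimes>\<^sub>M M') \<Otimes>\<^sub>M M'') n (\<lambda>q. snd (fst (fst q)))" by (rule mv_compose[OF mv_basic(3)[where M'="Lam n"], where h="\<lambda>q. fst (fst q)"]) simp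
  show "mv ((M' \<Otimes>\<^sub>M Lam n) \<Otimes>\<^sub>M M'') n (\<lambda>q. snd (fst q))" by (rule mv_compose[OF mv_basic(3)[where M'=M'], where h=fst]) simp
qed

lemma mE_measurable: "(\<lambda>p. mE (fst p) (snd p)) \<in> borel_measurable (LL n \<Otimes>\<^sub>M Lam n)"
proof -
  have "(\<lambda>q. P4 (fst (fst (fst q)), snd (fst (fst q))) (snd q, snd (fst q))) \<in> borel_measurable ((LL n \<Otimes>\<^sub>M Lam n) \<Otimes>\<^sub>M Lam n)"
    by (intro P4_mv mv3 mv_basic)
  then show ?thesis unfolding mE_P4
    using sigma_finite_measure.borel_measurable_nn_integral[OF sigma_finite_Lam, of "\<lambda>p u. ennreal (P4 (fst p) (u, snd p))" "LL n \<Otimes>\<^sub>M Lam n" n]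
    by (simp add: split_beta')
qed

lemma nn_MM: "F \<in> borel_measurable MM \<Longrightarrow> (\<integral>\<^sup>+w. F w \<partial>MM) = (\<integral>\<^sup>+T. \<integral>\<^sup>+U. F (T, U) \<partial>LL n \<partial>LL n)"
  by (rule sigma_finite_measure.nn_integral_fst[OF sigma_finite_LL, symmetric])

lemma nn_MM': "F \<in> borel_measurable MM \<Longrightarrow> (\<integral>\<^sup>+w. F w \<partial>MM) = (\<integral>\<^sup>+U. \<integral>\<^sup>+T. F (T, U) \<partial>LL n \<partial>LL n)"
  by (rule pair_sigma_finite.nn_integral_snd[OF pair_LL_Lam(2), symmetric])

lemma nn_P4_minus:
  assumes F: "F \<in> borel_measurable (LL n)"
  shows "(\<integral>\<^sup>+w. ennreal (P4' w) * F (snd (fst w), snd (snd w)) \<partial>MM) = (\<integral>\<^sup>+z. ennreal (\<phi>' z) * F z \<partial>LL n)"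
proof -
  have Fm: "(\<lambda>w. F (snd (fst w), snd (snd w))) \<in> borel_measurable MM" using F by simp
  have "(\<integral>\<^sup>+w. ennreal (P4' w) * F (snd (fst w), snd (snd w)) \<partial>MM) = (\<integral>\<^sup>+T. \<integral>\<^sup>+U. ennreal (P4 T U) * F (snd T, snd U) \<partial>LL n \<partial>LL n)"
    using P4_pair_measurable Fm by (subst nn_MM) (auto simp: P4'_def)
  also have "\<dots> = (\<integral>\<^sup>+T. \<integral>\<^sup>+u. mE T u * F (snd T, u) \<partial>Lam n \<partial>LL n)"
  proof (rule nn_integral_cong)
    fix T assume T: "T \<in> space (LL n)"
    have "snd T \<in> space (Lam n)" using T by (auto simp: space_pair_measure)
    then have Fu: "(\<lambda>U. F (snd T, snd U)) \<in> borel_measurable (LL n)" "(\<lambda>u. F (snd T, u)) \<in> borel_measurable (Lam n)" using F by auto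
    have P: "(\<lambda>U. ennreal (P4 T U)) \<in> borel_measurable (LL n)"
      using P4_mv[of "LL n" "\<lambda>_. fst T" "\<lambda>_. snd T" fst snd] by (simp add: mvI mv_basic)
    have "(\<integral>\<^sup>+U. ennreal (P4 T U) * F (snd T, snd U) \<partial>LL n) = (\<integral>\<^sup>+m. \<integral>\<^sup>+u. ennreal (P4 T (u, m)) * F (snd T, m) \<partial>Lam n \<partial>Lam n)"
      using P Fu by (subst nn_LL') auto
    also have "\<dots> = (\<integral>\<^sup>+u. mE T u * F (snd T, u) \<partial>Lam n)"
    proof (rule nn_integral_cong)
      fix m
      have "(\<lambda>u. ennreal (P4 T (u, m))) \<in> borel_measurable (Lam n)"
        using P4_mv[of "Lam n" "\<lambda>_. fst T" "\<lambda>_. snd T" "\<lambda>u. u" "\<lambda>_. m"] by (simp add: mvI mv_basic)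
      then show "(\<integral>\<^sup>+u. ennreal (P4 T (u, m)) * F (snd T, m) \<partial>Lam n) = mE T m * F (snd T, m)"
        unfolding mE_P4 by (rule nn_integral_multc)
    qed
    finally show "(\<integral>\<^sup>+U. ennreal (P4 T U) * F (snd T, snd U) \<partial>LL n) = (\<integral>\<^sup>+u. mE T u * F (snd T, u) \<partial>Lam n)" .
  qed
  also have "\<dots> = (\<integral>\<^sup>+u. \<integral>\<^sup>+T. mE T u * F (snd T, u) \<partial>LL n \<partial>Lam n)"
    by (rule swap_LL_Lam[symmetric]) (intro borel_measurable_times_ennreal mE_measurable, use F in simp)
  also have "\<dots> = (\<integral>\<^sup>+u. \<integral>\<^sup>+t. ennreal (\<phi>' (t, u)) * F (t, u) \<partial>Lam n \<partial>Lam n)"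
  proof (rule nn_integral_cong)
    fix u assume u: "u \<in> space (Lam n)"
    have M: "(\<lambda>T. mE T u) \<in> borel_measurable (LL n)" using measurable_compose[OF measurable_Pair2'[OF u] mE_measurable] by simp
    have "(\<lambda>T. F (snd T, u)) \<in> borel_measurable (LL n)" using F u by simp
    then have "(\<integral>\<^sup>+T. mE T u * F (snd T, u) \<partial>LL n) = (\<integral>\<^sup>+t. \<integral>\<^sup>+p. mE (p, t) u * F (t, u) \<partial>Lam n \<partial>Lam n)"
      using M by (subst nn_LL') auto
    also have "\<dots> = (\<integral>\<^sup>+t. ennreal (\<phi>' (t, u)) * F (t, u) \<partial>Lam n)"
    proof (rule nn_integral_cong)
      fix t assume t: "t \<in> space (Lam n)"
      have "(\<lambda>p. mE (p, t) u) \<in> borel_measurable (Lam n)" using M t by simp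
      then show "(\<integral>\<^sup>+p. mE (p, t) u * F (t, u) \<partial>Lam n) = ennreal (\<phi>' (t, u)) * F (t, u)"
        unfolding mE_fst[symmetric] by (rule nn_integral_multc)
    qed
    finally show "(\<integral>\<^sup>+T. mE T u * F (snd T, u) \<partial>LL n) = (\<integral>\<^sup>+t. ennreal (\<phi>' (t, u)) * F (t, u) \<partial>Lam n)" .
  qed
  also have "\<dots> = (\<integral>\<^sup>+z. ennreal (\<phi>' z) * F z \<partial>LL n)"
    by (subst nn_LL') (intro borel_measurable_times_ennreal measurable_compose[OF Jd_measurable measurable_ennreal] F, rule refl)
  finally show ?thesis .
qed

text \<open>Exchanging sums and differences reflects the Gaussian pair, whose law is symmetric.
  Statements on differences therefore transfer to sums.\<close>

lemma P4_swap: "P4 (snd T, fst T) (snd U, fst U) = P4 T U"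
proof -
  have m: "sc (1/2) (b - a) = - sc (1/2) (a - b)" for a b by (auto simp: fun_eq_iff algebra_simps)
  have "\<phi>2 (- t, - z) = \<phi>2 (t, z)" for t z
  proof -
    have "- z - sc k (- t) = - (z - sc k t)" for k by (auto simp: fun_eq_iff)
    then have "gd n v (- z - sc k (- t)) = gd n v (z - sc k t)" for v k by (simp only: gd_uminus)
    then show ?thesis by (simp add: Jd_def K2_def fm_def gd_uminus del: of_real_divide)
  qed
  then show ?thesis unfolding P4_def fst_conv snd_conv m[of "snd T" "fst T"] m[of "snd U" "fst U"] by (simp only: add.commute)
qed

lemma nn_MM_swap:
  assumes F: "F \<in> borel_measurable MM"
  shows "(\<integral>\<^sup>+w. F ((snd (fst w), fst (fst w)), (snd (snd w), fst (snd w))) \<partial>MM) = (\<integral>\<^sup>+w. F w \<partial>MM)"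
proof -
  have sw: "(\<lambda>z. (snd z, fst z)) \<in> measurable (LL n) (LL n)" by simp
  have swap: "(\<integral>\<^sup>+z. G (snd z, fst z) \<partial>LL n) = (\<integral>\<^sup>+z. G z \<partial>LL n)" if "G \<in> borel_measurable (LL n)" for G
    using nn_LL[OF measurable_compose[OF sw that]] nn_LL'[OF that] by simp
  have M: "(\<lambda>T. \<integral>\<^sup>+U. F (T, U) \<partial>LL n) \<in> borel_measurable (LL n)"
    using sigma_finite_measure.borel_measurable_nn_integral[OF sigma_finite_LL, of "\<lambda>T U. F (T, U)" "LL n" n] F by simp
  have "(\<integral>\<^sup>+w. F ((snd (fst w), fst (fst w)), (snd (snd w), fst (snd w))) \<partial>MM) = (\<integral>\<^sup>+T. \<integral>\<^sup>+U. F ((snd T, fst T), (snd U, fst U)) \<partial>LL n \<partial>LL n)"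
    using F by (subst nn_MM) auto
  also have "\<dots> = (\<integral>\<^sup>+T. \<integral>\<^sup>+U. F ((snd T, fst T), U) \<partial>LL n \<partial>LL n)"
    using measurable_space[OF sw] F by (intro nn_integral_cong swap) auto
  also have "\<dots> = (\<integral>\<^sup>+w. F w \<partial>MM)" unfolding nn_MM[OF F] by (rule swap[OF M])
  finally show ?thesis .
qed

lemma nn_P4_plus:
  assumes F: "F \<in> borel_measurable (LL n)"
  shows "(\<integral>\<^sup>+w. ennreal (P4' w) * F (fst (fst w), fst (snd w)) \<partial>MM) = (\<integral>\<^sup>+z. ennreal (\<phi>' z) * F z \<partial>LL n)"
proof -
  have "(\<lambda>w. ennreal (P4' w) * F (fst (fst w), fst (snd w))) \<in> borel_measurable MM"
    using P4'_measurable F by simp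
  from nn_MM_swap[OF this] show ?thesis using nn_P4_minus[OF F] by (simp add: P4'_def P4_swap)
qed

lemma nn_hf_hf:
  assumes G: "G \<in> borel_measurable MM"
  shows "(\<integral>\<^sup>+T. \<integral>\<^sup>+U. G (hf n T, hf n U) \<partial>LL n \<partial>LL n) = ennreal (16^n) * (\<integral>\<^sup>+w. G w \<partial>MM)"
proof -
  have hs: "hf n T \<in> space (LL n)" if "T \<in> space (LL n)" for T using measurable_space[OF hf_measurable that] .
  have GT: "(\<lambda>U. G (T, U)) \<in> borel_measurable (LL n)" if "T \<in> space (LL n)" for T using G that by simp
  have M: "(\<lambda>T. \<integral>\<^sup>+U. G (T, U) \<partial>LL n) \<in> borel_measurable (LL n)"
    using sigma_finite_measure.borel_measurable_nn_integral[OF sigma_finite_LL, of "\<lambda>T U. G (T, U)" "LL n" n] G by simp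
  have "(\<integral>\<^sup>+T. \<integral>\<^sup>+U. G (hf n T, hf n U) \<partial>LL n \<partial>LL n) = (\<integral>\<^sup>+T. ennreal (4^n) * (\<integral>\<^sup>+U. G (hf n T, U) \<partial>LL n) \<partial>LL n)"
    by (rule nn_integral_cong) (rule nn_integral_hf[OF GT[OF hs]])
  also have "\<dots> = ennreal (4^n) * (\<integral>\<^sup>+T. (\<integral>\<^sup>+U. G (hf n T, U) \<partial>LL n) \<partial>LL n)"
    by (rule nn_integral_cmult) (rule measurable_compose[OF hf_measurable M])
  also have "\<dots> = ennreal (4^n) * (ennreal (4^n) * (\<integral>\<^sup>+T. (\<integral>\<^sup>+U. G (T, U) \<partial>LL n) \<partial>LL n))"
    by (subst nn_integral_hf[OF M]) (rule refl)
  also have "\<dots> = ennreal (16^n) * (\<integral>\<^sup>+w. G w \<partial>MM)"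
    unfolding nn_MM[OF G] by (simp add: mult.assoc[symmetric] ennreal_mult'[symmetric] power_mult_distrib[symmetric])
  finally show ?thesis .
qed

abbreviation "h1 w \<equiv> (fst (hf n (fst w)), fst (hf n (snd w)))"
abbreviation "h2 w \<equiv> (snd (hf n (fst w)), snd (hf n (snd w)))"

lemma P4_h: "P4' w = \<phi>1 (h1 w) * \<phi>2 (h2 w) / 16^n"
proof -
  have "\<phi>1 (h1 w) = \<phi>1 (sc (1/2) (fst (fst w) + snd (fst w)), sc (1/2) (fst (snd w) + snd (snd w)))"
    by (rule Jd_cong) (simp_all add: hf_def)
  moreover have "\<phi>2 (h2 w) = \<phi>2 (sc (1/2) (fst (fst w) - snd (fst w)), sc (1/2) (fst (snd w) - snd (snd w)))"
    by (rule Jd_cong) (simp_all add: hf_def)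
  ultimately show ?thesis by (simp only: P4'_def P4_def)
qed

lemma split4: "(\<integral>\<^sup>+w. F (fst (fst w), fst (snd w)) * G (snd (fst w), snd (snd w)) \<partial>MM) = (\<integral>\<^sup>+z. F z \<partial>LL n) * (\<integral>\<^sup>+z. G z \<partial>LL n)"
  if F: "F \<in> borel_measurable (LL n)" and G: "G \<in> borel_measurable (LL n)"
proof -
  have Fm: "(\<lambda>w. F (fst (fst w), fst (snd w)) * G (snd (fst w), snd (snd w))) \<in> borel_measurable MM" using F G by simp
  have FT: "(\<lambda>u. F (t, u)) \<in> borel_measurable (Lam n)" "(\<lambda>u. G (t, u)) \<in> borel_measurable (Lam n)" if "t \<in> space (Lam n)" for t using F G that by auto
  have M: "(\<lambda>t. \<integral>\<^sup>+u. F (t, u) \<partial>Lam n) \<in> borel_measurable (Lam n)" "(\<lambda>t. \<integral>\<^sup>+u. G (t, u) \<partial>Lam n) \<in> borel_measurable (Lam n)"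
    using sigma_finite_measure.borel_measurable_nn_integral[OF sigma_finite_Lam, of "\<lambda>t u. F (t, u)" "Lam n" n]
      sigma_finite_measure.borel_measurable_nn_integral[OF sigma_finite_Lam, of "\<lambda>t u. G (t, u)" "Lam n" n] F G by simp_all
  have "(\<integral>\<^sup>+w. F (fst (fst w), fst (snd w)) * G (snd (fst w), snd (snd w)) \<partial>MM) = (\<integral>\<^sup>+T. \<integral>\<^sup>+U. F (fst T, fst U) * G (snd T, snd U) \<partial>LL n \<partial>LL n)"
    using Fm by (subst nn_MM) auto
  also have "\<dots> = (\<integral>\<^sup>+T. (\<integral>\<^sup>+u. F (fst T, u) \<partial>Lam n) * (\<integral>\<^sup>+u. G (snd T, u) \<partial>Lam n) \<partial>LL n)"
    by (rule nn_integral_cong, rule nn_prod_LL) (auto intro!: FT simp: space_pair_measure)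
  also have "\<dots> = (\<integral>\<^sup>+t. \<integral>\<^sup>+u. F (t, u) \<partial>Lam n \<partial>Lam n) * (\<integral>\<^sup>+t. \<integral>\<^sup>+u. G (t, u) \<partial>Lam n \<partial>Lam n)"
    by (rule nn_prod_LL[OF M])
  also have "\<dots> = (\<integral>\<^sup>+z. F z \<partial>LL n) * (\<integral>\<^sup>+z. G z \<partial>LL n)" unfolding nn_LL[OF F] nn_LL[OF G] ..
  finally show ?thesis .
qed

lemma JC_vpos: "0 < b1 + c" "0 < a1 + (cmod g)\<^sup>2 * (c * b1 / (b1 + c))" "0 < b2 + c" "0 < a2 + (cmod g)\<^sup>2 * (c * b2 / (b2 + c))"
  "0 < b1 + b2 + 2 * c" "0 < a1 + a2 + (cmod g)\<^sup>2 * (2 * c * (b1 + b2) / (b1 + b2 + 2 * c))"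
  using a b c vpos[of a1 b1 c] vpos[of a2 b2 c] vpos[of "a1 + a2" "b1 + b2" "2 * c"] by auto

lemma JC_one: "(\<integral>\<^sup>+z. ennreal (\<phi>1 z) \<partial>LL n) = 1" "(\<integral>\<^sup>+z. ennreal (\<phi>2 z) \<partial>LL n) = 1"
  using nn_Jd_fst[OF A J JC_vpos(1,2), of "\<lambda>_. 1" n x \<iota> "g * of_real (c / (b1 + c))"] nn_integral_fm[OF A JC_vpos(1), of n x 0]
    nn_Jd_fst[of "{()}" "{()}", OF _ _ _ _ JC_vpos(3,4), of "\<lambda>_. 1" n "\<lambda>_. 0" "\<lambda>_. 0" "g * of_real (c / (b2 + c))"] nn_integral_fm[of "{()}", OF _ _ JC_vpos(3), of n "\<lambda>_. 0" 0]
  by (simp_all del: of_real_divide)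

text \<open>Undoing the change of variables returns the two independent pairs; the factor
  \<open>16^n\<close> of the Jacobian cancels the one in \<open>P4\<close>.\<close>

lemma nn_P4_h:
  assumes F: "F \<in> borel_measurable (LL n)"
  shows "(\<integral>\<^sup>+w. ennreal (P4' w) * F (h1 w) \<partial>MM) = (\<integral>\<^sup>+z. ennreal (\<phi>1 z) * F z \<partial>LL n)"
    and "(\<integral>\<^sup>+w. ennreal (P4' w) * F (h2 w) \<partial>MM) = (\<integral>\<^sup>+z. ennreal (\<phi>2 z) * F z \<partial>LL n)"
proof -
  have P: "(\<lambda>z. ennreal (\<phi>1 z)) \<in> borel_measurable (LL n)" "(\<lambda>z. ennreal (\<phi>2 z)) \<in> borel_measurable (LL n)"
    using Jd_measurable by (auto intro!: measurable_compose[OF Jd_measurable measurable_ennreal])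
  have one: "ennreal (1 / 16^n) * (ennreal (16^n) * y) = y" for y by (simp add: mult.assoc[symmetric] ennreal_mult'[symmetric])
  have eP: "ennreal (P4' w) = ennreal (1 / 16^n) * (ennreal (\<phi>1 (h1 w)) * ennreal (\<phi>2 (h2 w)))" for w
    unfolding P4_h using JC_pos by (simp add: ennreal_mult[symmetric] less_imp_le)
  have hm: "(\<lambda>w. h1 w) \<in> measurable MM (LL n)" "(\<lambda>w. h2 w) \<in> measurable MM (LL n)"
    by (auto intro!: measurable_Pair measurable_compose[OF _ measurable_fst] measurable_compose[OF _ measurable_snd] measurable_compose[OF _ hf_measurable])
  have main: "(\<integral>\<^sup>+w. ennreal (P4' w) * K (h1 w) * L (h2 w) \<partial>MM) = (\<integral>\<^sup>+z. ennreal (\<phi>1 z) * K z \<partial>LL n) * (\<integral>\<^sup>+z. ennreal (\<phi>2 z) * L z \<partial>LL n)"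
    if K: "K \<in> borel_measurable (LL n)" and L: "L \<in> borel_measurable (LL n)" for K L
  proof -
    let ?G = "\<lambda>w. (ennreal (\<phi>1 (fst (fst w), fst (snd w))) * K (fst (fst w), fst (snd w))) * (ennreal (\<phi>2 (snd (fst w), snd (snd w))) * L (snd (fst w), snd (snd w)))"
    have c1: "(\<lambda>w. (fst (fst w), fst (snd w))) \<in> measurable MM (LL n)" "(\<lambda>w. (snd (fst w), snd (snd w))) \<in> measurable MM (LL n)" by simp_all
    have G: "?G \<in> borel_measurable MM"
      by (intro borel_measurable_times_ennreal measurable_compose[OF c1(1) P(1)] measurable_compose[OF c1(2) P(2)] measurable_compose[OF c1(1) K] measurable_compose[OF c1(2) L])
    have G': "(\<lambda>w. ?G (hf n (fst w), hf n (snd w))) \<in> borel_measurable MM"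
      by (rule measurable_compose[OF _ G]) (intro measurable_Pair measurable_compose[OF measurable_fst hf_measurable] measurable_compose[OF measurable_snd hf_measurable])
    have "(\<integral>\<^sup>+w. ennreal (P4' w) * K (h1 w) * L (h2 w) \<partial>MM) = (\<integral>\<^sup>+w. ennreal (1 / 16^n) * ?G (hf n (fst w), hf n (snd w)) \<partial>MM)"
      unfolding eP fst_conv snd_conv by (intro nn_integral_cong) (simp only: mult_ac)
    also have "\<dots> = ennreal (1 / 16^n) * (\<integral>\<^sup>+w. ?G (hf n (fst w), hf n (snd w)) \<partial>MM)" by (rule nn_integral_cmult[OF G'])
    also have "(\<integral>\<^sup>+w. ?G (hf n (fst w), hf n (snd w)) \<partial>MM) = ennreal (16^n) * (\<integral>\<^sup>+w. ?G w \<partial>MM)"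
      unfolding nn_MM[OF G'] using nn_hf_hf[OF G] by simp
    also have "(\<integral>\<^sup>+w. ?G w \<partial>MM) = (\<integral>\<^sup>+z. ennreal (\<phi>1 z) * K z \<partial>LL n) * (\<integral>\<^sup>+z. ennreal (\<phi>2 z) * L z \<partial>LL n)"
      by (rule split4) (intro borel_measurable_times_ennreal P K L)+
    finally show ?thesis by (simp only: one)
  qed
  show "(\<integral>\<^sup>+w. ennreal (P4' w) * F (h1 w) \<partial>MM) = (\<integral>\<^sup>+z. ennreal (\<phi>1 z) * F z \<partial>LL n)"
    using main[OF F, of "\<lambda>_. 1"] JC_one by simp
  show "(\<integral>\<^sup>+w. ennreal (P4' w) * F (h2 w) \<partial>MM) = (\<integral>\<^sup>+z. ennreal (\<phi>2 z) * F z \<partial>LL n)"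
    using main[OF _ F, of "\<lambda>_. 1"] JC_one by simp
qed

lemma nn_phi_snd: "(\<integral>\<^sup>+u. ennreal (\<phi>' (t, u)) \<partial>Lam n) = ennreal (gA t)"
proof -
  let ?e = "b1 + b2 + 2 * c" and ?v = "a1 + a2 + (cmod g)\<^sup>2 * (2 * c * (b1 + b2) / (b1 + b2 + 2 * c))" and ?g = "g * complex_of_real (2 * c / (b1 + b2 + 2 * c))"
  have e: "0 < ?e" and v: "0 < ?v" using JC_vpos by auto
  have p: "0 \<le> gd n ?e (t - x a) * fm n J \<iota> ?v (u - 0 - sc ?g (t - x a))" for a u using e v by (intro mult_nonneg_nonneg gd_nonneg fm_nonneg)
  have "(\<integral>\<^sup>+u. ennreal ((\<Sum>a\<in>A. gd n ?e (t - x a) * fm n J \<iota> ?v (u - 0 - sc ?g (t - x a))) / real (card A)) \<partial>Lam n) = ennreal ((\<Sum>a\<in>A. gd n ?e (t - x a)) / real (card A))"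
  proof (rule nn_integral_avg[OF A])
    fix a
    show "(\<lambda>u. gd n ?e (t - x a) * fm n J \<iota> ?v (u - 0 - sc ?g (t - x a))) \<in> borel_measurable (Lam n)"
      by (intro borel_measurable_times borel_measurable_const fm_measurable mvI mv_basic)
    have "(\<integral>\<^sup>+u. ennreal (gd n ?e (t - x a) * fm n J \<iota> ?v (u - 0 - sc ?g (t - x a))) \<partial>Lam n) = (\<integral>\<^sup>+u. ennreal (gd n ?e (t - x a)) * ennreal (fm n J \<iota> ?v (u - sc ?g (t - x a))) \<partial>Lam n)"
      by (intro nn_integral_cong) (simp only: diff_zero ennreal_mult[OF gd_nonneg[OF e] fm_nonneg[OF v]])
    also have "\<dots> = ennreal (gd n ?e (t - x a)) * (\<integral>\<^sup>+u. ennreal (fm n J \<iota> ?v (u - sc ?g (t - x a))) \<partial>Lam n)"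
      by (rule nn_integral_cmult) (intro fm_measurable_ennreal mvI mv_basic)
    also have "\<dots> = ennreal (gd n ?e (t - x a))" by (simp only: nn_integral_fm[OF J v] mult_1_right)
    finally show "(\<integral>\<^sup>+u. ennreal (gd n ?e (t - x a) * fm n J \<iota> ?v (u - 0 - sc ?g (t - x a))) \<partial>Lam n) = ennreal (gd n ?e (t - x a))" .
    show "0 \<le> gd n ?e (t - x a)" using e by simp
  qed (rule p)
  then show ?thesis unfolding Jd_def K2_def fst_conv snd_conv fm_def[of n A] .
qed

lemma nn_phi_fst: "(\<integral>\<^sup>+t. ennreal (\<phi>' (t, u)) \<partial>Lam n) = ennreal (gB u)"
proof -
  let ?f = "\<lambda>y t. ennreal (gd n (2 * c) y) * (ennreal (fm n A x (b1 + b2) (t - y)) * ennreal (fm n J \<iota> (a1 + a2) (u - sc g y)))"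
  have "(\<integral>\<^sup>+t. ennreal (\<phi>' (t, u)) \<partial>Lam n) = (\<integral>\<^sup>+y. \<integral>\<^sup>+t. ?f y t \<partial>Lam n \<partial>Lam n)"
    unfolding JC_rep by (rule swap_Lam) (intro borel_measurable_times_ennreal gd_measurable_ennreal fm_measurable_ennreal mvI mv_basic)
  also have "\<dots> = (\<integral>\<^sup>+y. ennreal (gd n (2 * c) (y - 0)) * ennreal (fm n J \<iota> (a1 + a2) (u - sc g y)) \<partial>Lam n)"
  proof (rule nn_integral_cong)
    fix y
    have "(\<integral>\<^sup>+t. ?f y t \<partial>Lam n) = (\<integral>\<^sup>+t. (ennreal (gd n (2 * c) y) * ennreal (fm n J \<iota> (a1 + a2) (u - sc g y))) * ennreal (fm n A x (b1 + b2) (t - y)) \<partial>Lam n)"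
      by (simp only: mult_ac)
    also have "\<dots> = (ennreal (gd n (2 * c) y) * ennreal (fm n J \<iota> (a1 + a2) (u - sc g y))) * (\<integral>\<^sup>+t. ennreal (fm n A x (b1 + b2) (t - y)) \<partial>Lam n)"
      by (rule nn_integral_cmult) (intro fm_measurable_ennreal mvI mv_basic)
    finally show "(\<integral>\<^sup>+t. ?f y t \<partial>Lam n) = ennreal (gd n (2 * c) (y - 0)) * ennreal (fm n J \<iota> (a1 + a2) (u - sc g y))"
      by (simp only: nn_integral_fm[OF A ab2(1)] mult_1_right diff_zero)
  qed
  also have "\<dots> = ennreal (gB (u - sc g 0))" by (rule nn_integral_fm_conv[OF J c2 ab2(2)])
  finally show ?thesis by simp
qed

lemma nn_FA_LL:
  assumes "finite A'" "A' \<noteq> {}" "0 < r" "0 < s"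
  shows "(\<integral>\<^sup>+z. ennreal (FA n A' x' r s z) \<partial>LL n) = 1"
proof -
  have "(\<lambda>z. ennreal (FA n A' x' r s (fst z, snd z))) \<in> borel_measurable (LL n)" by (intro FA_ennreal_measurable mv_basic)
  then have "(\<integral>\<^sup>+z. ennreal (FA n A' x' r s z) \<partial>LL n) = (\<integral>\<^sup>+p. \<integral>\<^sup>+m. ennreal (FA n A' x' r s (p, m)) \<partial>Lam n \<partial>Lam n)"
    by (subst nn_LL) simp_all
  also have "\<dots> = (\<integral>\<^sup>+p. ennreal (fm n A' x' (r + s) (p - 0)) \<partial>Lam n)" unfolding nn_FA_snd[OF assms] diff_zero ..
  also have "\<dots> = 1" using assms by (intro nn_integral_fm) auto
  finally show ?thesis .
qed

definition "mr T u = enn2real (mE T u)"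

lemma FA_le: "FA n A x b1 b2 z \<le> 1 / (pi * b1)^n * (1 / (pi * b2)^n)"
proof -
  have "FA n A x b1 b2 z \<le> fm n A x b1 (sc (1/2) (fst z + snd z)) * gd n b2 (sc (1/2) (fst z - snd z)) / 1"
    unfolding FA_def using fm_nonneg[OF b(1)] gd_nonneg[OF b(2)] by (intro divide_left_mono mult_nonneg_nonneg) auto
  also have "\<dots> \<le> 1 / (pi * b1)^n * (1 / (pi * b2)^n)"
    unfolding div_by_1 using fm_nonneg[OF b(1)] gd_nonneg[OF b(2)] b by (intro mult_mono fm_le gd_le A) auto
  finally show ?thesis .
qed

text \<open>All densities under the integral other than \<open>GG\<close> are bounded, and
  \<open>GG\<close> has mass 1. Together with positivity this turns \<open>mE\<close> into a real
  density that may stand in denominators and under logarithms.\<close>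

lemma mE_finite: "mE T u < \<infinity>"
proof -
  let ?K = "1 / (pi * b1)^n * (1 / (pi * b2)^n)" and ?L = "1 / (pi * (a1 + a2))^n"
  have K0: "0 \<le> ?K" "0 \<le> ?L" using a b by auto
  have G1: "(\<integral>\<^sup>+z. ennreal (GG n c z) \<partial>LL n) = 1"
  proof -
    have "(\<integral>\<^sup>+z. ennreal (GG n c z) \<partial>LL n) = (\<integral>\<^sup>+z. ennreal (gd n (2 * c) (fst z)) * ennreal (gd n (2 * c) (snd z)) \<partial>LL n)"
      using c by (simp add: GG_def ennreal_mult)
    also have "\<dots> = (\<integral>\<^sup>+y. ennreal (gd n (2 * c) y) \<partial>Lam n) * (\<integral>\<^sup>+y. ennreal (gd n (2 * c) y) \<partial>Lam n)"
      by (rule nn_prod_LL) (intro gd_measurable_ennreal mv_basic)+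
    finally show ?thesis by (simp add: gd1)
  qed
  have "mE T u \<le> (\<integral>\<^sup>+z. ennreal (GG n c z) * (ennreal ?K * ennreal ?L) \<partial>LL n)"
    unfolding mE_def by (intro nn_integral_mono mult_left_mono mult_mono ennreal_leI FA_le fm_le J ab2) auto
  also have "\<dots> = ennreal ?K * ennreal ?L" by (subst nn_integral_multc[OF GG1_measurable]) (simp add: G1)
  also have "\<dots> < \<infinity>" by (simp add: ennreal_mult_less_top)
  finally show ?thesis .
qed

text \<open>\<open>mE\<close> integrates a strictly positive function, so it could vanish only if
  \<open>Lam n\<close> were the zero measure.\<close>

lemma mE_pos: "0 < mE T u"
proof (rule ccontr)
  assume "\<not> 0 < mE T u"
  then have z: "(\<integral>\<^sup>+u'. ennreal (P4 T (u', u)) \<partial>Lam n) = 0" by (simp add: mE_P4)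
  have "(\<lambda>u'. ennreal (P4 T (u', u))) \<in> borel_measurable (Lam n)"
    using P4_mv[of "Lam n" "\<lambda>_. fst T" "\<lambda>_. snd T" "\<lambda>u. u" "\<lambda>_. u"] by (simp add: mvI mv_basic)
  then have "AE u' in Lam n. False" using z P4_pos[of T] by (simp add: nn_integral_0_iff_AE ennreal_eq_0_iff not_le[symmetric])
  then have "(\<integral>\<^sup>+y. ennreal (gd n (2 * c) y) \<partial>Lam n) = (\<integral>\<^sup>+y. 0 \<partial>Lam n)" by (intro nn_integral_cong_AE) auto
  then show False using gd1 by simp
qed

lemma mr: "0 < mr T u" "ennreal (mr T u) = mE T u"
  using mE_finite[of T u] mE_pos[of T u] unfolding mr_def by (auto simp: enn2real_positive_iff)

text \<open>The logarithm of \<open>R1 * R2\<close> integrates to the difference of mutual informations to be bounded. Each factor has mean one, and the conditional density \<open>mr\<close>, which has no closed form, cancels in the product.\<close>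

abbreviation "FAm \<equiv> FA n A x (b1 + c) (b2 + c)"
abbreviation "FBm \<equiv> FA n J \<iota> vB1 vB2"
definition "R1 w = FAm (fst w) * \<phi>' (snd (fst w), snd (snd w)) / (gA (snd (fst w)) * mr (fst w) (snd (snd w)))"
definition "R2 w = \<phi>' (fst (fst w), fst (snd w)) * FBm (snd w) * mr (fst w) (snd (snd w)) / (gB (fst (snd w)) * gA (fst (fst w)) * gB (snd (snd w)) * P4' w)"

lemma mr_measurable: "(\<lambda>w. mr (fst w) (snd (snd w))) \<in> borel_measurable MM"
proof -
  have "(\<lambda>w. (fst w, snd (snd w))) \<in> measurable MM (LL n \<Otimes>\<^sub>M Lam n)" by simp
  from measurable_compose[OF this mE_measurable] show ?thesis unfolding mr_def by simp
qed

lemma R_pos: "0 < R1 w" "0 < R2 w"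
  unfolding R1_def R2_def using JC_pos mr(1) fm_pos[OF A vB(6)] fm_pos[OF J vB(3)] FA_pos[OF A vB(4,5)] FA_pos[OF J vB(1,2)] P4_pos
  by (auto simp: P4'_def intro!: divide_pos_pos mult_pos_pos)

lemma R_measurable: "R1 \<in> borel_measurable MM" "R2 \<in> borel_measurable MM"
proof -
  have FAw: "(\<lambda>w. FA n A x (b1 + c) (b2 + c) (fst w)) \<in> borel_measurable MM"
    using FA_measurable[OF mvs(1,2), of A x "b1 + c" "b2 + c" "LL n"] by simp
  have FBw: "(\<lambda>w. FBm (snd w)) \<in> borel_measurable MM"
    using FA_measurable[OF mvs(3,4), of J \<iota> vB1 vB2 "LL n"] by simp
  show "R1 \<in> borel_measurable MM" unfolding R1_def[abs_def]
    by (intro borel_measurable_times borel_measurable_divide FAw mr_measurable Jd_mv fm_measurable mvs)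
  show "R2 \<in> borel_measurable MM" unfolding R2_def[abs_def]
    by (intro borel_measurable_times borel_measurable_divide FBw mr_measurable Jd_mv fm_measurable mvs P4'_measurable)
qed

text \<open>Integrating the sum coordinate of \<open>U\<close> turns \<open>P4\<close> into
  \<open>mr\<close>, which cancels; integrating the difference coordinate of \<open>U\<close> turns
  \<open>\<phi>'\<close> into \<open>gA\<close>, which cancels; the law of \<open>T\<close> remains.
  The mean of \<open>ln R1\<close> is minus the conditional information of \<open>fst T\<close> and
  \<open>snd U\<close> given \<open>snd T\<close>.\<close>

lemma nn_R1: "(\<integral>\<^sup>+w. ennreal (P4' w * R1 w) \<partial>MM) = 1"
proof -
  have m: "(\<lambda>w. ennreal (P4' w * R1 w)) \<in> borel_measurable MM" using R_measurable P4'_measurable by simp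
  have "(\<integral>\<^sup>+w. ennreal (P4' w * R1 w) \<partial>MM) = (\<integral>\<^sup>+T. \<integral>\<^sup>+U. ennreal (P4' (T, U) * R1 (T, U)) \<partial>LL n \<partial>LL n)" by (rule nn_MM[OF m])
  also have "\<dots> = (\<integral>\<^sup>+T. ennreal (FAm T) \<partial>LL n)"
  proof (rule nn_integral_cong)
    fix T assume T: "T \<in> space (LL n)"
    have "(\<integral>\<^sup>+U. ennreal (P4' (T, U) * R1 (T, U)) \<partial>LL n) = (\<integral>\<^sup>+u. \<integral>\<^sup>+p. ennreal (P4' (T, (p, u)) * R1 (T, (p, u))) \<partial>Lam n \<partial>Lam n)"
      using T m by (intro nn_LL') simp
    also have "\<dots> = (\<integral>\<^sup>+u. ennreal (FAm T / gA (snd T)) * ennreal (\<phi>' (snd T, u)) \<partial>Lam n)"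
    proof (rule nn_integral_cong)
      fix u
      let ?k = "FAm T * \<phi>' (snd T, u) / (gA (snd T) * mr T u)"
      have k0: "0 \<le> ?k" using FA_pos[OF A vB(4,5), of n x T] JC_pos(3)[of "(snd T, u)"] fm_pos[OF A vB(6), of n x "snd T"] mr(1)[of T u] by (auto simp del: of_real_divide)
      have pm: "(\<lambda>p. ennreal (P4 T (p, u))) \<in> borel_measurable (Lam n)"
        using P4_mv[of "Lam n" "\<lambda>_. fst T" "\<lambda>_. snd T" "\<lambda>u. u" "\<lambda>_. u"] by (simp add: mvI mv_basic)
      have "(\<integral>\<^sup>+p. ennreal (P4' (T, (p, u)) * R1 (T, (p, u))) \<partial>Lam n) = (\<integral>\<^sup>+p. ennreal (P4 T (p, u)) * ennreal ?k \<partial>Lam n)"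
        unfolding P4'_def R1_def fst_conv snd_conv using k0 by (intro nn_integral_cong ennreal_mult P4_pos[THEN less_imp_le])
      also have "\<dots> = mE T u * ennreal ?k" unfolding mE_P4 by (rule nn_integral_multc[OF pm])
      also have "\<dots> = ennreal (mr T u * ?k)" using mr[of T u] k0 by (simp only: mr(2)[symmetric]) (rule ennreal_mult[symmetric], auto)
      also have "mr T u * ?k = FAm T / gA (snd T) * \<phi>' (snd T, u)" using mr(1)[of T u] by (simp del: of_real_divide)
      also have "ennreal \<dots> = ennreal (FAm T / gA (snd T)) * ennreal (\<phi>' (snd T, u))"
        using FA_pos[OF A vB(4,5), of n x T] JC_pos(3)[of "(snd T, u)"] fm_pos[OF A vB(6), of n x "snd T"] by (intro ennreal_mult) auto
      finally show "(\<integral>\<^sup>+p. ennreal (P4' (T, (p, u)) * R1 (T, (p, u))) \<partial>Lam n) = ennreal (FAm T / gA (snd T)) * ennreal (\<phi>' (snd T, u))" .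
    qed
    also have "\<dots> = ennreal (FAm T / gA (snd T)) * (\<integral>\<^sup>+u. ennreal (\<phi>' (snd T, u)) \<partial>Lam n)"
      by (intro nn_integral_cmult measurable_compose[OF _ measurable_ennreal] Jd_mv mvI mv_basic)
    also have "\<dots> = ennreal (FAm T)" unfolding nn_phi_snd
      using FA_pos[OF A vB(4,5), of n x T] fm_pos[OF A vB(6), of n x "snd T"] by (simp add: ennreal_mult[symmetric])
    finally show "(\<integral>\<^sup>+U. ennreal (P4' (T, U) * R1 (T, U)) \<partial>LL n) = ennreal (FAm T)" .
  qed
  also have "\<dots> = 1" by (rule nn_FA_LL[OF A vB(4,5)])
  finally show ?thesis .
qed

text \<open>Here \<open>T\<close> is integrated first. Its difference coordinate turns
  \<open>mr\<close> into \<open>gA * gB\<close> by the independence in \<open>mE_snd\<close>, its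
  sum coordinate turns \<open>\<phi>'\<close> into \<open>gB\<close>, and the law of
  \<open>U\<close> remains. The mean of \<open>ln R2\<close> is
  \<open>I(fst T; fst U) - I(T; fst U | snd U)\<close>.\<close>

lemma nn_R2: "(\<integral>\<^sup>+w. ennreal (P4' w * R2 w) \<partial>MM) = 1"
proof -
  have m: "(\<lambda>w. ennreal (P4' w * R2 w)) \<in> borel_measurable MM" using R_measurable P4'_measurable by simp
  have "(\<integral>\<^sup>+w. ennreal (P4' w * R2 w) \<partial>MM) = (\<integral>\<^sup>+U. \<integral>\<^sup>+T. ennreal (P4' (T, U) * R2 (T, U)) \<partial>LL n \<partial>LL n)" by (rule nn_MM'[OF m])
  also have "\<dots> = (\<integral>\<^sup>+U. ennreal (FBm U) \<partial>LL n)"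
  proof (rule nn_integral_cong)
    fix U assume U: "U \<in> space (LL n)"
    then have U2: "snd U \<in> space (Lam n)" by (auto simp: space_pair_measure)
    have "(\<integral>\<^sup>+T. ennreal (P4' (T, U) * R2 (T, U)) \<partial>LL n) = (\<integral>\<^sup>+t. \<integral>\<^sup>+p. ennreal (P4' ((t, p), U) * R2 ((t, p), U)) \<partial>Lam n \<partial>Lam n)"
      using U m by (intro nn_LL) simp
    also have "\<dots> = (\<integral>\<^sup>+t. ennreal (FBm U / gB (fst U)) * ennreal (\<phi>' (t, fst U)) \<partial>Lam n)"
    proof (rule nn_integral_cong)
      fix t assume t: "t \<in> space (Lam n)"
      let ?k = "\<phi>' (t, fst U) * FBm U / (gB (fst U) * gA t * gB (snd U))"
      have k0: "0 \<le> ?k" using FA_pos[OF J vB(1,2), of n \<iota> U] JC_pos(3)[of "(t, fst U)"] fm_pos[OF A vB(6), of n x t] fm_pos[OF J vB(3), of n \<iota>] by (auto simp del: of_real_divide intro!: divide_nonneg_nonneg mult_nonneg_nonneg simp: less_imp_le)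
      have pm: "(\<lambda>p. mE (t, p) (snd U)) \<in> borel_measurable (Lam n)"
      proof -
        have "(\<lambda>p. ((t, p), snd U)) \<in> measurable (Lam n) (LL n \<Otimes>\<^sub>M Lam n)" using t U2 by simp
        from measurable_compose[OF this mE_measurable] show ?thesis by simp
      qed
      have "(\<integral>\<^sup>+p. ennreal (P4' ((t, p), U) * R2 ((t, p), U)) \<partial>Lam n) = (\<integral>\<^sup>+p. mE (t, p) (snd U) * ennreal ?k \<partial>Lam n)"
      proof (rule nn_integral_cong)
        fix p
        have P: "0 < P4' ((t, p), U)" using P4_pos[of "(t, p)" U] by (simp add: P4'_def)
        have "P4' ((t, p), U) * R2 ((t, p), U) = mr (t, p) (snd U) * ?k" unfolding R2_def fst_conv snd_conv using P by (simp del: of_real_divide)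
        then show "ennreal (P4' ((t, p), U) * R2 ((t, p), U)) = mE (t, p) (snd U) * ennreal ?k"
          using mr(1)[of "(t, p)" "snd U"] k0 by (simp only: mr(2)[symmetric]) (rule ennreal_mult, auto)
      qed
      also have "\<dots> = (\<integral>\<^sup>+p. mE (t, p) (snd U) \<partial>Lam n) * ennreal ?k" by (rule nn_integral_multc[OF pm])
      also have "\<dots> = ennreal (gA t * gB (snd U) * ?k)"
        unfolding mE_snd ennreal_mult[OF fm_nonneg[OF vB(6)] fm_nonneg[OF vB(3)], symmetric]
        by (rule ennreal_mult[symmetric]) (intro mult_nonneg_nonneg fm_nonneg vB, rule k0)
      also have "gA t * gB (snd U) * ?k = FBm U / gB (fst U) * \<phi>' (t, fst U)"
        using fm_pos[OF A vB(6), of n x t] fm_pos[OF J vB(3), of n \<iota> "snd U"] by (simp del: of_real_divide)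
      also have "ennreal \<dots> = ennreal (FBm U / gB (fst U)) * ennreal (\<phi>' (t, fst U))"
        using FA_pos[OF J vB(1,2), of n \<iota> U] JC_pos(3)[of "(t, fst U)"] fm_pos[OF J vB(3), of n \<iota> "fst U"] by (intro ennreal_mult) auto
      finally show "(\<integral>\<^sup>+p. ennreal (P4' ((t, p), U) * R2 ((t, p), U)) \<partial>Lam n) = ennreal (FBm U / gB (fst U)) * ennreal (\<phi>' (t, fst U))" .
    qed
    also have "\<dots> = ennreal (FBm U / gB (fst U)) * (\<integral>\<^sup>+t. ennreal (\<phi>' (t, fst U)) \<partial>Lam n)"
      by (intro nn_integral_cmult measurable_compose[OF _ measurable_ennreal] Jd_mv mvI mv_basic)
    also have "\<dots> = ennreal (FBm U)" unfolding nn_phi_fst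
      using FA_pos[OF J vB(1,2), of n \<iota> U] fm_pos[OF J vB(3), of n \<iota> "fst U"] by (simp add: ennreal_mult[symmetric])
    finally show "(\<integral>\<^sup>+T. ennreal (P4' (T, U) * R2 (T, U)) \<partial>LL n) = ennreal (FBm U)" .
  qed
  also have "\<dots> = 1" by (rule nn_FA_LL[OF J vB(1,2)])
  finally show ?thesis .
qed

lemma P4_push:
  assumes X: "X \<in> measurable MM (LL n)" and r: "r \<in> borel_measurable (LL n)" "\<And>z. 0 \<le> r z" and L: "L \<in> borel_measurable (LL n)"
    and eq: "\<And>F. F \<in> borel_measurable (LL n) \<Longrightarrow> (\<integral>\<^sup>+w. ennreal (P4' w) * F (X w) \<partial>MM) = (\<integral>\<^sup>+z. ennreal (r z) * F z \<partial>LL n)"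
    and V: "has_bochner_integral (LL n) (\<lambda>z. r z * L z) V"
  shows "has_bochner_integral MM (\<lambda>w. P4' w * L (X w)) V"
proof -
  have P0: "0 \<le> P4' w" for w using P4_pos by (simp add: P4'_def less_imp_le)
  show ?thesis using push_integral[OF X P4'_measurable r(1) P0 r(2) eq L] V by (simp add: has_bochner_integral_iff)
qed

abbreviation "xp w \<equiv> (fst (fst w), fst (snd w))"
abbreviation "xm w \<equiv> (snd (fst w), snd (snd w))"
abbreviation "J1 \<equiv> Jent n A x J \<iota> (b1 + c) (a1 + (cmod g)\<^sup>2 * (c * b1 / (b1 + c))) (g * of_real (c / (b1 + c)))"
abbreviation "J2 \<equiv> Jent n {()} (\<lambda>_. 0) {()} (\<lambda>_. 0) (b2 + c) (a2 + (cmod g)\<^sup>2 * (c * b2 / (b2 + c))) (g * of_real (c / (b2 + c)))"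
abbreviation "J' \<equiv> Jent n A x J \<iota> (b1 + b2 + 2 * c) (a1 + a2 + (cmod g)\<^sup>2 * (2 * c * (b1 + b2) / (b1 + b2 + 2 * c))) (g * of_real (2 * c / (b1 + b2 + 2 * c)))"

lemma pushes:
  "L \<in> borel_measurable (LL n) \<Longrightarrow> has_bochner_integral (LL n) (\<lambda>z. \<phi>' z * L z) V \<Longrightarrow> has_bochner_integral MM (\<lambda>w. P4' w * L (xp w)) V"
  "L \<in> borel_measurable (LL n) \<Longrightarrow> has_bochner_integral (LL n) (\<lambda>z. \<phi>' z * L z) V \<Longrightarrow> has_bochner_integral MM (\<lambda>w. P4' w * L (xm w)) V"
  "L \<in> borel_measurable (LL n) \<Longrightarrow> has_bochner_integral (LL n) (\<lambda>z. \<phi>1 z * L z) V \<Longrightarrow> has_bochner_integral MM (\<lambda>w. P4' w * L (h1 w)) V"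
  "L \<in> borel_measurable (LL n) \<Longrightarrow> has_bochner_integral (LL n) (\<lambda>z. \<phi>2 z * L z) V \<Longrightarrow> has_bochner_integral MM (\<lambda>w. P4' w * L (h2 w)) V"
proof -
  have hm: "h1 \<in> measurable MM (LL n)" "h2 \<in> measurable MM (LL n)"
    by (auto intro!: measurable_Pair measurable_compose[OF _ measurable_fst] measurable_compose[OF _ measurable_snd] measurable_compose[OF _ hf_measurable])
  have xm: "xp \<in> measurable MM (LL n)" "xm \<in> measurable MM (LL n)" by simp_all
  note JL = Jd_measurable JC_pos[THEN less_imp_le]
  show "L \<in> borel_measurable (LL n) \<Longrightarrow> has_bochner_integral (LL n) (\<lambda>z. \<phi>' z * L z) V \<Longrightarrow> has_bochner_integral MM (\<lambda>w. P4' w * L (xp w)) V"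
    by (rule P4_push[OF xm(1) JL(1) JL(4) _ nn_P4_plus])
  show "L \<in> borel_measurable (LL n) \<Longrightarrow> has_bochner_integral (LL n) (\<lambda>z. \<phi>' z * L z) V \<Longrightarrow> has_bochner_integral MM (\<lambda>w. P4' w * L (xm w)) V"
    by (rule P4_push[OF xm(2) JL(1) JL(4) _ nn_P4_minus])
  show "L \<in> borel_measurable (LL n) \<Longrightarrow> has_bochner_integral (LL n) (\<lambda>z. \<phi>1 z * L z) V \<Longrightarrow> has_bochner_integral MM (\<lambda>w. P4' w * L (h1 w)) V"
    by (rule P4_push[OF hm(1) JL(1) JL(2) _ nn_P4_h(1)])
  show "L \<in> borel_measurable (LL n) \<Longrightarrow> has_bochner_integral (LL n) (\<lambda>z. \<phi>2 z * L z) V \<Longrightarrow> has_bochner_integral MM (\<lambda>w. P4' w * L (h2 w)) V"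
    by (rule P4_push[OF hm(2) JL(1) JL(3) _ nn_P4_h(2)])
qed

abbreviation "u1 \<equiv> {()}"
abbreviation "f2 v \<equiv> fm n u1 (\<lambda>_. 0) v"

text \<open>In the product \<open>mr\<close> drops out, and the factors \<open>4^n\<close> of the
  laws of \<open>T\<close> and \<open>U\<close> cancel the \<open>16^n\<close> in
  \<open>P4'\<close>. What remains is a quotient of one-pair densities, whose logarithms integrate
  to known entropies.\<close>

lemma ln_R12: "ln (\<phi>' (xp w)) + ln (\<phi>' (xm w)) + (ln (fm n A x (b1 + c) (fst (h1 w))) + ln (f2 (b2 + c) (fst (h2 w))) + ln (fm n J \<iota> vB1 (snd (h1 w))) + ln (f2 vB2 (snd (h2 w))))
    - (ln (gA (fst (xp w))) + ln (gA (fst (xm w))) + ln (gB (snd (xp w))) + ln (gB (snd (xm w)))) - ln (\<phi>1 (h1 w)) - ln (\<phi>2 (h2 w)) \<le> R1 w + R2 w - 2"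
  (is "?L \<le> _")
proof -
  have eA: "FAm (fst w) = fm n A x (b1 + c) (fst (h1 w)) * f2 (b2 + c) (fst (h2 w)) / 4^n"
    unfolding FA_def fst_conv by (intro arg_cong2[where f="(/)"] arg_cong2[where f="(*)"] fm_cong refl) (simp_all add: hf_def fm_def, rule gd_cong, simp)
  have eB: "FBm (snd w) = fm n J \<iota> vB1 (snd (h1 w)) * f2 vB2 (snd (h2 w)) / 4^n"
    unfolding FA_def snd_conv by (intro arg_cong2[where f="(/)"] arg_cong2[where f="(*)"] fm_cong refl) (simp_all add: hf_def fm_def, rule gd_cong, simp)
  have u: "finite u1" "u1 \<noteq> {}" by auto
  have alg: "fa * p'' / (ga' * m) * (p' * fb * m / (gb * ga * gb' * p)) = (p' * p'' * (fa * fb)) / (ga * ga' * (gb * gb') * p)" if "m \<noteq> 0" for fa fb p' p'' ga ga' gb gb' m p :: real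
    using that by (simp add: mult_ac)
  have alg2: "(p' * p'' * ((k1 / q) * (k2 / q))) / (ga * (p1 * p2 / r)) = (p' * p'' * (k1 * k2)) / (ga * (p1 * p2))" if "r = q * q" "q \<noteq> 0" for p' p'' k1 k2 q r ga p1 p2 :: real
    using that by simp
  have q: "(16::real)^n = 4^n * 4^n" "(4::real)^n \<noteq> 0" by (simp_all add: power_mult_distrib[symmetric])
  have "R1 w * R2 w = (\<phi>' (xp w) * \<phi>' (xm w) * (FAm (fst w) * FBm (snd w))) / (gA (fst (xp w)) * gA (fst (xm w)) * (gB (snd (xp w)) * gB (snd (xm w))) * P4' w)"
    unfolding R1_def R2_def fst_conv snd_conv using mr(1)[of "fst w" "snd (snd w)"] by (intro alg) auto
  also have "\<dots> = (\<phi>' (xp w) * \<phi>' (xm w) * ((fm n A x (b1 + c) (fst (h1 w)) * f2 (b2 + c) (fst (h2 w))) * (fm n J \<iota> vB1 (snd (h1 w)) * f2 vB2 (snd (h2 w))))) / (gA (fst (xp w)) * gA (fst (xm w)) * (gB (snd (xp w)) * gB (snd (xm w))) * (\<phi>1 (h1 w) * \<phi>2 (h2 w)))"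
    unfolding eA eB P4_h by (rule alg2[OF q])
  finally have R: "R1 w * R2 w = \<dots>" .
  have lnalg: "ln ((p' * p'' * ((k1 * k2) * (k3 * k4))) / (ga * ga' * (gb * gb') * (p1 * p2))) = ln p' + ln p'' + (ln k1 + ln k2 + ln k3 + ln k4) - (ln ga + ln ga' + ln gb + ln gb') - ln p1 - ln p2"
    if "0 < p'" "0 < p''" "0 < k1" "0 < k2" "0 < k3" "0 < k4" "0 < ga" "0 < ga'" "0 < gb" "0 < gb'" "0 < p1" "0 < p2" for p' p'' k1 k2 k3 k4 ga ga' gb gb' p1 p2 :: real
    using that by (simp add: ln_div ln_mult_pos)
  have "?L = ln (R1 w * R2 w)" unfolding R
    by (rule lnalg[symmetric]) (intro JC_pos fm_pos A J u vB)+
  also have "\<dots> = ln (R1 w) + ln (R2 w)" using R_pos by (intro ln_mult_pos)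
  also have "\<dots> \<le> (R1 w - 1) + (R2 w - 1)" using R_pos by (intro add_mono ln_le_minus_one)
  finally show ?thesis by simp
qed

text \<open>Sums and differences determine the two pairs, so \<open>I(T; U)\<close> is the sum of
  the two informations on the right. By the chain rule it is
  \<open>I(T; snd U) + I(T; fst U | snd U)\<close>. The first term is at least
  \<open>I(snd T; snd U)\<close> and the second, by the independence of \<open>fst T\<close> and
  \<open>snd U\<close>, at least \<open>I(fst T; fst U)\<close>; both bounds are the information of
  \<open>\<phi>'\<close>.\<close>

lemma two_copies_ineq:
  "2 * (H n A x (b1 + b2 + 2 * c) + H n J \<iota> (a1 + a2 + (cmod g)\<^sup>2 * (2 * c)) - J')
    \<le> (H n A x (b1 + c) + H n J \<iota> vB1 - J1) + (H n u1 (\<lambda>_. 0) (b2 + c) + H n u1 (\<lambda>_. 0) vB2 - J2)"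
proof -
  have u: "finite u1" "u1 \<noteq> {}" by auto
  have v1: "a1 + (cmod g)\<^sup>2 * c = a1 + (cmod g)\<^sup>2 * (c * b1 / (b1 + c)) + (cmod (g * of_real (c / (b1 + c))))\<^sup>2 * (b1 + c)"
    and v2: "a2 + (cmod g)\<^sup>2 * c = a2 + (cmod g)\<^sup>2 * (c * b2 / (b2 + c)) + (cmod (g * of_real (c / (b2 + c))))\<^sup>2 * (b2 + c)"
    and v3: "a1 + a2 + (cmod g)\<^sup>2 * (2 * c) = a1 + a2 + (cmod g)\<^sup>2 * (2 * c * (b1 + b2) / (b1 + b2 + 2 * c)) + (cmod (g * of_real (2 * c / (b1 + b2 + 2 * c))))\<^sup>2 * (b1 + b2 + 2 * c)"
    using JC_snd_var[OF b(1) c] JC_snd_var[OF b(2) c] JC_snd_var[OF ab2(1) c2] by simp_all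
  have lnJ2: "(\<lambda>z. ln (\<phi>2 z)) \<in> borel_measurable (LL n)" using Jd_measurable by (intro borel_measurable_ln)
  have lnJ1: "(\<lambda>z. ln (\<phi>1 z)) \<in> borel_measurable (LL n)" using Jd_measurable by (intro borel_measurable_ln)
  have lnJ3: "(\<lambda>z. ln (\<phi>' z)) \<in> borel_measurable (LL n)" using Jd_measurable by (intro borel_measurable_ln)
  have lf': "(\<lambda>z. ln (fm n A' x' e (fst z))) \<in> borel_measurable (LL n)" "(\<lambda>z. ln (fm n A' x' e (snd z))) \<in> borel_measurable (LL n)" for A' :: "unit set" and x' e
    by (intro ln_fm_measurable mv_basic)+
  have lfW: "(\<lambda>z. ln (fm n A' x' e (snd z))) \<in> borel_measurable (LL n)" for A' :: "'b set" and x' e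
    by (intro ln_fm_measurable mv_basic)+
  have lfA: "(\<lambda>z. ln (fm n A' x' e (fst z))) \<in> borel_measurable (LL n)" for A' :: "'a set" and x' e
    by (intro ln_fm_measurable mv_basic)+
  have e1: "has_bochner_integral (LL n) (\<lambda>z. \<phi>1 z * ln (\<phi>1 z)) (- J1)"
    unfolding has_bochner_integral_iff Jent_def using Jd_ent_integrable[OF A J JC_vpos(1,2)] by simp
  have e2: "has_bochner_integral (LL n) (\<lambda>z. \<phi>2 z * ln (\<phi>2 z)) (- J2)"
    unfolding has_bochner_integral_iff Jent_def using Jd_ent_integrable[OF u u JC_vpos(3,4)] by simp
  have e3: "has_bochner_integral (LL n) (\<lambda>z. \<phi>' z * ln (\<phi>' z)) (- J')"
    unfolding has_bochner_integral_iff Jent_def using Jd_ent_integrable[OF A J JC_vpos(5,6)] by simp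
  note I = pushes(1)[OF lnJ3 e3] pushes(2)[OF lnJ3 e3]
    pushes(3)[OF lfA Jd_fst_ln[OF A J JC_vpos(1,2)]] pushes(4)[OF lf'(1) Jd_fst_ln[OF u u JC_vpos(3,4)]]
    pushes(3)[OF lfW Jd_snd_ln[OF A J JC_vpos(1,2) v1]] pushes(4)[OF lf'(2) Jd_snd_ln[OF u u JC_vpos(3,4) v2]]
    pushes(1)[OF lfA Jd_fst_ln[OF A J JC_vpos(5,6)]] pushes(2)[OF lfA Jd_fst_ln[OF A J JC_vpos(5,6)]]
    pushes(1)[OF lfW Jd_snd_ln[OF A J JC_vpos(5,6) v3]] pushes(2)[OF lfW Jd_snd_ln[OF A J JC_vpos(5,6) v3]]
    pushes(3)[OF lnJ1 e1] pushes(4)[OF lnJ2 e2]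
  let ?LN = "\<lambda>w. ln (\<phi>' (xp w)) + ln (\<phi>' (xm w)) + (ln (fm n A x (b1 + c) (fst (h1 w))) + ln (f2 (b2 + c) (fst (h2 w))) + ln (fm n J \<iota> vB1 (snd (h1 w))) + ln (f2 vB2 (snd (h2 w))))
    - (ln (gA (fst (xp w))) + ln (gA (fst (xm w))) + ln (gB (snd (xp w))) + ln (gB (snd (xm w)))) - ln (\<phi>1 (h1 w)) - ln (\<phi>2 (h2 w))"
  let ?V = "- J' + - J' + (- H n A x (b1 + c) + - H n u1 (\<lambda>_. 0) (b2 + c) + - H n J \<iota> vB1 + - H n u1 (\<lambda>_. 0) vB2)
    - (- H n A x (b1 + b2 + 2 * c) + - H n A x (b1 + b2 + 2 * c) + - H n J \<iota> (a1 + a2 + (cmod g)\<^sup>2 * (2 * c)) + - H n J \<iota> (a1 + a2 + (cmod g)\<^sup>2 * (2 * c))) - - J1 - - J2"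
  have L: "has_bochner_integral MM (\<lambda>w. P4' w * ?LN w) ?V"
    unfolding distrib_left[of "P4' _"] right_diff_distrib[of "P4' _"]
    by (intro has_bochner_integral_add has_bochner_integral_diff I)
  have P: "has_bochner_integral MM P4' 1"
    using pushes(1)[of "\<lambda>_. 1" 1] Jd_bi[OF A J JC_vpos(5,6), of n x \<iota> "g * of_real (2 * c / (b1 + b2 + 2 * c))"] by (simp del: of_real_divide)
  have P0: "0 < P4' w" for w using P4_pos by (simp add: P4'_def)
  have R: "has_bochner_integral MM (\<lambda>w. P4' w * R1 w) 1" "has_bochner_integral MM (\<lambda>w. P4' w * R2 w) 1"
    using nn_R1 nn_R2 R_measurable P4'_measurable P0 R_pos
    by (auto intro!: has_bochner_integral_nn_integral borel_measurable_times simp: less_imp_le)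
  have R': "has_bochner_integral MM (\<lambda>w. P4' w * R1 w + P4' w * R2 w - 2 * P4' w) (1 + 1 - 2 * 1)"
    by (intro has_bochner_integral_add has_bochner_integral_diff R has_bochner_integral_mult_right P)
  have "?V \<le> 1 + 1 - 2 * 1"
    unfolding has_bochner_integral_integral_eq[OF L, symmetric] has_bochner_integral_integral_eq[OF R', symmetric]
  proof (rule integral_mono)
    show "integrable MM (\<lambda>w. P4' w * ?LN w)" "integrable MM (\<lambda>w. P4' w * R1 w + P4' w * R2 w - 2 * P4' w)"
      using L R' by (simp_all only: has_bochner_integral_iff)
    fix w
    have "P4' w * ?LN w \<le> P4' w * (R1 w + R2 w - 2)" using P0[of w] ln_R12[of w] by (intro mult_left_mono) auto
    then show "P4' w * ?LN w \<le> P4' w * R1 w + P4' w * R2 w - 2 * P4' w" by (simp only: distrib_left[of "P4' w"] right_diff_distrib[of "P4' w"] mult.commute[of _ 2])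
  qed
  then show ?thesis by simp
qed

end

section \<open>High noise and the limit of repeated doubling\<close>

lemma exp_le_quadratic: fixes x :: real assumes "x \<le> 1" shows "exp x \<le> 1 + x + x\<^sup>2"
proof (cases "0 \<le> x")
  case True
  then show ?thesis using exp_bound[of x] assms by simp
next
  case False
  have "1 - x \<le> exp (- x)" using exp_ge_add_one_self[of "- x"] by simp
  then have 1: "(1 - x) * exp x \<le> 1" using mult_right_mono[of "1 - x" "exp (- x)" "exp x"] by (simp add: exp_minus)
  have "(1 - x) * (1 + x + x\<^sup>2) = 1 - x^3" by (simp add: algebra_simps power2_eq_square power3_eq_cube)
  also have "\<dots> \<ge> 1" using False by (simp add: power3_eq_cube mult_nonneg_nonpos mult_nonpos_nonpos)
  finally have "(1 - x) * exp x \<le> (1 - x) * (1 + x + x\<^sup>2)" using 1 by simp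
  then show ?thesis using False by simp
qed

lemma gd_product: "gd n v (y - m) * gd n v (y - m') / gd n v y = gd n v (y - (m + m')) * exp (2 * ip n m m' / v)" if v: "0 < v"
proof -
  have "- nsq n (y - m) / v + - nsq n (y - m') / v - - nsq n y / v = - nsq n (y - (m + m')) / v + 2 * ip n m m' / v"
  proof -
    have "- nsq n (y - m) + - nsq n (y - m') - - nsq n y = - nsq n (y - (m + m')) + 2 * ip n m m'"
      unfolding nsq_diff nsq_add ip_linear by simp
    then have "(- nsq n (y - m) + - nsq n (y - m') - - nsq n y) / v = (- nsq n (y - (m + m')) + 2 * ip n m m') / v" by (simp only:)
    then show ?thesis by (simp only: add_divide_distrib diff_divide_distrib)
  qed
  then have E: "exp (- nsq n (y - m) / v) * exp (- nsq n (y - m') / v) / exp (- nsq n y / v) = exp (- nsq n (y - (m + m')) / v) * exp (2 * ip n m m' / v)"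
    by (simp only: exp_add[symmetric] exp_diff[symmetric])
  have p: "(pi * v)^n \<noteq> 0" using v by simp
  have alg: "A / p * (B / p) / (C / p) = A * B / C / p" if "p \<noteq> 0" for A B C p :: real using that by simp
  show ?thesis unfolding gd_def alg[OF p] E by simp
qed

text \<open>The relative entropy to the centred Gaussian of variance \<open>v\<close> is at most the
  chi-square divergence, which is the average of \<open>exp (2 <x a, x b> / v) - 1\<close> over
  pairs of codewords. The cross entropy contributes \<open>P / v\<close> per symbol, no less than
  the required \<open>ln (1 + P / v)\<close>.\<close>

lemma H_high_noise:
  assumes A: "finite A" "A \<noteq> {}" and z: "zm n A x" and v: "0 < v" and P: "0 \<le> P"
    and pw: "(\<Sum>a\<in>A. nsq n (x a)) = real (card A) * (real n * P)"
    and M: "\<And>a b. a \<in> A \<Longrightarrow> b \<in> A \<Longrightarrow> \<bar>2 * ip n (x a) (x b)\<bar> \<le> M" "M \<le> v"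
  shows "real n * ln (pi * exp 1 * (P + v)) - (M / v)\<^sup>2 \<le> H n A x v"
proof -
  let ?f = "fm n A x v" and ?g = "gd n v" and ?N = "real (card A)"
  have N: "0 < ?N" using A by (simp add: card_gt_0_iff)
  have f0: "0 < ?f y" and g0: "0 < ?g y" for y using fm_pos[OF A v] v by auto
  let ?S = "(\<Sum>a\<in>A. \<Sum>b\<in>A. exp (2 * ip n (x a) (x b) / v)) / (?N * ?N)"
  have sq: "?f y * (?f y / ?g y) = (\<Sum>a\<in>A. \<Sum>b\<in>A. gd n v (y - (x a + x b)) * exp (2 * ip n (x a) (x b) / v)) / (?N * ?N)" for y
  proof -
    have "?f y * (?f y / ?g y) = (\<Sum>a\<in>A. \<Sum>b\<in>A. gd n v (y - x a) * gd n v (y - x b) / gd n v y) / (?N * ?N)"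
      unfolding fm_def by (simp add: sum_product sum_divide_distrib mult_ac)
    then show ?thesis by (simp only: gd_product[OF v])
  qed
  have I: "has_bochner_integral (Lam n) (\<lambda>y. ?f y * (?f y / ?g y)) ?S"
  proof -
    have "has_bochner_integral (Lam n) (\<lambda>y. gd n v (y - (x a + x b)) * exp (2 * ip n (x a) (x b) / v)) (1 * exp (2 * ip n (x a) (x b) / v))" for a b
      by (intro has_bochner_integral_mult_left gd_bi_shift v)
    then show ?thesis unfolding sq by (intro has_bochner_integral_divide_zero has_bochner_integral_sum) simp
  qed
  have L: "has_bochner_integral (Lam n) (\<lambda>y. ?f y * ln (?g y)) (- ((real n * v + real n * P) / v) - real n * ln (pi * v))"
    using fm_ln_gd[OF A v v, of n x 1 0] pw N by simp
  have Hh: "has_bochner_integral (Lam n) (\<lambda>y. ?f y * ln (?f y)) (- H n A x v)"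
    using H_integrable[OF A v] by (simp add: has_bochner_integral_iff H_def)
  have R: "has_bochner_integral (Lam n) (\<lambda>y. ?f y * (?f y / ?g y) - ?f y + ?f y * ln (?g y)) (?S - 1 + (- ((real n * v + real n * P) / v) - real n * ln (pi * v)))"
    by (intro has_bochner_integral_add has_bochner_integral_diff I fm_bi[OF A v] L)
  have "- H n A x v \<le> ?S - 1 + (- ((real n * v + real n * P) / v) - real n * ln (pi * v))"
    unfolding has_bochner_integral_integral_eq[OF Hh, symmetric] has_bochner_integral_integral_eq[OF R, symmetric]
  proof (rule integral_mono)
    show "integrable (Lam n) (\<lambda>y. ?f y * ln (?f y))" "integrable (Lam n) (\<lambda>y. ?f y * (?f y / ?g y) - ?f y + ?f y * ln (?g y))"
      using Hh R by (simp_all only: has_bochner_integral_iff)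
    fix y
    have "ln (?f y / ?g y) \<le> ?f y / ?g y - 1" using f0[of y] g0[of y] by (intro ln_le_minus_one) simp
    then have "ln (?f y) \<le> ?f y / ?g y - 1 + ln (?g y)" using f0[of y] g0[of y] by (simp add: ln_div)
    then have "?f y * ln (?f y) \<le> ?f y * (?f y / ?g y - 1 + ln (?g y))" using f0[of y] by (intro mult_left_mono) auto
    then show "?f y * ln (?f y) \<le> ?f y * (?f y / ?g y) - ?f y + ?f y * ln (?g y)" by (simp only: distrib_left right_diff_distrib mult_1_right)
  qed
  \<comment> \<open>The first-order terms average to 0 because the codebook is centred, so the error
    is of second order in \<open>1 / v\<close>. A first-order error would not vanish in the doubling
    argument.\<close>
  moreover have "?S \<le> 1 + (M / v)\<^sup>2"
  proof -
    have "(\<Sum>a\<in>A. \<Sum>b\<in>A. exp (2 * ip n (x a) (x b) / v)) \<le> (\<Sum>a\<in>A. \<Sum>b\<in>A. 1 + 2 / v * ip n (x a) (x b) + (M / v)\<^sup>2)"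
    proof (intro sum_mono)
      fix a b assume ab: "a \<in> A" "b \<in> A"
      let ?t = "2 * ip n (x a) (x b) / v"
      have t: "\<bar>?t\<bar> \<le> M / v" using M(1)[OF ab] v by (simp add: abs_divide divide_right_mono)
      have "?t \<le> 1" using t M(2) v by (smt (verit) divide_le_eq_1)
      then have "exp ?t \<le> 1 + ?t + ?t\<^sup>2" by (rule exp_le_quadratic)
      also have "?t\<^sup>2 \<le> (M / v)\<^sup>2" using power_mono[OF t abs_ge_zero, of 2] by (simp only: power2_abs)
      finally show "exp ?t \<le> 1 + 2 / v * ip n (x a) (x b) + (M / v)\<^sup>2" by simp
    qed
    also have "\<dots> = ?N * ?N * (1 + (M / v)\<^sup>2) + 2 / v * (\<Sum>a\<in>A. \<Sum>b\<in>A. ip n (x a) (x b))"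
      by (simp add: sum.distrib sum_distrib_left algebra_simps)
    also have "(\<Sum>a\<in>A. \<Sum>b\<in>A. ip n (x a) (x b)) = 0"
      using zm_ip[OF z, where k=1] by simp
    finally show ?thesis using N by (simp add: divide_le_eq mult.commute)
  qed
  moreover have "(real n * v + real n * P) / v = real n + real n * (P / v)" using v by (simp add: field_simps)
  moreover have "ln (pi * exp 1 * (P + v)) \<le> 1 + ln (pi * v) + P / v"
  proof -
    have "ln (pi * exp 1 * (P + v)) = ln (pi * exp 1 * v) + ln (1 + P / v)"
    proof -
      have "P + v = v * (1 + P / v)" using v by (simp add: distrib_left)
      then have "pi * exp 1 * (P + v) = pi * exp 1 * v * (1 + P / v)" by (simp only: mult.assoc)
      then show ?thesis using v P by (simp only:) (rule ln_mult_pos, auto intro: add_pos_nonneg)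
    qed
    also have "ln (1 + P / v) \<le> P / v" using v P by (intro ln_add_one_self_le_self) simp
    finally show ?thesis using ln_pie[OF v] by simp
  qed
  then have "real n * ln (pi * exp 1 * (P + v)) \<le> real n * (1 + ln (pi * v) + P / v)" by (intro mult_left_mono) auto
  ultimately show ?thesis by (simp add: algebra_simps)
qed

text \<open>Gibbs inequality against a Gaussian pair: the first coordinate has variance
  \<open>P + e\<close>, and the second is regressed on it with coefficient \<open>k\<close> and
  residual variance \<open>v'\<close>.\<close>

lemma Jent_gauss_le:
  assumes A: "finite A" "A \<noteq> {}" and J: "finite J" "J \<noteq> {}" and z: "zm n J \<iota>" and e: "0 < e" and v: "0 < v"
    and px: "(\<Sum>a\<in>A. nsq n (x a)) = real (card A) * (real n * P)" and pi: "(\<Sum>w\<in>J. nsq n (\<iota> w)) = real (card J) * (real n * \<epsilon>)"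
    and P: "0 \<le> P" and v': "0 < v'" "v' = (cmod (g - k))\<^sup>2 * e + v + (cmod k)\<^sup>2 * P + \<epsilon>"
  shows "Jent n A x J \<iota> e v g \<le> real n * ln (pi * exp 1 * (P + e)) + real n * ln (pi * exp 1 * v')"
proof -
  let ?e = "P + e" and ?N = "real (card A)"
  have e': "0 < ?e" using e P by simp
  have N: "0 < ?N" "0 < real (card J)" using A J by (auto simp: card_gt_0_iff)
  let ?q = "\<lambda>z. gd n ?e (sc 1 (fst z) + sc 0 (snd z) + 0) * gd n v' (sc (- k) (fst z) + sc 1 (snd z) + 0)"
  have q0: "0 < ?q z" for z using e' v' by simp
  have qm: "?q \<in> borel_measurable (LL n)" by (intro borel_measurable_times gd_measurable mvI mv_basic)
  have q1: "(\<integral>\<^sup>+z. ennreal (?q z) \<partial>LL n) \<le> 1"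
  proof -
    have "(\<integral>\<^sup>+z. ennreal (?q z) \<partial>LL n) = (\<integral>\<^sup>+t. \<integral>\<^sup>+u. ennreal (gd n ?e t) * ennreal (gd n v' (u - sc k t)) \<partial>Lam n \<partial>Lam n)"
    proof -
      have 1: "sc (- k) t + sc 1 u + 0 = u - sc k t" "sc 1 t + sc 0 u + 0 = t" for t u by (auto simp: fun_eq_iff)
      have "(\<integral>\<^sup>+z. ennreal (?q z) \<partial>LL n) = (\<integral>\<^sup>+t. \<integral>\<^sup>+u. ennreal (?q (t, u)) \<partial>Lam n \<partial>Lam n)"
        using qm by (intro nn_LL) simp
      then show ?thesis unfolding fst_conv snd_conv 1 using e' v' by (simp add: ennreal_mult)
    qed
    also have "\<dots> = (\<integral>\<^sup>+t. ennreal (gd n ?e (t - 0)) \<partial>Lam n)"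
    proof (rule nn_integral_cong)
      fix t
      have "(\<integral>\<^sup>+u. ennreal (gd n ?e t) * ennreal (gd n v' (u - sc k t)) \<partial>Lam n) = ennreal (gd n ?e t) * (\<integral>\<^sup>+u. ennreal (gd n v' (u - sc k t)) \<partial>Lam n)"
        by (intro nn_integral_cmult gd_measurable_ennreal mvI mv_basic)
      then show "(\<integral>\<^sup>+u. ennreal (gd n ?e t) * ennreal (gd n v' (u - sc k t)) \<partial>Lam n) = ennreal (gd n ?e (t - 0))"
        by (simp add: nn_integral_gd[OF v'(1)])
    qed
    also have "\<dots> = 1" by (rule nn_integral_gd[OF e'])
    finally show ?thesis by simp
  qed
  have c: "(\<Sum>w\<in>J. nsq n (sc \<alpha> y + sc 1 (0 + \<iota> w) + 0)) / real (card J) = (cmod \<alpha>)\<^sup>2 * nsq n y + real n * \<epsilon>" for \<alpha> y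
    using zm_nsq[OF z, of "sc \<alpha> y" 1] pi N by (simp add: add_divide_distrib)
  have I1: "has_bochner_integral (LL n) (\<lambda>z. Jd n A x J \<iota> e v g z * ln (gd n ?e (sc 1 (fst z) + sc 0 (snd z) + 0))) (- real n - real n * ln (pi * ?e))"
  proof -
    have "has_bochner_integral (LL n) (\<lambda>z. K2 n e J \<iota> v (x a) 0 g z * ln (gd n ?e (sc 1 (fst z) + sc 0 (snd z) + 0))) (- ((real n * e + nsq n (x a)) / ?e) - real n * ln (pi * ?e))" for a
      using K2_ln_gd[OF J e v e', of n \<iota> "x a" 0 g 1 0 0] N by simp
    from Jd_hbi[of A n e J \<iota> v x g, OF this] have "has_bochner_integral (LL n) (\<lambda>z. Jd n A x J \<iota> e v g z * ln (gd n ?e (sc 1 (fst z) + sc 0 (snd z) + 0))) ((\<Sum>a\<in>A. - ((real n * e + nsq n (x a)) / ?e) - real n * ln (pi * ?e)) / ?N)" .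
    moreover have "(\<Sum>a\<in>A. - ((real n * e + nsq n (x a)) / ?e) - real n * ln (pi * ?e)) / ?N = - real n - real n * ln (pi * ?e)"
    proof -
      have "(\<Sum>a\<in>A. - ((real n * e + nsq n (x a)) / ?e) - real n * ln (pi * ?e)) = - (\<Sum>a\<in>A. real n * e + nsq n (x a)) / ?e - ?N * (real n * ln (pi * ?e))"
        by (simp add: sum_subtractf sum_negf sum_divide_distrib)
      also have "(\<Sum>a\<in>A. real n * e + nsq n (x a)) = ?N * real n * ?e" unfolding sum.distrib px by (simp add: algebra_simps)
      finally show ?thesis using N e' by (simp only:) (simp add: diff_divide_distrib)
    qed
    ultimately show ?thesis by simp
  qed
  have I2: "has_bochner_integral (LL n) (\<lambda>z. Jd n A x J \<iota> e v g z * ln (gd n v' (sc (- k) (fst z) + sc 1 (snd z) + 0))) (- real n - real n * ln (pi * v'))"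
  proof -
    have "has_bochner_integral (LL n) (\<lambda>z. K2 n e J \<iota> v (x a) 0 g z * ln (gd n v' (sc (- k) (fst z) + sc 1 (snd z) + 0)))
        (- (((cmod (g - k))\<^sup>2 * real n * e + real n * v + ((cmod k)\<^sup>2 * nsq n (x a) + real n * \<epsilon>)) / v') - real n * ln (pi * v'))" for a
      using K2_ln_gd[OF J e v v'(1), of n \<iota> "x a" 0 g "- k" 1 0] unfolding c by simp
    from Jd_hbi[of A n e J \<iota> v x g, OF this] have "has_bochner_integral (LL n) (\<lambda>z. Jd n A x J \<iota> e v g z * ln (gd n v' (sc (- k) (fst z) + sc 1 (snd z) + 0)))
       ((\<Sum>a\<in>A. - (((cmod (g - k))\<^sup>2 * real n * e + real n * v + ((cmod k)\<^sup>2 * nsq n (x a) + real n * \<epsilon>)) / v') - real n * ln (pi * v')) / ?N)" .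
    moreover have "(\<Sum>a\<in>A. - (((cmod (g - k))\<^sup>2 * real n * e + real n * v + ((cmod k)\<^sup>2 * nsq n (x a) + real n * \<epsilon>)) / v') - real n * ln (pi * v')) / ?N = - real n - real n * ln (pi * v')"
    proof -
      have "(\<Sum>a\<in>A. - (((cmod (g - k))\<^sup>2 * real n * e + real n * v + ((cmod k)\<^sup>2 * nsq n (x a) + real n * \<epsilon>)) / v') - real n * ln (pi * v'))
        = - (\<Sum>a\<in>A. (cmod (g - k))\<^sup>2 * real n * e + real n * v + ((cmod k)\<^sup>2 * nsq n (x a) + real n * \<epsilon>)) / v' - ?N * (real n * ln (pi * v'))"
        by (simp add: sum_subtractf sum_negf sum_divide_distrib)
      also have "(\<Sum>a\<in>A. (cmod (g - k))\<^sup>2 * real n * e + real n * v + ((cmod k)\<^sup>2 * nsq n (x a) + real n * \<epsilon>)) = ?N * real n * v'"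
        unfolding sum.distrib sum_distrib_left[symmetric] px v'(2) by (simp add: algebra_simps)
      finally show ?thesis using N v'(1) by (simp only:) (simp add: diff_divide_distrib)
    qed
    ultimately show ?thesis by simp
  qed
  have lq: "ln (?q z) = ln (gd n ?e (sc 1 (fst z) + sc 0 (snd z) + 0)) + ln (gd n v' (sc (- k) (fst z) + sc 1 (snd z) + 0))" for z
    using e' v' by (intro ln_mult_pos gd_pos)
  have Q: "has_bochner_integral (LL n) (\<lambda>z. Jd n A x J \<iota> e v g z * ln (?q z)) (- real n - real n * ln (pi * ?e) + (- real n - real n * ln (pi * v')))"
    unfolding lq distrib_left[of "Jd n A x J \<iota> e v g _"] by (intro has_bochner_integral_add I1 I2)
  have "(\<integral>z. Jd n A x J \<iota> e v g z * ln (?q z) \<partial>LL n) \<le> (\<integral>z. Jd n A x J \<iota> e v g z * ln (Jd n A x J \<iota> e v g z) \<partial>LL n)"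
    using Jd_bi[OF A J e v, of n x \<iota> g] Q by (intro gibbs qm q0 q1 Jd_pos A J e v Jd_ent_integrable) (simp_all only: has_bochner_integral_iff)
  then show ?thesis unfolding Jent_def has_bochner_integral_integral_eq[OF Q] using ln_pie[OF e'] ln_pie[OF v'(1)] by (simp add: algebra_simps)
qed

lemma abs_ip_le_double_sum:
  assumes "finite B" "a \<in> B" "b \<in> B" shows "\<bar>2 * ip n (f a) (f b)\<bar> \<le> (\<Sum>a\<in>B. \<Sum>b\<in>B. \<bar>2 * ip n (f a) (f b)\<bar>)"
proof -
  have "\<bar>2 * ip n (f a) (f b)\<bar> \<le> (\<Sum>b\<in>B. \<bar>2 * ip n (f a) (f b)\<bar>)" by (rule member_le_sum) (use assms in auto)
  also have "\<dots> \<le> (\<Sum>a\<in>B. \<Sum>b\<in>B. \<bar>2 * ip n (f a) (f b)\<bar>)" by (rule member_le_sum) (use assms in \<open>auto intro: sum_nonneg\<close>)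
  finally show ?thesis .
qed

lemma Jent_gauss: assumes "0 < e" "0 < v" shows "Jent n {()} (\<lambda>_. 0) {()} (\<lambda>_. 0) e v k = real n * ln (pi * exp 1 * e) + real n * ln (pi * exp 1 * v)"
proof -
  have u: "finite {()}" "{()} \<noteq> {}" by auto
  have "H n {()} (\<lambda>_. 0) v = real n * ln (pi * exp 1 * v)" using assms by (intro H_zero) (auto simp: nsq_def)
  then show ?thesis
    using has_bochner_integral_integral_eq[OF K2_ent[OF u assms, of n "\<lambda>_. 0" 0 0 k]] by (simp add: Jent_def Jd_def[abs_def])
qed

text \<open>Split off the common noise component and add an independent Gaussian pair: by the two-copies
  inequality the excess of the mutual information over its Gaussian value is at least halved.  After \<open>k\<close>
  such steps the noise dominates the codebooks by a factor \<open>N = 2^k\<close>, where a second-order expansion shows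
  that the excess is at least \<open>- C / N\<^sup>2\<close>, so the original excess is at least \<open>- C / N\<close>.\<close>

lemma Jent_le_exact:
  fixes P \<epsilon> sT VW :: real and g :: complex
  assumes A: "finite A" "A \<noteq> {}" "zm n A x" and J: "finite J" "J \<noteq> {}" "zm n J \<iota>"
    and px: "(\<Sum>a\<in>A. nsq n (x a)) = real (card A) * (real n * P)" and pi: "(\<Sum>w\<in>J. nsq n (\<iota> w)) = real (card J) * (real n * \<epsilon>)"
    and P: "0 \<le> P" and E: "0 \<le> \<epsilon>" and sT: "0 < sT" and VW: "0 < VW"
  defines "w \<equiv> VW + (cmod g)\<^sup>2 * sT"
  shows "Jent n A x J \<iota> sT VW g \<le> H n A x sT + H n J \<iota> w + real n * ln (1 - (cmod g)\<^sup>2 * sT\<^sup>2 / ((P + sT) * (\<epsilon> + w)))"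
proof -
  define Gq where "Gq = (cmod g)\<^sup>2"
  define q where "q = Gq * sT"
  have Gq: "0 \<le> Gq" and q: "0 \<le> q" using sT by (auto simp: Gq_def q_def)
  have w: "w = VW + q" "0 < w" using VW q by (auto simp: w_def q_def Gq_def)
  \<comment> \<open>The midpoint of \<open>q / w\<close> and 1: below 1 the first noise keeps a
    private part, and above \<open>q / w\<close> the second noise does.\<close>
  define \<theta> where "\<theta> = (q + VW / 2) / (q + VW)"
  have \<theta>: "0 < \<theta>" "\<theta> < 1" using q VW by (auto simp: \<theta>_def divide_simps)
  \<comment> \<open>Only the fraction \<theta> of the first noise is declared common; dividing
    \<open>g\<close> by \<theta> preserves the covariance \<open>g' vC = g sT\<close> of the two
    noises.\<close>
  define vC \<beta> \<alpha> g' where "vC = \<theta> * sT" and "\<beta> = (1 - \<theta>) * sT" and "\<alpha> = w - q / \<theta>" and "g' = g / of_real \<theta>"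
  have vC: "0 < vC" and \<beta>: "0 < \<beta>" and \<beta>C: "\<beta> + vC = sT" using \<theta> sT by (auto simp: vC_def \<beta>_def algebra_simps)
  have \<alpha>: "0 < \<alpha>"
  proof -
    have "q * (q + VW) < (VW + q) * (q + VW / 2)" using q VW by (simp add: algebra_simps add_pos_nonneg)
    then have "q / \<theta> < VW + q" using q VW \<theta> by (simp add: \<theta>_def pos_divide_less_eq field_simps)
    then show ?thesis by (simp add: \<alpha>_def w)
  qed
  define G2 where "G2 = (cmod g')\<^sup>2"
  have G2: "G2 = Gq / \<theta>\<^sup>2" "0 \<le> G2" using \<theta> by (auto simp: G2_def g'_def Gq_def norm_divide power_divide)
  have G2C: "G2 * vC = q / \<theta>" "G2 * vC\<^sup>2 = Gq * sT\<^sup>2" using \<theta> by (auto simp: G2 vC_def q_def power2_eq_square field_simps)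
  have \<alpha>w: "\<alpha> + G2 * vC = w" by (simp add: \<alpha>_def G2C)
  \<comment> \<open>At scale \<open>N\<close> codebook and noise together have \<open>N\<close>
    times the second moments of the start. Since the codebook contributes only one share
    \<open>P\<close>, the private noise takes over the other \<open>N - 1\<close> shares, and
    likewise for \<epsilon>.\<close>
  define b a c where "b N = N * \<beta> + (N - 1) * P" and "a N = N * \<alpha> + (N - 1) * \<epsilon>" and "c N = N * vC" for N :: real
  define F where "F N = H n A x (b N + c N) + H n J \<iota> (a N + (cmod g')\<^sup>2 * c N)
    - Jent n A x J \<iota> (b N + c N) (a N + (cmod g')\<^sup>2 * (c N * b N / (b N + c N))) (g' * of_real (c N / (b N + c N)))" for N
  define \<rho> where "\<rho> = Gq * sT\<^sup>2 / ((P + sT) * (\<epsilon> + w))"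
  define v0 where "v0 = \<epsilon> + w - Gq * sT\<^sup>2 / (P + sT)"
  have Ps: "0 < P + sT" "0 < \<epsilon> + w" using P sT E w by auto
  have qw: "Gq * sT\<^sup>2 / (P + sT) \<le> q"
  proof -
    have "Gq * sT\<^sup>2 = q * sT" by (simp add: q_def power2_eq_square)
    also have "\<dots> \<le> q * (P + sT)" using q P by (intro mult_left_mono) auto
    finally show ?thesis using Ps by (simp add: pos_divide_le_eq)
  qed
  have v0: "0 < v0" using qw w VW E by (simp add: v0_def)
  have v0\<rho>: "v0 = (\<epsilon> + w) * (1 - \<rho>)" using Ps by (simp add: v0_def \<rho>_def right_diff_distrib)
  then have \<rho>1: "0 < 1 - \<rho>" using v0 Ps by (simp add: zero_less_mult_iff)
  \<comment> \<open>The mutual information of the Gaussian pair with the same second moments, with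
    \<rho> the squared correlation coefficient; it is independent of the scale
    \<open>N\<close>.\<close>
  define I where "I = - (real n * ln (1 - \<rho>))"
  have ab0: "0 < b N" "0 < a N" "0 < c N" if "1 \<le> N" for N
    using that \<beta> \<alpha> vC P E by (auto simp: b_def a_def c_def intro!: add_pos_nonneg)
  have bc: "b N + c N = N * sT + (N - 1) * P" for N by (simp add: b_def c_def \<beta>C[symmetric] algebra_simps)
  have ac: "a N + G2 * c N = N * w + (N - 1) * \<epsilon>" for N by (simp add: a_def c_def \<alpha>w[symmetric] algebra_simps)
  have step: "2 * F (2 * N) \<le> F N + I" if N: "1 \<le> N" for N
  proof -
    \<comment> \<open>The Gaussian copy has no codebook, so its private noises absorb the powers
      completely. With these variances the information of the copy is exactly
      \<open>I\<close>.\<close>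
    let ?b2 = "N * (\<beta> + P)" and ?a2 = "N * (\<alpha> + \<epsilon>)"
    have p2: "0 < ?b2" "0 < ?a2" using N \<beta> \<alpha> P E by (auto intro!: mult_pos_pos add_pos_nonneg)
    interpret two_copies n A x J \<iota> "b N" ?b2 "a N" ?a2 "c N" g'
      using A J ab0[OF N] p2 by unfold_locales auto
    have e: "b (2 * N) = b N + ?b2" "a (2 * N) = a N + ?a2" "c (2 * N) = 2 * c N" by (auto simp: b_def a_def c_def algebra_simps)
    have u: "H n {()} (\<lambda>_. 0) v = real n * ln (pi * exp 1 * v)" if "0 < v" for v using that by (intro H_zero) (auto simp: nsq_def)
    have G: "H n {()} (\<lambda>_. 0) (?b2 + c N) + H n {()} (\<lambda>_. 0) (?a2 + (cmod g')\<^sup>2 * c N) - J2 = I"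
    proof -
      have "?a2 + (cmod g')\<^sup>2 * (c N * ?b2 / (?b2 + c N)) = N * v0"
      proof -
        have "?b2 + c N = N * (P + sT)" by (simp add: c_def \<beta>C[symmetric] algebra_simps)
        then have "c N * ?b2 / (?b2 + c N) = N * (vC * (\<beta> + P) / (P + sT))" using N Ps by (simp add: c_def)
        also have "vC * (\<beta> + P) / (P + sT) = vC - vC\<^sup>2 / (P + sT)"
        proof -
          have "vC * (\<beta> + P) = vC * (P + sT) - vC\<^sup>2" unfolding \<beta>C[symmetric] by (simp add: algebra_simps power2_eq_square)
          then show ?thesis using Ps by (simp add: diff_divide_distrib)
        qed
        finally have "G2 * (c N * ?b2 / (?b2 + c N)) = G2 * (N * (vC - vC\<^sup>2 / (P + sT)))" by (simp only:)
        also have "\<dots> = N * (G2 * vC - G2 * vC\<^sup>2 / (P + sT))" by (simp add: algebra_simps)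
        finally have "G2 * (c N * ?b2 / (?b2 + c N)) = \<dots>" .
        then show ?thesis unfolding G2_def[symmetric] by (simp add: G2C(2) v0_def \<alpha>w[symmetric] algebra_simps)
      qed
      moreover have "?a2 + (cmod g')\<^sup>2 * c N = N * (\<epsilon> + w)" unfolding G2_def[symmetric] by (simp add: c_def \<alpha>w[symmetric] algebra_simps)
      moreover have "ln (pi * exp 1 * (N * v0)) = ln (pi * exp 1 * (N * (\<epsilon> + w))) + ln (1 - \<rho>)"
        using Ps N \<rho>1 by (subst ln_mult_pos[symmetric]) (auto simp: v0\<rho> mult_ac)
      moreover have "0 < N * v0" "0 < N * (\<epsilon> + w)" using N v0 Ps by auto
      ultimately show ?thesis using vB(5) by (simp only: Jent_gauss u) (simp add: I_def algebra_simps)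
    qed
    from two_copies_ineq show ?thesis unfolding F_def e G by simp
  qed
  obtain M where M: "0 \<le> M" "\<And>a b. a \<in> A \<Longrightarrow> b \<in> A \<Longrightarrow> \<bar>2 * ip n (x a) (x b)\<bar> \<le> M" "\<And>a b. a \<in> J \<Longrightarrow> b \<in> J \<Longrightarrow> \<bar>2 * ip n (\<iota> a) (\<iota> b)\<bar> \<le> M"
  proof
    let ?M = "(\<Sum>a\<in>A. \<Sum>b\<in>A. \<bar>2 * ip n (x a) (x b)\<bar>) + (\<Sum>a\<in>J. \<Sum>b\<in>J. \<bar>2 * ip n (\<iota> a) (\<iota> b)\<bar>)"
    have nn: "0 \<le> (\<Sum>a\<in>A. \<Sum>b\<in>A. \<bar>2 * ip n (x a) (x b)\<bar>)" "0 \<le> (\<Sum>a\<in>J. \<Sum>b\<in>J. \<bar>2 * ip n (\<iota> a) (\<iota> b)\<bar>)" by (intro sum_nonneg; simp)+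
    show "0 \<le> ?M" using nn by simp
    show "\<bar>2 * ip n (x a) (x b)\<bar> \<le> ?M" if "a \<in> A" "b \<in> A" for a b
    proof -
      have "\<bar>2 * ip n (x a) (x b)\<bar> \<le> (\<Sum>a\<in>A. \<Sum>b\<in>A. \<bar>2 * ip n (x a) (x b)\<bar>)" by (rule abs_ip_le_double_sum) (use that A in auto)
      then show ?thesis using nn(2) by linarith
    qed
    show "\<bar>2 * ip n (\<iota> a) (\<iota> b)\<bar> \<le> ?M" if "a \<in> J" "b \<in> J" for a b
    proof -
      have "\<bar>2 * ip n (\<iota> a) (\<iota> b)\<bar> \<le> (\<Sum>a\<in>J. \<Sum>b\<in>J. \<bar>2 * ip n (\<iota> a) (\<iota> b)\<bar>)" by (rule abs_ip_le_double_sum) (use that J in auto)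
      then show ?thesis using nn(1) by linarith
    qed
  qed
  define C where "C = (M / sT)\<^sup>2 + (M / w)\<^sup>2"
  have low: "I - C / N\<^sup>2 \<le> F N" if N: "1 \<le> N" "M / sT \<le> N" "M / w \<le> N" for N
  proof -
    have e0: "0 < b N + c N" and N0: "0 < N" using ab0[OF N(1)] N by auto
    have aG: "0 < a N + G2 * c N" using ab0[OF N(1)] by (intro add_pos_nonneg mult_nonneg_nonneg G2(2)) auto
    have vbig: "N * sT \<le> b N + c N" "N * w \<le> a N + G2 * c N" unfolding bc ac using N P E by auto
    have Mv: "M \<le> N * sT" "M \<le> N * w" using N sT w by (auto simp: pos_divide_le_eq)
    have sqb: "(M / v)\<^sup>2 \<le> (M / s)\<^sup>2 / N\<^sup>2" if "N * s \<le> v" "0 < s" for s v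
    proof -
      have "M / v \<le> M / (N * s)" using that N0 M(1) by (intro divide_left_mono) (auto intro!: mult_pos_pos less_le_trans[of 0 "N * s" v])
      then have "(M / v)\<^sup>2 \<le> (M / (N * s))\<^sup>2" using M(1) that N0 by (intro power_mono) (auto intro!: divide_nonneg_nonneg order_trans[of 0 "N * s" v])
      then show ?thesis by (simp add: power_divide power_mult_distrib mult.commute)
    qed
    have h1: "real n * ln (pi * exp 1 * (P + (b N + c N))) - (M / (b N + c N))\<^sup>2 \<le> H n A x (b N + c N)"
      using Mv vbig by (intro H_high_noise[OF A e0 P px M(2)]) auto
    have h2: "real n * ln (pi * exp 1 * (\<epsilon> + (a N + G2 * c N))) - (M / (a N + G2 * c N))\<^sup>2 \<le> H n J \<iota> (a N + G2 * c N)"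
      using Mv vbig by (intro H_high_noise[OF J aG E pi M(3)]) auto
    \<comment> \<open>\<open>?k\<close> is the regression coefficient of the second coordinate on
      the first, covariance \<open>N g sT\<close> over variance \<open>N (P + sT)\<close>.\<close>
    let ?e = "b N + c N" and ?k = "of_real (sT / (P + sT)) * g" and ?g = "g' * of_real (c N / (b N + c N))"
    have v1: "0 < a N + (cmod g')\<^sup>2 * (c N * b N / (b N + c N))" using ab0[OF N(1)] by (intro add_pos_nonneg mult_nonneg_nonneg divide_nonneg_nonneg) auto
    have h3: "Jent n A x J \<iota> ?e (a N + (cmod g')\<^sup>2 * (c N * b N / ?e)) ?g \<le> real n * ln (pi * exp 1 * (P + ?e)) + real n * ln (pi * exp 1 * (N * v0))"
    proof (rule Jent_gauss_le[OF A(1,2) J e0 v1 px pi P])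
      show "0 < N * v0" using N v0 by simp
      have "?g - ?k = of_real (N * sT / ?e - sT / (P + sT)) * g"
        using \<theta> by (simp add: g'_def c_def vC_def field_simps)
      then have "(cmod (?g - ?k))\<^sup>2 = (N * sT / ?e - sT / (P + sT))\<^sup>2 * Gq"
        by (simp only: norm_mult norm_of_real power_mult_distrib power2_abs Gq_def)
      moreover have "(cmod ?k)\<^sup>2 = (sT / (P + sT))\<^sup>2 * Gq"
        by (simp only: norm_mult norm_of_real power_mult_distrib power2_abs Gq_def)
      moreover have "a N + G2 * (c N * b N / ?e) = N * w + (N - 1) * \<epsilon> - (N * sT)\<^sup>2 * Gq / ?e"
      proof -
        have "c N * b N / ?e = c N - (c N)\<^sup>2 / ?e" using e0 by (simp add: field_simps power2_eq_square)
        then have "a N + G2 * (c N * b N / ?e) = a N + G2 * (c N - (c N)\<^sup>2 / ?e)" by (simp only:)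
        also have "\<dots> = (a N + G2 * c N) - (N\<^sup>2 * (G2 * vC\<^sup>2)) / ?e" by (simp add: algebra_simps c_def power_mult_distrib)
        finally show ?thesis unfolding ac G2C(2) by (simp add: power_mult_distrib mult_ac)
      qed
      moreover have key: "N * v0 = (N * sT / e - sT / p)\<^sup>2 * Gq * e + (N * w + (N - 1) * \<epsilon> - (N * sT)\<^sup>2 * Gq / e) + (sT / p)\<^sup>2 * Gq * (N * p - e) + \<epsilon>"
        if "e \<noteq> 0" "p \<noteq> 0" "v0 = \<epsilon> + w - Gq * sT\<^sup>2 / p" for e p :: real
      proof -
        define X where "X = Gq * sT\<^sup>2 / p"
        have "(N * sT / e - sT / p)\<^sup>2 * Gq * e = (N * sT)\<^sup>2 * Gq / e - 2 * N * X + (sT / p)\<^sup>2 * Gq * e"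
          unfolding X_def using that by (simp add: power2_eq_square field_simps)
        moreover have "(sT / p)\<^sup>2 * Gq * (N * p) = N * X" using that by (simp add: power2_eq_square X_def)
        moreover have "N * v0 = N * \<epsilon> + N * w - N * X" unfolding that(3) X_def by (simp add: algebra_simps)
        ultimately show ?thesis unfolding right_diff_distrib[of "(sT / p)\<^sup>2 * Gq"] left_diff_distrib[of N 1 \<epsilon>] by linarith
      qed
      have Pe: "N * (P + sT) - ?e = P" unfolding bc by (simp add: algebra_simps)
      from key[of ?e "P + sT"] have "N * v0 = (N * sT / ?e - sT / (P + sT))\<^sup>2 * Gq * ?e + (N * w + (N - 1) * \<epsilon> - (N * sT)\<^sup>2 * Gq / ?e) + (sT / (P + sT))\<^sup>2 * Gq * P + \<epsilon>"
        using e0 Ps v0_def Pe by simp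
      ultimately show "N * v0 = (cmod (?g - ?k))\<^sup>2 * ?e + (a N + (cmod g')\<^sup>2 * (c N * b N / ?e)) + (cmod ?k)\<^sup>2 * P + \<epsilon>"
        by (simp only: G2_def[symmetric])
    qed
    have "ln (pi * exp 1 * (N * v0)) = ln (pi * exp 1 * (N * (\<epsilon> + w))) + ln (1 - \<rho>)"
      using Ps N0 \<rho>1 by (subst ln_mult_pos[symmetric]) (auto simp: v0\<rho> mult_ac)
    moreover have "\<epsilon> + (a N + G2 * c N) = N * (\<epsilon> + w)" unfolding ac by (simp add: algebra_simps)
    ultimately have "I - (M / (b N + c N))\<^sup>2 - (M / (a N + G2 * c N))\<^sup>2 \<le> F N"
      using h1 h2 h3 unfolding F_def G2_def[symmetric] I_def by (simp add: algebra_simps)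
    moreover have "(M / (b N + c N))\<^sup>2 \<le> (M / sT)\<^sup>2 / N\<^sup>2" "(M / (a N + G2 * c N))\<^sup>2 \<le> (M / w)\<^sup>2 / N\<^sup>2"
      using sqb vbig sT w by auto
    ultimately show ?thesis by (simp add: C_def add_divide_distrib)
  qed
  have D: "2^k * (F (2^k) - I) \<le> F 1 - I" for k :: nat
  proof (induction k)
    case (Suc k)
    have "2 * (F (2 * 2^k) - I) \<le> F (2^k) - I" using step[of "2^k"] by simp
    then have "2^k * (2 * (F (2 * 2^k) - I)) \<le> 2^k * (F (2^k) - I)" by (intro mult_left_mono) auto
    from order_trans[OF this Suc] show ?case by (simp only: power_Suc mult_ac)
  qed simp
  have "0 \<le> F 1 - I"
  proof (rule LIMSEQ_le_const2)
    have "(\<lambda>k. C * (1/2)^k) \<longlonglongrightarrow> C * 0" by (intro tendsto_mult tendsto_const LIMSEQ_realpow_zero) auto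
    then show "(\<lambda>k. - (C * (1/2)^k)) \<longlonglongrightarrow> 0" using tendsto_minus by fastforce
    obtain K :: nat where K: "max (M / sT) (M / w) < 2^K" using real_arch_pow[of 2 "max (M / sT) (M / w)"] by (auto simp del: max_less_iff_conj)
    show "\<exists>N. \<forall>k\<ge>N. - (C * (1/2)^k) \<le> F 1 - I"
    proof (intro exI allI impI)
      fix k assume "K \<le> k"
      then have pw: "(2::real)^K \<le> 2^k" by (intro power_increasing) auto
      have "M / sT < 2^K" "M / w < 2^K" using K by auto
      with pw have "M / sT \<le> 2^k" "M / w \<le> 2^k" by linarith+
      then have "I - C / (2^k)\<^sup>2 \<le> F (2^k)" by (intro low) auto
      then have "2^k * (- (C / (2^k)\<^sup>2)) \<le> 2^k * (F (2^k) - I)" by (intro mult_left_mono) auto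
      with D[of k] have "2^k * (- (C / (2^k)\<^sup>2)) \<le> F 1 - I" by linarith
      moreover have "2^k * (- (C / (2^k)\<^sup>2)) = - (C * (1/2)^k)" by (simp add: power2_eq_square power_divide)
      ultimately show "- (C * (1/2)^k) \<le> F 1 - I" by simp
    qed
  qed
  moreover have "F 1 = H n A x sT + H n J \<iota> w - Jent n A x J \<iota> sT VW g"
  proof -
    have 1: "b 1 + c 1 = sT" "a 1 + (cmod g')\<^sup>2 * c 1 = w" using bc[of 1] ac[of 1] by (auto simp: G2_def)
    have "(cmod g')\<^sup>2 * (c 1 * b 1 / sT) = q / \<theta> * (1 - \<theta>)"
      unfolding G2_def[symmetric] G2C(1)[symmetric] using sT by (simp add: c_def b_def \<beta>_def)
    then have "a 1 + (cmod g')\<^sup>2 * (c 1 * b 1 / sT) = VW" using \<theta> by (simp add: a_def \<alpha>_def w field_simps)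
    moreover have "g' * of_real (c 1 / sT) = g" using \<theta> sT by (simp add: g'_def c_def vC_def)
    ultimately show ?thesis unfolding F_def 1 by simp
  qed
  ultimately show ?thesis by (simp add: I_def \<rho>_def Gq_def)
qed

text \<open>The exact version is applied to the actual mean powers. The squared correlation
  decreases when the powers grow, so passing to the permitted powers only weakens the bound.\<close>

lemma Jent_le:
  fixes P \<epsilon> sT VW :: real and g :: complex
  assumes n: "0 < n" and x: "pwr n A x P" and \<iota>: "pwr n J \<iota> \<epsilon>" and sT: "0 < sT" and VW: "0 < VW"
  defines "w \<equiv> VW + (cmod g)\<^sup>2 * sT"
  shows "Jent n A x J \<iota> sT VW g \<le> H n A x sT + H n J \<iota> w + real n * ln (1 - (cmod g)\<^sup>2 * sT\<^sup>2 / ((P + sT) * (\<epsilon> + w)))"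
    and "(cmod g)\<^sup>2 * sT\<^sup>2 < (P + sT) * (\<epsilon> + w)"
proof -
  define P' \<epsilon>' where "P' = (\<Sum>a\<in>A. nsq n (x a)) / (real (card A) * real n)" and "\<epsilon>' = (\<Sum>a\<in>J. nsq n (\<iota> a)) / (real (card J) * real n)"
  have N: "0 < real (card A) * real n" "0 < real (card J) * real n" using x \<iota> n by (auto simp: pwr_def card_gt_0_iff)
  have P': "0 \<le> P'" "P' \<le> P" "0 \<le> \<epsilon>'" "\<epsilon>' \<le> \<epsilon>" using x \<iota> N
    by (auto simp: P'_def \<epsilon>'_def pwr_def sum_nonneg pos_divide_le_eq mult_ac intro!: divide_nonneg_nonneg)
  have w0: "0 < w" using VW sT by (simp add: w_def add_pos_nonneg)
  have lt: "(cmod g)\<^sup>2 * sT\<^sup>2 < sT * w" using VW sT by (simp add: w_def power2_eq_square algebra_simps)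
  have le1: "sT * w \<le> (P' + sT) * (\<epsilon>' + w)" using P' sT w0 by (intro mult_mono) auto
  have le2: "(P' + sT) * (\<epsilon>' + w) \<le> (P + sT) * (\<epsilon> + w)" using P' sT w0 by (intro mult_mono) auto
  show lt2: "(cmod g)\<^sup>2 * sT\<^sup>2 < (P + sT) * (\<epsilon> + w)" using lt le1 le2 by linarith
  have pos: "0 < (P' + sT) * (\<epsilon>' + w)" using P' sT w0 by (intro mult_pos_pos) auto
  have "Jent n A x J \<iota> sT VW g \<le> H n A x sT + H n J \<iota> w + real n * ln (1 - (cmod g)\<^sup>2 * sT\<^sup>2 / ((P' + sT) * (\<epsilon>' + w)))"
    unfolding w_def using x \<iota> N by (intro Jent_le_exact[OF _ _ _ _ _ _ _ _ P'(1,3) sT VW]) (auto simp: pwr_def P'_def \<epsilon>'_def)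
  moreover have "ln (1 - (cmod g)\<^sup>2 * sT\<^sup>2 / ((P' + sT) * (\<epsilon>' + w))) \<le> ln (1 - (cmod g)\<^sup>2 * sT\<^sup>2 / ((P + sT) * (\<epsilon> + w)))"
  proof -
    have "(cmod g)\<^sup>2 * sT\<^sup>2 / ((P + sT) * (\<epsilon> + w)) \<le> (cmod g)\<^sup>2 * sT\<^sup>2 / ((P' + sT) * (\<epsilon>' + w))"
      using le2 pos by (intro divide_left_mono) auto
    moreover have "(cmod g)\<^sup>2 * sT\<^sup>2 / ((P' + sT) * (\<epsilon>' + w)) < 1" using pos lt le1 by (simp add: pos_divide_less_eq)
    ultimately show ?thesis by (subst ln_le_cancel_iff) auto
  qed
  then have "real n * ln (1 - (cmod g)\<^sup>2 * sT\<^sup>2 / ((P' + sT) * (\<epsilon>' + w))) \<le> real n * ln (1 - (cmod g)\<^sup>2 * sT\<^sup>2 / ((P + sT) * (\<epsilon> + w)))"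
    by (intro mult_left_mono) auto
  ultimately show "Jent n A x J \<iota> sT VW g \<le> H n A x sT + H n J \<iota> w + real n * ln (1 - (cmod g)\<^sup>2 * sT\<^sup>2 / ((P + sT) * (\<epsilon> + w)))" by simp
qed

text \<open>Entropies are replaced by gaps. The entropies of the codeword at level \<open>sT\<close>
  and of the interference at level \<open>w\<close> come from \<open>Jent_le\<close>, that of the
  interference at \<open>VW\<close> from the noise term of Fano; the logarithm is the mutual
  information for Gaussian inputs as a ratio of determinants.\<close>

lemma rate_le_genie:
  assumes n: "0 < n" and x: "pwr n {..<Ma} x P" and \<iota>: "pwr n J \<iota> \<epsilon>" and s: "succ n Ma x J \<iota> \<psi> e"
    and sT: "0 < sT" and VW: "0 < VW" and one: "VW + (cmod (1 + g))\<^sup>2 * sT = 1" and w: "w = VW + (cmod g)\<^sup>2 * sT"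
  shows "(1 - e) * ln (real Ma) - ln 2 \<le> - Dd n {..<Ma} x sT P - Dd n J \<iota> w \<epsilon> + Dd n J \<iota> VW \<epsilon>
     + real n * ln (((P + sT) * (\<epsilon> + w) - (cmod g)\<^sup>2 * sT\<^sup>2) / (sT * (\<epsilon> + VW)))"
proof -
  have J: "finite J" "J \<noteq> {}" and PE: "0 \<le> P" "0 \<le> \<epsilon>" using x \<iota> by (auto simp: pwr_def)
  have w0: "0 < w" using VW sT by (simp add: w add_pos_nonneg)
  note JL = Jent_le[OF n x \<iota> sT VW, of g, folded w]
  have p: "0 < P + sT" "0 < \<epsilon> + w" "0 < \<epsilon> + VW" using PE sT w0 VW by auto
  have q: "0 < (P + sT) * (\<epsilon> + w) - (cmod g)\<^sup>2 * sT\<^sup>2" using JL(2) by simp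
  have r: "0 < 1 - (cmod g)\<^sup>2 * sT\<^sup>2 / ((P + sT) * (\<epsilon> + w))" using JL(2) p by (simp add: pos_divide_less_eq)
  have "ln ((P + sT) * (\<epsilon> + w) - (cmod g)\<^sup>2 * sT\<^sup>2) = ln ((P + sT) * (\<epsilon> + w) * (1 - (cmod g)\<^sup>2 * sT\<^sup>2 / ((P + sT) * (\<epsilon> + w))))"
    using p by (simp add: right_diff_distrib)
  also have "\<dots> = ln (P + sT) + ln (\<epsilon> + w) + ln (1 - (cmod g)\<^sup>2 * sT\<^sup>2 / ((P + sT) * (\<epsilon> + w)))"
    using p r by (subst ln_mult_pos, simp, simp, subst ln_mult_pos) simp_all
  finally have L: "ln (((P + sT) * (\<epsilon> + w) - (cmod g)\<^sup>2 * sT\<^sup>2) / (sT * (\<epsilon> + VW))) = ln (P + sT) + ln (\<epsilon> + w) + ln (1 - (cmod g)\<^sup>2 * sT\<^sup>2 / ((P + sT) * (\<epsilon> + w))) - ln sT - ln (\<epsilon> + VW)"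
    using q p sT by (simp add: ln_div ln_mult_pos)
  have E: "ln (pi * exp 1 * u) = ln pi + 1 + ln u" if "0 < u" for u using that by (simp add: ln_mult_pos)
  show ?thesis
    using rate_le_genie_entropy[OF x J s sT VW one] JL(1) unfolding L Dd_def E[OF p(1)] E[OF p(2)] E[OF p(3)] E[OF sT] by (simp add: algebra_simps)
qed

text \<open>The entropy bound rewritten in gaps. The gap of \<open>h32 \<beta>\<close> at level
  \<open>VN\<close> becomes one of \<beta> itself at level \<open>VN / (cmod h32)\<^sup>2\<close>,
  the form in which the bound for that user can absorb it.\<close>

lemma rate_le_side_info:
  fixes h31 h32 cc g \<kappa> :: complex and d :: "'c \<Rightarrow> nat \<Rightarrow> complex"
  assumes x: "pwr n {..<Ma} x P" and xb: "pwr n B \<beta> Pb" and C: "finite C" "C \<noteq> {}"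
    and s: "succ n Ma x (B \<times> C) (\<lambda>(b, c). sc (cc * h32) (\<beta> b) + d c) \<psi> e"
    and e: "0 < ee" and v: "0 < VN" and h32: "h32 \<noteq> 0" and cc: "cc \<noteq> 0"
    and one: "(cmod cc)\<^sup>2 * VN + (cmod (1 + cc * g))\<^sup>2 * ee = 1"
    and sN: "VN + (cmod g)\<^sup>2 * ee = sN2"
    and \<tau>: "\<tau> = (cmod (1 + (cc - \<kappa>) * g))\<^sup>2 * ee + (cmod (cc - \<kappa>))\<^sup>2 * VN + (cmod (1 - \<kappa> * h31))\<^sup>2 * P + (cmod (cc * h32 - \<kappa> * h32))\<^sup>2 * Pb" and \<tau>0: "0 < \<tau>"
  shows "(1 - e) * ln (real Ma) - ln 2 \<le> - Dd n ({..<Ma} \<times> B) (\<lambda>(a, b). sc h31 (x a) + sc h32 (\<beta> b)) sN2 ((cmod h31)\<^sup>2 * P + (cmod h32)\<^sup>2 * Pb)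
      + Dd n B \<beta> (VN / (cmod h32)\<^sup>2) Pb + real n * ln (((cmod h31)\<^sup>2 * P + (cmod h32)\<^sup>2 * Pb + sN2) * \<tau> / (ee * ((cmod h32)\<^sup>2 * Pb + VN)))"
proof -
  have PE: "0 \<le> P" "0 \<le> Pb" "finite B" "B \<noteq> {}" using x xb by (auto simp: pwr_def)
  have hp: "0 < (cmod h32)\<^sup>2" using h32 by simp
  have sN0: "0 < sN2" using sN v e by (metis add_pos_nonneg less_imp_le mult_nonneg_nonneg zero_le_power2)
  have p: "0 < (cmod h31)\<^sup>2 * P + (cmod h32)\<^sup>2 * Pb + sN2" "0 < (cmod h32)\<^sup>2 * Pb + VN" using PE sN0 v by (auto intro!: add_nonneg_pos)
  have D: "Dd n B \<beta> (VN / (cmod h32)\<^sup>2) Pb = Dd n B (\<lambda>b. sc h32 (\<beta> b)) VN ((cmod h32)\<^sup>2 * Pb)"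
    using Dd_scale[of B "VN / (cmod h32)\<^sup>2" h32 Pb n \<beta>] PE v hp h32 by simp
  have E: "ln (pi * exp 1 * u) = ln pi + 1 + ln u" if "0 < u" for u using that by (simp add: ln_mult_pos)
  have L: "ln (((cmod h31)\<^sup>2 * P + (cmod h32)\<^sup>2 * Pb + sN2) * \<tau> / (ee * ((cmod h32)\<^sup>2 * Pb + VN))) = ln ((cmod h31)\<^sup>2 * P + (cmod h32)\<^sup>2 * Pb + sN2) + ln \<tau> - ln ee - ln ((cmod h32)\<^sup>2 * Pb + VN)"
    using p \<tau>0 e by (simp add: ln_div ln_mult_pos)
  show ?thesis using rate_le_side_info_entropy[OF x xb C s e v h32 cc one sN \<tau> \<tau>0]
    unfolding D unfolding Dd_def L E[OF p(1)] E[OF p(2)] E[OF e] E[OF \<tau>0] by (simp add: algebra_simps)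
qed

section \<open>Bounds for one user\<close>

lemma fm_const_fst: "finite A \<Longrightarrow> A \<noteq> {} \<Longrightarrow> fm n (A \<times> B) (\<lambda>(a, b). c b) v y = fm n B c v y"
proof -
  assume A: "finite A" "A \<noteq> {}"
  have "(\<Sum>w\<in>A \<times> B. gd n v (y - (case w of (a, b) \<Rightarrow> c b))) = (\<Sum>a\<in>A. \<Sum>b\<in>B. gd n v (y - c b))"
    by (simp only: sum.cartesian_product split_def)
  then show ?thesis using A by (simp add: fm_def card_cartesian_product)
qed

text \<open>Here \<open>w\<close> is the variance of \<open>W\<close> and \<open>z = E[Z W\<^sup>*]\<close>; \<open>v1\<close> is the variance of the noise \<open>N\<close> of the next user, and \<open>vbar\<close> the noise level at which that of the previous user measures the codeword.\<close>

lemma label_outer_bound: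
  fixes P \<epsilon> w :: real and z :: complex
  defines "sT \<equiv> 1 + w - 2 * Re z"
  assumes n: "0 < n" and x: "pwr n {..<Ma} x P" and \<iota>: "pwr n J \<iota> \<epsilon>" and s: "succ n Ma x J \<iota> \<psi> e"
    and w: "0 \<le> w" "w \<le> 1" and z: "(cmod z)\<^sup>2 \<le> w" and v1: "0 < v1" "v1 \<le> 1" and vbar: "0 < vbar" "0 < P \<Longrightarrow> sT \<le> vbar"
    and m: "0 \<le> m1" "0 \<le> m3" and G1: "0 < P \<Longrightarrow> ln (1 + P / (\<epsilon> + 1)) \<le> m1"
    and G3: "\<And>\<gamma>. 0 < P \<Longrightarrow> 0 < (cmod (1 + \<gamma>))\<^sup>2 * \<epsilon> + (1 + (cmod \<gamma>)\<^sup>2 * w + 2 * Re (cnj \<gamma> * z)) \<and>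
         ln (1 + P / ((cmod (1 + \<gamma>))\<^sup>2 * \<epsilon> + (1 + (cmod \<gamma>)\<^sup>2 * w + 2 * Re (cnj \<gamma> * z)))) \<le> m3"
    and C: "v1 \<le> w - (cmod (z - of_real w))\<^sup>2 / sT \<or> w \<le> w - (cmod (z - of_real w))\<^sup>2 / sT \<or> \<epsilon> = 0"
  shows "2 * ((1 - e) * ln (real Ma) - ln 2) + Dd n {..<Ma} x vbar P \<le> Dd n J \<iota> v1 \<epsilon> + real n * (m1 + m3)"
proof (cases "P = 0")
  case True
  have J: "finite J" "J \<noteq> {}" using \<iota> by (auto simp: pwr_def)
  have "(1 - e) * ln (real Ma) - ln 2 \<le> 0" using rate_le_zero_power[OF _ J s] x True by simp
  moreover have "Dd n {..<Ma} x vbar P = 0" using Dd_zero[OF _ vbar(1)] x True by simp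
  moreover have "0 \<le> Dd n J \<iota> v1 \<epsilon>" by (rule Dd_nonneg[OF \<iota> v1(1)])
  moreover have "0 \<le> real n * (m1 + m3)" using m by simp
  ultimately show ?thesis by simp
next
  case False
  have PE: "0 < P" "0 \<le> \<epsilon>" and J: "finite J" "J \<noteq> {}" using x \<iota> False by (auto simp: pwr_def)
  \<comment> \<open>With weight -1 for \<open>U\<close> the interference cancels and the noise
    \<open>Z - W\<close> of variance \<open>sT\<close> is left.\<close>
  have sTp: "0 < sT" and G3a: "ln (1 + P / sT) \<le> m3" using G3[of "- 1"] PE by (auto simp: sT_def)
  have vb: "sT \<le> vbar" using vbar PE by simp
  have Dx: "Dd n {..<Ma} x vbar P \<le> Dd n {..<Ma} x sT P" by (rule Dd_mono[OF x sTp vb])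
  have "(P + \<epsilon> + 1) / (\<epsilon> + 1) = 1 + P / (\<epsilon> + 1)" using PE by (simp add: field_simps)
  then have t1: "(1 - e) * ln (real Ma) - ln 2 \<le> Dd n J \<iota> 1 \<epsilon> + real n * m1"
    using rate_le_interference_as_noise[OF x \<iota> s] mult_left_mono[OF G1[OF PE(1)], of "real n"] by simp
  show ?thesis
  \<comment> \<open>If \<open>W\<close> vanishes, \<open>U\<close> is the interference itself and
    the pair has no density; the bound for known interference takes its place.\<close>
  proof (cases "w = 0")
    case True
    then have "sT = 1" using z by (simp add: sT_def)
    then have "real n * ln (P + 1) \<le> real n * m3" using G3a by (intro mult_left_mono) (auto simp: add.commute)
    moreover have "Dd n J \<iota> 1 \<epsilon> \<le> Dd n J \<iota> v1 \<epsilon>" by (rule Dd_mono[OF \<iota> v1])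
    ultimately show ?thesis using t1 rate_le_known_interference[OF x J s] Dx \<open>sT = 1\<close> by (simp add: distrib_left)
  next
    case w0: False
    have wp: "0 < w" using w w0 by simp
    define r where "r = z - of_real w"
    \<comment> \<open>Conditional variance of \<open>W\<close> given \<open>Z - W\<close>; here
      \<open>r = E[(Z - W) W\<^sup>*]\<close>.\<close>
    define VW where "VW = w - (cmod r)\<^sup>2 / sT"
    \<comment> \<open>Error variance of the best linear estimate of \<open>Z - W\<close> from
      \<open>U\<close>, which for Gaussian interference is the effective noise of the receiver that
      knows \<open>U\<close>.\<close>
    define \<eta> where "\<eta> = sT - (cmod r)\<^sup>2 / (\<epsilon> + w)"
    have ew: "0 < \<epsilon> + w" using PE wp by simp
    have \<eta>: "0 < \<eta>" "ln (1 + P / \<eta>) \<le> m3"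
    proof -
      \<comment> \<open>The weight \<open>- 1 - \<kappa>\<close> of \<open>U\<close> removes the
        interference and then the estimate of \<open>Z - W\<close>.\<close>
      define \<kappa> where "\<kappa> = of_real (1 / (\<epsilon> + w)) * r"
      have "(cmod (1 + (- 1 - \<kappa>)))\<^sup>2 * \<epsilon> + (1 + (cmod (- 1 - \<kappa>))\<^sup>2 * w + 2 * Re (cnj (- 1 - \<kappa>) * z)) = sT + (cmod \<kappa>)\<^sup>2 * (\<epsilon> + w) - 2 * Re (cnj \<kappa> * r)"
        unfolding cmod_power2 r_def sT_def by (simp add: algebra_simps power2_eq_square)
      moreover have "(cmod \<kappa>)\<^sup>2 * (\<epsilon> + w) = (cmod r)\<^sup>2 / (\<epsilon> + w)"
        using ew by (simp add: \<kappa>_def norm_mult power_mult_distrib norm_divide power_divide power2_eq_square[of "\<epsilon> + w"] del: of_real_add of_real_divide)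
      moreover have "Re (cnj \<kappa> * r) = (cmod r)\<^sup>2 / (\<epsilon> + w)"
      proof -
        have "cnj \<kappa> * r = of_real (1 / (\<epsilon> + w)) * (r * cnj r)" by (simp add: \<kappa>_def mult_ac del: of_real_divide)
        also have "\<dots> = of_real (1 / (\<epsilon> + w) * (cmod r)\<^sup>2)" by (simp only: complex_norm_square[symmetric] of_real_mult of_real_power)
        finally show ?thesis by (simp del: of_real_mult of_real_divide)
      qed
      ultimately have "(cmod (1 + (- 1 - \<kappa>)))\<^sup>2 * \<epsilon> + (1 + (cmod (- 1 - \<kappa>))\<^sup>2 * w + 2 * Re (cnj (- 1 - \<kappa>) * z)) = \<eta>"
        unfolding \<eta>_def by linarith
      then show "0 < \<eta>" "ln (1 + P / \<eta>) \<le> m3" using G3[of "- 1 - \<kappa>"] PE(1) by (simp_all only:)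
    qed
    have VWw: "VW \<le> w" using sTp by (simp add: VW_def)
    have VW: "0 < VW"
    proof -
      have "0 < VW" if "\<epsilon> = 0"
      proof -
        have "(cmod r)\<^sup>2 < sT * w" using \<eta>(1) wp by (simp add: \<eta>_def that pos_divide_less_eq)
        then show ?thesis using sTp by (simp add: VW_def pos_divide_less_eq mult.commute)
      qed
      then show ?thesis using C v1 wp by (auto simp: VW_def r_def)
    qed
    \<comment> \<open>Regression coefficient of \<open>W\<close> on \<open>Z - W\<close>, so that
      \<open>W = g (Z - W) + V\<close> with \<open>V\<close> of variance \<open>VW\<close>
      uncorrelated with \<open>Z - W\<close>.\<close>
    define g where "g = of_real (1 / sT) * cnj r"
    have gs: "(cmod g)\<^sup>2 * sT = (cmod r)\<^sup>2 / sT" "(cmod g)\<^sup>2 * sT\<^sup>2 = (cmod r)\<^sup>2"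
      using sTp by (simp_all add: g_def norm_mult norm_divide power_divide power2_eq_square)
    have wV: "w = VW + (cmod g)\<^sup>2 * sT" by (simp add: VW_def gs)
    have one: "VW + (cmod (1 + g))\<^sup>2 * sT = 1"
    proof -
      have "Re (1 * cnj g) * sT = Re r" using sTp by (simp add: g_def)
      then have "(cmod (1 + g))\<^sup>2 * sT = sT + 2 * Re r + (cmod g)\<^sup>2 * sT"
        unfolding cmod_add_sq by (simp add: algebra_simps)
      moreover have "Re r = Re z - w" by (simp add: r_def)
      ultimately show ?thesis using wV sT_def by linarith
    qed
    have "((P + sT) * (\<epsilon> + w) - (cmod g)\<^sup>2 * sT\<^sup>2) / (sT * (\<epsilon> + VW)) = 1 + P / \<eta>"
    proof -
      have d1: "(\<epsilon> + w) * \<eta> = (\<epsilon> + w) * sT - (cmod r)\<^sup>2" using ew by (simp add: \<eta>_def right_diff_distrib)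
      have "sT * (\<epsilon> + VW) = sT * (\<epsilon> + w) - (cmod r)\<^sup>2" using sTp by (simp add: VW_def right_diff_distrib distrib_left)
      then have d: "sT * (\<epsilon> + VW) = (\<epsilon> + w) * \<eta>" unfolding d1 by (simp only: mult.commute)
      have "(P + sT) * (\<epsilon> + w) - (cmod g)\<^sup>2 * sT\<^sup>2 = (\<epsilon> + w) * (P + \<eta>)" unfolding gs distrib_left[of "\<epsilon> + w" P] d1 by (simp add: distrib_right mult.commute)
      then show ?thesis unfolding d using ew \<eta>(1) by (simp add: add_divide_distrib)
    qed
    then have t3: "(1 - e) * ln (real Ma) - ln 2 \<le> - Dd n {..<Ma} x sT P - Dd n J \<iota> w \<epsilon> + Dd n J \<iota> VW \<epsilon> + real n * m3"
      using rate_le_genie[OF n x \<iota> s sTp VW one wV] mult_left_mono[OF \<eta>(2), of "real n"] by simp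
    \<comment> \<open>Gaps decrease in the noise level. In the first case \<open>v1 \<le> VW\<close>
      and \<open>w \<le> 1\<close> are compared separately; in the second \<open>VW = w\<close>, so
      two gaps cancel; without interference all four vanish.\<close>
    have DI: "Dd n J \<iota> 1 \<epsilon> + Dd n J \<iota> VW \<epsilon> \<le> Dd n J \<iota> w \<epsilon> + Dd n J \<iota> v1 \<epsilon>"
      using C
    proof (elim disjE)
      assume "v1 \<le> w - (cmod (z - of_real w))\<^sup>2 / sT"
      then have "v1 \<le> VW" by (simp add: VW_def r_def)
      then show ?thesis using Dd_mono[OF \<iota> v1(1)] Dd_mono[OF \<iota> wp w(2)] by fastforce
    next
      assume "w \<le> w - (cmod (z - of_real w))\<^sup>2 / sT"
      then have "VW = w" using VWw by (simp add: VW_def r_def)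
      then show ?thesis using Dd_mono[OF \<iota> v1] by simp
    next
      assume "\<epsilon> = 0"
      then show ?thesis using Dd_zero[of n J \<iota>] \<iota> v1 wp VW by simp
    qed
    show ?thesis using t1 t3 Dx DI by (simp add: distrib_left)
  qed
qed

text \<open>Here \<open>s\<close> is the standard deviation of \<open>N\<close> and \<open>z = E[Z N\<^sup>*]\<close>. The premise for \<open>e = 0\<close> covers the case where \<open>N\<close> is a multiple of \<open>Z\<close>, in which the conditional variances of the paper divide by zero.\<close>

lemma label_middle_bound:
  fixes P Pb s sT m2 :: real and h12 h31 h32 z :: complex
  defines "cc \<equiv> h12 / h32"
  defines "e \<equiv> 1 + (cmod cc)\<^sup>2 * s\<^sup>2 - 2 * Re (cnj cc * z)"
  assumes P: "0 \<le> P" "0 \<le> Pb" and h: "h12 \<noteq> 0" "h31 \<noteq> 0" "h32 \<noteq> 0" and s: "0 \<le> s" and z: "cmod z \<le> s"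
    and m: "0 \<le> m2" and G2: "\<And>\<alpha> \<gamma>. 0 < P \<Longrightarrow> \<alpha> + \<gamma> * h31 = 1 \<Longrightarrow>
       0 < (cmod (\<alpha> * h12 + \<gamma> * h32))\<^sup>2 * Pb + ((cmod \<alpha>)\<^sup>2 + (cmod \<gamma>)\<^sup>2 * s\<^sup>2 + 2 * Re (\<alpha> * cnj \<gamma> * z)) \<and>
       ln (1 + P / ((cmod (\<alpha> * h12 + \<gamma> * h32))\<^sup>2 * Pb + ((cmod \<alpha>)\<^sup>2 + (cmod \<gamma>)\<^sup>2 * s\<^sup>2 + 2 * Re (\<alpha> * cnj \<gamma> * z)))) \<le> m2"
    and K1: "e \<noteq> 0 \<Longrightarrow> (cmod h32)\<^sup>2 * sT \<le> (s\<^sup>2 - (cmod z)\<^sup>2) / e" and K2: "e = 0 \<Longrightarrow> sT \<le> 1 / (cmod h12)\<^sup>2" and sT: "0 < Pb \<Longrightarrow> 0 < sT"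
  shows "s = 0 \<longrightarrow> P = 0 \<and> Pb = 0"
    and "\<exists>vbar>0. (0 < Pb \<longrightarrow> sT \<le> vbar) \<and>
      (\<forall>n Ma x (B :: nat set) \<beta> (C :: nat set) d \<psi> er. pwr n {..<Ma} x P \<longrightarrow> pwr n B \<beta> Pb \<longrightarrow> finite C \<longrightarrow> C \<noteq> {} \<longrightarrow>
        succ n Ma x (B \<times> C) (\<lambda>(b, c). sc h12 (\<beta> b) + d c) \<psi> er \<longrightarrow>
        (1 - er) * ln (real Ma) - ln 2 + Dd n ({..<Ma} \<times> B) (\<lambda>(a, b). sc h31 (x a) + sc h32 (\<beta> b)) (if s = 0 then 1 else s\<^sup>2) ((cmod h31)\<^sup>2 * P + (cmod h32)\<^sup>2 * Pb)
          \<le> Dd n B \<beta> vbar Pb + real n * m2)" (is "\<exists>vbar>0. _ \<and> ?B vbar")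
proof -
  have hp: "0 < (cmod h12)\<^sup>2" "0 < (cmod h31)\<^sup>2" "0 < (cmod h32)\<^sup>2" using h by auto
  have cch: "cc * h32 = h12" "cc \<noteq> 0" using h by (auto simp: cc_def)
  have ccn: "(cmod cc)\<^sup>2 = (cmod h12)\<^sup>2 / (cmod h32)\<^sup>2" by (simp add: cc_def norm_divide power_divide)
  have zz: "(cmod z)\<^sup>2 \<le> s\<^sup>2" using z by (intro power_mono) auto
  have Rz: "Re (cnj cc * z) \<le> cmod cc * s"
    using complex_Re_le_cmod[of "cnj cc * z"] mult_left_mono[OF z, of "cmod cc"] by (simp add: norm_mult)
  \<comment> \<open>Cauchy-Schwarz; \<open>e\<close> is the variance of
    \<open>Z - cc N\<close>.\<close>
  have esq: "(1 - cmod cc * s)\<^sup>2 \<le> e" using Rz by (simp add: e_def power2_eq_square algebra_simps)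
  then have e0: "0 \<le> e" using zero_le_power2 order_trans by blast
  have eZ: "cmod cc * s = 1" if "e = 0" using esq that by simp
  show s0: "s = 0 \<longrightarrow> P = 0 \<and> Pb = 0"
  proof
    \<comment> \<open>A noiseless \<open>S\<close> has conditional variance 0, which
      \<open>K1\<close> allows only if \<open>Pb = 0\<close>; then \<open>S\<close> alone, with
      weight \<open>1 / h31\<close>, would reveal the input exactly, contradicting positivity in
      \<open>G2\<close> unless \<open>P = 0\<close>.\<close>
    assume s0: "s = 0"
    then have [simp]: "z = 0" using z by simp
    have "e = 1" by (simp add: e_def s0)
    then have "(cmod h32)\<^sup>2 * sT \<le> 0" using K1 s0 by simp
    then have Pb: "Pb = 0" using sT P hp by (metis linorder_not_less mult_pos_pos order_le_less)
    moreover have "\<not> 0 < P"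
    proof
      assume "0 < P"
      from G2[OF this, of 0 "1 / h31"] show False using h s0 Pb by simp
    qed
    ultimately show "P = 0 \<and> Pb = 0" using P by simp
  qed
  show "\<exists>vbar>0. (0 < Pb \<longrightarrow> sT \<le> vbar) \<and> ?B vbar"
  proof (cases "P = 0")
    case P0: True
    show ?thesis
    proof (cases "Pb = 0")
      case True
      show ?thesis
      proof (intro exI[of _ 1] conjI allI impI)
        fix n Ma x d \<psi> er and B C :: "nat set" and \<beta>
        assume a: "pwr n {..<Ma} x P" "pwr n B \<beta> Pb" "finite C" "C \<noteq> {}" "succ n Ma x (B \<times> C) (\<lambda>(b, c). sc h12 (\<beta> b) + d c) \<psi> er"
        have BC: "finite (B \<times> C)" "B \<times> C \<noteq> {}" using a by (auto simp: pwr_def)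
        have v1: "0 < (if s = 0 then 1 else s\<^sup>2)" using s by simp
        have "(1 - er) * ln (real Ma) - ln 2 \<le> 0" using rate_le_zero_power[OF _ BC a(5)] a(1) P0 by simp
        moreover have "Dd n ({..<Ma} \<times> B) (\<lambda>(a, b). sc h31 (x a) + sc h32 (\<beta> b)) (if s = 0 then 1 else s\<^sup>2) 0 = 0"
          using pwr_pair(1)[OF a(1,2), of h31 h32] P0 True v1 by (intro Dd_zero) auto
        moreover have "Dd n B \<beta> 1 Pb = 0" using Dd_zero[of n B \<beta> 1] a True by simp
        moreover have "0 \<le> real n * m2" using m by simp
        ultimately show "(1 - er) * ln (real Ma) - ln 2 + Dd n ({..<Ma} \<times> B) (\<lambda>(a, b). sc h31 (x a) + sc h32 (\<beta> b)) (if s = 0 then 1 else s\<^sup>2) ((cmod h31)\<^sup>2 * P + (cmod h32)\<^sup>2 * Pb) \<le> Dd n B \<beta> 1 Pb + real n * m2"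
          using P0 True by simp
      qed (use True in auto)
    next
      case False
      then have sp: "0 < s" "s \<noteq> 0" and Pbp: "0 < Pb" using s0 s P by auto
      \<comment> \<open>With \<open>P = 0\<close> the signal in \<open>S\<close> is just
        \<open>h32 \<beta>\<close>, so its gap is that of \<beta> at level
        \<open>s\<^sup>2 / (cmod h32)\<^sup>2\<close>. This level is high enough, since a
        conditional variance of \<open>N\<close> is at most \<open>s\<^sup>2\<close>.\<close>
      have vb: "sT \<le> s\<^sup>2 / (cmod h32)\<^sup>2"
      proof (cases "e = 0")
        case True
        have "s\<^sup>2 * (cmod cc)\<^sup>2 = 1" using eZ[OF True] by (metis mult.commute one_power2 power_mult_distrib)
        then have "s\<^sup>2 / (cmod h32)\<^sup>2 = 1 / (cmod h12)\<^sup>2" using hp sp unfolding ccn by (simp add: field_simps)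
        then show ?thesis using K2[OF True] by simp
      next
        case False
        then have ep: "0 < e" using e0 by simp
        have "s\<^sup>2 * e - (s\<^sup>2 - (cmod z)\<^sup>2) = (cmod (z - cc * of_real (s\<^sup>2)))\<^sup>2"
          unfolding e_def cmod_power2 by (simp add: algebra_simps power2_eq_square)
        then have "s\<^sup>2 - (cmod z)\<^sup>2 \<le> s\<^sup>2 * e" using zero_le_power2[of "cmod (z - cc * of_real (s\<^sup>2))"] by linarith
        then have "(s\<^sup>2 - (cmod z)\<^sup>2) / e \<le> s\<^sup>2" using ep by (simp add: pos_divide_le_eq)
        then show ?thesis using K1[OF False] hp by (simp add: pos_le_divide_eq mult.commute)
      qed
      show ?thesis
      proof (intro exI[of _ "s\<^sup>2 / (cmod h32)\<^sup>2"] conjI allI impI)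
        show "0 < s\<^sup>2 / (cmod h32)\<^sup>2" using sp hp by simp
        show "sT \<le> s\<^sup>2 / (cmod h32)\<^sup>2" by (rule vb)
        fix n Ma x d \<psi> er and B C :: "nat set" and \<beta>
        assume a: "pwr n {..<Ma} x P" "pwr n B \<beta> Pb" "finite C" "C \<noteq> {}" "succ n Ma x (B \<times> C) (\<lambda>(b, c). sc h12 (\<beta> b) + d c) \<psi> er"
        have BC: "finite (B \<times> C)" "B \<times> C \<noteq> {}" and A: "finite {..<Ma}" "{..<Ma} \<noteq> {}" and B: "finite B" "B \<noteq> {}" using a unfolding pwr_def by auto
        have "(1 - er) * ln (real Ma) - ln 2 \<le> 0" using rate_le_zero_power[OF _ BC a(5)] a(1) P0 by simp
        moreover have "Dd n ({..<Ma} \<times> B) (\<lambda>(a, b). sc h31 (x a) + sc h32 (\<beta> b)) (s\<^sup>2) ((cmod h32)\<^sup>2 * Pb) = Dd n B \<beta> (s\<^sup>2 / (cmod h32)\<^sup>2) Pb"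
        proof -
          have "H n ({..<Ma} \<times> B) (\<lambda>(a, b). sc h31 (x a) + sc h32 (\<beta> b)) (s\<^sup>2) = H n ({..<Ma} \<times> B) (\<lambda>(a, b). sc h32 (\<beta> b)) (s\<^sup>2)"
            using pwr_zero[of n "{..<Ma}" x] a(1) P0 by (intro H_cong) auto
          also have "\<dots> = H n B (\<lambda>b. sc h32 (\<beta> b)) (s\<^sup>2)" unfolding H_def fm_const_fst[OF A] ..
          finally have "Dd n ({..<Ma} \<times> B) (\<lambda>(a, b). sc h31 (x a) + sc h32 (\<beta> b)) (s\<^sup>2) ((cmod h32)\<^sup>2 * Pb) = Dd n B (\<lambda>b. sc h32 (\<beta> b)) (s\<^sup>2) ((cmod h32)\<^sup>2 * Pb)"
            by (simp add: Dd_def)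
          also have "\<dots> = Dd n B \<beta> (s\<^sup>2 / (cmod h32)\<^sup>2) Pb"
            using Dd_scale[OF B, of "s\<^sup>2 / (cmod h32)\<^sup>2" h32 Pb n \<beta>] sp hp h P by simp
          finally show ?thesis .
        qed
        moreover have "0 \<le> real n * m2" using m by simp
        ultimately show "(1 - er) * ln (real Ma) - ln 2 + Dd n ({..<Ma} \<times> B) (\<lambda>(a, b). sc h31 (x a) + sc h32 (\<beta> b)) (if s = 0 then 1 else s\<^sup>2) ((cmod h31)\<^sup>2 * P + (cmod h32)\<^sup>2 * Pb) \<le> Dd n B \<beta> (s\<^sup>2 / (cmod h32)\<^sup>2) Pb + real n * m2"
          using P0 sp by simp
      qed
    qed
  next
    case False
    then have Pp: "0 < P" using P by simp
    then have sp: "0 < s" "s \<noteq> 0" using s0 s by auto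
    \<comment> \<open>Covariance matrix of the disturbances \<open>h12 \<beta> + Z\<close> and
      \<open>h32 \<beta> + N\<close> for Gaussian \<beta>.\<close>
    define A11 A22 xx where "A11 = (cmod h12)\<^sup>2 * Pb + 1" and "A22 = (cmod h32)\<^sup>2 * Pb + s\<^sup>2" and "xx = h12 * cnj h32 * of_real Pb + z"
    \<comment> \<open>\<open>P * Q / det\<close> is the signal-to-noise ratio of the best linear
      combination of \<open>Y\<close> and \<open>S\<close>; \<open>Q\<close> is also the variance of
      \<open>h31 (h12 \<beta> + Z) - (h32 \<beta> + N)\<close>.\<close>
    define det Q where "det = A11 * A22 - (cmod xx)\<^sup>2" and "Q = A22 - 2 * Re (xx * h31) + (cmod h31)\<^sup>2 * A11"
    have A0: "0 < A11" "0 < A22" using P sp by (auto simp: A11_def A22_def intro!: add_nonneg_pos)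
    define q0 where "q0 = (cmod h31)\<^sup>2 + s\<^sup>2 - 2 * Re (h31 * z)"
    have Qq: "Q = (cmod (h31 * h12 - h32))\<^sup>2 * Pb + q0"
      unfolding Q_def A11_def A22_def xx_def q0_def cmod_power2 by (simp add: algebra_simps power2_eq_square)
    have q0: "(cmod h31 - s)\<^sup>2 \<le> q0"
    proof -
      have "Re (h31 * z) \<le> cmod h31 * s" using complex_Re_le_cmod[of "h31 * z"] mult_left_mono[OF z, of "cmod h31"] by (simp add: norm_mult)
      then show ?thesis by (simp add: q0_def power2_eq_square algebra_simps)
    qed
    have q00: "0 \<le> q0" using q0 zero_le_power2 order_trans by blast
    have Q0: "0 \<le> Q" using q00 P by (simp add: Qq)
    show ?thesis
    proof (cases "Q = 0")
      case True
      \<comment> \<open>Then \<open>S\<close> is \<open>h31\<close> times the output in mean square: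
        \<open>N = h31 Z\<close>, and the interference is proportional as well unless \<beta> has no
        power. The estimate from \<open>Y\<close> alone is optimal.\<close>
      have qz: "q0 = 0" and h2: "(cmod (h31 * h12 - h32))\<^sup>2 * Pb = 0" using True q00 P mult_nonneg_nonneg[OF zero_le_power2 P(2), of "cmod (h31 * h12 - h32)"] unfolding Qq by linarith+
      have hs: "cmod h31 = s" using q0 qz by simp
      have c2: "Pb = 0 \<or> h32 = h31 * h12" using h2 by auto
      have G: "ln (1 + P / A11) \<le> m2" using G2[of 1 0] Pp by (simp add: A11_def)
      show ?thesis
      proof (intro exI[of _ "1 / (cmod h12)\<^sup>2"] conjI allI impI)
        show "0 < 1 / (cmod h12)\<^sup>2" using hp by simp
        show "sT \<le> 1 / (cmod h12)\<^sup>2" if "0 < Pb"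
        proof (rule K2)
          have h3: "h32 = h31 * h12" using c2 that by simp
          have "cnj cc * z = (h31 * z) / (h31 * cnj h31)" using h by (simp add: cc_def h3 field_simps)
          also have "\<dots> = (h31 * z) / of_real ((cmod h31)\<^sup>2)" by (simp only: complex_norm_square)
          finally have "Re (cnj cc * z) = Re (h31 * z) / (cmod h31)\<^sup>2" by (simp only: Re_divide_of_real)
          moreover have "Re (h31 * z) = s\<^sup>2" using qz hs by (simp add: q0_def)
          moreover have "(cmod cc)\<^sup>2 = 1 / (cmod h31)\<^sup>2" using h by (simp add: cc_def h3 norm_divide norm_mult power_divide power_mult_distrib)
          ultimately show "e = 0" using sp by (simp add: e_def hs)
        qed
        fix n Ma x d \<psi> er and B C :: "nat set" and \<beta>
        assume a: "pwr n {..<Ma} x P" "pwr n B \<beta> Pb" "finite C" "C \<noteq> {}" "succ n Ma x (B \<times> C) (\<lambda>(b, c). sc h12 (\<beta> b) + d c) \<psi> er"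
        have "(P + (cmod h12)\<^sup>2 * Pb + 1) / ((cmod h12)\<^sup>2 * Pb + 1) = 1 + P / A11" using A0 by (simp add: A11_def add_divide_distrib[symmetric] field_simps)
        then show "(1 - er) * ln (real Ma) - ln 2 + Dd n ({..<Ma} \<times> B) (\<lambda>(a, b). sc h31 (x a) + sc h32 (\<beta> b)) (if s = 0 then 1 else s\<^sup>2) ((cmod h31)\<^sup>2 * P + (cmod h32)\<^sup>2 * Pb) \<le> Dd n B \<beta> (1 / (cmod h12)\<^sup>2) Pb + real n * m2"
          using rate_le_side_info_degenerate[OF a(1,2,3,4,5) h(2,1) disjI2[OF refl] c2] mult_left_mono[OF G, of "real n"] sp hs by simp
      qed
    next
      case False
      then have Qp: "0 < Q" using Q0 by simp
      have G: "0 < det" "ln (1 + P * Q / det) \<le> m2"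
      proof -
        \<comment> \<open>The minimum variance weights with unit gain: the inverse covariance
          applied to the signal direction \<open>(1, h31)\<close>, normalised.\<close>
        define \<alpha> \<gamma> where "\<alpha> = of_real (1 / Q) * (of_real A22 - cnj h31 * cnj xx)" and "\<gamma> = of_real (1 / Q) * (cnj h31 * of_real A11 - xx)"
        have one: "\<alpha> + \<gamma> * h31 = 1"
        proof -
          have "(of_real A22 - cnj h31 * cnj xx) + (cnj h31 * of_real A11 - xx) * h31 = of_real Q"
            unfolding Q_def cmod_power2 complex_eq_iff by (simp add: algebra_simps power2_eq_square)
          then have "\<alpha> + \<gamma> * h31 = of_real (1 / Q) * of_real Q" unfolding \<alpha>_def \<gamma>_def by (metis distrib_left mult.assoc)
          then show ?thesis using Qp by simp
        qed
        have gen: "(cmod (\<alpha> * h12 + \<gamma> * h32))\<^sup>2 * Pb + ((cmod \<alpha>)\<^sup>2 + (cmod \<gamma>)\<^sup>2 * s\<^sup>2 + 2 * Re (\<alpha> * cnj \<gamma> * z)) = (cmod \<alpha>)\<^sup>2 * A11 + (cmod \<gamma>)\<^sup>2 * A22 + 2 * Re (\<alpha> * cnj \<gamma> * xx)" for \<alpha> \<gamma>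
          unfolding A11_def A22_def xx_def cmod_power2 by (simp add: algebra_simps power2_eq_square)
        have "(cmod \<alpha>)\<^sup>2 * A11 + (cmod \<gamma>)\<^sup>2 * A22 + 2 * Re (\<alpha> * cnj \<gamma> * xx) = det / Q"
        proof -
          let ?a = "of_real A22 - cnj h31 * cnj xx" and ?g = "cnj h31 * of_real A11 - xx"
          have n: "(cmod ?a)\<^sup>2 * A11 + (cmod ?g)\<^sup>2 * A22 + 2 * Re (?a * cnj ?g * xx) = det * Q"
            unfolding det_def Q_def cmod_power2 by (simp add: algebra_simps power2_eq_square)
          have "(cmod \<alpha>)\<^sup>2 = (cmod ?a)\<^sup>2 / Q\<^sup>2" "(cmod \<gamma>)\<^sup>2 = (cmod ?g)\<^sup>2 / Q\<^sup>2"
            by (simp_all add: \<alpha>_def \<gamma>_def norm_mult norm_divide power_divide power_mult_distrib)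
          moreover have "Re (\<alpha> * cnj \<gamma> * xx) = Re (?a * cnj ?g * xx) / Q\<^sup>2"
          proof -
            have "\<alpha> * cnj \<gamma> * xx = of_real (1 / Q\<^sup>2) * (?a * cnj ?g * xx)" by (simp add: \<alpha>_def \<gamma>_def power2_eq_square)
            then show ?thesis by (simp only: Re_complex_of_real Im_complex_of_real times_complex.simps) simp
          qed
          ultimately have "(cmod \<alpha>)\<^sup>2 * A11 + (cmod \<gamma>)\<^sup>2 * A22 + 2 * Re (\<alpha> * cnj \<gamma> * xx) = ((cmod ?a)\<^sup>2 * A11 + (cmod ?g)\<^sup>2 * A22 + 2 * Re (?a * cnj ?g * xx)) / Q\<^sup>2"
            by (simp only: add_divide_distrib times_divide_eq_left times_divide_eq_right)
          also have "\<dots> = det / Q" unfolding n using Qp by (simp add: power2_eq_square)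
          finally show ?thesis .
        qed
        then have "0 < det / Q" "ln (1 + P / (det / Q)) \<le> m2" using G2[OF Pp one] unfolding gen by auto
        then show "0 < det" "ln (1 + P * Q / det) \<le> m2" using Qp by (auto simp: zero_less_divide_iff)
      qed
      \<comment> \<open>Replacing \<open>Y\<close> by \<open>Y - cc S\<close> leaves the determinant
        unchanged and frees the first coordinate of \<beta>.\<close>
      have dete: "det = (cmod h32)\<^sup>2 * Pb * e + (s\<^sup>2 - (cmod z)\<^sup>2)"
        unfolding det_def A11_def A22_def xx_def e_def cch(1)[symmetric] cmod_power2 by (simp add: algebra_simps power2_eq_square)
      \<comment> \<open>If \<open>Z = cc N\<close>, then \<open>N\<close> is a multiple of
        \<open>Z\<close> and both terms of \<open>dete\<close> vanish, whereas \<open>G2\<close>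
        makes \<open>det\<close> positive.\<close>
      have ep: "0 < e"
      proof (rule ccontr)
        assume "\<not> 0 < e"
        then have ez: "e = 0" using e0 by simp
        have "s\<^sup>2 * (cmod cc)\<^sup>2 = 1" using eZ[OF ez] by (metis mult.commute one_power2 power_mult_distrib)
        then have "Re (cnj cc * z) = 1" using ez by (simp add: e_def mult.commute)
        then have "1 \<le> cmod cc * cmod z" using complex_Re_le_cmod[of "cnj cc * z"] by (simp add: norm_mult)
        then have "cmod cc * s \<le> cmod cc * cmod z" using eZ[OF ez] by simp
        then have "s \<le> cmod z" using cch by simp
        then have "s\<^sup>2 \<le> (cmod z)\<^sup>2" using s by (intro power_mono) auto
        then show False using G(1) dete ez by simp
      qed
      \<comment> \<open>Conditional variance of \<open>N\<close> given
        \<open>Z - cc N\<close>.\<close>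
      define VN where "VN = (s\<^sup>2 - (cmod z)\<^sup>2) / e"
      have VNe: "VN * e = s\<^sup>2 - (cmod z)\<^sup>2" using ep by (simp add: VN_def)
      have VN: "0 < VN"
      proof (cases "Pb = 0")
        case True
        then show ?thesis using G(1) dete ep by (simp add: VN_def)
      next
        case False
        then have "0 < (cmod h32)\<^sup>2 * sT" using sT P hp by simp
        then show ?thesis using K1 ep by (simp add: VN_def)
      qed
      \<comment> \<open>\<open>gn\<close> is the covariance of \<open>N\<close> with
        \<open>Z - cc N\<close>, and \<open>g\<close> is the regression coefficient.\<close>
      define gn g where "gn = cnj z - cnj cc * of_real (s\<^sup>2)" and "g = of_real (1 / e) * gn"
      have ge: "(cmod g)\<^sup>2 * e = (cmod gn)\<^sup>2 / e" using ep by (simp add: g_def norm_mult norm_divide power_divide power2_eq_square)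
      have sN: "VN + (cmod g)\<^sup>2 * e = s\<^sup>2"
      proof -
        have "s\<^sup>2 - (cmod z)\<^sup>2 + (cmod gn)\<^sup>2 = s\<^sup>2 * e" unfolding gn_def e_def cmod_power2 by (simp add: algebra_simps power2_eq_square)
        then show ?thesis unfolding ge VN_def add_divide_distrib[symmetric] using ep by simp
      qed
      have gen: "(cmod (1 + \<mu> * g))\<^sup>2 * e + (cmod \<mu>)\<^sup>2 * VN = e + 2 * Re (\<mu> * gn) + (cmod \<mu>)\<^sup>2 * s\<^sup>2" for \<mu>
      proof -
        have "Re (1 * cnj (\<mu> * g)) * e = Re (\<mu> * gn)"
        proof -
          have "\<mu> * g = of_real (1 / e) * (\<mu> * gn)" by (simp add: g_def)
          then have "Re (\<mu> * g) = 1 / e * Re (\<mu> * gn)" by simp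
          then show ?thesis using ep by simp
        qed
        then have "(cmod (1 + \<mu> * g))\<^sup>2 * e = e + 2 * Re (\<mu> * gn) + (cmod \<mu>)\<^sup>2 * ((cmod g)\<^sup>2 * e)"
          unfolding cmod_add_sq by (simp add: norm_mult power_mult_distrib algebra_simps)
        then show ?thesis by (simp add: sN[symmetric] algebra_simps)
      qed
      have one: "(cmod cc)\<^sup>2 * VN + (cmod (1 + cc * g))\<^sup>2 * e = 1"
      proof -
        have "e + 2 * Re (cc * gn) + (cmod cc)\<^sup>2 * s\<^sup>2 = 1" unfolding gn_def e_def cmod_power2 by (simp add: algebra_simps power2_eq_square)
        then show ?thesis using gen[of cc] by simp
      qed
      \<comment> \<open>Variance of \<open>S\<close> and covariance of \<open>Y\<close> with
        \<open>S\<close>, the known interference being removed; \<kappa> is then the regression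
        coefficient and \<tau> the residual variance of \<open>Y\<close>.\<close>
      define Ss cv where "Ss = (cmod h31)\<^sup>2 * P + A22" and "cv = cnj h31 * of_real P + xx"
      have Ss: "0 < Ss" using A0 P by (simp add: Ss_def add_nonneg_pos)
      define \<kappa> where "\<kappa> = of_real (1 / Ss) * cv"
      define \<tau> where "\<tau> = (cmod (1 + (cc - \<kappa>) * g))\<^sup>2 * e + (cmod (cc - \<kappa>))\<^sup>2 * VN + (cmod (1 - \<kappa> * h31))\<^sup>2 * P + (cmod (cc * h32 - \<kappa> * h32))\<^sup>2 * Pb"
      have "e + 2 * Re ((cc - k) * gn) + (cmod (cc - k))\<^sup>2 * s\<^sup>2 + (cmod (1 - k * h31))\<^sup>2 * P + (cmod (h12 - k * h32))\<^sup>2 * Pb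
          = P + A11 + (cmod k)\<^sup>2 * Ss - 2 * Re (cnj k * cv)" for k
        unfolding e_def gn_def A11_def Ss_def cv_def A22_def xx_def cmod_power2 by (simp add: algebra_simps power2_eq_square)
      then have "\<tau> = P + A11 + (cmod \<kappa>)\<^sup>2 * Ss - 2 * Re (cnj \<kappa> * cv)" unfolding \<tau>_def gen cch(1) .
      moreover have "(cmod \<kappa>)\<^sup>2 * Ss = (cmod cv)\<^sup>2 / Ss" using Ss by (simp add: \<kappa>_def norm_mult norm_divide power_divide power2_eq_square)
      moreover have "Re (cnj \<kappa> * cv) = (cmod cv)\<^sup>2 / Ss"
      proof -
        have "cnj \<kappa> * cv = of_real (1 / Ss) * (cv * cnj cv)" by (simp add: \<kappa>_def mult_ac del: of_real_divide)
        also have "\<dots> = of_real (1 / Ss * (cmod cv)\<^sup>2)" by (simp only: complex_norm_square[symmetric] of_real_mult of_real_power)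
        finally show ?thesis by (simp del: of_real_mult of_real_divide)
      qed
      ultimately have "\<tau> = P + A11 - (cmod cv)\<^sup>2 / Ss" by simp
      then have "Ss * \<tau> = (P + A11) * Ss - (cmod cv)\<^sup>2" using Ss by (simp add: right_diff_distrib mult.commute)
      also have "\<dots> = det + P * Q" unfolding Ss_def cv_def det_def Q_def cmod_power2 by (simp add: algebra_simps power2_eq_square)
      finally have \<tau>S: "Ss * \<tau> = det + P * Q" .
      have "0 < det + P * Q" using G(1) Pp Qp by (simp add: add_pos_pos)
      then have \<tau>0: "0 < \<tau>" using Ss unfolding \<tau>S[symmetric] by (simp add: zero_less_mult_iff)
      have de: "e * ((cmod h32)\<^sup>2 * Pb + VN) = det" unfolding dete VNe[symmetric] by (simp add: algebra_simps)
      have Ss': "(cmod h31)\<^sup>2 * P + (cmod h32)\<^sup>2 * Pb + s\<^sup>2 = Ss" by (simp add: Ss_def A22_def)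
      have L: "((cmod h31)\<^sup>2 * P + (cmod h32)\<^sup>2 * Pb + s\<^sup>2) * \<tau> / (e * ((cmod h32)\<^sup>2 * Pb + VN)) = 1 + P * Q / det"
        unfolding Ss' de \<tau>S using G(1) by (simp add: add_divide_distrib)
      show ?thesis
      proof (intro exI[of _ "VN / (cmod h32)\<^sup>2"] conjI allI impI)
        show "0 < VN / (cmod h32)\<^sup>2" using VN hp by simp
        show "sT \<le> VN / (cmod h32)\<^sup>2" using K1 ep hp by (simp add: VN_def pos_le_divide_eq mult_ac)
        fix n Ma x d \<psi> er and B C :: "nat set" and \<beta>
        assume a: "pwr n {..<Ma} x P" "pwr n B \<beta> Pb" "finite C" "C \<noteq> {}" "succ n Ma x (B \<times> C) (\<lambda>(b, c). sc h12 (\<beta> b) + d c) \<psi> er"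
        show "(1 - er) * ln (real Ma) - ln 2 + Dd n ({..<Ma} \<times> B) (\<lambda>(a, b). sc h31 (x a) + sc h32 (\<beta> b)) (if s = 0 then 1 else s\<^sup>2) ((cmod h31)\<^sup>2 * P + (cmod h32)\<^sup>2 * Pb) \<le> Dd n B \<beta> (VN / (cmod h32)\<^sup>2) Pb + real n * m2"
          using rate_le_side_info[OF a(1,2,3,4) a(5)[folded cch(1)] ep VN h(3) cch(2) one sN \<tau>_def \<tau>0] mult_left_mono[OF G(2), of "real n"] sp unfolding L by simp
      qed
    qed
  qed
qed

section \<open>From codes to centred codebooks\<close>

lemma cgauss_1: "cgauss 1 = density lborel (\<lambda>z. ennreal (g1 1 z))"
  unfolding cgauss_def g1_def ..

lemma prob_cgauss: "prob_space (cgauss 1)"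
  unfolding cgauss_1 by (rule prob_spaceI) (use nn_integral_g1[of 1] in \<open>simp add: emeasure_density\<close>)

lemma sets_cgauss [simp]: "sets (cgauss 1) = sets borel" by (simp add: cgauss_def)

lemma prob_noiseM: "prob_space (noiseM n)"
  unfolding noiseM_def by (intro prob_space_PiM prob_cgauss)

text \<open>Both measures agree on boxes, because the \<open>n\<close>-dimensional density is a
  product. This connects the noise of the channel model with the densities used so far.\<close>

lemma PiM_cgauss: "PiM {..<n} (\<lambda>_. cgauss 1) = density (Lam n) (\<lambda>y. ennreal (gd n 1 y))"
proof -
  interpret C: prob_space "cgauss 1" by (rule prob_cgauss)
  interpret product_sigma_finite "\<lambda>_::nat. cgauss 1" by unfold_locales
  have L: "product_sigma_finite (\<lambda>_::nat. lborel :: complex measure)" by unfold_locales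
  have gm: "(\<lambda>y. ennreal (gd n 1 y)) \<in> borel_measurable (Lam n)" by (intro gd_measurable_ennreal mv_basic)
  show ?thesis
  proof (rule PiM_eqI[symmetric])
    show "sets (density (Lam n) (\<lambda>y. ennreal (gd n 1 y))) = sets (PiM {..<n} (\<lambda>_. cgauss 1))"
      unfolding Lam_def sets_density by (intro sets_PiM_cong) auto
    fix A :: "nat \<Rightarrow> complex set" assume A: "\<And>t. t \<in> {..<n} \<Longrightarrow> A t \<in> sets (cgauss 1)"
    have AS: "PiE {..<n} A \<in> sets (Lam n)" unfolding Lam_def using A by (intro sets_PiM_I_finite) auto
    have "emeasure (density (Lam n) (\<lambda>y. ennreal (gd n 1 y))) (PiE {..<n} A) = (\<integral>\<^sup>+y. ennreal (gd n 1 y) * indicator (PiE {..<n} A) y \<partial>Lam n)"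
      by (rule emeasure_density[OF gm AS])
    also have "\<dots> = (\<integral>\<^sup>+y. (\<Prod>t<n. ennreal (g1 1 (y t)) * indicator (A t) (y t)) \<partial>Lam n)"
    proof (rule nn_integral_cong)
      fix y assume y: "y \<in> space (Lam n)"
      have "indicator (PiE {..<n} A) y = (\<Prod>t<n. indicator (A t) (y t) :: ennreal)"
        using y by (auto simp: space_Lam PiE_iff indicator_def prod_zero_iff)
      moreover have "ennreal (gd n 1 y) = (\<Prod>t<n. ennreal (g1 1 (y t)))" unfolding gd_prod by (rule prod_ennreal[symmetric]) (simp add: g1_nonneg)
      ultimately show "ennreal (gd n 1 y) * indicator (PiE {..<n} A) y = (\<Prod>t<n. ennreal (g1 1 (y t)) * indicator (A t) (y t))"
        by (simp add: prod.distrib)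
    qed
    also have "\<dots> = (\<Prod>t<n. \<integral>\<^sup>+z. ennreal (g1 1 z) * indicator (A t) z \<partial>lborel)"
      unfolding Lam_def using A by (intro product_sigma_finite.product_nn_integral_prod[OF L]) auto
    also have "\<dots> = (\<Prod>t<n. emeasure (cgauss 1) (A t))"
      using A by (intro prod.cong refl) (auto simp: cgauss_1 emeasure_density)
    finally show "emeasure (density (Lam n) (\<lambda>y. ennreal (gd n 1 y))) (PiE {..<n} A) = (\<Prod>t<n. emeasure (cgauss 1) (A t))" .
  qed simp
qed

lemma noise_law:
  assumes "k \<in> users"
  shows "distr (noiseM n) (Lam n) (\<lambda>z. \<lambda>t\<in>{..<n}. z (k, t)) = density (Lam n) (\<lambda>y. ennreal (gd n 1 y))"
proof -
  have "distr (noiseM n) (PiM {..<n} (\<lambda>_. cgauss 1)) (\<lambda>z. \<lambda>t\<in>{..<n}. z (k, t)) = PiM {..<n} (\<lambda>_. cgauss 1)"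
    unfolding noiseM_def using assms by (intro distr_PiM_reindex prob_cgauss) (auto simp: inj_on_def)
  moreover have "sets (PiM {..<n} (\<lambda>_. cgauss 1)) = sets (Lam n)" unfolding Lam_def by (intro sets_PiM_cong) auto
  ultimately show ?thesis using PiM_cgauss distr_cong[OF refl, of "PiM {..<n} (\<lambda>_. cgauss 1)" "Lam n" "noiseM n"] by metis
qed

lemma noise_meas: "k \<in> users \<Longrightarrow> (\<lambda>z. \<lambda>t\<in>{..<n}. z (k, t)) \<in> measurable (noiseM n) (Lam n)"
  unfolding noiseM_def Lam_def
  by (intro measurable_restrict measurable_compose[OF measurable_component_singleton]) (auto simp: measurable_def)

text \<open>The block of noise at receiver \<open>k\<close> has density \<open>gd n 1\<close>;
  translating by the noiseless signal \<open>s\<close> gives the law of the received block.\<close>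

lemma success_prob:
  assumes k: "k \<in> users" and d: "\<phi> \<in> measurable (Lam n) (count_space UNIV)"
  shows "measure (noiseM n) {z \<in> space (noiseM n). \<phi> (rs n (s + (\<lambda>t. z (k, t)))) = a} = (\<integral>y. gd n 1 (y - s) * indicator {y. \<phi> y = a} y \<partial>Lam n)"
proof -
  have r: "rs n (s + (\<lambda>t. z (k, t))) = rs n ((\<lambda>t\<in>{..<n}. z (k, t)) + s)" for z by (auto simp: fun_eq_iff restrict_def add.commute)
  let ?X = "\<lambda>z. \<lambda>t\<in>{..<n}. z (k, t)"
  have dm: "(\<lambda>y. \<phi> (rs n (y + s))) \<in> measurable (Lam n) (count_space UNIV)"
    by (rule measurable_compose[OF measurable_Lam_mv d]) (intro mvI mv_basic)
  let ?E = "{y \<in> space (Lam n). \<phi> (rs n (y + s)) = a}"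
  have E: "?E \<in> sets (Lam n)" using measurable_sets[OF dm, of "{a}"] by (auto simp: vimage_def Int_def conj_commute)
  have gm: "(\<lambda>y. ennreal (gd n 1 y)) \<in> borel_measurable (Lam n)" by (intro gd_measurable_ennreal mv_basic)
  have "measure (noiseM n) {z \<in> space (noiseM n). \<phi> (rs n (s + (\<lambda>t. z (k, t)))) = a} = measure (distr (noiseM n) (Lam n) ?X) ?E"
    unfolding r using measurable_space[OF noise_meas[OF k]] by (subst measure_distr[OF noise_meas[OF k] E]) (auto intro!: arg_cong[where f="measure _"])
  also have "\<dots> = (\<integral>y. gd n 1 y * indicator ?E y \<partial>Lam n)"
    unfolding noise_law[OF k] using E gm integral_eq_nn_integral[of "\<lambda>y. gd n 1 y * indicator ?E y" "Lam n"] gd_measurable[OF mv_basic(1), of n 1]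
    by (simp add: measure_def emeasure_density ennreal_mult' ennreal_indicator)
  also have "\<dots> = (\<integral>y. (\<lambda>y. gd n 1 (y - s) * indicator {y. \<phi> y = a} y) (rs n (y + s)) \<partial>Lam n)"
  proof (rule Bochner_Integration.integral_cong[OF refl])
    fix y assume "y \<in> space (Lam n)"
    moreover have "gd n 1 (rs n (y + s) - s) = gd n 1 y" by (rule gd_cong) simp
    ultimately show "gd n 1 y * indicator ?E y = (\<lambda>y. gd n 1 (y - s) * indicator {y. \<phi> y = a} y) (rs n (y + s))" by (simp add: indicator_def)
  qed
  also have "\<dots> = (\<integral>y. gd n 1 (y - s) * indicator {y. \<phi> y = a} y \<partial>Lam n)"
    using gd_ind_integrable[OF _ d, of 1 s a] by (intro integral_translate(2)) simp
  finally show ?thesis .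
qed

lemma sum_PiE_users:
  assumes u: "users = {k, v, t}" "k \<noteq> v" "k \<noteq> t" "v \<noteq> t"
  shows "(\<Sum>m\<in>PiE users (\<lambda>k. {..<M k}). F (m k) (m v) (m t)) = (\<Sum>a<M k. \<Sum>w\<in>{..<M v} \<times> {..<M t}. F a (fst w) (snd w) :: real)"
proof -
  have "(\<Sum>m\<in>PiE users (\<lambda>k. {..<M k}). F (m k) (m v) (m t)) = (\<Sum>q\<in>{..<M k} \<times> ({..<M v} \<times> {..<M t}). F (fst q) (fst (snd q)) (snd (snd q)))"
    by (rule sum.reindex_bij_witness[where i="\<lambda>q. \<lambda>j\<in>users. if j = k then fst q else if j = v then fst (snd q) else snd (snd q)" and j="\<lambda>m. (m k, (m v, m t))"])
      (use u in \<open>auto simp: PiE_iff extensional_def fun_eq_iff restrict_def\<close>)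
  then show ?thesis by (simp add: sum.cartesian_product split_def)
qed

lemma msize_ge: "2 powr (real n * R k) \<le> real (msize n R k)" "1 \<le> msize n R k"
proof -
  show "2 powr (real n * R k) \<le> real (msize n R k)" unfolding msize_def by (smt (verit) of_nat_nat powr_ge_zero real_nat_ceiling_ge)
  have "0 < 2 powr (real n * R k)" by simp
  then show "1 \<le> msize n R k" unfolding msize_def by (simp add: Suc_le_eq)
qed

text \<open>Subtracting the mean of a codebook does not increase its power and shifts every received
  block by a constant, which the decoder can add back. Error probabilities stay the same, so centred
  codebooks lose nothing.\<close>

lemma code_reduction:
  assumes code: "is_code P n M en d" and M: "\<And>k. 1 \<le> M k" and P: "\<And>k. k \<in> users \<Longrightarrow> 0 \<le> P k"
  obtains x \<psi> where "\<And>k. k \<in> users \<Longrightarrow> pwr n {..<M k} (x k) (P k)"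
    "\<And>k v t. users = {k, v, t} \<Longrightarrow> k \<noteq> v \<Longrightarrow> k \<noteq> t \<Longrightarrow> v \<noteq> t \<Longrightarrow>
       succ n (M k) (x k) ({..<M v} \<times> {..<M t}) (\<lambda>(b, c). sc (h k v) (x v b) + sc (h k t) (x t c)) (\<psi> k) (err h n M en d)"
proof -
  define \<mu> where "\<mu> k = (\<lambda>t. (\<Sum>w<M k. en k w t) / of_nat (M k))" for k
  define x where "x k w = en k w - \<mu> k" for k w
  \<comment> \<open>The total offset at receiver \<open>k\<close>: its own mean plus the means of
    the interferers through their channel coefficients.\<close>
  define sh where "sh k = \<mu> k + (\<lambda>t. \<Sum>j\<in>users - {k}. h k j * \<mu> j t)" for k
  define \<psi> where "\<psi> k y = d k (rs n (y + sh k))" for k y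
  have M0: "real (M k) > 0" "of_nat (M k) \<noteq> (0::complex)" for k using M[of k] by auto
  have zm: "zm n {..<M k} (x k)" for k
    using M0(2)[of k] by (auto simp: zm_def x_def \<mu>_def sum_subtractf)
  have pw: "pwr n {..<M k} (x k) (P k)" if k: "k \<in> users" for k
  proof -
    have "(\<Sum>w<M k. nsq n (en k w)) = (\<Sum>w<M k. nsq n (\<mu> k + sc 1 (x k w)))" by (simp add: x_def)
    also have "\<dots> = real (M k) * nsq n (\<mu> k) + (\<Sum>w<M k. nsq n (x k w))" using zm_nsq[OF zm, of "\<mu> k" 1 k] by simp
    finally have "(\<Sum>w<M k. nsq n (x k w)) \<le> (\<Sum>w<M k. nsq n (en k w))" using M0[of k] by simp
    also have "\<dots> \<le> (\<Sum>w<M k. real n * P k)" using code k by (intro sum_mono) (auto simp: is_code_def nsq_def)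
    finally show ?thesis using zm[of k] M[of k] P[OF k] by (auto simp: pwr_def lessThan_empty_iff)
  qed
  have sets_eq: "sets (PiM {..<n} (\<lambda>_. borel :: complex measure)) = sets (Lam n)" unfolding Lam_def by (intro sets_PiM_cong) auto
  have dm: "d k \<in> measurable (Lam n) (count_space UNIV)" if "k \<in> users" for k
    using code that unfolding is_code_def measurable_cong_sets[OF sets_eq refl] by blast
  have \<psi>m: "\<psi> k \<in> measurable (Lam n) (count_space UNIV)" if "k \<in> users" for k
    unfolding \<psi>_def[abs_def] by (rule measurable_compose[OF measurable_Lam_mv dm[OF that]]) (intro mvI mv_basic)
  have su: "succ n (M k) (x k) ({..<M v} \<times> {..<M t}) (\<lambda>(b, c). sc (h k v) (x v b) + sc (h k t) (x t c)) (\<psi> k) (err h n M en d)"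
    if u: "users = {k, v, t}" "k \<noteq> v" "k \<noteq> t" "v \<noteq> t" for k v t
  proof -
    have k: "k \<in> users" using u by auto
    have uk: "users - {k} = {v, t}" using u by auto
    interpret N: prob_space "noiseM n" by (rule prob_noiseM)
    let ?s = "\<lambda>m. x k (m k) + (sc (h k v) (x v (m v)) + sc (h k t) (x t (m t)))"
    let ?ok = "\<lambda>m. {z \<in> space (noiseM n). \<psi> k (rs n (?s m + (\<lambda>t. z (k, t)))) = m k}"
    have rx: "d k (rx h n en m z k) = \<psi> k (rs n (?s m + (\<lambda>t. z (k, t))))" for m z
      unfolding \<psi>_def rx_def uk sh_def by (intro arg_cong[where f="d k"]) (use u in \<open>auto simp: fun_eq_iff restrict_def x_def algebra_simps\<close>)
    have okm: "?ok m \<in> sets (noiseM n)" for m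
    proof -
      have "(\<lambda>z. rs n (?s m + (\<lambda>t. z (k, t)))) \<in> measurable (noiseM n) (Lam n)"
      proof -
        have "(\<lambda>z. rs n (?s m + (\<lambda>t\<in>{..<n}. z (k, t)))) \<in> measurable (noiseM n) (Lam n)"
          by (intro measurable_Lam_mv mvI mv_Lam noise_meas[OF k])
        moreover have "rs n (?s m + (\<lambda>t\<in>{..<n}. z (k, t))) = rs n (?s m + (\<lambda>t. z (k, t)))" for z by (auto simp: fun_eq_iff restrict_def)
        ultimately show ?thesis by simp
      qed
      from measurable_sets[OF measurable_compose[OF this \<psi>m[OF k]], of "{m k}"] show ?thesis by (auto simp: vimage_def Int_def conj_commute)
    qed
    \<comment> \<open>An error at receiver \<open>k\<close> is one way for the overall error event
      to occur.\<close>
    have ge: "1 - measure (noiseM n) (?ok m) \<le> measure (noiseM n) {z \<in> space (noiseM n). \<exists>k\<in>users. d k (rx h n en m z k) \<noteq> m k}" for m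
    proof -
      have Em: "{z \<in> space (noiseM n). d j (rx h n en m z j) \<noteq> m j} \<in> sets (noiseM n)" if j: "j \<in> users" for j
      proof -
        have "(\<lambda>z. rs n ((en j (m j) + (\<lambda>t. \<Sum>i\<in>users - {j}. h j i * en i (m i) t)) + (\<lambda>t\<in>{..<n}. z (j, t)))) \<in> measurable (noiseM n) (Lam n)"
          by (intro measurable_Lam_mv mvI mv_Lam noise_meas[OF j])
        moreover have "rs n ((en j (m j) + (\<lambda>t. \<Sum>i\<in>users - {j}. h j i * en i (m i) t)) + (\<lambda>t\<in>{..<n}. z (j, t))) = rx h n en m z j" for z
          unfolding rx_def by (auto simp: fun_eq_iff restrict_def)
        ultimately have "(\<lambda>z. rx h n en m z j) \<in> measurable (noiseM n) (Lam n)" by simp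
        from measurable_sets[OF measurable_compose[OF this dm[OF j]], of "- {m j}"] show ?thesis by (auto simp: vimage_def Int_def conj_commute)
      qed
      have "space (noiseM n) - ?ok m \<subseteq> {z \<in> space (noiseM n). \<exists>k\<in>users. d k (rx h n en m z k) \<noteq> m k}"
        unfolding rx[symmetric] using k by blast
      moreover have "{z \<in> space (noiseM n). \<exists>k\<in>users. d k (rx h n en m z k) \<noteq> m k} = (\<Union>j\<in>users. {z \<in> space (noiseM n). d j (rx h n en m z j) \<noteq> m j})" by auto
      ultimately have "measure (noiseM n) (space (noiseM n) - ?ok m) \<le> measure (noiseM n) {z \<in> space (noiseM n). \<exists>k\<in>users. d k (rx h n en m z k) \<noteq> m k}"
        using Em by (intro N.finite_measure_mono) (auto simp: users_def)
      then show ?thesis using N.prob_compl[OF okm] by simp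
    qed
    let ?PE = "PiE users (\<lambda>k. {..<M k})"
    have card: "real (card ?PE) = real (M k) * (real (M v) * real (M t))"
    proof -
      have "card ?PE = (\<Prod>j\<in>users. M j)" by (simp add: card_PiE users_def)
      also have "\<dots> = M k * (M v * M t)" unfolding u(1) using u(2-4) by simp
      finally show ?thesis by simp
    qed
    have cardu: "real (M 1 * M 2 * M 3) = real (card ?PE)" by (simp add: card_PiE users_def)
    have pos: "0 < real (card ?PE)" unfolding card using M0 by simp
    have "(\<Sum>m\<in>?PE. 1 - measure (noiseM n) (?ok m)) \<le> err h n M en d * real (card ?PE)"
    proof -
      have "err h n M en d * real (card ?PE) = (\<Sum>m\<in>?PE. measure (noiseM n) {z \<in> space (noiseM n). \<exists>k\<in>users. d k (rx h n en m z k) \<noteq> m k})"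
        unfolding err_def cardu using pos by simp
      then show ?thesis using ge by (simp add: sum_mono)
    qed
    then have "(1 - err h n M en d) * real (card ?PE) \<le> (\<Sum>m\<in>?PE. measure (noiseM n) (?ok m))" by (simp add: sum_subtractf algebra_simps)
    also have "\<dots> = (\<Sum>m\<in>?PE. \<integral>y. gd n 1 (y - ?s m) * indicator {y. \<psi> k y = m k} y \<partial>Lam n)"
      by (intro sum.cong refl success_prob k \<psi>m)
    also have "\<dots> = (\<Sum>a<M k. \<Sum>w\<in>{..<M v} \<times> {..<M t}. \<integral>y. gd n 1 (y - (x k a + (sc (h k v) (x v (fst w)) + sc (h k t) (x t (snd w))))) * indicator {y. \<psi> k y = a} y \<partial>Lam n)"
      using sum_PiE_users[OF u, where F="\<lambda>a b c. \<integral>y. gd n 1 (y - (x k a + (sc (h k v) (x v b) + sc (h k t) (x t c)))) * indicator {y. \<psi> k y = a} y \<partial>Lam n"] by simp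
    finally show ?thesis unfolding succ_def using \<psi>m[OF k] by (simp add: card card_cartesian_product split_def)
  qed
  show ?thesis by (rule that[OF pw su])
qed

section \<open>Gaussian mutual informations\<close>

lemma users_finite [simp]: "finite users" by (simp add: users_def)

lemma sum_gbase: "(\<Sum>i\<in>gbase. f i) = (\<Sum>k\<in>users. \<Sum>i\<in>{GX k, GZ k, GW k, GN k, GV k, GV' k}. f i :: 'a::comm_monoid_add)"
  unfolding gbase_def by (rule sum.UNION_disjoint) auto

text \<open>A common form of \<open>K0\<close> and \<open>Kf\<close>, with the variances of the two
  extra families as parameters.\<close>

definition Kg :: "prm \<Rightarrow> (nat \<Rightarrow> real) \<Rightarrow> (nat \<Rightarrow> real) \<Rightarrow> gv \<Rightarrow> gv \<Rightarrow> complex" where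
  "Kg Q f f' i j = (case (i, j) of
      (GV k, GV l) \<Rightarrow> if k = l then complex_of_real (f k) else 0
    | (GV' k, GV' l) \<Rightarrow> if k = l then complex_of_real (f' k) else 0
    | _ \<Rightarrow> K0 Q i j)"

lemma K0_Kg: "K0 Q = Kg Q (\<lambda>_. 0) (\<lambda>_. 0)"
  by (intro ext) (auto simp: Kg_def K0_def split: gv.splits)

lemma Kf_Kg: "Kf Q p = Kg Q (vVN Q p) (vVN' Q p)"
  by (intro ext) (auto simp: Kg_def Kf_def split: gv.splits)

definition qc :: "prm \<Rightarrow> (nat \<Rightarrow> real) \<Rightarrow> (nat \<Rightarrow> real) \<Rightarrow> lin \<Rightarrow> lin \<Rightarrow> nat \<Rightarrow> complex" where
  "qc Q f f' a b k = a (GX k) * cnj (b (GX k)) * of_real (ch_P Q k) + a (GZ k) * cnj (b (GZ k)) + a (GW k) * cnj (b (GW k)) * of_real ((sW Q k)\<^sup>2)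
    + a (GN k) * cnj (b (GN k)) * of_real ((sN Q k)\<^sup>2) + a (GZ k) * cnj (b (GW k)) * (rW Q k * of_real (sW Q k)) + a (GW k) * cnj (b (GZ k)) * (cnj (rW Q k) * of_real (sW Q k))
    + a (GZ k) * cnj (b (GN k)) * (rN Q k * of_real (sN Q k)) + a (GN k) * cnj (b (GZ k)) * (cnj (rN Q k) * of_real (sN Q k))
    + a (GV k) * cnj (b (GV k)) * of_real (f k) + a (GV' k) * cnj (b (GV' k)) * of_real (f' k)"

text \<open>Variables of different users are uncorrelated, so the covariance is block diagonal and
  reduces to one block per user.\<close>

lemma gcov_Kg: "gcov (Kg Q f f') a b = (\<Sum>k\<in>users. qc Q f f' a b k)"
proof -
  define B where "B k l = (\<Sum>i\<in>{GX k, GZ k, GW k, GN k, GV k, GV' k}. \<Sum>j\<in>{GX l, GZ l, GW l, GN l, GV l, GV' l}. a i * cnj (b j) * Kg Q f f' i j)" for k l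
  have off: "B k l = 0" if "k \<noteq> l" for k l using that by (simp add: B_def Kg_def K0_def)
  have diag: "B k k = qc Q f f' a b k" for k by (simp add: B_def Kg_def K0_def qc_def algebra_simps)
  have "gcov (Kg Q f f') a b = (\<Sum>k\<in>users. \<Sum>l\<in>users. B k l)"
    unfolding gcov_def sum_gbase B_def by (intro sum.cong refl) (rule sum.swap)
  also have "\<dots> = (\<Sum>k\<in>users. B k k)"
  proof (intro sum.cong refl)
    fix k assume "k \<in> users"
    then show "(\<Sum>l\<in>users. B k l) = B k k" using off by (subst sum.remove[of _ k]) (auto intro: sum.neutral)
  qed
  finally show ?thesis by (simp add: diag)
qed

definition qv :: "prm \<Rightarrow> (nat \<Rightarrow> real) \<Rightarrow> (nat \<Rightarrow> real) \<Rightarrow> lin \<Rightarrow> nat \<Rightarrow> real" where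
  "qv Q f f' a k = (cmod (a (GX k)))\<^sup>2 * ch_P Q k + (cmod (a (GZ k)))\<^sup>2 + (cmod (a (GW k)))\<^sup>2 * (sW Q k)\<^sup>2
    + (cmod (a (GN k)))\<^sup>2 * (sN Q k)\<^sup>2 + 2 * Re (a (GZ k) * cnj (a (GW k)) * (rW Q k * of_real (sW Q k)))
    + 2 * Re (a (GZ k) * cnj (a (GN k)) * (rN Q k * of_real (sN Q k))) + (cmod (a (GV k)))\<^sup>2 * f k + (cmod (a (GV' k)))\<^sup>2 * f' k"

lemma gvar_Kg: "gvar (Kg Q f f') a = (\<Sum>k\<in>users. qv Q f f' a k)"
proof -
  have "Re (qc Q f f' a a k) = qv Q f f' a k" for k
    unfolding qc_def qv_def cmod_power2 by (simp add: algebra_simps power2_eq_square)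
  then show ?thesis by (simp add: gvar_def gcov_Kg)
qed

text \<open>\<open>K0\<close> sets the covariance of \<open>W\<close> and \<open>N\<close> of one
  user to 0, which can be incompatible with strong correlation of both with \<open>Z\<close>; the
  form may then be indefinite. It is nonnegative on forms that contain only one of the two, by
  Cauchy-Schwarz for that one and \<open>Z\<close>.\<close>

lemma qv_nonneg:
  assumes "0 \<le> ch_P Q k" "0 \<le> sW Q k" "cmod (rW Q k) \<le> 1" "0 \<le> sN Q k" "cmod (rN Q k) \<le> 1" "0 \<le> f k" "0 \<le> f' k"
    and a: "a (GW k) = 0 \<or> a (GN k) = 0"
  shows "(cmod (a (GX k)))\<^sup>2 * ch_P Q k \<le> qv Q f f' a k"
proof -
  have key: "0 \<le> (cmod x)\<^sup>2 + (cmod y)\<^sup>2 * s\<^sup>2 + 2 * Re (x * cnj y * (r * of_real s))" if "0 \<le> s" "cmod r \<le> 1" for x y r s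
  proof -
    have "- Re (x * cnj y * (r * of_real s)) \<le> cmod (x * cnj y * (r * of_real s))" using complex_Re_le_cmod[of "- (x * cnj y * (r * of_real s))"] by simp
    also have "\<dots> = (cmod x * (cmod y * s)) * cmod r" using that by (simp add: norm_mult)
    also have "\<dots> \<le> (cmod x * (cmod y * s)) * 1" using that by (intro mult_left_mono) auto
    finally have "(cmod x - cmod y * s)\<^sup>2 \<le> (cmod x)\<^sup>2 + (cmod y)\<^sup>2 * s\<^sup>2 + 2 * Re (x * cnj y * (r * of_real s))"
      by (simp add: power2_eq_square algebra_simps)
    then show ?thesis using zero_le_power2 order_trans by blast
  qed
  have nn: "0 \<le> (cmod (a (GV k)))\<^sup>2 * f k" "0 \<le> (cmod (a (GV' k)))\<^sup>2 * f' k" using assms by auto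
  from a show ?thesis
  proof
    assume "a (GW k) = 0"
    then show ?thesis using key[OF assms(4,5), of "a (GZ k)" "a (GN k)"] nn by (simp add: qv_def)
  next
    assume "a (GN k) = 0"
    then show ?thesis using key[OF assms(2,3), of "a (GZ k)" "a (GW k)"] nn by (simp add: qv_def)
  qed
qed

text \<open>The infimum of a set of reals is informative only if the set is bounded below, so a
  lower bound for all residual variances is needed in both directions.\<close>

lemma condvar_bounds:
  assumes nn: "\<And>c. B \<le> gvar K (\<lambda>v. a v - (\<Sum>i<length cs. c i * (cs ! i) v))"
  shows "B \<le> condvar K a cs" "condvar K a cs \<le> gvar K (\<lambda>v. a v - (\<Sum>i<length cs. c i * (cs ! i) v))"
  unfolding condvar_def by (intro cINF_greatest nn cINF_lower bdd_belowI[of _ B]; use nn in auto)+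

lemma gmi_zero:
  assumes "\<And>c. 0 \<le> gvar K (\<lambda>v. a v - (\<Sum>i<length cs. c i * (cs ! i) v))" "gvar K a = 0"
  shows "gmi K a bs cs = 0"
proof -
  have "condvar K a cs = 0" using condvar_bounds(1)[OF assms(1)] condvar_bounds(2)[OF assms(1), of "\<lambda>_. 0"] assms(2) by simp
  then show ?thesis by (simp add: gmi_def)
qed

text \<open>Any linear estimate bounds the second conditional variance from above and thus the
  mutual information from below. Finiteness excludes a vanishing residual, which also shows that no
  linear estimate is exact.\<close>

lemma gmi_lower:
  assumes P: "0 < P" and lo: "\<And>c. P \<le> gvar K (\<lambda>v. a v - (\<Sum>i<length cs. c i * (cs ! i) v))"
    and nn: "\<And>c. 0 \<le> gvar K (\<lambda>v. a v - (\<Sum>i<length (bs @ cs). c i * ((bs @ cs) ! i) v))" and fin: "gmi K a bs cs \<noteq> \<infinity>"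
    and V: "gvar K (\<lambda>v. a v - (\<Sum>i<length (bs @ cs). c0 i * ((bs @ cs) ! i) v)) = V"
  shows "0 < V" "ln (P / V) \<le> ln 2 * real_of_ereal (gmi K a bs cs)"
proof -
  let ?s1 = "condvar K a cs" and ?s2 = "condvar K a (bs @ cs)"
  have s1: "P \<le> ?s1" by (rule condvar_bounds(1)[OF lo])
  have s2: "0 \<le> ?s2" "?s2 \<le> V" using condvar_bounds(1)[OF nn] condvar_bounds(2)[OF nn, of c0] V by auto
  have "?s2 \<noteq> 0" using fin s1 P by (auto simp: gmi_def Let_def)
  then have s2p: "0 < ?s2" using s2 by simp
  then show V0: "0 < V" using s2 by simp
  have "real_of_ereal (gmi K a bs cs) = log 2 (?s1 / ?s2)" using s2p s1 P by (auto simp: gmi_def Let_def)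
  then have "ln 2 * real_of_ereal (gmi K a bs cs) = ln (?s1 / ?s2)" by (simp add: log_def)
  moreover have "P / V \<le> ?s1 / ?s2" using s1 s2 s2p P by (intro frac_le) auto
  moreover have "0 < P / V" using P V0 by simp
  ultimately show "ln (P / V) \<le> ln 2 * real_of_ereal (gmi K a bs cs)" by simp
qed

text \<open>An observation of the signal with unit gain and noise variance \<eta> is shrunk by
  \<open>P / (P + \<eta>)\<close>, the optimal factor; the error variance is then
  \<open>P * \<eta> / (P + \<eta>)\<close>.\<close>

lemma mmse_combine:
  assumes P: "0 < (P::real)" and \<eta>: "0 \<le> \<eta>" and V: "V = (1 - P / (P + \<eta>))\<^sup>2 * P + (P / (P + \<eta>))\<^sup>2 * \<eta>" "0 < V"
  shows "0 < \<eta>" "P / V = 1 + P / \<eta>"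
proof -
  have s: "0 < P + \<eta>" using P \<eta> by simp
  have "1 - P / (P + \<eta>) = \<eta> / (P + \<eta>)" using s by (simp add: field_simps)
  then have "V = (\<eta>\<^sup>2 * P + P\<^sup>2 * \<eta>) / (P + \<eta>)\<^sup>2" unfolding V(1) by (simp add: power_divide add_divide_distrib)
  also have "\<eta>\<^sup>2 * P + P\<^sup>2 * \<eta> = P * \<eta> * (P + \<eta>)" by (simp add: power2_eq_square algebra_simps)
  finally have Ve: "V = P * \<eta> / (P + \<eta>)" using s by (simp add: power2_eq_square)
  then have "\<eta> \<noteq> 0" using V(2) by auto
  then show e: "0 < \<eta>" using \<eta> by simp
  show "P / V = 1 + P / \<eta>" unfolding Ve using e P s by (simp add: field_simps)
qed

text \<open>The zero estimate is among the competitors, so an observation cannot raise the residual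
  variance.\<close>

lemma gmi_nonneg_single:
  assumes nn: "\<And>c. 0 \<le> gvar K (\<lambda>v. a v - c * b v)"
  shows "0 \<le> gmi K a [b] []"
proof -
  have 0: "\<And>c. 0 \<le> gvar K (\<lambda>v. a v - (\<Sum>i<length [b]. c i * ([b] ! i) v))" using nn by simp
  have "0 \<le> condvar K a [b]" "condvar K a [b] \<le> gvar K a" using condvar_bounds(1)[OF 0] condvar_bounds(2)[OF 0, of "\<lambda>_. 0"] by simp_all
  moreover have "condvar K a [] = gvar K a" by (simp add: condvar_def)
  ultimately show ?thesis by (auto simp: gmi_def Let_def)
qed

section \<open>Lower bounds for the Gaussian terms of \<open>Aterm\<close> by explicit linear
  estimates\<close>

locale gic =
  fixes Q :: prm
  assumes P0: "\<forall>k\<in>users. 0 \<le> ch_P Q k"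
    and h0: "\<forall>j\<in>users. \<forall>k\<in>users. j \<noteq> k \<longrightarrow> ch_h Q j k \<noteq> 0"
    and W0: "\<forall>k\<in>users. 0 \<le> sW Q k \<and> sW Q k \<le> 1 \<and> cmod (rW Q k) \<le> 1"
    and N0: "\<forall>k\<in>users. 0 \<le> sN Q k \<and> sN Q k \<le> 1 \<and> cmod (rN Q k) \<le> 1"
begin

abbreviation "Pw \<equiv> ch_P Q"
abbreviation "hh \<equiv> ch_h Q"
abbreviation "zW k \<equiv> rW Q k * complex_of_real (sW Q k)"
abbreviation "zN k \<equiv> rN Q k * complex_of_real (sN Q k)"

lemma gvar_ge_signal:
  assumes a: "\<And>k. k \<in> users \<Longrightarrow> a (GW k) = 0 \<or> a (GN k) = 0" and f: "\<And>k. k \<in> users \<Longrightarrow> 0 \<le> f k" "\<And>k. k \<in> users \<Longrightarrow> 0 \<le> f' k"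
  shows "0 \<le> gvar (Kg Q f f') a" and "u \<in> users \<Longrightarrow> (cmod (a (GX u)))\<^sup>2 * Pw u \<le> gvar (Kg Q f f') a"
proof -
  have q: "(cmod (a (GX k)))\<^sup>2 * Pw k \<le> qv Q f f' a k" if "k \<in> users" for k
    using P0 W0 N0 f a that by (intro qv_nonneg) auto
  have nn: "0 \<le> (cmod (a (GX k)))\<^sup>2 * Pw k" if "k \<in> users" for k using P0 that by simp
  have q0: "0 \<le> qv Q f f' a k" if "k \<in> users" for k using q[OF that] nn[OF that] by linarith
  show "0 \<le> gvar (Kg Q f f') a" unfolding gvar_Kg using q0 by (intro sum_nonneg)
  assume u: "u \<in> users"
  show "(cmod (a (GX u)))\<^sup>2 * Pw u \<le> gvar (Kg Q f f') a"
    unfolding gvar_Kg using q[OF u] member_le_sum[of u users "qv Q f f' a"] q0 u by fastforce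
qed

lemma gvar_lbase_GX: "u \<in> users \<Longrightarrow> gvar (K0 Q) (lbase (GX u)) = Pw u"
  unfolding K0_Kg gvar_Kg by (subst sum.remove[of _ u]) (auto simp: qv_def lbase_def intro: sum.neutral)

text \<open>The combination \<open>c0\<close> is meant to be a shrunk observation of input
  \<open>u\<close> with unit gain and noise variance \<eta>. If \<open>u\<close> has no power, the
  mutual information is 0 by definition, and the first claim still holds.\<close>

lemma gmi_signal:
  fixes bs cs :: "lin list"
  assumes u: "u \<in> users" and fin: "gmi (K0 Q) (lbase (GX u)) bs cs \<noteq> \<infinity>"
    and lo: "\<And>c. Pw u \<le> gvar (K0 Q) (\<lambda>v. lbase (GX u) v - (\<Sum>i<length cs. c i * (cs ! i) v))"
    and nn: "\<And>c. 0 \<le> gvar (K0 Q) (\<lambda>v. lbase (GX u) v - (\<Sum>i<length (bs @ cs). c i * ((bs @ cs) ! i) v))"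
  shows "0 \<le> ln 2 * real_of_ereal (gmi (K0 Q) (lbase (GX u)) bs cs)"
    and "0 < Pw u \<Longrightarrow> 0 \<le> \<eta> \<Longrightarrow> gvar (K0 Q) (\<lambda>v. lbase (GX u) v - (\<Sum>i<length (bs @ cs). c0 i * ((bs @ cs) ! i) v))
        = (1 - Pw u / (Pw u + \<eta>))\<^sup>2 * Pw u + (Pw u / (Pw u + \<eta>))\<^sup>2 * \<eta> \<Longrightarrow>
      0 < \<eta> \<and> ln (1 + Pw u / \<eta>) \<le> ln 2 * real_of_ereal (gmi (K0 Q) (lbase (GX u)) bs cs)"
proof -
  have Pu: "0 \<le> Pw u" using P0 u by simp
  show "0 \<le> ln 2 * real_of_ereal (gmi (K0 Q) (lbase (GX u)) bs cs)"
  proof (cases "Pw u = 0")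
    case True
    then have "gmi (K0 Q) (lbase (GX u)) bs cs = 0" using lo gvar_lbase_GX[OF u] by (intro gmi_zero) auto
    then show ?thesis by simp
  next
    case False
    then have P: "0 < Pw u" using Pu by simp
    have "ln (Pw u / Pw u) \<le> ln 2 * real_of_ereal (gmi (K0 Q) (lbase (GX u)) bs cs)"
      by (rule gmi_lower(2)[OF P lo nn fin, where ?c0.0="\<lambda>_. 0"]) (simp add: gvar_lbase_GX[OF u])
    then show ?thesis using P by simp
  qed
  assume P: "0 < Pw u" and \<eta>: "0 \<le> \<eta>" and V: "gvar (K0 Q) (\<lambda>v. lbase (GX u) v - (\<Sum>i<length (bs @ cs). c0 i * ((bs @ cs) ! i) v))
        = (1 - Pw u / (Pw u + \<eta>))\<^sup>2 * Pw u + (Pw u / (Pw u + \<eta>))\<^sup>2 * \<eta>"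
  note L = gmi_lower[OF P lo nn fin V]
  note M = mmse_combine[OF P \<eta> refl L(1)]
  show "0 < \<eta> \<and> ln (1 + Pw u / \<eta>) \<le> ln 2 * real_of_ereal (gmi (K0 Q) (lbase (GX u)) bs cs)"
    using L(2) M by simp
qed

lemma gvar_three_users: "users = {u, v, t} \<Longrightarrow> u \<noteq> v \<Longrightarrow> u \<noteq> t \<Longrightarrow> v \<noteq> t \<Longrightarrow> gvar (K0 Q) a = qv Q (\<lambda>_. 0) (\<lambda>_. 0) a u + qv Q (\<lambda>_. 0) (\<lambda>_. 0) a v + qv Q (\<lambda>_. 0) (\<lambda>_. 0) a t"
proof -
  assume u: "users = {u, v, t}" "u \<noteq> v" "u \<noteq> t" "v \<noteq> t"
  show ?thesis unfolding K0_Kg gvar_Kg u(1) using u(2-4) by simp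
qed

lemmas lin_defs = lbase_def ladd_def lsub_def lsc_def lI_def lY_def lU_def lS_def

lemma cmod_1k: "(cmod (1 - complex_of_real k))\<^sup>2 = (1 - k)\<^sup>2"
  by (metis norm_of_real of_real_1 of_real_diff power2_abs)

context
  fixes u v t :: nat
  assumes u: "users = {u, v, t}" "u \<noteq> v" "u \<noteq> t" "v \<noteq> t"
begin

lemma uvt: "u \<in> users" "v \<in> users" "t \<in> users" using u by auto

lemma uvt_neq: "v \<noteq> u" "t \<noteq> u" "t \<noteq> v" using u by auto

abbreviation "ep \<equiv> (cmod (hh u v))\<^sup>2 * Pw v + (cmod (hh u t))\<^sup>2 * Pw t"

lemma K0_nonneg: "(\<And>k. k \<in> users \<Longrightarrow> a (GW k) = 0 \<or> a (GN k) = 0) \<Longrightarrow> 0 \<le> gvar (K0 Q) a"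
  "(\<And>k. k \<in> users \<Longrightarrow> a (GW k) = 0 \<or> a (GN k) = 0) \<Longrightarrow> a (GX u) = 1 \<Longrightarrow> Pw u \<le> gvar (K0 Q) a"
  unfolding K0_Kg using gvar_ge_signal(1)[of a "\<lambda>_. 0" "\<lambda>_. 0"] gvar_ge_signal(2)[of a "\<lambda>_. 0" "\<lambda>_. 0" u] uvt by auto

lemma ep0: "0 \<le> ep" using P0 uvt by simp

lemma var_1: "gvar (K0 Q) (\<lambda>x. lbase (GX u) x - k * lY Q u x) = (cmod (1 - k))\<^sup>2 * Pw u + (cmod k)\<^sup>2 * (ep + 1)"
  unfolding gvar_three_users[OF u] qv_def using u(2-4) uvt uvt_neq by (simp add: lin_defs norm_mult power_mult_distrib algebra_simps)

text \<open>\<gamma> is the relative weight of \<open>U\<close>: the interference is seen with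
  factor \<open>1 + \<gamma>\<close>, and the noises combine to
  \<open>Z + \<gamma> W\<close>.\<close>

lemma var_3: "gvar (K0 Q) (\<lambda>x. lbase (GX u) x - (k * lY Q u x + k * \<gamma> * lU Q u x)) = (cmod (1 - k))\<^sup>2 * Pw u
    + (cmod k)\<^sup>2 * ((cmod (1 + \<gamma>))\<^sup>2 * ep + (1 + (cmod \<gamma>)\<^sup>2 * (sW Q u)\<^sup>2 + 2 * Re (cnj \<gamma> * zW u)))"
  unfolding gvar_three_users[OF u] qv_def cmod_power2 using u(2-4) uvt uvt_neq by (simp add: lin_defs algebra_simps power2_eq_square)

lemma g1_bounds:
  assumes fin: "gmi (K0 Q) (lbase (GX u)) [lY Q u] [] \<noteq> \<infinity>"
  shows "0 \<le> ln 2 * real_of_ereal (gmi (K0 Q) (lbase (GX u)) [lY Q u] [])"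
    and "0 < Pw u \<Longrightarrow> ln (1 + Pw u / (ep + 1)) \<le> ln 2 * real_of_ereal (gmi (K0 Q) (lbase (GX u)) [lY Q u] [])"
proof -
  have lo: "Pw u \<le> gvar (K0 Q) (\<lambda>x. lbase (GX u) x - (\<Sum>i<length ([] :: lin list). c i * ([] ! i) x))" for c
    by (rule K0_nonneg(2)) (simp_all add: lin_defs)
  have nn: "0 \<le> gvar (K0 Q) (\<lambda>x. lbase (GX u) x - (\<Sum>i<length ([lY Q u] @ []). c i * (([lY Q u] @ []) ! i) x))" for c
    by (rule K0_nonneg(1)) (simp add: lin_defs)
  show "0 \<le> ln 2 * real_of_ereal (gmi (K0 Q) (lbase (GX u)) [lY Q u] [])" by (rule gmi_signal(1)[OF uvt(1) fin lo nn])
  assume P: "0 < Pw u"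
  let ?k = "complex_of_real (Pw u / (Pw u + (ep + 1)))"
  have V: "gvar (K0 Q) (\<lambda>x. lbase (GX u) x - (\<Sum>i<length ([lY Q u] @ []). (\<lambda>_. ?k) i * (([lY Q u] @ []) ! i) x)) = (1 - Pw u / (Pw u + (ep + 1)))\<^sup>2 * Pw u + (Pw u / (Pw u + (ep + 1)))\<^sup>2 * (ep + 1)"
    using var_1[of ?k] unfolding cmod_1k norm_of_real power2_abs by (simp del: of_real_add of_real_divide)
  show "ln (1 + Pw u / (ep + 1)) \<le> ln 2 * real_of_ereal (gmi (K0 Q) (lbase (GX u)) [lY Q u] [])"
    using gmi_signal(2)[OF uvt(1) fin lo nn P _ V] ep0 by simp
qed

lemma g3_bounds:
  assumes fin: "gmi (K0 Q) (lbase (GX u)) [lY Q u] [lU Q u] \<noteq> \<infinity>"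
  shows "0 \<le> ln 2 * real_of_ereal (gmi (K0 Q) (lbase (GX u)) [lY Q u] [lU Q u])"
    and "0 < Pw u \<Longrightarrow> 0 < (cmod (1 + \<gamma>))\<^sup>2 * ep + (1 + (cmod \<gamma>)\<^sup>2 * (sW Q u)\<^sup>2 + 2 * Re (cnj \<gamma> * zW u)) \<and>
       ln (1 + Pw u / ((cmod (1 + \<gamma>))\<^sup>2 * ep + (1 + (cmod \<gamma>)\<^sup>2 * (sW Q u)\<^sup>2 + 2 * Re (cnj \<gamma> * zW u)))) \<le> ln 2 * real_of_ereal (gmi (K0 Q) (lbase (GX u)) [lY Q u] [lU Q u])"
proof -
  have lo: "Pw u \<le> gvar (K0 Q) (\<lambda>x. lbase (GX u) x - (\<Sum>i<length [lU Q u]. c i * ([lU Q u] ! i) x))" for c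
    by (rule K0_nonneg(2)) (simp_all add: lin_defs)
  have nn: "0 \<le> gvar (K0 Q) (\<lambda>x. lbase (GX u) x - (\<Sum>i<length ([lY Q u] @ [lU Q u]). c i * (([lY Q u] @ [lU Q u]) ! i) x))" for c
    by (rule K0_nonneg(1)) (simp add: lin_defs)
  show "0 \<le> ln 2 * real_of_ereal (gmi (K0 Q) (lbase (GX u)) [lY Q u] [lU Q u])" by (rule gmi_signal(1)[OF uvt(1) fin lo nn])
  assume P: "0 < Pw u"
  define \<eta> where "\<eta> = (cmod (1 + \<gamma>))\<^sup>2 * ep + (1 + (cmod \<gamma>)\<^sup>2 * (sW Q u)\<^sup>2 + 2 * Re (cnj \<gamma> * zW u))"
  have \<eta>0: "0 \<le> \<eta>"
  proof -
    have "0 \<le> gvar (K0 Q) (\<lambda>x. lbase (GX u) x - (1 * lY Q u x + 1 * \<gamma> * lU Q u x))" by (rule K0_nonneg(1)) (simp add: lin_defs)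
    then show ?thesis unfolding var_3 \<eta>_def by simp
  qed
  let ?k = "complex_of_real (Pw u / (Pw u + \<eta>))"
  have V: "gvar (K0 Q) (\<lambda>x. lbase (GX u) x - (\<Sum>i<length ([lY Q u] @ [lU Q u]). (\<lambda>i. if i = 0 then ?k else ?k * \<gamma>) i * (([lY Q u] @ [lU Q u]) ! i) x)) = (1 - Pw u / (Pw u + \<eta>))\<^sup>2 * Pw u + (Pw u / (Pw u + \<eta>))\<^sup>2 * \<eta>"
    using var_3[of ?k \<gamma>] unfolding cmod_1k norm_of_real power2_abs \<eta>_def[symmetric] by (simp del: of_real_add of_real_divide)
  show "0 < (cmod (1 + \<gamma>))\<^sup>2 * ep + (1 + (cmod \<gamma>)\<^sup>2 * (sW Q u)\<^sup>2 + 2 * Re (cnj \<gamma> * zW u)) \<and>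
       ln (1 + Pw u / ((cmod (1 + \<gamma>))\<^sup>2 * ep + (1 + (cmod \<gamma>)\<^sup>2 * (sW Q u)\<^sup>2 + 2 * Re (cnj \<gamma> * zW u)))) \<le> ln 2 * real_of_ereal (gmi (K0 Q) (lbase (GX u)) [lY Q u] [lU Q u])"
    unfolding \<eta>_def[symmetric] by (rule gmi_signal(2)[OF uvt(1) fin lo nn P \<eta>0 V])
qed

abbreviation "S \<equiv> ladd (lI Q t) (lbase (GN u))"

text \<open>The input of user \<open>t\<close> is known and is subtracted with exactly its
  coefficient in \<open>Y\<close>; \<open>\<alpha> + \<gamma> * hh t u\<close> is the gain of the
  wanted input.\<close>

lemma var_2: "gvar (K0 Q) (\<lambda>x. lbase (GX u) x - (k * \<alpha> * lY Q u x + k * \<gamma> * S x + - (k * \<alpha> * hh u t) * lbase (GX t) x)) = (cmod (1 - k * (\<alpha> + \<gamma> * hh t u)))\<^sup>2 * Pw u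
    + (cmod k)\<^sup>2 * ((cmod (\<alpha> * hh u v + \<gamma> * hh t v))\<^sup>2 * Pw v + ((cmod \<alpha>)\<^sup>2 + (cmod \<gamma>)\<^sup>2 * (sN Q u)\<^sup>2 + 2 * Re (\<alpha> * cnj \<gamma> * zN u)))"
  unfolding gvar_three_users[OF u] qv_def cmod_power2 using u(2-4) uvt uvt_neq by (simp add: lin_defs algebra_simps power2_eq_square)

lemma g2_bounds:
  assumes fin: "gmi (K0 Q) (lbase (GX u)) [lY Q u, S] [lbase (GX t)] \<noteq> \<infinity>"
  shows "0 \<le> ln 2 * real_of_ereal (gmi (K0 Q) (lbase (GX u)) [lY Q u, S] [lbase (GX t)])"
    and "0 < Pw u \<Longrightarrow> \<alpha> + \<gamma> * hh t u = 1 \<Longrightarrow> 0 < (cmod (\<alpha> * hh u v + \<gamma> * hh t v))\<^sup>2 * Pw v + ((cmod \<alpha>)\<^sup>2 + (cmod \<gamma>)\<^sup>2 * (sN Q u)\<^sup>2 + 2 * Re (\<alpha> * cnj \<gamma> * zN u)) \<and>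
       ln (1 + Pw u / ((cmod (\<alpha> * hh u v + \<gamma> * hh t v))\<^sup>2 * Pw v + ((cmod \<alpha>)\<^sup>2 + (cmod \<gamma>)\<^sup>2 * (sN Q u)\<^sup>2 + 2 * Re (\<alpha> * cnj \<gamma> * zN u)))) \<le> ln 2 * real_of_ereal (gmi (K0 Q) (lbase (GX u)) [lY Q u, S] [lbase (GX t)])"
proof -
  let ?bs = "[lY Q u, S]" and ?cs = "[lbase (GX t)]"
  have lo: "Pw u \<le> gvar (K0 Q) (\<lambda>x. lbase (GX u) x - (\<Sum>i<length ?cs. c i * (?cs ! i) x))" for c
    by (rule K0_nonneg(2)) (use u in \<open>simp_all add: lin_defs\<close>)
  have nn: "0 \<le> gvar (K0 Q) (\<lambda>x. lbase (GX u) x - (\<Sum>i<length (?bs @ ?cs). c i * ((?bs @ ?cs) ! i) x))" for c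
    by (rule K0_nonneg(1)) (simp add: lin_defs)
  show "0 \<le> ln 2 * real_of_ereal (gmi (K0 Q) (lbase (GX u)) ?bs ?cs)" by (rule gmi_signal(1)[OF uvt(1) fin lo nn])
  assume P: "0 < Pw u" and one: "\<alpha> + \<gamma> * hh t u = 1"
  define \<eta> where "\<eta> = (cmod (\<alpha> * hh u v + \<gamma> * hh t v))\<^sup>2 * Pw v + ((cmod \<alpha>)\<^sup>2 + (cmod \<gamma>)\<^sup>2 * (sN Q u)\<^sup>2 + 2 * Re (\<alpha> * cnj \<gamma> * zN u))"
  have \<eta>0: "0 \<le> \<eta>"
  proof -
    have "0 \<le> gvar (K0 Q) (\<lambda>x. lbase (GX u) x - (1 * \<alpha> * lY Q u x + 1 * \<gamma> * S x + - (1 * \<alpha> * hh u t) * lbase (GX t) x))" by (rule K0_nonneg(1)) (simp add: lin_defs)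
    then show ?thesis unfolding var_2 \<eta>_def one by simp
  qed
  let ?k = "complex_of_real (Pw u / (Pw u + \<eta>))"
  let ?c = "\<lambda>i. if i = 0 then ?k * \<alpha> else if i = 1 then ?k * \<gamma> else - (?k * \<alpha> * hh u t)"
  have V: "gvar (K0 Q) (\<lambda>x. lbase (GX u) x - (\<Sum>i<length (?bs @ ?cs). ?c i * ((?bs @ ?cs) ! i) x)) = (1 - Pw u / (Pw u + \<eta>))\<^sup>2 * Pw u + (Pw u / (Pw u + \<eta>))\<^sup>2 * \<eta>"
    using var_2[of ?k \<alpha> \<gamma>] unfolding one mult_1_right cmod_1k norm_of_real power2_abs \<eta>_def[symmetric] by (simp del: of_real_add of_real_divide)
  show "0 < (cmod (\<alpha> * hh u v + \<gamma> * hh t v))\<^sup>2 * Pw v + ((cmod \<alpha>)\<^sup>2 + (cmod \<gamma>)\<^sup>2 * (sN Q u)\<^sup>2 + 2 * Re (\<alpha> * cnj \<gamma> * zN u)) \<and>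
       ln (1 + Pw u / ((cmod (\<alpha> * hh u v + \<gamma> * hh t v))\<^sup>2 * Pw v + ((cmod \<alpha>)\<^sup>2 + (cmod \<gamma>)\<^sup>2 * (sN Q u)\<^sup>2 + 2 * Re (\<alpha> * cnj \<gamma> * zN u)))) \<le> ln 2 * real_of_ereal (gmi (K0 Q) (lbase (GX u)) ?bs ?cs)"
    unfolding \<eta>_def[symmetric] by (rule gmi_signal(2)[OF uvt(1) fin lo nn P \<eta>0 V])
qed

end

end

section \<open>Conditional variances of the auxiliary noises and the assembly over users\<close>

context gic begin

lemma gcov_one:
  assumes k: "k \<in> users" and a: "\<And>j. j \<noteq> k \<Longrightarrow> a (GX j) = 0 \<and> a (GZ j) = 0 \<and> a (GW j) = 0 \<and> a (GN j) = 0"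
  shows "gcov (K0 Q) a b = qc Q (\<lambda>_. 0) (\<lambda>_. 0) a b k"
proof -
  have "qc Q (\<lambda>_. 0) (\<lambda>_. 0) a b j = 0" if "j \<noteq> k" for j using a[OF that] by (simp add: qc_def)
  then show ?thesis unfolding K0_Kg gcov_Kg using k by (subst sum.remove[of _ k]) (auto intro: sum.neutral)
qed

lemma gvar_one:
  assumes k: "k \<in> users" and a: "\<And>j. j \<noteq> k \<Longrightarrow> a (GX j) = 0 \<and> a (GZ j) = 0 \<and> a (GW j) = 0 \<and> a (GN j) = 0"
  shows "gvar (K0 Q) a = qv Q (\<lambda>_. 0) (\<lambda>_. 0) a k"
proof -
  have "qv Q (\<lambda>_. 0) (\<lambda>_. 0) a j = 0" if "j \<noteq> k" for j using a[OF that] by (simp add: qv_def)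
  then show ?thesis unfolding K0_Kg gvar_Kg using k by (subst sum.remove[of _ k]) (auto intro: sum.neutral)
qed

lemma vZW_eq: assumes k: "k \<in> users" shows "vZW Q k = 1 + (sW Q k)\<^sup>2 - 2 * Re (zW k)"
  unfolding vZW_def by (subst gvar_one[OF k]) (auto simp: lin_defs qv_def)

lemma vVW_eq: assumes k: "k \<in> users" shows "vVW Q k = (sW Q k)\<^sup>2 - (cmod (zW k - of_real ((sW Q k)\<^sup>2)))\<^sup>2 / vZW Q k"
proof -
  have "gvar (K0 Q) (lbase (GW k)) = (sW Q k)\<^sup>2" by (subst gvar_one[OF k]) (auto simp: lin_defs qv_def)
  moreover have "gcov (K0 Q) (lbase (GW k)) (lsub (lbase (GZ k)) (lbase (GW k))) = cnj (zW k - of_real ((sW Q k)\<^sup>2))"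
    by (subst gcov_one[OF k]) (auto simp: lin_defs qc_def)
  ultimately show ?thesis unfolding vVW_def csv_def vZW_def[symmetric] by (simp only: complex_mod_cnj)
qed

context
  fixes p :: "nat \<Rightarrow> nat" and i u v t :: nat
  assumes pu: "p i = u" "p (nxt i) = v" "p (prv i) = t"
    and u: "users = {u, v, t}" "u \<noteq> v" "u \<noteq> t" "v \<noteq> t"
begin

lemma uu: "u \<in> users" using u by auto
lemma hnz: "hh u v \<noteq> 0" "hh t u \<noteq> 0" "hh t v \<noteq> 0" "hh u t \<noteq> 0"
proof -
  have "u \<in> users" "v \<in> users" "t \<in> users" "v \<noteq> u" "t \<noteq> u" "t \<noteq> v" using u by auto
  then show "hh u v \<noteq> 0" "hh t u \<noteq> 0" "hh t v \<noteq> 0" "hh u t \<noteq> 0" using h0 by metis+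
qed

abbreviation "cc \<equiv> hh u v / hh t v"
abbreviation "ee \<equiv> 1 + (cmod cc)\<^sup>2 * (sN Q u)\<^sup>2 - 2 * Re (cnj cc * zN u)"

lemma zN_le: "cmod (zN u) \<le> sN Q u" "(cmod (zN u))\<^sup>2 \<le> (sN Q u)\<^sup>2"
proof -
  show z: "cmod (zN u) \<le> sN Q u" using N0 uu mult_right_mono[of "cmod (rN Q u)" 1 "sN Q u"] by (auto simp: norm_mult)
  then show "(cmod (zN u))\<^sup>2 \<le> (sN Q u)\<^sup>2" by (intro power_mono) auto
qed

lemma ee_sq: "(1 - cmod cc * sN Q u)\<^sup>2 \<le> ee"
proof -
  have "Re (cnj cc * zN u) \<le> cmod cc * cmod (zN u)" using complex_Re_le_cmod[of "cnj cc * zN u"] by (simp add: norm_mult norm_divide)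
  also have "\<dots> \<le> cmod cc * sN Q u" by (intro mult_left_mono zN_le) auto
  finally show ?thesis by (simp add: power2_eq_square algebra_simps)
qed

lemma ee0: "0 \<le> ee" using ee_sq zero_le_power2 order_trans by blast

lemma ee_zero: assumes "ee = 0" shows "(sN Q u)\<^sup>2 = (cmod (hh t v))\<^sup>2 / (cmod (hh u v))\<^sup>2"
proof -
  have "cmod cc * sN Q u = 1" using ee_sq unfolding assms by simp
  then have "sN Q u = cmod (hh t v) / cmod (hh u v)" using hnz by (simp add: norm_divide field_simps)
  then show ?thesis by (simp add: power_divide)
qed

text \<open>The Schur complement of \<open>N\<close> with respect to \<open>Z - cc N\<close>. If
  that variable vanishes, the quotient in \<open>csv\<close> is a division by 0 with value 0, so the
  full variance of \<open>N\<close> remains.\<close>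

lemma vVN_eq: "vVN Q p i = (if ee = 0 then (sN Q u)\<^sup>2 else ((sN Q u)\<^sup>2 - (cmod (zN u))\<^sup>2) / ee)"
proof -
  have 1: "gvar (K0 Q) (lbase (GN u)) = (sN Q u)\<^sup>2" by (subst gvar_one[OF uu]) (auto simp: lin_defs qv_def)
  have 2: "gcov (K0 Q) (lbase (GN u)) (lsub (lbase (GZ u)) (lsc cc (lbase (GN u)))) = cnj (zN u) - cnj cc * of_real ((sN Q u)\<^sup>2)"
    by (subst gcov_one[OF uu]) (auto simp: lin_defs qc_def)
  have 3: "gvar (K0 Q) (lsub (lbase (GZ u)) (lsc cc (lbase (GN u)))) = ee"
    by (subst gvar_one[OF uu]) (auto simp: lin_defs qv_def)
  have key: "s\<^sup>2 - (cmod (cnj z - cnj c * of_real (s\<^sup>2)))\<^sup>2 / e = (s\<^sup>2 - (cmod z)\<^sup>2) / e" if "e = 1 + (cmod c)\<^sup>2 * s\<^sup>2 - 2 * Re (cnj c * z)" "e \<noteq> 0" for s e :: real and c z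
  proof -
    have "s\<^sup>2 * e - (cmod (cnj z - cnj c * of_real (s\<^sup>2)))\<^sup>2 = s\<^sup>2 - (cmod z)\<^sup>2"
      unfolding that(1) cmod_power2 by (simp add: algebra_simps power2_eq_square)
    then have "(s\<^sup>2 * e - (cmod (cnj z - cnj c * of_real (s\<^sup>2)))\<^sup>2) / e = (s\<^sup>2 - (cmod z)\<^sup>2) / e" by (simp only:)
    then show ?thesis using that(2) by (simp add: diff_divide_distrib)
  qed
  show ?thesis
  proof (cases "ee = 0")
    case True
    then show ?thesis unfolding vVN_def pu csv_def 1 2 3 by simp
  next
    case False
    then show ?thesis unfolding vVN_def pu csv_def 1 2 3 using key[OF refl False] by (simp only: if_False)
  qed
qed

lemma vVN'_eq: "vVN' Q p i = (if ee = 0 then 1 else ((sN Q u)\<^sup>2 - (cmod (zN u))\<^sup>2) * (cmod cc)\<^sup>2 / ee)"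
proof -
  let ?d = "hh t v / hh u v"
  let ?e = "(sN Q u)\<^sup>2 + (cmod ?d)\<^sup>2 - 2 * Re (?d * zN u)"
  have 1: "gvar (K0 Q) (lbase (GZ u)) = 1" by (subst gvar_one[OF uu]) (auto simp: lin_defs qv_def)
  have 2: "gcov (K0 Q) (lbase (GZ u)) (lsub (lbase (GN u)) (lsc ?d (lbase (GZ u)))) = zN u - cnj ?d"
    by (subst gcov_one[OF uu]) (auto simp: lin_defs qc_def)
  have 3: "gvar (K0 Q) (lsub (lbase (GN u)) (lsc ?d (lbase (GZ u)))) = ?e"
    by (subst gvar_one[OF uu]) (auto simp: lin_defs qv_def)
  have c0: "cc \<noteq> 0" using hnz by simp
  have d: "?d = 1 / cc" by simp
  have cn: "0 < (cmod cc)\<^sup>2" using c0 by (simp only: zero_less_power2 norm_eq_zero not_False_eq_True)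
  \<comment> \<open>\<open>N - Z / cc\<close> is \<open>- 1 / cc\<close> times
    \<open>Z - cc N\<close>, so the two conditioning variables are proportional.\<close>
  have ce: "?e = ee / (cmod cc)\<^sup>2"
  proof -
    have r: "Re (1 / c * z) = Re (cnj c * z) / (cmod c)\<^sup>2" if "c \<noteq> 0" for c z :: complex
    proof -
      have "1 / c * z = (cnj c * z) / (c * cnj c)" using that by (simp add: field_simps)
      also have "\<dots> = (cnj c * z) / of_real ((cmod c)\<^sup>2)" by (simp only: complex_norm_square)
      finally show ?thesis by (simp only: Re_divide_of_real)
    qed
    have n: "(cmod (1 / c))\<^sup>2 = 1 / (cmod c)\<^sup>2" for c :: complex by (simp add: norm_divide power_divide)
    have "s\<^sup>2 + (cmod (1 / c))\<^sup>2 - 2 * Re (1 / c * z) = (1 + (cmod c)\<^sup>2 * s\<^sup>2 - 2 * Re (cnj c * z)) / (cmod c)\<^sup>2" if "c \<noteq> 0" for c z :: complex and s :: real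
      unfolding r[OF that] n using that by (simp add: diff_divide_distrib add_divide_distrib)
    from this[OF c0, of "sN Q u" "zN u"] show ?thesis unfolding d .
  qed
  have key: "1 - (cmod (z - cnj d))\<^sup>2 / e = (s\<^sup>2 - (cmod z)\<^sup>2) / e" if "e = s\<^sup>2 + (cmod d)\<^sup>2 - 2 * Re (d * z)" "e \<noteq> 0" for s e :: real and d z
  proof -
    have "e - (cmod (z - cnj d))\<^sup>2 = s\<^sup>2 - (cmod z)\<^sup>2"
      unfolding that(1) cmod_power2 by (simp add: algebra_simps power2_eq_square)
    then have "(e - (cmod (z - cnj d))\<^sup>2) / e = (s\<^sup>2 - (cmod z)\<^sup>2) / e" by (simp only:)
    then show ?thesis using that(2) by (simp add: diff_divide_distrib)
  qed
  show ?thesis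
  proof (cases "ee = 0")
    case True
    then have "?e = 0" unfolding ce by simp
    then show ?thesis unfolding vVN'_def pu csv_def 1 2 3 using True by simp
  next
    case False
    then have e: "?e \<noteq> 0" unfolding ce using cn by simp
    have "vVN' Q p i = ((sN Q u)\<^sup>2 - (cmod (zN u))\<^sup>2) / ?e" unfolding vVN'_def pu csv_def 1 2 3 by (rule key[OF refl e])
    also have "\<dots> = ((sN Q u)\<^sup>2 - (cmod (zN u))\<^sup>2) * (cmod cc)\<^sup>2 / ee" unfolding ce by (simp only: divide_divide_eq_right)
    finally show ?thesis using False by (simp only: if_False)
  qed
qed

lemma vVN_nonneg: "0 \<le> vVN Q p i" "0 \<le> vVN' Q p i"
  unfolding vVN_eq vVN'_eq using zN_le(2) ee0 by (auto intro!: divide_nonneg_nonneg mult_nonneg_nonneg)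

text \<open>In the regular case \<open>vVN'\<close> is \<open>(cmod cc)\<^sup>2\<close> times
  \<open>vVN\<close>, and the right-hand sides of the two conditions differ by the same factor. So
  both kinds of condition on \<open>N\<close> lead to the same two premises of
  \<open>label_middle_bound\<close>, also when \<open>ee = 0\<close>.\<close>

lemma noise_condition:
  assumes "vVN Q p i \<ge> (cmod (hh t v))\<^sup>2 * s \<or> vVN' Q p i \<ge> (cmod (hh u v))\<^sup>2 * s"
  shows "ee \<noteq> 0 \<Longrightarrow> (cmod (hh t v))\<^sup>2 * s \<le> ((sN Q u)\<^sup>2 - (cmod (zN u))\<^sup>2) / ee" and "ee = 0 \<Longrightarrow> s \<le> 1 / (cmod (hh u v))\<^sup>2"
proof -
  have hp: "0 < (cmod (hh u v))\<^sup>2" "0 < (cmod (hh t v))\<^sup>2" using hnz by auto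
  assume e: "ee \<noteq> 0"
  from assms show "(cmod (hh t v))\<^sup>2 * s \<le> ((sN Q u)\<^sup>2 - (cmod (zN u))\<^sup>2) / ee"
  proof
    assume "vVN Q p i \<ge> (cmod (hh t v))\<^sup>2 * s"
    then show ?thesis unfolding vVN_eq using e by (simp only: if_False)
  next
    assume "vVN' Q p i \<ge> (cmod (hh u v))\<^sup>2 * s"
    then have a: "(cmod (hh u v))\<^sup>2 * s \<le> ((sN Q u)\<^sup>2 - (cmod (zN u))\<^sup>2) * (cmod cc)\<^sup>2 / ee" unfolding vVN'_eq using e by (simp only: if_False)
    define X where "X = ((sN Q u)\<^sup>2 - (cmod (zN u))\<^sup>2) / ee"
    have a': "(cmod (hh u v))\<^sup>2 * s \<le> X * (cmod cc)\<^sup>2" using a unfolding X_def by (simp only: times_divide_eq_left)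
    have c2: "(cmod cc)\<^sup>2 = (cmod (hh u v))\<^sup>2 / (cmod (hh t v))\<^sup>2" by (simp add: norm_divide power_divide)
    have "(cmod (hh u v))\<^sup>2 * s \<le> X * ((cmod (hh u v))\<^sup>2 / (cmod (hh t v))\<^sup>2)" using a' unfolding c2 .
    then have "(cmod (hh t v))\<^sup>2 * s \<le> X" using hp by (simp add: field_simps)
    then show ?thesis unfolding X_def .
  qed
next
  have hp: "0 < (cmod (hh u v))\<^sup>2" "0 < (cmod (hh t v))\<^sup>2" using hnz by auto
  assume e: "ee = 0"
  from assms show "s \<le> 1 / (cmod (hh u v))\<^sup>2"
  proof
    assume "vVN Q p i \<ge> (cmod (hh t v))\<^sup>2 * s"
    then have "(cmod (hh t v))\<^sup>2 * s \<le> (cmod (hh t v))\<^sup>2 / (cmod (hh u v))\<^sup>2" unfolding vVN_eq if_P[OF e] unfolding ee_zero[OF e] .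
    then show ?thesis using hp by (simp add: field_simps)
  next
    assume "vVN' Q p i \<ge> (cmod (hh u v))\<^sup>2 * s"
    then have "(cmod (hh u v))\<^sup>2 * s \<le> 1" unfolding vVN'_eq if_P[OF e] .
    then show ?thesis using hp by (simp add: field_simps)
  qed
qed

end

lemma nxt_prv: "i \<in> users \<Longrightarrow> nxt i \<in> users" "i \<in> users \<Longrightarrow> prv i \<in> users" "i \<in> users \<Longrightarrow> users = {i, nxt i, prv i}"
  "i \<in> users \<Longrightarrow> i \<noteq> nxt i" "i \<in> users \<Longrightarrow> i \<noteq> prv i" "i \<in> users \<Longrightarrow> nxt i \<noteq> prv i"
  "i \<in> users \<Longrightarrow> nxt (prv i) = i" "i \<in> users \<Longrightarrow> prv (nxt i) = i" "nxt (nxt i) = prv i" "i \<in> users \<Longrightarrow> prv (prv i) = nxt i"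
  by (auto simp: users_def nxt_def prv_def)

lemma labels:
  assumes p: "p permutes users" and i: "i \<in> users"
  shows "users = {p i, p (nxt i), p (prv i)}" "p i \<noteq> p (nxt i)" "p i \<noteq> p (prv i)" "p (nxt i) \<noteq> p (prv i)"
proof -
  have "users = p ` users" using permutes_image[OF p] by simp
  also have "p ` users = p ` {i, nxt i, prv i}" by (rule arg_cong[OF nxt_prv(3)[OF i]])
  finally show "users = {p i, p (nxt i), p (prv i)}" by (simp only: image_insert image_empty)
  show "p i \<noteq> p (nxt i)" "p i \<noteq> p (prv i)" "p (nxt i) \<noteq> p (prv i)"
    using nxt_prv(4-6)[OF i] permutes_inj[OF p] by (auto simp: inj_def)
qed

lemma gmi_I_nonneg:
  assumes p: "p permutes users"
  shows "0 \<le> gmi (Kf Q p) (lU Q k) [ladd (lY Q k) (lsc c (lbase (GV j)))] []" "0 \<le> gmi (Kf Q p) (lU Q k) [ladd (lY Q k) (lsc c (lbase (GV' j)))] []"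
proof -
  have f: "0 \<le> vVN Q p i" "0 \<le> vVN' Q p i" if "i \<in> users" for i
    using vVN_nonneg[OF refl refl refl labels[OF p that]] by auto
  show "0 \<le> gmi (Kf Q p) (lU Q k) [ladd (lY Q k) (lsc c (lbase (GV j)))] []" "0 \<le> gmi (Kf Q p) (lU Q k) [ladd (lY Q k) (lsc c (lbase (GV' j)))] []"
    unfolding Kf_Kg by (intro gmi_nonneg_single gvar_ge_signal(1) f; simp add: lin_defs)+
qed

lemma I_nonneg: assumes p: "p permutes users" shows "0 \<le> I0term Q p" "0 \<le> I1term Q p"
proof -
  show "0 \<le> I0term Q p" unfolding I0term_def by (intro ereal_0_le_mult sum_nonneg gmi_I_nonneg p) simp
  show "0 \<le> I1term Q p" unfolding I1term_def by (intro ereal_0_le_mult sum_nonneg gmi_I_nonneg p) simp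
qed

abbreviation "G1 p j \<equiv> gmi (K0 Q) (lbase (GX (p j))) [lY Q (p j)] []"
abbreviation "G2 p j \<equiv> gmi (K0 Q) (lbase (GX (p j))) [lY Q (p j), lS Q p j] [lbase (GX (p (prv j)))]"
abbreviation "G3 p j \<equiv> gmi (K0 Q) (lbase (GX (p j))) [lY Q (p j)] [lU Q (p j)]"

text \<open>The cyclic shifts only reorder the nine terms, so they can be grouped by the user whose
  input is estimated.\<close>

lemma Aterm_eq: "Aterm Q p = ereal (1/3) * (\<Sum>j\<in>users. G1 p j + G2 p j + G3 p j)"
proof -
  have rot: "(\<Sum>i\<in>users. a i + b (nxt i) + c (prv i)) = (\<Sum>i\<in>users. a i + b i + c i)" for a b c :: "nat \<Rightarrow> ereal"
    by (simp add: users_def nxt_def prv_def add_ac numeral_2_eq_2 numeral_3_eq_3)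
  have "Aterm Q p = ereal (1/3) * (\<Sum>i\<in>users. G1 p i + G2 p (nxt i) + G3 p (prv i))"
    unfolding Aterm_def by (intro arg_cong2[where f="(*)"] sum.cong refl) (simp add: nxt_prv(8))
  then show ?thesis unfolding rot[of "G1 p" "G2 p" "G3 p"] .
qed

text \<open>An infinite \<open>Aterm\<close> is trivial. Otherwise each of its terms is finite,
  which excludes noiseless observations of active users, and the per-user bounds apply at every
  block length.\<close>

lemma sum_rate_bound:
  assumes p: "p permutes users" and cond: "cond_a Q p \<or> cond_b Q p" and ach: "achievable hh Pw R"
  shows "ereal (R 1 + R 2 + R 3) \<le> Aterm Q p"
proof (cases "Aterm Q p = \<infinity>")
  case False
  note lab = labels[OF p]
  have fin: "G1 p j \<noteq> \<infinity>" "G2 p j \<noteq> \<infinity>" "G3 p j \<noteq> \<infinity>" if j: "j \<in> users" for j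
  proof -
    have "(\<Sum>j\<in>users. G1 p j + G2 p j + G3 p j) \<noteq> \<infinity>" using False unfolding Aterm_eq by auto
    then have "G1 p j + G2 p j + G3 p j \<noteq> \<infinity>" using j by (auto simp: sum_Pinfty)
    then show "G1 p j \<noteq> \<infinity>" "G2 p j \<noteq> \<infinity>" "G3 p j \<noteq> \<infinity>" by auto
  qed
  define m1 m2 m3 where "m1 j = ln 2 * real_of_ereal (G1 p j)" and "m2 j = ln 2 * real_of_ereal (G2 p j)" and "m3 j = ln 2 * real_of_ereal (G3 p j)" for j
  define \<epsilon> where "\<epsilon> j = (cmod (hh (p j) (p (nxt j))))\<^sup>2 * Pw (p (nxt j)) + (cmod (hh (p j) (p (prv j))))\<^sup>2 * Pw (p (prv j))" for j
  have nm: "gmi K a bs cs \<noteq> - \<infinity>" for K a bs cs by (auto simp: gmi_def Let_def)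
  have ge: "gmi K a bs cs = ereal (real_of_ereal (gmi K a bs cs))" if "gmi K a bs cs \<noteq> \<infinity>" for K a bs cs
    using that nm[of K a bs cs] by (cases "gmi K a bs cs") auto
  have A: "Aterm Q p = ereal ((\<Sum>j\<in>users. m1 j + m2 j + m3 j) / (3 * ln 2))"
  proof -
    have e: "G1 p j + G2 p j + G3 p j = ereal ((m1 j + m2 j + m3 j) / ln 2)" if j: "j \<in> users" for j
    proof -
      have "G1 p j + G2 p j + G3 p j = ereal (real_of_ereal (G1 p j) + real_of_ereal (G2 p j) + real_of_ereal (G3 p j))"
        using ge[OF fin(1)[OF j]] ge[OF fin(2)[OF j]] ge[OF fin(3)[OF j]] by (metis plus_ereal.simps(1))
      then show ?thesis by (simp add: m1_def m2_def m3_def add_divide_distrib)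
    qed
    have "(\<Sum>j\<in>users. G1 p j + G2 p j + G3 p j) = ereal (\<Sum>j\<in>users. (m1 j + m2 j + m3 j) / ln 2)"
      unfolding sum_ereal[symmetric] by (intro sum.cong refl e)
    then show ?thesis unfolding Aterm_eq by (simp add: sum_divide_distrib[symmetric])
  qed
  have GA: "0 \<le> m1 j" "0 < Pw (p j) \<Longrightarrow> ln (1 + Pw (p j) / (\<epsilon> j + 1)) \<le> m1 j" if j: "j \<in> users" for j
    using g1_bounds[OF lab[OF j] fin(1)[OF j]] unfolding m1_def \<epsilon>_def by auto
  have GC: "0 \<le> m3 j" "0 < Pw (p j) \<Longrightarrow> 0 < (cmod (1 + \<gamma>))\<^sup>2 * \<epsilon> j + (1 + (cmod \<gamma>)\<^sup>2 * (sW Q (p j))\<^sup>2 + 2 * Re (cnj \<gamma> * zW (p j))) \<and>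
         ln (1 + Pw (p j) / ((cmod (1 + \<gamma>))\<^sup>2 * \<epsilon> j + (1 + (cmod \<gamma>)\<^sup>2 * (sW Q (p j))\<^sup>2 + 2 * Re (cnj \<gamma> * zW (p j))))) \<le> m3 j" if j: "j \<in> users" for j \<gamma>
    using g3_bounds[OF lab[OF j] fin(3)[OF j]] unfolding m3_def \<epsilon>_def by auto
  have fin2: "gmi (K0 Q) (lbase (GX (p j))) [lY Q (p j), ladd (lI Q (p (prv j))) (lbase (GN (p j)))] [lbase (GX (p (prv j)))] \<noteq> \<infinity>" if j: "j \<in> users" for j
    using fin(2)[OF j] unfolding lS_def .
  have GB: "0 \<le> m2 j" "0 < Pw (p j) \<Longrightarrow> \<alpha> + \<gamma> * hh (p (prv j)) (p j) = 1 \<Longrightarrow>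
       0 < (cmod (\<alpha> * hh (p j) (p (nxt j)) + \<gamma> * hh (p (prv j)) (p (nxt j))))\<^sup>2 * Pw (p (nxt j)) + ((cmod \<alpha>)\<^sup>2 + (cmod \<gamma>)\<^sup>2 * (sN Q (p j))\<^sup>2 + 2 * Re (\<alpha> * cnj \<gamma> * zN (p j))) \<and>
       ln (1 + Pw (p j) / ((cmod (\<alpha> * hh (p j) (p (nxt j)) + \<gamma> * hh (p (prv j)) (p (nxt j))))\<^sup>2 * Pw (p (nxt j)) + ((cmod \<alpha>)\<^sup>2 + (cmod \<gamma>)\<^sup>2 * (sN Q (p j))\<^sup>2 + 2 * Re (\<alpha> * cnj \<gamma> * zN (p j))))) \<le> m2 j"
    if j: "j \<in> users" for j \<alpha> \<gamma>
    using g2_bounds[OF lab[OF j] fin2[OF j]] unfolding m2_def lS_def by auto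
  have pj: "p j \<in> users" if "j \<in> users" for j using permutes_in_image[OF p] that by blast
  have sTpos: "0 < vZW Q (p j)" if j: "j \<in> users" and P: "0 < Pw (p j)" for j
    using GC(2)[OF j P, of "- 1"] vZW_eq[OF pj[OF j]] by simp
  have Pnn: "0 \<le> Pw (p j)" if "j \<in> users" for j using P0 pj[OF that] by blast
  \<comment> \<open>The conditions are indexed so that the noise \<open>N\<close> of label
    \<open>j\<close> occurs at index \<open>prv j\<close>.\<close>
  have K: "vVN Q p j \<ge> (cmod (hh (p (prv j)) (p (nxt j))))\<^sup>2 * vZW Q (p (nxt j)) \<or> vVN' Q p j \<ge> (cmod (hh (p j) (p (nxt j))))\<^sup>2 * vZW Q (p (nxt j))" if j: "j \<in> users" for j
  proof -
    have pr: "prv j \<in> users" using nxt_prv(2)[OF j] .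
    show ?thesis using cond
    proof
      assume "cond_a Q p"
      then show ?thesis using pr unfolding cond_a_def by (metis nxt_prv(7)[OF j] nxt_prv(10)[OF j])
    next
      assume "cond_b Q p"
      then show ?thesis using pr unfolding cond_b_def by (metis nxt_prv(7)[OF j] nxt_prv(10)[OF j])
    qed
  qed
  \<comment> \<open>The value 1 is a default: if \<open>N\<close> is degenerate, the users heard
    through its signal have no power, so the gap in question is 0 at every level.\<close>
  define v1 where "v1 j = (if sN Q (p j) = 0 then 1 else (sN Q (p j))\<^sup>2)" for j
  have v1: "0 < v1 j" "v1 j \<le> 1" if j: "j \<in> users" for j
    using N0 pj[OF j] by (auto simp: v1_def power_le_one)
  define MB where "MB j vb \<longleftrightarrow> (\<forall>n Ma x (B :: nat set) \<beta> (C :: nat set) d \<psi> er. pwr n {..<Ma} x (Pw (p j)) \<longrightarrow> pwr n B \<beta> (Pw (p (nxt j))) \<longrightarrow> finite C \<longrightarrow> C \<noteq> {} \<longrightarrow>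
        succ n Ma x (B \<times> C) (\<lambda>(b, c). sc (hh (p j) (p (nxt j))) (\<beta> b) + d c) \<psi> er \<longrightarrow>
        (1 - er) * ln (real Ma) - ln 2 + Dd n ({..<Ma} \<times> B) (\<lambda>(a, b). sc (hh (p (prv j)) (p j)) (x a) + sc (hh (p (prv j)) (p (nxt j))) (\<beta> b)) (v1 j)
            ((cmod (hh (p (prv j)) (p j)))\<^sup>2 * Pw (p j) + (cmod (hh (p (prv j)) (p (nxt j))))\<^sup>2 * Pw (p (nxt j)))
          \<le> Dd n B \<beta> vb (Pw (p (nxt j))) + real n * m2 j)" for j vb
  have mid: "(sN Q (p j) = 0 \<longrightarrow> Pw (p j) = 0 \<and> Pw (p (nxt j)) = 0) \<and> (\<exists>vbar>0. (0 < Pw (p (nxt j)) \<longrightarrow> vZW Q (p (nxt j)) \<le> vbar) \<and> MB j vbar)" if j: "j \<in> users" for j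
  proof -
    note h = hnz[OF refl refl refl lab[OF j]]
    note nc = noise_condition[OF refl refl refl lab[OF j] K[OF j]]
    have s0: "0 \<le> sN Q (p j)" using N0 pj[OF j] by blast
    note L = label_middle_bound[where P="Pw (p j)" and Pb="Pw (p (nxt j))" and s="sN Q (p j)" and sT="vZW Q (p (nxt j))" and ?m2.0="m2 j" and ?h12.0="hh (p j) (p (nxt j))" and ?h31.0="hh (p (prv j)) (p j)" and ?h32.0="hh (p (prv j)) (p (nxt j))" and z="zN (p j)",
      OF Pnn[OF j] Pnn[OF nxt_prv(1)[OF j]] h(1,2,3) s0 zN_le(1)[OF refl refl refl lab[OF j]] GB(1)[OF j] GB(2)[OF j] nc sTpos[OF nxt_prv(1)[OF j]]]
    show ?thesis unfolding MB_def v1_def by (rule conjI[OF L])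
  qed
  have "\<forall>j\<in>users. \<exists>vbar. 0 < vbar \<and> (0 < Pw (p (nxt j)) \<longrightarrow> vZW Q (p (nxt j)) \<le> vbar) \<and> MB j vbar" using mid by blast
  from bchoice[OF this] obtain vbar where vbar: "\<forall>j\<in>users. 0 < vbar j \<and> (0 < Pw (p (nxt j)) \<longrightarrow> vZW Q (p (nxt j)) \<le> vbar j) \<and> MB j (vbar j)" ..
  have vb: "0 < vbar j" "0 < Pw (p (nxt j)) \<Longrightarrow> vZW Q (p (nxt j)) \<le> vbar j" and MB: "MB j (vbar j)" if "j \<in> users" for j
    using vbar that by blast+
  note mb = MB[unfolded MB_def, rule_format]
  \<comment> \<open>Case (b) gives the second alternative. In case (a) the first one holds unless
    \<open>N\<close> of the next label is degenerate, and then the interference at label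
    \<open>j\<close> has no power.\<close>
  have C: "v1 (nxt j) \<le> (sW Q (p j))\<^sup>2 - (cmod (zW (p j) - of_real ((sW Q (p j))\<^sup>2)))\<^sup>2 / vZW Q (p j)
      \<or> (sW Q (p j))\<^sup>2 \<le> (sW Q (p j))\<^sup>2 - (cmod (zW (p j) - of_real ((sW Q (p j))\<^sup>2)))\<^sup>2 / vZW Q (p j) \<or> \<epsilon> j = 0" if j: "j \<in> users" for j
    unfolding vVW_eq[OF pj[OF j], symmetric]
  proof (cases "cond_b Q p")
    case True
    then show "v1 (nxt j) \<le> vVW Q (p j) \<or> (sW Q (p j))\<^sup>2 \<le> vVW Q (p j) \<or> \<epsilon> j = 0" using j by (auto simp: cond_b_def)
  next
    case False
    then have ca: "cond_a Q p" using cond by simp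
    show "v1 (nxt j) \<le> vVW Q (p j) \<or> (sW Q (p j))\<^sup>2 \<le> vVW Q (p j) \<or> \<epsilon> j = 0"
    proof (cases "sN Q (p (nxt j)) = 0")
      case True
      then show ?thesis using mid[OF nxt_prv(1)[OF j]] by (auto simp: \<epsilon>_def nxt_prv(9))
    next
      case False
      then show ?thesis using ca j by (auto simp: cond_a_def v1_def)
    qed
  qed
  define S where "S = (\<Sum>j\<in>users. m1 j + m2 j + m3 j)"
  obtain en d where code: "\<And>n. is_code Pw n (msize n R) (en n) (d n)" and lim: "(\<lambda>n. err hh n (msize n R) (en n) (d n)) \<longlonglongrightarrow> 0"
    using ach unfolding achievable_def by blast
  define er where "er n = err hh n (msize n R) (en n) (d n)" for n
  have per_n: "3 * (\<Sum>j\<in>users. (1 - er n) * ln (real (msize n R (p j))) - ln 2) \<le> real n * S" if n: "0 < n" for n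
  proof -
    let ?M = "msize n R"
    have P0': "\<And>k. k \<in> users \<Longrightarrow> 0 \<le> Pw k" using P0 by blast
    obtain x \<psi> where pw: "\<And>k. k \<in> users \<Longrightarrow> pwr n {..<?M k} (x k) (Pw k)"
      and su: "\<And>k v t. users = {k, v, t} \<Longrightarrow> k \<noteq> v \<Longrightarrow> k \<noteq> t \<Longrightarrow> v \<noteq> t \<Longrightarrow>
         succ n (?M k) (x k) ({..<?M v} \<times> {..<?M t}) (\<lambda>(b, c). sc (hh k v) (x v b) + sc (hh k t) (x t c)) (\<psi> k) (er n)"
      unfolding er_def using code_reduction[where h=hh, OF code[of n] msize_ge(2) P0'] by metis
    define DI where "DI j v = Dd n ({..<?M (p (nxt j))} \<times> {..<?M (p (prv j))}) (\<lambda>(b, c). sc (hh (p j) (p (nxt j))) (x (p (nxt j)) b) + sc (hh (p j) (p (prv j))) (x (p (prv j)) c)) v (\<epsilon> j)" for j v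
    define Dx where "Dx j v = Dd n {..<?M (p j)} (x (p j)) v (Pw (p j))" for j v
    define L where "L j = (1 - er n) * ln (real (?M (p j))) - ln 2" for j
    \<comment> \<open>Two of the three bounds at a receiver; the codeword gap on the left is taken
      at the level supplied by the middle bound of \<open>prv j\<close>.\<close>
    have outer: "2 * L j + Dx j (vbar (prv j)) \<le> DI j (v1 (nxt j)) + real n * (m1 j + m3 j)" if j: "j \<in> users" for j
    proof -
      have nj: "nxt j \<in> users" "prv j \<in> users" using nxt_prv(1,2)[OF j] by auto
      have wk: "0 \<le> (sW Q (p j))\<^sup>2" "(sW Q (p j))\<^sup>2 \<le> 1" using W0 pj[OF j] by (auto simp: power_le_one)
      have zk: "(cmod (zW (p j)))\<^sup>2 \<le> (sW Q (p j))\<^sup>2"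
        using W0 pj[OF j] mult_right_mono[of "(cmod (rW Q (p j)))\<^sup>2" 1 "(sW Q (p j))\<^sup>2"] by (auto simp: norm_mult power_mult_distrib power_le_one)
      have ip: "pwr n ({..<?M (p (nxt j))} \<times> {..<?M (p (prv j))}) (\<lambda>(b, c). sc (hh (p j) (p (nxt j))) (x (p (nxt j)) b) + sc (hh (p j) (p (prv j))) (x (p (prv j)) c)) (\<epsilon> j)"
        unfolding \<epsilon>_def by (rule pwr_pair(1)[OF pw[OF pj[OF nj(1)]] pw[OF pj[OF nj(2)]]])
      have vbj: "0 < Pw (p j) \<Longrightarrow> 1 + (sW Q (p j))\<^sup>2 - 2 * Re (zW (p j)) \<le> vbar (prv j)"
        using vb(2)[OF nj(2)] vZW_eq[OF pj[OF j]] by (simp add: nxt_prv(7)[OF j])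
      show ?thesis unfolding L_def Dx_def DI_def
        by (rule label_outer_bound[OF n pw[OF pj[OF j]] ip su[OF lab[OF j]] wk zk v1[OF nj(1)] vb(1)[OF nj(2)] vbj GA(1)[OF j] GC(1)[OF j] GA(2)[OF j] GC(2)[OF j] C[OF j, unfolded vZW_eq[OF pj[OF j]]]])
    qed
    \<comment> \<open>Its interference gap is the one at receiver \<open>prv j\<close>, because
      \<open>S\<close> carries the interference heard there.\<close>
    have middle: "L j + DI (prv j) (v1 j) \<le> Dx (nxt j) (vbar j) + real n * m2 j" if j: "j \<in> users" for j
    proof -
      have nj: "nxt j \<in> users" "prv j \<in> users" using nxt_prv(1,2)[OF j] by auto
      have ne: "{..<?M (p (prv j))} \<noteq> {}" using msize_ge(2)[of n R "p (prv j)"] by (auto simp: lessThan_empty_iff)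
      from mb[OF j pw[OF pj[OF j]] pw[OF pj[OF nj(1)]] finite_lessThan ne su[OF lab[OF j]]]
      show ?thesis unfolding L_def Dx_def DI_def \<epsilon>_def nxt_prv(7)[OF j] nxt_prv(10)[OF j] .
    qed
    have n3: "nxt 1 = 2" "nxt 2 = 3" "nxt 3 = 1" "prv 1 = 3" "prv 2 = 1" "prv 3 = 2" by (simp_all add: nxt_def prv_def)
    have uu: "1 \<in> users" "2 \<in> users" "3 \<in> users" by (auto simp: users_def)
    have s3: "(\<Sum>j\<in>users. f j) = f 1 + f 2 + f 3" for f :: "nat \<Rightarrow> real" by (simp add: users_def)
    \<comment> \<open>Among the six inequalities each of the three interference gaps and each of the
      three codeword gaps occurs exactly once on either side, so they cancel in the sum.\<close>
    have "3 * (L 1 + L 2 + L 3) \<le> real n * (m1 1 + m3 1) + real n * (m1 2 + m3 2) + real n * (m1 3 + m3 3) + real n * m2 1 + real n * m2 2 + real n * m2 3"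
    proof -
      have "3 * (l1 + l2 + l3) \<le> a1 + a2 + a3 + b1 + b2 + b3"
        if "2 * l1 + x1 \<le> d1 + a1" "2 * l2 + x2 \<le> d2 + a2" "2 * l3 + x3 \<le> d3 + a3" "l1 + d3 \<le> x2 + b1" "l2 + d1 \<le> x3 + b2" "l3 + d2 \<le> x1 + b3"
        for l1 l2 l3 a1 a2 a3 b1 b2 b3 x1 x2 x3 d1 d2 d3 :: real using that by argo
      from this[OF outer[OF uu(1), unfolded n3] outer[OF uu(2), unfolded n3] outer[OF uu(3), unfolded n3] middle[OF uu(1), unfolded n3] middle[OF uu(2), unfolded n3] middle[OF uu(3), unfolded n3]]
      show ?thesis .
    qed
    then show ?thesis unfolding S_def s3 L_def by (simp add: algebra_simps)
  qed
  define RS where "RS = (\<Sum>j\<in>users. R (p j))"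
  have RS: "RS = R 1 + R 2 + R 3"
  proof -
    have "RS = (\<Sum>k\<in>users. R k)" unfolding RS_def using sum.permute[OF p, of R] by (simp add: comp_def)
    then show ?thesis by (simp add: users_def)
  qed
  have ln2: "0 < ln (2::real)" by simp
  \<comment> \<open>Divide by \<open>n\<close> and let it grow: the error probability tends to 0,
    and the nine terms \<open>ln 2\<close> from Fano's inequality vanish.\<close>
  have "3 * (1 - 0) * ln 2 * RS - 9 * ln 2 * 0 \<le> S"
  proof (rule LIMSEQ_le_const2)
    have er0: "er \<longlonglongrightarrow> 0" using lim unfolding er_def .
    show "(\<lambda>n. 3 * (1 - er n) * ln 2 * RS - 9 * ln 2 * (1 / real n)) \<longlonglongrightarrow> 3 * (1 - 0) * ln 2 * RS - 9 * ln 2 * 0"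
      by (intro tendsto_intros er0 lim_1_over_n)
    have "eventually (\<lambda>n. er n < 1) sequentially" using er0 by (rule order_tendstoD) simp
    then obtain N where N: "\<And>n. n \<ge> N \<Longrightarrow> er n < 1" unfolding eventually_sequentially by blast
    show "\<exists>N. \<forall>n\<ge>N. 3 * (1 - er n) * ln 2 * RS - 9 * ln 2 * (1 / real n) \<le> S"
    proof (intro exI[of _ "max N 1"] allI impI)
      fix n assume n: "max N 1 \<le> n"
      have lnM: "(1 - er n) * (real n * R (p j) * ln 2) \<le> (1 - er n) * ln (real (msize n R (p j)))" for j
      proof (rule mult_left_mono)
        have "ln (2 powr (real n * R (p j))) \<le> ln (real (msize n R (p j)))" using msize_ge(1)[of n R "p j"] msize_ge(2)[of n R "p j"] by (subst ln_le_cancel_iff) auto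
        then show "real n * R (p j) * ln 2 \<le> ln (real (msize n R (p j)))" by (simp add: ln_powr)
        show "0 \<le> 1 - er n" using N[of n] n by simp
      qed
      have "real n * (3 * (1 - er n) * ln 2 * RS - 9 * ln 2 * (1 / real n)) = 3 * (\<Sum>j\<in>users. (1 - er n) * (real n * R (p j) * ln 2) - ln 2)"
      proof -
        have "(\<Sum>j\<in>users. (1 - er n) * (real n * R (p j) * ln 2) - ln 2) = (1 - er n) * real n * ln 2 * RS - 3 * ln 2"
          unfolding RS_def by (simp add: users_def algebra_simps)
        then show ?thesis using n by (simp add: algebra_simps)
      qed
      also have "\<dots> \<le> 3 * (\<Sum>j\<in>users. (1 - er n) * ln (real (msize n R (p j))) - ln 2)"
        by (intro mult_left_mono sum_mono diff_mono lnM) auto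
      also have "\<dots> \<le> real n * S" using n by (intro per_n) auto
      finally show "3 * (1 - er n) * ln 2 * RS - 9 * ln 2 * (1 / real n) \<le> S" using n by (simp add: mult_le_cancel_left)
    qed
  qed
  then have "RS \<le> S / (3 * ln 2)" using ln2 by (simp add: pos_le_divide_eq mult_ac)
  then show ?thesis unfolding A RS S_def by simp
qed simp

end

theorem theorem3:
  fixes Q :: prm
  assumes "\<forall>k\<in>users. 0 \<le> ch_P Q k"
      and "\<forall>j\<in>users. \<forall>k\<in>users. j \<noteq> k \<longrightarrow> ch_h Q j k \<noteq> 0"
      and "\<forall>k\<in>users. 0 \<le> sW Q k \<and> sW Q k \<le> 1 \<and> cmod (rW Q k) \<le> 1"
      and "\<forall>k\<in>users. 0 \<le> sN Q k \<and> sN Q k \<le> 1 \<and> cmod (rN Q k) \<le> 1"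
  shows "\<forall>p. p permutes users \<longrightarrow>
           (cond_a Q p \<longrightarrow> (\<forall>R. achievable (ch_h Q) (ch_P Q) R \<longrightarrow>
               ereal (R 1 + R 2 + R 3) \<le> Aterm Q p + I0term Q p)) \<and>
           (cond_b Q p \<longrightarrow> (\<forall>R. achievable (ch_h Q) (ch_P Q) R \<longrightarrow>
               ereal (R 1 + R 2 + R 3) \<le> Aterm Q p + I1term Q p)) \<and>
           (cond_a Q p \<and> cond_b Q p \<longrightarrow>
               sum_capacity (ch_h Q) (ch_P Q) \<le> Aterm Q p + min (I0term Q p) (I1term Q p))"
proof (intro allI impI)
  fix p :: "nat \<Rightarrow> nat" assume p: "p permutes users"
  interpret gic Q by (rule gic.intro[OF assms])
  have le: "a \<le> b \<Longrightarrow> 0 \<le> c \<Longrightarrow> a \<le> b + c" for a b c :: ereal using add_mono[of a b 0 c] by simp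
  note I = I_nonneg[OF p] and B = sum_rate_bound[OF p]
  show "(cond_a Q p \<longrightarrow> (\<forall>R. achievable (ch_h Q) (ch_P Q) R \<longrightarrow> ereal (R 1 + R 2 + R 3) \<le> Aterm Q p + I0term Q p)) \<and>
       (cond_b Q p \<longrightarrow> (\<forall>R. achievable (ch_h Q) (ch_P Q) R \<longrightarrow> ereal (R 1 + R 2 + R 3) \<le> Aterm Q p + I1term Q p)) \<and>
       (cond_a Q p \<and> cond_b Q p \<longrightarrow> sum_capacity (ch_h Q) (ch_P Q) \<le> Aterm Q p + min (I0term Q p) (I1term Q p))"
  proof (intro conjI impI allI)
    fix R assume "cond_a Q p" "achievable (ch_h Q) (ch_P Q) R"
    then show "ereal (R 1 + R 2 + R 3) \<le> Aterm Q p + I0term Q p" using B I by (intro le) auto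
  next
    fix R assume "cond_b Q p" "achievable (ch_h Q) (ch_P Q) R"
    then show "ereal (R 1 + R 2 + R 3) \<le> Aterm Q p + I1term Q p" using B I by (intro le) auto
  next
    assume "cond_a Q p \<and> cond_b Q p"
    then show "sum_capacity (ch_h Q) (ch_P Q) \<le> Aterm Q p + min (I0term Q p) (I1term Q p)"
      unfolding sum_capacity_def using B I by (intro SUP_least le) auto
  qed
qed

end
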